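(* There is a truly subquadratic algorithm for computing the diameter of chordal dominating pair graphs; that is, there exist $\varepsilon>0$ and an algorithm computing the diameter of every $m$-edge chordal dominating pair graph in ${\cal O}(m^{2-\varepsilon})$ time.
   Context: All graphs are finite, simple and connected. A dominating pair of a graph is a pair $(u,v)$ of vertices such that for every vertex $x$, every $uv$-path intersects the closed neighbourhood $N[x]$. A dominating pair graph is a graph such that every induced subgraph has a dominating pair. *)

theory Defs
  imports
    "Graph_Theory.Graph_Theory"
    "HOL-Library.Landau_Symbols"
    "HOL-Library.Discrete_Functions"
begin

section \<open>Graphs\<close>

text \<open>
  A finite simple graph is a \<^locale>\<open>pair_graph\<close>: a finite, loop-free, symmetric set of pairs,
  so each undirected edge is stored as two opposite arcs.
\<close>

definition num_edges :: "'a pair_pre_digraph \<Rightarrow> nat" where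
  "num_edges G = card ((\<lambda>(u, v). {u, v}) ` parcs G)"

definition closed_nbhd :: "('a, 'b) pre_digraph \<Rightarrow> 'a \<Rightarrow> 'a set" where
  "closed_nbhd G x = insert x {y. x \<rightarrow>\<^bsub>G\<^esub> y}"

definition dominating_pair :: "('a, 'b) pre_digraph \<Rightarrow> 'a \<Rightarrow> 'a \<Rightarrow> bool" where
  "dominating_pair G u v \<longleftrightarrow> u \<in> verts G \<and> v \<in> verts G \<and>
     (\<forall>x \<in> verts G. \<forall>p. vpath p G \<and> hd p = u \<and> last p = v \<longrightarrow> set p \<inter> closed_nbhd G x \<noteq> {})"

text \<open>
  Graphs are connected (hence nonempty) by convention, so the quantification is over the connected
  induced subgraphs. A disconnected one has a dominating pair anyway: take two vertices with no
  path between them.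
\<close>

definition dominating_pair_graph :: "('a, 'b) pre_digraph \<Rightarrow> bool" where
  "dominating_pair_graph G \<longleftrightarrow>
     (\<forall>H. induced_subgraph H G \<and> Digraph_Component.connected H \<longrightarrow> (\<exists>u v. dominating_pair H u v))"

text \<open>
  A chord is an edge that joins two vertices of the cycle and is, in neither direction, an edge of
  the cycle. Closed walks \<open>u, v, u\<close> count as cycles in a symmetric digraph, but have length 2.
\<close>

definition chordal :: "('a, 'b) pre_digraph \<Rightarrow> bool" where
  "chordal G \<longleftrightarrow>
     (\<forall>p. pre_digraph.cycle G p \<and> 4 \<le> length p \<longrightarrow>
        (\<exists>u v. u \<rightarrow>\<^bsub>G\<^esub> v \<and> u \<in> tail G ` set p \<and> v \<in> tail G ` set p \<and>
           (u, v) \<notin> arc_to_ends G ` set p \<and> (v, u) \<notin> arc_to_ends G ` set p))"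

definition diameter :: "('a, 'b) pre_digraph \<Rightarrow> ereal" where
  "diameter G = (SUP u \<in> verts G. SUP v \<in> verts G. wf_digraph.\<mu> G (\<lambda>_. 1) u v)"


section \<open>Random access machine with logarithmic costs\<close>

text \<open>
  Structured programs over finitely many registers and an unbounded memory of natural numbers, run
  on a deterministic RAM. Since memory words are unbounded, time is measured by the logarithmic
  cost criterion: every evaluation of a subexpression costs the binary length of its value. In
  particular a memory access pays for the address and for the contents. On programs whose values
  are polynomial in the input size this differs from unit cost on words of logarithmic length only
  by a logarithmic factor.
\<close>

datatype aexp =
    Lit nat
  | Reg nat
  | Load aexp
  | Add aexp aexp
  | Sub aexp aexp
  | Mul aexp aexp
  | Div aexp aexp

datatype com =
    Skip
  | Assign nat aexp
  | Store aexp aexp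
  | Seq com com
  | Cond aexp com com
  | While aexp com

type_synonym state = "(nat \<Rightarrow> nat) \<times> (nat \<Rightarrow> nat)"  \<comment> \<open>registers and memory\<close>

definition binlen :: "nat \<Rightarrow> nat" where
  "binlen k = floor_log k + 1"

text \<open>Subtraction is truncated at 0, so comparisons are expressible; division by 0 yields 0.\<close>

fun aval :: "aexp \<Rightarrow> state \<Rightarrow> nat" where
  "aval (Lit k) s = k"
| "aval (Reg r) s = fst s r"
| "aval (Load a) s = snd s (aval a s)"
| "aval (Add a b) s = aval a s + aval b s"
| "aval (Sub a b) s = aval a s - aval b s"
| "aval (Mul a b) s = aval a s * aval b s"
| "aval (Div a b) s = aval a s div aval b s"

fun acost :: "aexp \<Rightarrow> state \<Rightarrow> nat" where
  "acost (Lit k) s = binlen k"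
| "acost (Reg r) s = binlen (fst s r)"
| "acost (Load a) s = acost a s + binlen (aval (Load a) s)"
| "acost (Add a b) s = acost a s + acost b s + binlen (aval (Add a b) s)"
| "acost (Sub a b) s = acost a s + acost b s + binlen (aval (Sub a b) s)"
| "acost (Mul a b) s = acost a s + acost b s + binlen (aval (Mul a b) s)"
| "acost (Div a b) s = acost a s + acost b s + binlen (aval (Div a b) s)"

text \<open>
  \<open>exec c s t s'\<close>: started in state \<open>s\<close>, the program \<open>c\<close> terminates after time \<open>t\<close> in state \<open>s'\<close>.
  Conditions are true iff nonzero.
\<close>

inductive exec :: "com \<Rightarrow> state \<Rightarrow> nat \<Rightarrow> state \<Rightarrow> bool" where
  Skip: "exec Skip s 1 s"
| Assign: "exec (Assign r a) s (acost a s) ((fst s)(r := aval a s), snd s)"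
| Store: "exec (Store a b) s (acost a s + acost b s) (fst s, (snd s)(aval a s := aval b s))"
| Seq: "exec c s t s' \<Longrightarrow> exec d s' t' s'' \<Longrightarrow> exec (Seq c d) s (t + t') s''"
| CondT: "aval b s \<noteq> 0 \<Longrightarrow> exec c s t s' \<Longrightarrow> exec (Cond b c d) s (acost b s + t) s'"
| CondF: "aval b s = 0 \<Longrightarrow> exec d s t s' \<Longrightarrow> exec (Cond b c d) s (acost b s + t) s'"
| WhileF: "aval b s = 0 \<Longrightarrow> exec (While b c) s (acost b s) s"
| WhileT: "aval b s \<noteq> 0 \<Longrightarrow> exec c s t s' \<Longrightarrow> exec (While b c) s' t' s'' \<Longrightarrow>
    exec (While b c) s (acost b s + t + t') s''"

lemma exec_deterministic:
  "exec c s t s' \<Longrightarrow> exec c s t2 s2 \<Longrightarrow> t2 = t \<and> s2 = s'"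
proof (induction arbitrary: t2 s2 rule: exec.induct)
  case (Skip s)
  then show ?case by (auto elim: exec.cases)
next
  case (Assign r a s)
  then show ?case by (auto elim: exec.cases)
next
  case (Store a b s)
  then show ?case by (auto elim: exec.cases)
next
  case (Seq c s t s' d t' s'')
  from Seq.prems show ?case by cases (use Seq.IH in blast)+
next
  case (CondT b s c t s' d)
  from CondT.prems CondT.hyps show ?case by cases (use CondT.IH in blast)+
next
  case (CondF b s d t s' c)
  from CondF.prems CondF.hyps show ?case by cases (use CondF.IH in blast)+
next
  case (WhileF b s c)
  from WhileF.prems WhileF.hyps show ?case by cases auto
next
  case (WhileT b s c t s' t' s'')
  from WhileT.prems WhileT.hyps show ?case by cases (use WhileT.IH in blast)+
qed


section \<open>Input and output\<close>

text \<open>The lists may be ordered arbitrarily.\<close>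

definition adjacency_lists :: "nat list list \<Rightarrow> nat pair_pre_digraph \<Rightarrow> bool" where
  "adjacency_lists adj G \<longleftrightarrow> pverts G = {..<length adj} \<and>
     (\<forall>u < length adj. distinct (adj ! u) \<and> set (adj ! u) = {v. (u, v) \<in> parcs G})"

text \<open>
  For \<open>n\<close> vertices, cell 0 holds \<open>n\<close>; cell \<open>u + 1\<close>, for \<open>u \<le> n\<close>, holds the address at which the
  list of \<open>u\<close> starts (for \<open>u = n\<close>: the first address past the input); the concatenated lists start
  at address \<open>n + 2\<close>. All other cells and all registers are initially 0.
\<close>

definition input_words :: "nat list list \<Rightarrow> nat list" where
  "input_words adj = (let n = length adj in
     n # map (\<lambda>u. n + 2 + length (concat (take u adj))) [0..<n + 1] @ concat adj)"

definition initial_state :: "nat list list \<Rightarrow> state" where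
  "initial_state adj = (let ws = input_words adj in
     (\<lambda>_. 0, \<lambda>i. if i < length ws then ws ! i else 0))"

text \<open>The result is left in register 0.\<close>

definition result :: "state \<Rightarrow> nat" where
  "result s = fst s 0"

definition computes_diameter_within :: "com \<Rightarrow> (nat pair_pre_digraph \<Rightarrow> bool) \<Rightarrow> (nat \<Rightarrow> real) \<Rightarrow> bool"
where
  "computes_diameter_within P \<G> T \<longleftrightarrow>
     (\<forall>G adj. \<G> G \<and> adjacency_lists adj G \<longrightarrow>
        (\<exists>t s. exec P (initial_state adj) t s \<and> ereal (real (result s)) = diameter (with_proj G) \<and>
               real t \<le> T (num_edges G)))"

end

theory Submission
  imports Defs "HOL-Real_Asymp.Real_Asymp"
begin

text \<open>
  Let \<open>m\<close> be the total size of the closed neighbourhoods. Triangles, and hence common neighbourhoods of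
  all edges, are enumerated in time \<open>O(m\<^sup>3\<^sup>/\<^sup>2)\<close>; this also finds the simplicial vertices. Since a
  net (a triangle with three pendant vertices) has no dominating pair, the ball of radius 2 around a simplicial
  vertex \<open>y\<close> is the union of only two neighbourhoods \<open>N a\<close>, \<open>N b\<close> with \<open>a\<close>, \<open>b\<close> in \<open>N y\<close>, namely of a pair for which
  this union is largest. Every vertex has a farthest vertex that is simplicial, so the diameter
  is at most 2 iff every such union is everything, and at most 3 iff every \<open>N y\<close> contains a vertex of
  eccentricity at most 2. These are the vertices that lie in \<open>N a\<close> or \<open>N b\<close> for every \<open>y\<close>,
  which is decided for all vertices at once by counting.

  If the diameter is at least 5, let \<open>z\<close> be a simplicial vertex farthest from some vertex and \<open>v\<close> a vertex
  farthest from \<open>z\<close>. Unless \<open>z\<close> has maximal eccentricity, the vertices at distance 2 from \<open>z\<close> that touch the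
  component of \<open>v\<close> in \<open>{w. 3 \<le> d z w}\<close> form a clique \<open>C\<close> separating the ends of some diametral path.
  As \<open>C\<close> has at most \<open>\<surd>m\<close> elements, breadth-first search from each of them is affordable.
  For \<open>u\<close> on one side of \<open>C\<close>, the sets of vertices of \<open>C\<close> nearest to \<open>u\<close> are nested, because incomparable ones would give
  an asteroidal triple. So a vertex \<open>x\<close> at maximal distance from \<open>C\<close> with, subject to that, the fewest
  nearest vertices in \<open>C\<close> has maximal eccentricity, unless some vertex of \<open>C\<close> has. One more search, from
  \<open>x\<close>, then gives the diameter. The total time is \<open>O(m\<^sup>3\<^sup>/\<^sup>2 log m)\<close>.
\<close>

section \<open>Connected graphs as relations\<close>

text \<open>All exclusions rest on one pigeonhole argument. If a connected induced subgraph
  \<open>H\<close> stays connected without \<open>N x\<close>, then one end of every dominating pair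
  of \<open>H\<close> lies in \<open>N x\<close>; so three such vertices cannot have disjoint closed
  neighbourhoods in \<open>H\<close>. Asteroidal triples as such are not excluded: the 3-sun
  contains one, with overlapping neighbourhoods. Only triples at pairwise distance at least 3 are
  impossible, and this shapes the case distinction. The sweep needs distance at least 2 from the
  separator on both sides, which is available from diameter 5 on; below that, the net and the
  counting have to do the work. Diameter 4 is never tested for: it is what remains when the diameter
  exceeds 3 and no distance above 4 has been found. Chordality enters as two facts: a set separating
  two connected sets, all of whose vertices touch both of them, is a clique, and geodesics that
  overlap in an edge can be concatenated at the loss of that edge. A clique with \<open>k\<close>
  vertices has degree sum at least \<open>k^2\<close>, which is the origin of every square root in
  the running time.\<close>

locale con_graph =
  fixes V :: "'a set" and E :: "'a \<Rightarrow> 'a \<Rightarrow> bool"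
  assumes fin: "finite V" and sym: "E x y \<Longrightarrow> E y x" and irr: "\<not> E x x"
    and EV: "E x y \<Longrightarrow> x \<in> V" and ne: "V \<noteq> {}"
    and conn: "x \<in> V \<Longrightarrow> y \<in> V \<Longrightarrow> E\<^sup>*\<^sup>* x y"
begin

definition N :: "'a \<Rightarrow> 'a set" where
  "N x = insert x {y. E x y}"

text \<open>Reflexive at every vertex, also outside \<open>W\<close>; hence the assumption in
  \<open>reach_in\<close> that the start lies in \<open>W\<close>.\<close>

definition reach :: "'a set \<Rightarrow> 'a \<Rightarrow> 'a \<Rightarrow> bool" where
  "reach W = (\<lambda>x y. x \<in> W \<and> y \<in> W \<and> E x y)\<^sup>*\<^sup>*"

definition d :: "'a \<Rightarrow> 'a \<Rightarrow> nat" where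
  "d u v = (LEAST n. (E ^^ n) u v)"

lemma EV2: "E x y \<Longrightarrow> y \<in> V"
  using EV sym by blast

lemma N_sym: "x \<in> N y \<longleftrightarrow> y \<in> N x"
  using sym by (auto simp: N_def)

lemma N_subset: "x \<in> V \<Longrightarrow> N x \<subseteq> V"
  using EV2 by (auto simp: N_def)

lemma finite_N [simp]: "finite (N x)"
proof -
  have "{y. E x y} \<subseteq> V" using EV2 by auto
  then show ?thesis using fin finite_subset by (auto simp: N_def)
qed

lemma reach_refl [simp]: "reach W x x"
  by (simp add: reach_def)

lemma reach_trans: "reach W x y \<Longrightarrow> reach W y z \<Longrightarrow> reach W x z"
  by (auto simp: reach_def)

lemma reach_sym: "reach W x y \<Longrightarrow> reach W y x"
  unfolding reach_def
  by (induction rule: rtranclp_induct) (auto intro: converse_rtranclp_into_rtranclp sym)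

lemma reach_edge: "E x y \<Longrightarrow> x \<in> W \<Longrightarrow> y \<in> W \<Longrightarrow> reach W x y"
  by (auto simp: reach_def)

lemma reach_mono: "reach W x y \<Longrightarrow> W \<subseteq> W' \<Longrightarrow> reach W' x y"
  unfolding reach_def by (erule rtranclp_mono[THEN predicate2D, rotated]) auto

lemma reach_in: "reach W x y \<Longrightarrow> x \<in> W \<Longrightarrow> y \<in> W"
  unfolding reach_def by (induction rule: rtranclp_induct) auto

section \<open>Walks as vertex lists\<close>

lemma reach_list:
  "successively E r \<Longrightarrow> set r \<subseteq> W \<Longrightarrow> a \<in> set r \<Longrightarrow> b \<in> set r \<Longrightarrow> reach W a b"
proof -
  have *: "successively E r \<Longrightarrow> set r \<subseteq> W \<Longrightarrow> r \<noteq> [] \<Longrightarrow> b \<in> set r \<Longrightarrow> reach W (hd r) b" for b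
  proof (induction r)
    case (Cons x r)
    show ?case
    proof (cases "b = x \<or> r = []")
      case False
      then have "reach W (hd r) b" "E x (hd r)" "hd r \<in> W" "x \<in> W"
        using Cons by (auto simp: successively_Cons)
      then show ?thesis
        using reach_trans[of W x "hd r" b] reach_edge[of x "hd r" W] by simp
    qed (use Cons in auto)
  qed auto
  assume "successively E r" "set r \<subseteq> W" "a \<in> set r" "b \<in> set r"
  moreover from this have "r \<noteq> []" by auto
  ultimately have "reach W (hd r) a" "reach W (hd r) b" using *[of a] *[of b] by blast+
  then show ?thesis using reach_sym[of W "hd r" a] reach_trans[of W a "hd r" b] by blast
qed

lemma reach_obtain_list:
  assumes "reach W a b" "a \<in> W"
  shows "\<exists>r. r \<noteq> [] \<and> set r \<subseteq> W \<and> successively E r \<and> hd r = a \<and> last r = b"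
  using assms unfolding reach_def
proof (induction rule: rtranclp_induct)
  case base
  then show ?case by (intro exI[of _ "[a]"]) auto
next
  case (step y z)
  then obtain r where "r \<noteq> []" "set r \<subseteq> W" "successively E r" "hd r = a" "last r = y" by auto
  with step show ?case
    by (intro exI[of _ "r @ [z]"]) (auto simp: successively_append_iff)
qed

text \<open>A shortest walk in \<open>K\<close> from a \<open>P\<close>-vertex to a
  \<open>Q\<close>-vertex: a repetition, a later \<open>P\<close>-vertex, an earlier
  \<open>Q\<close>-vertex or an edge between non-consecutive vertices would each allow a shorter
  one. The result is an induced path that meets \<open>P\<close> and \<open>Q\<close> only at its
  ends, ready to be closed to a cycle.\<close>

lemma minimal_list:
  assumes "k1 \<in> K" "P k1" "Q k2" "reach K k1 k2"
  shows "\<exists>r. r \<noteq> [] \<and> set r \<subseteq> K \<and> distinct r \<and> successively E r \<and> P (hd r) \<and> Q (last r) \<and>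
    (\<forall>u\<in>set r. P u \<longrightarrow> u = hd r) \<and> (\<forall>u\<in>set r. Q u \<longrightarrow> u = last r) \<and>
    (\<forall>u\<in>set r. \<forall>v\<in>set r. E u v \<longrightarrow> (u, v) \<in> set (vwalk_arcs r) \<or> (v, u) \<in> set (vwalk_arcs r))"
proof -
  define ok where "ok r \<longleftrightarrow> r \<noteq> [] \<and> set r \<subseteq> K \<and> successively E r \<and> P (hd r) \<and> Q (last r)" for r
  obtain r0 where "ok r0" using reach_obtain_list[OF assms(4,1)] assms unfolding ok_def by auto
  then obtain r where r: "ok r" and min: "\<And>s. ok s \<Longrightarrow> length r \<le> length s"
    using ex_has_least_nat[of ok r0 length] by auto
  have arcs_mid: "(u, v) \<in> set (vwalk_arcs (xs @ u # v # zs))" for u v xs zs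
    by (induction xs rule: vwalk_arcs.induct) auto
  have "distinct r"
  proof (rule ccontr)
    assume "\<not> distinct r"
    then obtain xs u ys zs where e: "r = xs @ [u] @ ys @ [u] @ zs"
      using not_distinct_decomp by blast
    have "ok (xs @ [u] @ zs)" using r unfolding ok_def e
      by (cases zs) (auto simp: successively_append_iff successively_Cons hd_append split: if_splits)
    from min[OF this] show False by (simp add: e)
  qed
  moreover have "u = hd r" if "u \<in> set r" "P u" for u
  proof (rule ccontr)
    assume n: "u \<noteq> hd r"
    from that obtain xs ys where e: "r = xs @ u # ys" by (meson split_list)
    have "ok (u # ys)" using r that unfolding ok_def e
      by (auto simp: successively_append_iff)
    from min[OF this] n show False by (cases xs) (auto simp: e)
  qed
  moreover have "u = last r" if "u \<in> set r" "Q u" for u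
  proof (rule ccontr)
    assume n: "u \<noteq> last r"
    from that obtain xs ys where e: "r = xs @ u # ys" by (meson split_list)
    have "ok (xs @ [u])" using r that unfolding ok_def e
      by (auto simp: successively_append_iff successively_Cons hd_append split: if_splits)
    from min[OF this] n show False by (cases ys) (auto simp: e)
  qed
  moreover have "(u, v) \<in> set (vwalk_arcs r) \<or> (v, u) \<in> set (vwalk_arcs r)"
    if uv: "u \<in> set r" "v \<in> set r" "E u v" for u v
  proof -
    have *: "(u, v) \<in> set (vwalk_arcs r)" if "r = xs @ u # ys @ v # zs" "E u v" for u v xs ys zs
    proof (cases ys)
      case Nil
      then show ?thesis using that arcs_mid by simp
    next
      case (Cons y ys')
      have "ok (xs @ u # v # zs)" using r that unfolding ok_def
        by (cases zs) (auto simp: successively_append_iff successively_Cons hd_append split: if_splits)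
      from min[OF this] show ?thesis using Cons that by simp
    qed
    from uv obtain xs ys where e: "r = xs @ u # ys" by (meson split_list)
    have "u \<noteq> v" using irr uv by auto
    with uv(2) e consider "v \<in> set ys" | "v \<in> set xs" by auto
    then show ?thesis
    proof cases
      case 1
      then obtain as bs where "ys = as @ v # bs" by (meson split_list)
      then show ?thesis using *[of xs u as v bs] e uv by simp
    next
      case 2
      then obtain as bs where "xs = as @ v # bs" by (meson split_list)
      then show ?thesis using *[of as v bs u ys] e uv sym by simp
    qed
  qed
  ultimately show ?thesis using r unfolding ok_def by blast
qed

subsection \<open>Distances\<close>

lemma E_rtranclp_V: "E\<^sup>*\<^sup>* x y \<Longrightarrow> x \<in> V \<Longrightarrow> y \<in> V"
  by (induction rule: rtranclp_induct) (auto intro: EV2)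

lemma d_walk: assumes "x \<in> V" "y \<in> V" shows "(E ^^ d x y) x y"
  using conn[OF assms] rtranclp_imp_relpowp LeastI_ex unfolding d_def by metis

lemma d_le: "(E ^^ n) x y \<Longrightarrow> d x y \<le> n"
  unfolding d_def by (rule Least_le)

lemma d_refl [simp]: "d x x = 0"
  using d_le[of 0 x x] by simp

lemma relpowp_sym: "(E ^^ n) x y \<Longrightarrow> (E ^^ n) y x"
proof (induction n arbitrary: x y)
  case (Suc n)
  then obtain z where "(E ^^ n) x z" "E z y" by auto
  then show ?case using Suc.IH sym relpowp_Suc_I2 by metis
qed auto

lemma d_sym: "x \<in> V \<Longrightarrow> y \<in> V \<Longrightarrow> d x y = d y x"
  by (meson d_le d_walk le_antisym relpowp_sym)

lemma d_tri: assumes "x \<in> V" "y \<in> V" "z \<in> V" shows "d x z \<le> d x y + d y z"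
proof -
  have "(E ^^ (d x y + d y z)) x z"
    using d_walk[OF assms(1,2)] d_walk[OF assms(2,3)] by (auto simp: relpowp_add)
  then show ?thesis by (rule d_le)
qed

lemma d_0: "x \<in> V \<Longrightarrow> y \<in> V \<Longrightarrow> d x y = 0 \<longleftrightarrow> x = y"
  using d_walk[of x y] by auto

lemma d_edge: "E x y \<Longrightarrow> d x y \<le> 1"
  by (rule d_le) (simp add: eq_OO)

lemma d_1: "x \<in> V \<Longrightarrow> y \<in> V \<Longrightarrow> d x y \<le> 1 \<longleftrightarrow> y \<in> N x"
  using d_walk[of x y] d_edge[of x y] by (auto simp: N_def le_Suc_eq)

lemma d_between:
  assumes "x \<in> V" "y \<in> V" "i \<le> d x y"
  shows "\<exists>w\<in>V. d x w = i \<and> d w y = d x y - i"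
proof -
  from assms d_walk[OF assms(1,2)] have "(E ^^ (i + (d x y - i))) x y" by simp
  then obtain w where w: "(E ^^ i) x w" "(E ^^ (d x y - i)) w y"
    by (auto simp: relpowp_add)
  then have "w \<in> V" using E_rtranclp_V assms(1) relpowp_imp_rtranclp by metis
  moreover have "d x w \<le> i" "d w y \<le> d x y - i" using w d_le by auto
  moreover have "d x y \<le> d x w + d w y" using d_tri assms \<open>w \<in> V\<close> by blast
  ultimately show ?thesis using assms by (intro bexI[of _ w]) auto
qed

lemma d_step: "E x y \<Longrightarrow> z \<in> V \<Longrightarrow> d z y \<le> d z x + 1"
  using d_tri[of z x y] d_edge[of x y] EV[of x y] EV2[of x y] by linarith

lemma d_prev:
  assumes "x \<in> V" "y \<in> V" "x \<noteq> y"
  shows "\<exists>w. E w y \<and> d x w + 1 = d x y"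
proof -
  have "1 \<le> d x y" using assms d_0[of x y] by linarith
  then obtain w where "w \<in> V" "d x w = d x y - 1" "d w y = d x y - (d x y - 1)"
    using d_between[of x y "d x y - 1"] assms by auto
  moreover from this have "d w y \<le> 1" using \<open>1 \<le> d x y\<close> by linarith
  then have "y \<in> N w" using d_1[of w y] assms(2) \<open>w \<in> V\<close> by simp
  moreover have "y \<noteq> w" using calculation \<open>1 \<le> d x y\<close> by auto
  ultimately show ?thesis using \<open>1 \<le> d x y\<close> by (auto simp: N_def intro!: exI[of _ w])
qed

text \<open>A shortest path connects \<open>u\<close> to \<open>c\<close>; no vertex of it can lie in \<open>N z\<close>.\<close>

lemma reach_avoid:
  assumes "u \<in> V" "c \<in> V" "z \<in> V" "d u c + 2 < d u z + d z c"
  shows "reach (V - N z) u c"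
  using assms(2-)
proof (induction "d u c" arbitrary: c)
  case 0
  then show ?case using d_0 assms(1) by auto
next
  case (Suc n)
  then have "u \<noteq> c" by auto
  then obtain w where w: "E w c" "d u w + 1 = d u c" using d_prev[of u c] assms(1) Suc.prems by blast
  have "w \<in> V" using w EV[of w c] by auto
  have "d z c \<le> d z w + 1" using d_step[of w c z] w Suc.prems by blast
  moreover have "d u z \<le> d u w + d w z" "d w z = d z w"
    using d_tri[of u w z] d_sym[of w z] assms(1) Suc.prems \<open>w \<in> V\<close> by auto
  moreover have "n = d u w" using Suc.hyps(2) w(2) by linarith
  moreover have "d u w + 2 < d u z + d z w" using Suc.prems w(2) \<open>d z c \<le> d z w + 1\<close> by linarith
  ultimately have "reach (V - N z) u w" using Suc.hyps(1)[of w] Suc.prems \<open>w \<in> V\<close> by blast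
  moreover have "reach (V - N z) w c"
  proof (rule reach_edge[OF w(1)])
    have uz: "d u z \<le> d u c + d c z" "d c z = d z c"
      using d_tri[of u c z] d_sym[of c z] assms(1) Suc.prems by blast+
    have "c \<notin> N z" using d_1[of z c] Suc.prems uz by linarith
    then show "c \<in> V - N z" using Suc.prems by auto
    have "w \<notin> N z"
      using d_1[of z w] \<open>w \<in> V\<close> Suc.prems w(2) \<open>d z c \<le> d z w + 1\<close> \<open>d u z \<le> d u w + d w z\<close> \<open>d w z = d z w\<close>
      by linarith
    then show "w \<in> V - N z" using \<open>w \<in> V\<close> by auto
  qed
  ultimately show ?case using reach_trans[of _ u w c] by blast
qed

section \<open>Cliques, connected balls and intervals, eccentricities\<close>

definition clique :: "'a set \<Rightarrow> bool" where
  "clique Q \<longleftrightarrow> Q \<subseteq> V \<and> (\<forall>a\<in>Q. \<forall>b\<in>Q. a \<noteq> b \<longrightarrow> E a b)"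

definition simplicial :: "'a \<Rightarrow> bool" where
  "simplicial y \<longleftrightarrow> y \<in> V \<and> clique (N y)"

lemma ball_reach:
  assumes "s \<in> V" "w \<in> V" "d s w \<le> r"
  shows "reach {u \<in> V. d s u \<le> r} s w"
  using assms(2,3)
proof (induction "d s w" arbitrary: w)
  case 0
  then show ?case using d_0[of s w] assms(1) by simp
next
  case (Suc n)
  then have "s \<noteq> w" by auto
  then obtain u where u: "E u w" "d s u + 1 = d s w" using d_prev[of s w] assms(1) Suc.prems by blast
  have "u \<in> V" using EV[of u w] u by simp
  have "reach {u \<in> V. d s u \<le> r} s u" using Suc.hyps(1)[of u] Suc.hyps(2) Suc.prems u \<open>u \<in> V\<close> by simp
  moreover have "reach {u \<in> V. d s u \<le> r} u w" using reach_edge[OF u(1)] u Suc.prems \<open>u \<in> V\<close> by simp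
  ultimately show ?case using reach_trans by blast
qed

text \<open>The predecessor of \<open>c\<close> on a shortest path from \<open>u\<close> again lies
  on a shortest path from \<open>u\<close> to \<open>v\<close>, so the interval between
  \<open>u\<close> and \<open>v\<close> is connected.\<close>

lemma interval_reach:
  assumes "u \<in> V" "v \<in> V" "c \<in> V" "d u c + d c v = d u v"
  shows "reach {w \<in> V. d u w + d w v = d u v} u c"
  using assms(3,4)
proof (induction "d u c" arbitrary: c)
  case 0
  then show ?case using d_0[of u c] assms(1) by simp
next
  case (Suc n)
  then have "u \<noteq> c" by auto
  then obtain w where w: "E w c" "d u w + 1 = d u c" using d_prev[of u c] assms(1) Suc.prems by blast
  have "w \<in> V" using EV[of w c] w by simp
  have "d w v \<le> 1 + d c v" using d_tri[of w c v] d_edge[OF w(1)] \<open>w \<in> V\<close> Suc.prems assms(2) by linarith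
  moreover have "d u v \<le> d u w + d w v" using d_tri[of u w v] \<open>w \<in> V\<close> assms by simp
  ultimately have I: "d u w + d w v = d u v" using w Suc.prems by linarith
  have "reach {w \<in> V. d u w + d w v = d u v} u w" using Suc.hyps(1)[of w] Suc.hyps(2) I w \<open>w \<in> V\<close> by simp
  moreover have "reach {w \<in> V. d u w + d w v = d u v} w c" using reach_edge[OF w(1)] I \<open>w \<in> V\<close> Suc.prems by simp
  ultimately show ?case using reach_trans by blast
qed

definition ecc :: "'a \<Rightarrow> nat" where
  "ecc s = Max (d s ` V)"

definition diam :: nat where
  "diam = Max (ecc ` V)"

lemma d_le_ecc: "v \<in> V \<Longrightarrow> d s v \<le> ecc s"
  using fin by (auto simp: ecc_def)

lemma ecc_le_diam: "s \<in> V \<Longrightarrow> ecc s \<le> diam"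
  using fin by (auto simp: diam_def)

lemma d_le_diam: "s \<in> V \<Longrightarrow> v \<in> V \<Longrightarrow> d s v \<le> diam"
  using d_le_ecc ecc_le_diam le_trans by blast

lemma ecc_attained: "\<exists>v\<in>V. d s v = ecc s"
  using Max_in[of "d s ` V"] fin ne unfolding ecc_def by fastforce

lemma diam_attained: "\<exists>s\<in>V. ecc s = diam"
  using Max_in[of "ecc ` V"] fin ne unfolding diam_def by fastforce

end

section \<open>Chordal dominating pair graphs\<close>

text \<open>A cycle is presented as two walks \<open>p\<close> and \<open>q\<close> glued at both
  ends, because the cycles below are formed from two minimal paths;
  \<open>butlast p @ butlast q\<close> lists its vertices once. The dominating pair is kept in the
  form used by the pigeonhole argument: a vertex \<open>x\<close> of \<open>H\<close> with neither
  end in \<open>N x\<close> separates the ends by \<open>N x\<close>.\<close>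

locale chordal_dp = con_graph +
  assumes chord: "successively E p \<Longrightarrow> successively E q \<Longrightarrow> p \<noteq> [] \<Longrightarrow> q \<noteq> [] \<Longrightarrow>
      hd q = last p \<Longrightarrow> last q = hd p \<Longrightarrow> distinct (butlast p @ butlast q) \<Longrightarrow>
      4 \<le> length (butlast p @ butlast q) \<Longrightarrow>
      \<exists>u v. E u v \<and> u \<in> set p \<union> set q \<and> v \<in> set p \<union> set q \<and>
        (u, v) \<notin> set (vwalk_arcs p) \<union> set (vwalk_arcs q) \<and>
        (v, u) \<notin> set (vwalk_arcs p) \<union> set (vwalk_arcs q)"
    and dp: "H \<subseteq> V \<Longrightarrow> H \<noteq> {} \<Longrightarrow> (\<And>x y. x \<in> H \<Longrightarrow> y \<in> H \<Longrightarrow> reach H x y) \<Longrightarrow>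
      \<exists>u\<in>H. \<exists>v\<in>H. \<forall>x\<in>H. u \<notin> N x \<longrightarrow> v \<notin> N x \<longrightarrow> \<not> reach (H - N x) u v"
begin

text \<open>Take a minimal path in \<open>W\<close> from a neighbour of \<open>c1\<close> to a
  neighbour of \<open>c2\<close>. If it has more than one vertex, it closes with the edge
  \<open>c1 c2\<close> to a chordless cycle of length at least 4; otherwise its only vertex is the
  common neighbour.\<close>

lemma edge_triangle:
  assumes "E c1 c2" "c1 \<notin> W" "c2 \<notin> W" "k1 \<in> W" "k2 \<in> W" "E c1 k1" "E k2 c2" "reach W k1 k2"
  shows "\<exists>w\<in>W. E c1 w \<and> E c2 w"
proof -
  obtain r where r: "r \<noteq> []" "set r \<subseteq> W" "distinct r" "successively E r" "E c1 (hd r)" "E (last r) c2"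
    "\<forall>u\<in>set r. E c1 u \<longrightarrow> u = hd r" "\<forall>u\<in>set r. E u c2 \<longrightarrow> u = last r"
    "\<forall>u\<in>set r. \<forall>v\<in>set r. E u v \<longrightarrow> (u, v) \<in> set (vwalk_arcs r) \<or> (v, u) \<in> set (vwalk_arcs r)"
    using minimal_list[of k1 W "E c1" "\<lambda>u. E u c2" k2] assms by blast
  show ?thesis
  proof (cases "hd r = last r")
    case True
    then show ?thesis using r sym[of "last r" c2] by (intro bexI[of _ "hd r"]) auto
  next
    case False
    define p q where "p = c1 # r @ [c2]" and "q = [c2, c1]"
    have "length r \<ge> 2" using False r(1) by (cases r; cases "tl r") auto
    have neq: "c1 \<noteq> c2" using assms irr by auto
    have "vwalk_arcs p = (c1, hd r) # vwalk_arcs r @ [(last r, c2)]"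
      using vwalk_arcs_append[of r "[c2]"] r(1) by (simp add: p_def)
    then have ap: "set (vwalk_arcs p) = {(c1, hd r), (last r, c2)} \<union> set (vwalk_arcs r)"
      by auto
    have "\<exists>u v. E u v \<and> u \<in> set p \<union> set q \<and> v \<in> set p \<union> set q \<and>
        (u, v) \<notin> set (vwalk_arcs p) \<union> set (vwalk_arcs q) \<and>
        (v, u) \<notin> set (vwalk_arcs p) \<union> set (vwalk_arcs q)"
    proof (rule chord)
      show "successively E p" "successively E q"
        using r(1,4,5,6) sym[OF assms(1)] by (auto simp: p_def q_def successively_append_iff successively_Cons)
      show "distinct (butlast p @ butlast q)"
        using r(2,3) assms(2,3) neq by (auto simp: p_def q_def butlast_append)
    qed (use r(1) \<open>length r \<ge> 2\<close> in \<open>simp_all add: p_def q_def\<close>)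
    then obtain u v where uv: "E u v" "u \<in> set p \<union> set q" "v \<in> set p \<union> set q"
      "(u, v) \<notin> set (vwalk_arcs p) \<union> set (vwalk_arcs q)"
      "(v, u) \<notin> set (vwalk_arcs p) \<union> set (vwalk_arcs q)" by blast
    have aq: "set (vwalk_arcs q) = {(c2, c1)}" by (simp add: q_def)
    have sq: "set p \<union> set q = {c1, c2} \<union> set r" by (auto simp: p_def q_def)
    \<comment> \<open>\<open>ok u v\<close> says that \<open>u\<close> and \<open>v\<close> are
      joined by an edge of the cycle. Running through the possible positions of two ends shows that
      every edge among the vertices of the cycle is \<open>ok\<close>, against the chord obtained
      above.\<close>
    define ok where "ok u v \<longleftrightarrow> (u, v) \<in> set (vwalk_arcs p) \<union> set (vwalk_arcs q) \<or>
        (v, u) \<in> set (vwalk_arcs p) \<union> set (vwalk_arcs q)" for u v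
    have s: "E v u" "ok u v = ok v u" using sym[OF uv(1)] by (auto simp: ok_def)
    have 1: "ok c1 w" if "w \<in> set r" "E c1 w" for w using that r(7) by (auto simp: ok_def ap)
    have 2: "ok w c2" if "w \<in> set r" "E w c2" for w using that r(8) by (auto simp: ok_def ap)
    have 3: "ok w w'" if "w \<in> set r" "w' \<in> set r" "E w w'" for w w'
      using that r(9) unfolding ok_def ap by blast
    have 4: "ok c1 c2" "ok c2 c1" by (auto simp: ok_def aq)
    have "ok u v"
      using uv(2,3) unfolding sq
      by (elim UnE insertE emptyE) (use uv(1) s irr 1 2 3 4 in metis)+
    then have False using uv(4,5) by (auto simp: ok_def)
    then show ?thesis ..
  qed
qed

text \<open>The argument behind the theorem that minimal separators of chordal graphs are cliques:
  if \<open>a\<close> and \<open>b\<close> were not adjacent, minimal paths between them through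
  \<open>K\<close> and through \<open>M\<close> would form a chordless cycle of length at least
  4.\<close>

lemma separated_clique:
  assumes "a \<noteq> b" "a \<notin> K \<union> M" "b \<notin> K \<union> M" "K \<inter> M = {}"
    and nE: "\<And>k m. k \<in> K \<Longrightarrow> m \<in> M \<Longrightarrow> \<not> E k m"
    and K: "k1 \<in> K" "k2 \<in> K" "E a k1" "E k2 b" "reach K k1 k2"
    and M: "m1 \<in> M" "m2 \<in> M" "E b m1" "E m2 a" "reach M m1 m2"
  shows "E a b"
proof (rule ccontr)
  assume nab: "\<not> E a b"
  obtain r where r: "r \<noteq> []" "set r \<subseteq> K" "distinct r" "successively E r" "E a (hd r)" "E (last r) b"
    "\<forall>u\<in>set r. E a u \<longrightarrow> u = hd r" "\<forall>u\<in>set r. E u b \<longrightarrow> u = last r"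
    "\<forall>u\<in>set r. \<forall>v\<in>set r. E u v \<longrightarrow> (u, v) \<in> set (vwalk_arcs r) \<or> (v, u) \<in> set (vwalk_arcs r)"
    using minimal_list[of k1 K "E a" "\<lambda>u. E u b" k2] K by blast
  obtain s where s: "s \<noteq> []" "set s \<subseteq> M" "distinct s" "successively E s" "E b (hd s)" "E (last s) a"
    "\<forall>u\<in>set s. E b u \<longrightarrow> u = hd s" "\<forall>u\<in>set s. E u a \<longrightarrow> u = last s"
    "\<forall>u\<in>set s. \<forall>v\<in>set s. E u v \<longrightarrow> (u, v) \<in> set (vwalk_arcs s) \<or> (v, u) \<in> set (vwalk_arcs s)"
    using minimal_list[of m1 M "E b" "\<lambda>u. E u a" m2] M by blast
  define p q where "p = a # r @ [b]" and "q = b # s @ [a]"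
  have "vwalk_arcs p = (a, hd r) # vwalk_arcs r @ [(last r, b)]"
      using vwalk_arcs_append[of r "[b]"] r(1) by (simp add: p_def)
    then have ap: "set (vwalk_arcs p) = {(a, hd r), (last r, b)} \<union> set (vwalk_arcs r)"
    by auto
  have "vwalk_arcs q = (b, hd s) # vwalk_arcs s @ [(last s, a)]"
      using vwalk_arcs_append[of s "[a]"] s(1) by (simp add: q_def)
    then have aq: "set (vwalk_arcs q) = {(b, hd s), (last s, a)} \<union> set (vwalk_arcs s)"
    by auto
  have sq: "set p \<union> set q = {a, b} \<union> set r \<union> set s" by (auto simp: p_def q_def)
  have "length r \<ge> 1" "length s \<ge> 1" using r(1) s(1) by (auto simp: Suc_le_eq)
  have "\<exists>u v. E u v \<and> u \<in> set p \<union> set q \<and> v \<in> set p \<union> set q \<and>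
      (u, v) \<notin> set (vwalk_arcs p) \<union> set (vwalk_arcs q) \<and>
      (v, u) \<notin> set (vwalk_arcs p) \<union> set (vwalk_arcs q)"
  proof (rule chord)
    show "successively E p" "successively E q"
      using r(1,4,5,6) s(1,4,5,6) by (auto simp: p_def q_def successively_append_iff successively_Cons)
    show "distinct (butlast p @ butlast q)"
      using r(2,3) s(2,3) assms(1-4) by (auto simp: p_def q_def butlast_append)
  qed (use r(1) s(1) \<open>length r \<ge> 1\<close> \<open>length s \<ge> 1\<close> in \<open>simp_all add: p_def q_def\<close>)
  then obtain u v where uv: "E u v" "u \<in> {a, b} \<union> set r \<union> set s" "v \<in> {a, b} \<union> set r \<union> set s"
    "(u, v) \<notin> set (vwalk_arcs p) \<union> set (vwalk_arcs q)"
    "(v, u) \<notin> set (vwalk_arcs p) \<union> set (vwalk_arcs q)" unfolding sq by blast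
  define ok where "ok u v \<longleftrightarrow> (u, v) \<in> set (vwalk_arcs p) \<union> set (vwalk_arcs q) \<or>
      (v, u) \<in> set (vwalk_arcs p) \<union> set (vwalk_arcs q)" for u v
  have y: "E v u" "ok u v = ok v u" "\<not> E b a" using sym[OF uv(1)] sym[of b a] nab by (auto simp: ok_def)
  have 1: "ok a w" if "w \<in> set r" "E a w" for w using that r(7) by (auto simp: ok_def ap)
  have 2: "ok w b" if "w \<in> set r" "E w b" for w using that r(8) by (auto simp: ok_def ap)
  have 3: "ok w w'" if "w \<in> set r" "w' \<in> set r" "E w w'" for w w'
    using that r(9) unfolding ok_def ap by blast
  have 4: "ok b w" if "w \<in> set s" "E b w" for w using that s(7) by (auto simp: ok_def aq)
  have 5: "ok w a" if "w \<in> set s" "E w a" for w using that s(8) by (auto simp: ok_def aq)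
  have 6: "ok w w'" if "w \<in> set s" "w' \<in> set s" "E w w'" for w w'
    using that s(9) unfolding ok_def aq by blast
  have 7: "\<not> E w w'" if "w \<in> set r" "w' \<in> set s" for w w'
    using nE subsetD[OF r(2) that(1)] subsetD[OF s(2) that(2)] by blast
  have "ok u v"
    using uv(2,3)
    by (elim UnE insertE emptyE) (use uv(1) y nab irr 1 2 3 4 5 6 7 in metis)+
  then show False using uv(4,5) by (auto simp: ok_def)
qed

text \<open>The \<alpha>-metric property of chordal graphs. Suppose \<open>d p1 p2\<close> is
  smaller. Stop the geodesics to \<open>c1\<close> and \<open>c2\<close> one vertex before these
  ends and add the interval between \<open>p1\<close> and \<open>p2\<close>: the union
  \<open>W\<close> is connected and avoids the edge \<open>c1 c2\<close>. A common neighbour of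
  \<open>c1\<close> and \<open>c2\<close> in \<open>W\<close> has distance at least
  \<open>d p1 c1\<close> from \<open>p1\<close> and at least \<open>d p2 c2\<close> from
  \<open>p2\<close>, too far for each of the three intervals.\<close>

lemma alpha_metric:
  assumes V: "p1 \<in> V" "p2 \<in> V" and c: "E c1 c2"
    and d1: "d p1 c2 = d p1 c1 + 1" and d2: "d p2 c1 = d p2 c2 + 1"
  shows "d p1 c1 + d p2 c2 \<le> d p1 p2"
proof (rule ccontr)
  assume lt: "\<not> ?thesis"
  have cV: "c1 \<in> V" "c2 \<in> V" using EV[OF c] EV2[OF c] by auto
  have "p1 \<noteq> c1" using lt d2 d_sym[of p1 p2] V by auto
  then obtain k1 where k1: "E k1 c1" "d p1 k1 + 1 = d p1 c1" using d_prev V cV by blast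
  have "p2 \<noteq> c2" using lt d1 by auto
  then obtain k2 where k2: "E k2 c2" "d p2 k2 + 1 = d p2 c2" using d_prev V cV by blast
  have kV: "k1 \<in> V" "k2 \<in> V" using k1 k2 EV by auto
  define I where "I u v = {w \<in> V. d u w + d w v = d u v}" for u v
  define W where "W = I p1 k1 \<union> I p2 k2 \<union> I p1 p2"
  have dd: "d p2 w = d w p2" if "w \<in> V" for w using d_sym V that by blast
  have "reach (I p1 k1) p1 k1" "reach (I p2 k2) p2 k2" "reach (I p1 p2) p1 p2"
    unfolding I_def using interval_reach V kV by simp_all
  then have "reach W p1 k1" "reach W p2 k2" "reach W p1 p2"
    using reach_mono[of _ _ _ W] unfolding W_def by blast+
  then have R: "reach W k1 k2" using reach_sym[of W p1 k1] reach_trans[of W] by blast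
  have nI: "c1 \<notin> W" "c2 \<notin> W"
    unfolding W_def I_def using k1 k2 d1 d2 lt dd cV by auto
  have kW: "k1 \<in> W" "k2 \<in> W" unfolding W_def I_def using kV by auto
  obtain w where w: "w \<in> W" "E c1 w" "E c2 w"
    using edge_triangle[OF c nI kW _ _ R] k1 k2 sym by blast
  have wV: "w \<in> V" using EV2 w by blast
  have "d p1 c2 \<le> d p1 w + 1" "d p2 c1 \<le> d p2 w + 1"
    using d_step[of w c2 p1] d_step[of w c1 p2] sym[OF w(2)] sym[OF w(3)] V by blast+
  with w(1) show False unfolding W_def I_def using k1 k2 d1 d2 lt dd[OF wV] by auto
qed

text \<open>By \<open>av\<close>, each of the three closed neighbourhoods has to contain an end of
  the dominating pair of \<open>H\<close>; inside \<open>H\<close> they are disjoint, and there are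
  only two ends.\<close>

lemma dp_triple:
  assumes H: "H \<subseteq> V" "x \<in> H" "y \<in> H" "z \<in> H"
    and con: "\<And>u v. u \<in> H \<Longrightarrow> v \<in> H \<Longrightarrow> reach H u v"
    and dj: "H \<inter> N x \<inter> N y = {}" "H \<inter> N x \<inter> N z = {}" "H \<inter> N y \<inter> N z = {}"
    and av: "\<And>t u v. t \<in> {x, y, z} \<Longrightarrow> u \<in> H - N t \<Longrightarrow> v \<in> H - N t \<Longrightarrow> reach (H - N t) u v"
  shows False
proof -
  obtain u v where uv: "u \<in> H" "v \<in> H"
    "\<forall>x\<in>H. u \<notin> N x \<longrightarrow> v \<notin> N x \<longrightarrow> \<not> reach (H - N x) u v"
    using dp[of H] con H by blast
  have "u \<in> N t \<or> v \<in> N t" if "t \<in> {x, y, z}" for t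
    using uv av[OF that, of u v] H that by blast
  then show False using dj uv by blast
qed

text \<open>One side of an asteroidal triple. \<open>P\<close> is a path from \<open>x\<close> to
  \<open>y\<close> off \<open>N z\<close> in which \<open>x\<close> and \<open>y\<close> have a
  single neighbour each. Removing \<open>N x\<close> or \<open>N y\<close> therefore only cuts off
  one end and leaves a connected rest.\<close>

lemma asteroidal_path:
  assumes V: "x \<in> V" "y \<in> V" and zz: "x \<notin> N z" "y \<notin> N z" and xy: "y \<notin> N x" and R: "reach (V - N z) x y"
  shows "\<exists>P. x \<in> P \<and> y \<in> P \<and> P \<subseteq> V - N z \<and> (\<forall>a\<in>P. reach P a y) \<and>
    (\<forall>u\<in>P - N x. reach (P - N x) u y) \<and> (\<forall>u\<in>P - N y. reach (P - N y) u x)"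
proof -
  have neq: "x \<noteq> y" "\<not> E x y" using xy by (auto simp: N_def)
  obtain k1 where k1: "x \<in> V - N z" "k1 \<in> V - N z" "E x k1" "reach (V - N z) k1 y"
    using R neq(1) unfolding reach_def by (auto elim: converse_rtranclpE)
  obtain k2 where k2: "k2 \<in> V - N z" "E k2 y" "reach (V - N z) x k2"
    using R neq(1) unfolding reach_def by (auto elim: rtranclp.cases)
  have yz: "y \<in> V - N z" using V zz by auto
  have "reach (V - N z) k1 k2"
    using reach_trans[OF k1(4) reach_trans[OF reach_sym[OF R] k2(3)]] .
  then obtain r where r: "r \<noteq> []" "set r \<subseteq> V - N z" "distinct r" "successively E r" "E x (hd r)" "E (last r) y"
    "\<forall>u\<in>set r. E x u \<longrightarrow> u = hd r" "\<forall>u\<in>set r. E u y \<longrightarrow> u = last r"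
    using minimal_list[of k1 "V - N z" "E x" "\<lambda>u. E u y" k2] k1 k2 by blast
  have hd0: "hd r \<in> set r" "last r \<in> set r" using r(1) by auto
  \<comment> \<open>Otherwise the successor of \<open>x\<close> on \<open>r\<close> would be a
    neighbour of \<open>x\<close> different from \<open>hd r\<close>.\<close>
  have xr: "x \<notin> set r"
  proof
    assume "x \<in> set r"
    then obtain xs ys where e: "r = xs @ x # ys" by (meson split_list)
    have "xs \<noteq> []" using r(5) irr e by auto
    have "ys \<noteq> []" using r(6) neq e by auto
    then have "E x (hd ys)" using r(4) e by (auto simp: successively_append_iff successively_Cons)
    then have "hd ys = hd r" using r(7) e \<open>ys \<noteq> []\<close> by auto
    then show False using r(3) e \<open>xs \<noteq> []\<close> \<open>ys \<noteq> []\<close>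
      by (metis Int_iff disjoint_iff distinct_append hd_append2 hd_in_set list.set_intros(2))
  qed
  have yr: "y \<notin> set r"
  proof
    assume "y \<in> set r"
    then obtain xs ys where e: "r = xs @ y # ys" by (meson split_list)
    have "ys \<noteq> []" using r(6) irr e by auto
    have "xs \<noteq> []" using r(5) neq e by auto
    then have "E (last xs) y" using r(4) e by (auto simp: successively_append_iff successively_Cons)
    then have "last xs = last r" using r(8) e \<open>xs \<noteq> []\<close> by auto
    moreover have "last r = last ys" using e \<open>ys \<noteq> []\<close> by simp
    ultimately show False using r(3) e \<open>xs \<noteq> []\<close> \<open>ys \<noteq> []\<close>
      by (metis disjoint_iff distinct_append last_in_set list.set_intros(2))
  qed
  obtain h t where ht: "r = h # t" using r(1) by (cases r) auto
  obtain b l where bl: "r = b @ [l]" using r(1) by (cases r rule: rev_cases) auto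
  define P where "P = insert x (insert y (set r))"
  have Px: "P - N x = set (t @ [y])"
    using r(3,7) ht xr xy r(5) unfolding P_def by (auto simp: N_def)
  have Py: "P - N y = set (x # b)"
  proof -
    have "x \<notin> N y" using xy N_sym by blast
    moreover have "u \<in> N y \<longleftrightarrow> u = last r" if "u \<in> set r" for u
      using that r(6,8) yr sym by (auto simp: N_def)
    ultimately show ?thesis unfolding P_def using bl r(3) by (auto simp: N_def)
  qed
  have s1: "successively E (t @ [y])"
    using r(4,6) ht by (cases "t = []") (auto simp: successively_append_iff successively_Cons)
  have s2: "successively E (x # b)"
    using r(4,5) bl by (cases "b = []") (auto simp: successively_append_iff successively_Cons)
  have s3: "successively E (x # r @ [y])" using r(4,5,6) r(1) by (auto simp: successively_append_iff successively_Cons)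
  have P3: "P = set (x # r @ [y])" by (auto simp: P_def)
  show ?thesis
  proof (intro exI[of _ P] conjI ballI)
    show "P \<subseteq> V - N z" using r(2) k1 yz by (auto simp: P_def)
    show "reach P a y" if "a \<in> P" for a
      using reach_list[OF s3, of P a y] that P3 by auto
    show "reach (P - N x) u y" if "u \<in> P - N x" for u
      using reach_list[OF s1, of "P - N x" u y] that unfolding Px by auto
    show "reach (P - N y) u x" if "u \<in> P - N y" for u
      using reach_list[OF s2, of "P - N y" u x] that unfolding Py by auto
  qed (auto simp: P_def)
qed

text \<open>Distance at least 3 makes the closed neighbourhoods disjoint. Let \<open>H\<close> be
  the union of the three paths of \<open>asteroidal_path\<close>. Removing \<open>N t\<close> for a
  member \<open>t\<close> of the triple shortens the two paths that end in \<open>t\<close> and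
  leaves the third one whole, so the rest of \<open>H\<close> is connected and
  \<open>dp_triple\<close> applies.\<close>

lemma no_far_asteroidal_triple:
  assumes V: "x \<in> V" "y \<in> V" "z \<in> V" and far: "3 \<le> d x y" "3 \<le> d x z" "3 \<le> d y z"
    and R: "reach (V - N z) x y" "reach (V - N y) x z" "reach (V - N x) y z"
  shows False
proof -
  have dj: "N a \<inter> N b = {}" if "a \<in> V" "b \<in> V" "3 \<le> d a b" for a b
  proof (rule ccontr)
    assume "N a \<inter> N b \<noteq> {}"
    then obtain w where w: "w \<in> N a" "w \<in> N b" by blast
    have "w \<in> V" using w N_subset that by blast
    have "d a w \<le> 1" using d_1[of a w] \<open>w \<in> V\<close> that w by simp
    moreover have "d b w \<le> 1" using d_1[of b w] \<open>w \<in> V\<close> that w by simp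
    ultimately show False using d_tri[of a w b] d_sym[of w b] that \<open>w \<in> V\<close> by linarith
  qed
  have self: "a \<in> N a" for a by (simp add: N_def)
  note D = dj[OF V(1,2) far(1)] dj[OF V(1,3) far(2)] dj[OF V(2,3) far(3)]
  have out: "x \<notin> N y" "x \<notin> N z" "y \<notin> N x" "y \<notin> N z" "z \<notin> N x" "z \<notin> N y"
    using D self by blast+
  obtain A where A: "x \<in> A" "y \<in> A" "A \<subseteq> V - N z" "\<forall>a\<in>A. reach A a y"
    "\<forall>u\<in>A - N x. reach (A - N x) u y" "\<forall>u\<in>A - N y. reach (A - N y) u x"
    using asteroidal_path[of x y z] V out R by blast
  obtain B where B: "x \<in> B" "z \<in> B" "B \<subseteq> V - N y" "\<forall>a\<in>B. reach B a z"
    "\<forall>u\<in>B - N x. reach (B - N x) u z" "\<forall>u\<in>B - N z. reach (B - N z) u x"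
    using asteroidal_path[of x z y] V out R by blast
  obtain C where C: "y \<in> C" "z \<in> C" "C \<subseteq> V - N x" "\<forall>a\<in>C. reach C a z"
    "\<forall>u\<in>C - N y. reach (C - N y) u z" "\<forall>u\<in>C - N z. reach (C - N z) u y"
    using asteroidal_path[of y z x] V out R by blast
  define H where "H = A \<union> B \<union> C"
  have hub: "reach S u v" if "u \<in> T" "v \<in> T" "\<forall>w\<in>T. reach S w c" for S T u v c
    using that reach_trans reach_sym by meson
  show False
  proof (rule dp_triple[of H x y z])
    show "H \<subseteq> V" using A B C by (auto simp: H_def)
    show "reach H u v" if "u \<in> H" "v \<in> H" for u v
    proof (rule hub[OF that])
      show "\<forall>w\<in>H. reach H w z"
      proof
        fix w assume "w \<in> H"
        have m: "reach H a b" if "reach S a b" "S \<subseteq> {w. w \<in> H}" for S a b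
          using reach_mono[OF that(1), of H] that(2) by simp
        have "reach H y z" using m[of C y z] C by (auto simp: H_def)
        moreover have "w \<in> A \<Longrightarrow> reach H w y" using m[of A w y] A by (auto simp: H_def)
        moreover have "w \<in> B \<Longrightarrow> reach H w z" using m[of B w z] B by (auto simp: H_def)
        moreover have "w \<in> C \<Longrightarrow> reach H w z" using m[of C w z] C by (auto simp: H_def)
        ultimately show "reach H w z" using \<open>w \<in> H\<close> reach_trans unfolding H_def by blast
      qed
    qed
    \<comment> \<open>\<open>S1\<close> and \<open>S2\<close> are the two paths ending in
      \<open>t\<close>, with other ends \<open>b\<close> and \<open>c\<close>; \<open>S3\<close> is
      the path from \<open>b\<close> to \<open>c\<close> that avoids \<open>N t\<close>. Everything
      left is joined to \<open>c\<close>.\<close>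
    have av: "reach (H - N t) u v"
      if "u \<in> H - N t" "v \<in> H - N t" "S1 \<subseteq> H" "S2 \<subseteq> H" "S3 \<subseteq> H - N t" "H = S1 \<union> S2 \<union> S3"
        "b \<in> S3" "c \<in> S3" "\<forall>a\<in>S3. reach S3 a c"
        "\<forall>w\<in>S1 - N t. reach (S1 - N t) w b" "\<forall>w\<in>S2 - N t. reach (S2 - N t) w c" for t u v S1 S2 S3 b c
    proof (rule hub[OF that(1,2)])
      show "\<forall>w\<in>H - N t. reach (H - N t) w c"
      proof
        fix w assume w: "w \<in> H - N t"
        have "reach (H - N t) b c" using that reach_mono[of S3 b c "H - N t"] by blast
        moreover have "w \<in> S1 \<Longrightarrow> reach (H - N t) w b"
          using that w reach_mono[of "S1 - N t" w b "H - N t"] by blast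
        moreover have "w \<in> S2 \<Longrightarrow> reach (H - N t) w c"
          using that w reach_mono[of "S2 - N t" w c "H - N t"] by blast
        moreover have "w \<in> S3 \<Longrightarrow> reach (H - N t) w c"
          using that w reach_mono[of S3 w c "H - N t"] by blast
        ultimately show "reach (H - N t) w c" using w that(6) reach_trans by blast
      qed
    qed
    fix t u v assume t: "t \<in> {x, y, z}" and uv: "u \<in> H - N t" "v \<in> H - N t"
    have Bx: "\<forall>a\<in>B. reach B a x" using B reach_trans reach_sym by meson
    from t consider "t = x" | "t = y" | "t = z" by auto
    then show "reach (H - N t) u v"
    proof cases
      case 1
      show ?thesis by (rule av[OF uv, of A B C y z]) (use 1 A B C H_def in auto)
    next
      case 2
      show ?thesis by (rule av[OF uv, of A C B x z]) (use 2 A B C H_def in auto)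
    next
      case 3
      show ?thesis by (rule av[OF uv, of B C A x y]) (use 3 A B C H_def in auto)
    qed
  qed (use A B C D H_def in auto)
qed

end

context con_graph begin

lemma reach_via: "reach S h a \<Longrightarrow> reach S h b \<Longrightarrow> reach S a b"
  using reach_sym[of S h a] reach_trans[of S a h b] by blast

lemma component_connected:
  assumes "reach W t a" "reach W t b"
  shows "reach {u. reach W t u} a b"
proof -
  have "reach {u. reach W t u} t u" if "reach W t u" for u
    using that unfolding reach_def[of W]
  proof (induction rule: rtranclp_induct)
    case (step y z)
    then have "reach W t y" "reach W t z" "E y z"
      unfolding reach_def by (auto intro: rtranclp.rtrancl_into_rtrancl)
    then have "reach {u. reach W t u} y z" using reach_edge[of y z] by simp
    then show ?case using step.IH reach_trans unfolding reach_def[of W] by blast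
  qed simp
  then show ?thesis using reach_via assms by blast
qed

end

section \<open>Nets and the best pair of vertices in a clique\<close>

context chordal_dp begin

text \<open>In the six vertices, \<open>N p1\<close>, \<open>N p2\<close> and \<open>N p3\<close>
  are the three disjoint pendant edges, and removing one of them leaves a connected rest, as
  \<open>dp_triple\<close> requires. That no two pendants are adjacent is not assumed but follows
  from chordality.\<close>

lemma no_net:
  assumes c: "E c1 c2" "E c1 c3" "E c2 c3"
    and p: "E c1 p1" "E c2 p2" "E c3 p3"
    and np: "p1 \<notin> N c2" "p1 \<notin> N c3" "p2 \<notin> N c1" "p2 \<notin> N c3" "p3 \<notin> N c1" "p3 \<notin> N c2"
  shows False
proof -
  \<comment> \<open>An edge \<open>q r\<close> would close a 4-cycle \<open>a, b, r, q\<close>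
    without a diagonal.\<close>
  have sq: "\<not> E q r"
    if "E a b" "E a q" "E b r" "q \<notin> N b" "r \<notin> N a" for a b q r
  proof
    assume "E q r"
    have "E q b"
    proof (rule separated_clique[of q b "{a}" "{r}" a a r r])
      show "E r q" "E q a" "E b r" using \<open>E q r\<close> that sym by blast+
      show "q \<notin> {a} \<union> {r}" "b \<notin> {a} \<union> {r}" using that irr \<open>E q r\<close> by (auto simp: N_def)
      show "{a} \<inter> {r} = {}" "q \<noteq> b" "\<And>k m. k \<in> {a} \<Longrightarrow> m \<in> {r} \<Longrightarrow> \<not> E k m" using that by (auto simp: N_def)
    qed (use that in auto)
    then have "E b q" by (rule sym)
    then show False using that by (simp add: N_def)
  qed
  have pp: "\<not> E p1 p2" "\<not> E p1 p3" "\<not> E p2 p3"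
    using sq[of c1 c2 p1 p2] sq[of c1 c3 p1 p3] sq[of c2 c3 p2 p3] c p np by blast+
  have neq: "p1 \<noteq> p2" "p1 \<noteq> p3" "p2 \<noteq> p3" using p np by (auto simp: N_def)
  have ncp: "p1 \<noteq> c2" "p1 \<noteq> c3" "p2 \<noteq> c1" "p2 \<noteq> c3" "p3 \<noteq> c1" "p3 \<noteq> c2" "p1 \<noteq> c1" "p2 \<noteq> c2" "p3 \<noteq> c3"
    "c1 \<noteq> c2" "c1 \<noteq> c3" "c2 \<noteq> c3"
    using np c p irr by (auto simp: N_def)
  have ncE: "\<not> E c2 p1" "\<not> E c3 p1" "\<not> E c1 p2" "\<not> E c3 p2" "\<not> E c1 p3" "\<not> E c2 p3"
    using np by (auto simp: N_def)
  note syms = sym[OF c(1)] sym[OF c(2)] sym[OF c(3)] sym[OF p(1)] sym[OF p(2)] sym[OF p(3)]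
  have ncE': "\<not> E p1 c2" "\<not> E p1 c3" "\<not> E p2 c1" "\<not> E p2 c3" "\<not> E p3 c1" "\<not> E p3 c2"
    "\<not> E p2 p1" "\<not> E p3 p1" "\<not> E p3 p2"
    using ncE pp by (metis sym)+
  define H where "H = {c1, c2, c3, p1, p2, p3}"
  have star: "reach S u v" if "u \<in> S" "v \<in> S" "c \<in> S" and near: "\<forall>w\<in>S. w = c \<or> E c w \<or> (\<exists>x\<in>S. E c x \<and> E x w)" for S u v c
  proof -
    have "reach S c w" if wS: "w \<in> S" for w
    proof -
      consider "w = c" | "E c w" | x where "x \<in> S" "E c x" "E x w"
        using wS near by blast
      then show ?thesis
      proof cases
        case 2
        then show ?thesis using reach_edge[of c w S] wS \<open>c \<in> S\<close> by blast
      next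
        case 3
        then show ?thesis
          using reach_trans[OF reach_edge[of c x S] reach_edge[of x w S]] wS \<open>c \<in> S\<close> by blast
      qed simp
    qed
    then show ?thesis using that(1,2) reach_sym[of S c u] reach_trans[of S u c v] by blast
  qed
  show False
  proof (rule dp_triple[of H p1 p2 p3])
    show "H \<subseteq> V" using c p EV EV2 unfolding H_def by blast
    show "reach H u v" if "u \<in> H" "v \<in> H" for u v
      by (rule star[OF that, of c1]) (use c p syms in \<open>auto simp: H_def\<close>)
    have n1: "H \<inter> N p1 = {p1, c1}" "H \<inter> N p2 = {p2, c2}" "H \<inter> N p3 = {p3, c3}"
      unfolding H_def N_def using syms ncE' pp irr by auto
    have m: "H - N p1 = {c2, c3, p2, p3}" "H - N p2 = {c1, c3, p1, p3}" "H - N p3 = {c1, c2, p1, p2}"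
    proof -
      have "H - N p = H - (H \<inter> N p)" for p by blast
      note this[of p1] this[of p2] this[of p3]
      then show "H - N p1 = {c2, c3, p2, p3}" "H - N p2 = {c1, c3, p1, p3}" "H - N p3 = {c1, c2, p1, p2}"
        unfolding n1 unfolding H_def using ncp neq by auto
    qed
    show "H \<inter> N p1 \<inter> N p2 = {}" "H \<inter> N p1 \<inter> N p3 = {}" "H \<inter> N p2 \<inter> N p3 = {}"
    proof -
      have "H \<inter> N a \<inter> N b = (H \<inter> N a) \<inter> (H \<inter> N b)" for a b by blast
      note this[of p1 p2] this[of p1 p3] this[of p2 p3]
      then show "H \<inter> N p1 \<inter> N p2 = {}" "H \<inter> N p1 \<inter> N p3 = {}" "H \<inter> N p2 \<inter> N p3 = {}"
        unfolding n1 using neq ncp by simp_all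
    qed
    fix t u v assume t: "t \<in> {p1, p2, p3}" and uv: "u \<in> H - N t" "v \<in> H - N t"
    from t consider "t = p1" | "t = p2" | "t = p3" by blast
    then show "reach (H - N t) u v"
    proof cases
      case 1
      show ?thesis by (rule star[OF uv, of c2]) (unfold 1 m, simp_all add: c p syms)
    next
      case 2
      show ?thesis by (rule star[OF uv, of c1]) (unfold 2 m, simp_all add: c p syms)
    next
      case 3
      show ?thesis by (rule star[OF uv, of c1]) (unfold 3 m, simp_all add: c p syms)
    qed
  qed (auto simp: H_def)
qed

text \<open>An exchange argument. If \<open>p3\<close> were not covered, replacing \<open>c2\<close>
  by \<open>c3\<close> would gain \<open>p3\<close>, so by maximality it must lose something: a
  vertex seen by \<open>c2\<close> but by neither \<open>c1\<close> nor \<open>c3\<close>. Likewise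
  \<open>c1\<close> has a private vertex. Together with \<open>p3\<close> these are the pendants of
  a net.\<close>

lemma best_pair_covers:
  assumes Q: "clique Q" "c1 \<in> Q" "c2 \<in> Q" "c3 \<in> Q"
    and max: "\<And>a b. a \<in> Q \<Longrightarrow> b \<in> Q \<Longrightarrow> card (N a \<union> N b) \<le> card (N c1 \<union> N c2)"
    and p3: "p3 \<in> N c3"
  shows "p3 \<in> N c1 \<union> N c2"
proof (rule ccontr)
  assume n3: "p3 \<notin> N c1 \<union> N c2"
  have priv: "\<exists>p. p \<in> N c2 \<and> p \<notin> N c1 \<and> p \<notin> N c3"
    if "c1 \<in> Q" "card (N c1 \<union> N c3) \<le> card (N c1 \<union> N c2)" "p3 \<notin> N c1 \<union> N c2" for c1 c2
  proof (rule ccontr)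
    assume "\<not> ?thesis"
    then have "N c1 \<union> N c2 \<subset> N c1 \<union> N c3" using p3 that by blast
    then have "card (N c1 \<union> N c2) < card (N c1 \<union> N c3)" by (intro psubset_card_mono) auto
    then show False using that by simp
  qed
  obtain p2 where p2: "p2 \<in> N c2" "p2 \<notin> N c1" "p2 \<notin> N c3" using priv[of c1 c2] max Q n3 by blast
  obtain p1 where p1: "p1 \<in> N c1" "p1 \<notin> N c2" "p1 \<notin> N c3"
    using priv[of c2 c1] max[of c2 c3] Q n3 by (metis Un_commute)
  have cE: "E a b" if "a \<in> Q" "b \<in> Q" "a \<noteq> b" for a b using Q that by (auto simp: clique_def)
  have ne: "c1 \<noteq> c2" "c1 \<noteq> c3" "c2 \<noteq> c3" using p1 p2 by auto
  have inN: "a \<in> N b" if "a \<in> Q" "b \<in> Q" for a b using cE that by (auto simp: N_def)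
  have "E c1 p1" "E c2 p2" "E c3 p3"
    using p1 p2 p3 n3 inN Q by (auto simp: N_def)
  then show False
    using no_net[of c1 c2 c3 p1 p2 p3] cE Q ne p1 p2 n3 by blast
qed

subsection \<open>Simplicial vertices\<close>

text \<open>Dirac's theorem on simplicial vertices, relative to a set with clique boundary. Unless
  every vertex of \<open>K\<close> sees all of \<open>K\<close> and its boundary, some vertex
  \<open>t\<close> misses some \<open>t'\<close> in \<open>K\<close>. The component of
  \<open>t'\<close> outside \<open>N t\<close> is a smaller set, and its boundary is a clique since
  \<open>t\<close> and the component lie on different sides of it.\<close>

lemma simplicial_in_set:
  assumes "K \<noteq> {}" "K \<subseteq> V" "clique {b \<in> V - K. \<exists>k\<in>K. E b k}"
  shows "\<exists>y\<in>K. simplicial y"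
  using assms
proof (induction "card K" arbitrary: K rule: less_induct)
  case less
  define B where "B = {b \<in> V - K. \<exists>k\<in>K. E b k}"
  have NK: "N k \<subseteq> K \<union> B" if "k \<in> K" for k
    using that less.prems EV2 sym unfolding B_def N_def by blast
  have Bcl: "E a b" if "a \<in> B" "b \<in> B" "a \<noteq> b" for a b
    using less.prems(3) that by (auto simp: clique_def B_def)
  show ?case
  proof (cases "\<forall>a\<in>K \<union> B. \<forall>b\<in>K. a \<noteq> b \<longrightarrow> E a b")
    case True
    obtain y where y: "y \<in> K" using less.prems by auto
    have cl: "E a b" if "a \<in> K \<union> B" "b \<in> K \<union> B" "a \<noteq> b" for a b
      using that True Bcl by (metis UnE sym)
    have "clique (N y)" unfolding clique_def
      using NK[OF y] cl N_subset y less.prems by blast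
    then show ?thesis using y less.prems by (auto simp: simplicial_def)
  next
    case False
    \<comment> \<open>\<open>t\<close> is taken from the boundary \<open>B\<close> whenever
      possible. If it has to come from \<open>K\<close>, then \<open>B\<close> is completely joined
      to \<open>K\<close>. Either way \<open>B\<close> lies in \<open>N t\<close>, which keeps the
      component inside \<open>K\<close>.\<close>
    obtain t t' where t: "t \<in> K \<union> B" "t' \<in> K" "t \<noteq> t'" "\<not> E t t'" "t \<in> K \<longrightarrow> B \<subseteq> N t"
    proof (cases "\<exists>a\<in>B. \<exists>b\<in>K. a \<noteq> b \<and> \<not> E a b")
      case True
      then obtain a b where "a \<in> B" "b \<in> K" "a \<noteq> b" "\<not> E a b" by blast
      moreover from this have "a \<notin> K" by (auto simp: B_def)
      ultimately show ?thesis using that[of a b] by blast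
    next
      case nB: False
      with False obtain a b where ab: "a \<in> K" "b \<in> K" "a \<noteq> b" "\<not> E a b" by blast
      have "B \<subseteq> N a"
      proof
        fix x assume "x \<in> B"
        then have "x \<noteq> a \<and> E x a" using nB ab(1) by (auto simp: B_def)
        then show "x \<in> N a" using sym[of x a] by (auto simp: N_def)
      qed
      then show ?thesis using that[of a b] ab by blast
    qed
    define K' where "K' = {u. reach (K \<union> B - N t) t' u}"
    have t': "t' \<in> K \<union> B - N t" using t by (auto simp: N_def)
    have sub: "K' \<subseteq> K \<union> B - N t" using reach_in t' unfolding K'_def by blast
    have BN: "B \<subseteq> N t"
    proof (cases "t \<in> K")
      case False
      then have "t \<in> B" using t by auto
      then show ?thesis using Bcl by (auto simp: N_def)
    qed (use t in blast)
    have K'K: "K' \<subseteq> K" using sub BN by blast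
    have "K' \<noteq> K"
    proof (cases "t \<in> K")
      case True
      moreover have "t \<notin> K'" using sub by (auto simp: N_def)
      ultimately show ?thesis by blast
    next
      case False
      then obtain k where "k \<in> K" "E t k" using t by (auto simp: B_def)
      moreover from this have "k \<notin> K'" using sub by (auto simp: N_def)
      ultimately show ?thesis by blast
    qed
    then have lt: "card K' < card K"
      using K'K psubset_card_mono[of K K'] finite_subset[OF less.prems(2) fin] by blast
    have ne': "K' \<noteq> {}" by (auto simp: K'_def intro: reach_refl)
    have "E a b" if a: "a \<in> V - K'" "k1 \<in> K'" "E a k1" and b: "b \<in> V - K'" "k2 \<in> K'" "E b k2"
      and "a \<noteq> b" for a b k1 k2
    proof -
      have near: "E c t \<and> c \<noteq> t" if c: "c \<in> V - K'" "k \<in> K'" "E c k" for c k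
      proof -
        have "c \<in> N k" using sym[OF c(3)] by (auto simp: N_def)
        then have "c \<in> K \<union> B" using NK[of k] c K'K by blast
        have "c \<in> N t"
        proof (rule ccontr)
          assume "c \<notin> N t"
          then have "reach (K \<union> B - N t) k c" using reach_edge[OF sym[OF c(3)]] sub c \<open>c \<in> K \<union> B\<close> by blast
          then have "c \<in> K'" using c(2) reach_trans unfolding K'_def by blast
          then show False using c by blast
        qed
        moreover have "c \<noteq> t" using c sub sym[OF c(3)] by (auto simp: N_def)
        ultimately show ?thesis using sym[of t c] by (auto simp: N_def)
      qed
      have kk: "reach K' k1 k2" using component_connected a(2) b(2) unfolding K'_def by blast
      show ?thesis
      proof (rule separated_clique[of a b K' "{t}" k1 k2 t t])
        show "\<not> E k m" if "k \<in> K'" "m \<in> {t}" for k m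
          using sub that sym[of k t] by (auto simp: N_def)
        show "K' \<inter> {t} = {}" using sub by (auto simp: N_def)
        show "E k2 b" "E b t" "E t a"
          using near[OF a] near[OF b] sym[OF b(3)] sym[of a t] by blast+
      qed (use near[OF a] near[OF b] a b kk \<open>a \<noteq> b\<close> in auto)
    qed
    then have "clique {b \<in> V - K'. \<exists>k\<in>K'. E b k}" unfolding clique_def by blast
    then obtain y where "y \<in> K'" "simplicial y" using less.hyps[OF lt ne'] K'K less.prems by blast
    then show ?thesis using K'K by blast
  qed
qed

text \<open>A component \<open>K\<close> of the last breadth-first layer has its boundary in the
  layer before. Two boundary vertices are joined through \<open>K\<close> and through the ball of
  radius \<open>k - 2\<close>, which has no edge to \<open>K\<close>; so they are adjacent, and
  \<open>simplicial_in_set\<close> applies to \<open>K\<close>.\<close>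

lemma simplicial_farthest:
  assumes s: "s \<in> V"
  shows "\<exists>y. simplicial y \<and> d s y = ecc s"
proof -
  obtain v0 where v0: "v0 \<in> V" "d s v0 = ecc s" using ecc_attained by blast
  define k where "k = ecc s"
  define L where "L = {w \<in> V. d s w = k}"
  define K where "K = {u. reach L v0 u}"
  have "v0 \<in> L" using v0 by (simp add: L_def k_def)
  then have KL: "K \<subseteq> L" using reach_in unfolding K_def by blast
  have KV: "K \<subseteq> V" using KL by (auto simp: L_def)
  have conK: "reach K a b" if "a \<in> K" "b \<in> K" for a b
    using component_connected that unfolding K_def by blast
  have lay: "d s b + 1 = k" if b: "b \<in> V - K" "u \<in> K" "E b u" for b u
  proof -
    have "d s b \<noteq> k"
    proof
      assume "d s b = k"
      then have "reach L u b" using reach_edge[OF sym[OF b(3)]] KL b by (auto simp: L_def)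
      then have "b \<in> K" using b reach_trans unfolding K_def by blast
      then show False using b by simp
    qed
    moreover have "d s b \<le> k" using d_le_ecc b by (auto simp: k_def)
    moreover have "d s u \<le> d s b + 1" using d_step[OF b(3) s] .
    moreover have "d s u = k" using b KL by (auto simp: L_def)
    ultimately show ?thesis by linarith
  qed
  have "E a b" if a: "a \<in> V - K" "k1 \<in> K" "E a k1" and b: "b \<in> V - K" "k2 \<in> K" "E b k2" and "a \<noteq> b" for a b k1 k2
  proof -
    have l: "d s a + 1 = k" "d s b + 1 = k" using lay a b by blast+
    \<comment> \<open>\<open>a\<close> and \<open>b\<close> are on the same layer, so if one of them
      were \<open>s\<close>, they would coincide. This also yields \<open>2 \<le> k\<close>, without
      which the ball of radius \<open>k - 2\<close> would be truncated.\<close>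
    have "a \<noteq> s" "b \<noteq> s" using l \<open>a \<noteq> b\<close> d_0[of s a] d_0[of s b] s a b by auto
    define M where "M = {w \<in> V. d s w \<le> k - 2}"
    obtain m2 where m2: "E m2 a" "d s m2 + 1 = d s a" using d_prev[OF s, of a] a(1) \<open>a \<noteq> s\<close> by blast
    obtain m1 where m1: "E m1 b" "d s m1 + 1 = d s b" using d_prev[OF s, of b] b(1) \<open>b \<noteq> s\<close> by blast
    have mM: "m1 \<in> M" "m2 \<in> M" using m1 m2 l EV[OF m1(1)] EV[OF m2(1)] by (auto simp: M_def)
    then have "reach M s m1" "reach M s m2" unfolding M_def using ball_reach[OF s] by auto
    then have mm: "reach M m1 m2" by (rule reach_via)
    have "2 \<le> k" using m2 l by linarith
    show ?thesis
    proof (rule separated_clique[of a b K M k1 k2 m1 m2])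
      show "\<not> E u m" if "u \<in> K" "m \<in> M" for u m
      proof
        assume "E u m"
        then have "d s u \<le> d s m + 1" using d_step[OF sym[OF \<open>E u m\<close>] s] by blast
        then show False using that KL \<open>2 \<le> k\<close> by (auto simp: L_def M_def)
      qed
      show "K \<inter> M = {}" using KL \<open>2 \<le> k\<close> by (auto simp: L_def M_def)
      show "a \<notin> K \<union> M" "b \<notin> K \<union> M" using a b l \<open>2 \<le> k\<close> by (auto simp: M_def)
      show "E b m1" "E k2 b" using sym[OF m1(1)] sym[OF b(3)] by blast+
    qed (use a b m1 m2 mM mm conK \<open>a \<noteq> b\<close> in auto)
  qed
  then have "clique {b \<in> V - K. \<exists>k\<in>K. E b k}" unfolding clique_def by blast
  moreover have "K \<noteq> {}" by (auto simp: K_def intro: reach_refl)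
  ultimately obtain y where "y \<in> K" "simplicial y" using simplicial_in_set KV by blast
  then show ?thesis using KL by (auto simp: L_def k_def)
qed

section \<open>Diameter tests from balls around simplicial vertices\<close>

lemma simplicial_diametral_pair:
  "\<exists>x y. simplicial x \<and> simplicial y \<and> d x y = diam"
proof -
  obtain s where s: "s \<in> V" "ecc s = diam" using diam_attained by blast
  obtain x where x: "simplicial x" "d s x = diam" using simplicial_farthest s by metis
  have xV: "x \<in> V" using x by (simp add: simplicial_def)
  have "ecc x = diam" using d_le_ecc[of s x] ecc_le_diam[OF xV] d_sym[of s x] s xV x by linarith
  moreover obtain y where "simplicial y" "d x y = ecc x" using simplicial_farthest xV by blast
  ultimately show ?thesis using x by auto
qed

lemma simplicial_adjacent: "simplicial y \<Longrightarrow> a \<in> N y \<Longrightarrow> b \<in> N y \<Longrightarrow> a \<noteq> b \<Longrightarrow> E a b"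
  by (auto simp: simplicial_def clique_def)

lemma simplicial_V: "simplicial y \<Longrightarrow> y \<in> V"
  by (simp add: simplicial_def)

definition best_pair :: "'a \<Rightarrow> 'a \<times> 'a \<Rightarrow> bool" where
  "best_pair y = (\<lambda>(a, b). a \<in> N y \<and> b \<in> N y \<and>
     (\<forall>a'\<in>N y. \<forall>b'\<in>N y. card (N a' \<union> N b') \<le> card (N a \<union> N b)))"

lemma best_pair_ball2:
  assumes y: "simplicial y" and ab: "best_pair y (a, b)" and v: "v \<in> V"
  shows "v \<in> N a \<union> N b \<longleftrightarrow> d y v \<le> 2"
proof
  have ab': "a \<in> N y" "b \<in> N y" using ab by (auto simp: best_pair_def)
  have yV: "y \<in> V" using y by (rule simplicial_V)
  note NV = N_subset[OF yV]
  {
    assume "v \<in> N a \<union> N b"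
    then obtain c where c: "c \<in> N y" "v \<in> N c" using ab' by blast
    have "d y c \<le> 1" "d c v \<le> 1" using d_1[of y c] d_1[of c v] c NV yV v by auto
    then show "d y v \<le> 2" using d_tri[of y c v] c NV yV v by fastforce
  }
  assume "d y v \<le> 2"
  then obtain c where c: "c \<in> V" "d y c \<le> 1" "d c v \<le> 1"
  proof (cases "d y v \<le> 1")
    case True
    then show ?thesis using that[of y] yV by simp
  next
    case False
    then obtain w where "w \<in> V" "d y w = 1" "d w v = d y v - 1" using d_between[of y v 1] yV v by auto
    then show ?thesis using that[of w] \<open>d y v \<le> 2\<close> by simp
  qed
  then have "c \<in> N y" "v \<in> N c" using d_1[of y c] d_1[of c v] yV v by auto
  then show "v \<in> N a \<union> N b"
    using best_pair_covers[of "N y" a b c v] y ab by (auto simp: simplicial_def best_pair_def)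
qed

text \<open>Stated with cardinalities because the program only knows the size of the union, from two
  degrees and a number of common neighbours. Simplicial vertices suffice since they contain a
  diametral pair.\<close>

theorem diam_le_2_iff:
  assumes bp: "\<And>y. simplicial y \<Longrightarrow> best_pair y (a y, b y)"
  shows "diam \<le> 2 \<longleftrightarrow> (\<forall>y. simplicial y \<longrightarrow> card (N (a y) \<union> N (b y)) = card V)"
proof -
  have eq: "card (N (a y) \<union> N (b y)) = card V \<longleftrightarrow> (\<forall>v\<in>V. d y v \<le> 2)" if y: "simplicial y" for y
  proof -
    have "a y \<in> N y" "b y \<in> N y" using bp[OF y] by (auto simp: best_pair_def)
    then have "N (a y) \<union> N (b y) \<subseteq> V" using N_subset simplicial_V[OF y] by blast
    then have "card (N (a y) \<union> N (b y)) = card V \<longleftrightarrow> N (a y) \<union> N (b y) = V"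
      using card_subset_eq fin by metis
    then show ?thesis using best_pair_ball2[OF y bp[OF y]] \<open>N (a y) \<union> N (b y) \<subseteq> V\<close> by blast
  qed
  obtain x y where xy: "simplicial x" "simplicial y" "d x y = diam" using simplicial_diametral_pair by blast
  show ?thesis
  proof
    assume "diam \<le> 2"
    then have "d y v \<le> 2" if "simplicial y" "v \<in> V" for y v
      using d_le_diam[of y v] that simplicial_V le_trans by blast
    then show "\<forall>y. simplicial y \<longrightarrow> card (N (a y) \<union> N (b y)) = card V" using eq by blast
  next
    assume "\<forall>y. simplicial y \<longrightarrow> card (N (a y) \<union> N (b y)) = card V"
    then have "d x y \<le> 2" using eq[OF xy(1)] xy simplicial_V by blast
    then show "diam \<le> 2" using xy by simp
  qed
qed

text \<open>Distance 2 is symmetric, so the balls around simplicial vertices decide it also for the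
  centre \<open>c\<close>, which need not be simplicial; a farthest vertex from \<open>c\<close> can
  be chosen simplicial.\<close>

lemma ecc_le_2_iff:
  assumes bp: "\<And>y. simplicial y \<Longrightarrow> best_pair y (a y, b y)" and c: "c \<in> V"
  shows "ecc c \<le> 2 \<longleftrightarrow> (\<forall>y. simplicial y \<longrightarrow> c \<in> N (a y) \<union> N (b y))"
proof -
  have eq: "c \<in> N (a y) \<union> N (b y) \<longleftrightarrow> d c y \<le> 2" if "simplicial y" for y
    using best_pair_ball2[OF that bp[OF that] c] d_sym[of c y] simplicial_V[OF that] c by simp
  obtain y where y: "simplicial y" "d c y = ecc c" using simplicial_farthest c by blast
  show ?thesis
  proof
    assume "ecc c \<le> 2"
    then show "\<forall>y. simplicial y \<longrightarrow> c \<in> N (a y) \<union> N (b y)"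
      using eq d_le_ecc[of _ c] simplicial_V le_trans by metis
  next
    assume "\<forall>y. simplicial y \<longrightarrow> c \<in> N (a y) \<union> N (b y)"
    then have "d c y \<le> 2" using eq y by blast
    then show "ecc c \<le> 2" using y by simp
  qed
qed

text \<open>For the nontrivial direction let \<open>c\<close> in \<open>N y\<close> have a ball
  \<open>B c\<close> of radius 2 of maximal size. If it misses \<open>p2\<close>, another vertex
  \<open>c'\<close> of \<open>N y\<close> reaches \<open>p2\<close> within 2 and by maximality loses
  some \<open>p1\<close> of \<open>B c\<close>. Then \<open>d p1 c\<close> and
  \<open>d p2 c'\<close> are 2 and both grow along the edge \<open>c c'\<close>, so
  \<open>alpha_metric\<close> gives \<open>d p1 p2 \<ge> 4\<close>.\<close>

theorem diam_le_3_iff: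
  "diam \<le> 3 \<longleftrightarrow> (\<forall>y. simplicial y \<longrightarrow> (\<exists>c\<in>N y. ecc c \<le> 2))"
proof
  assume D: "diam \<le> 3"
  show "\<forall>y. simplicial y \<longrightarrow> (\<exists>c\<in>N y. ecc c \<le> 2)"
  proof (intro allI impI)
    fix y assume y: "simplicial y"
    have yV: "y \<in> V" using y by (rule simplicial_V)
    note NV = N_subset[OF yV]
    define B where "B c = {v \<in> V. d c v \<le> 2}" for c
    have ne: "(\<lambda>c. card (B c)) ` N y \<noteq> {}" by (simp add: N_def)
    obtain c where c: "c \<in> N y" and max: "\<And>c'. c' \<in> N y \<Longrightarrow> card (B c') \<le> card (B c)"
      using Max_in[OF _ ne] Max_ge[of "(\<lambda>c. card (B c)) ` N y"] by fastforce
    have "ecc c \<le> 2"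
    proof (rule ccontr)
      assume "\<not> ecc c \<le> 2"
      then obtain p2 where p2: "p2 \<in> V" "2 < d c p2" using ecc_attained[of c] by auto
      have cV: "c \<in> V" using c NV by blast
      have "y \<in> N y" by (simp add: N_def)
      have "c \<noteq> y \<or> d y p2 \<le> 3" using d_le_diam[OF yV p2(1)] D by simp
      obtain c' where c': "c' \<in> N y" "d c' p2 \<le> 2"
      proof -
        have "d y p2 \<le> 3" using d_le_diam[OF yV p2(1)] D by simp
        show ?thesis
        proof (cases "d y p2 \<le> 2")
          case True
          then show ?thesis using that[of y] \<open>y \<in> N y\<close> by simp
        next
          case False
          then obtain w where w: "w \<in> V" "d y w = 1" "d w p2 = d y p2 - 1"
            using d_between[of y p2 1] yV p2 by auto
          then show ?thesis using that[of w] d_1[of y w] yV \<open>d y p2 \<le> 3\<close> by simp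
        qed
      qed
      have c'V: "c' \<in> V" using c' NV by blast
      have "c \<noteq> c'" using c' p2 by auto
      then have cc: "E c c'" using simplicial_adjacent[OF y] c c' by blast
      have "\<not> B c \<subset> B c'" using max[OF c'(1)] psubset_card_mono[of "B c'" "B c"] fin by (auto simp: B_def)
      moreover have "p2 \<in> B c'" "p2 \<notin> B c" using p2 c' by (auto simp: B_def)
      ultimately have "\<not> B c \<subseteq> B c'" by blast
      then obtain p1 where "p1 \<in> B c" "p1 \<notin> B c'" by blast
      then have p1: "p1 \<in> V" "d c p1 \<le> 2" "2 < d c' p1" by (simp_all add: B_def)
      have e: "d p1 c' \<le> d p1 c + 1" "d p2 c \<le> d p2 c' + 1"
        using d_step[OF cc p1(1)] d_step[OF sym[OF cc] p2(1)] .
      have s: "d c p1 = d p1 c" "d c' p1 = d p1 c'" "d c p2 = d p2 c" "d c' p2 = d p2 c'"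
        using d_sym cV c'V p1 p2 by auto
      have "d p1 c + d p2 c' \<le> d p1 p2"
        by (rule alpha_metric[OF p1(1) p2(1) cc]) (use e s p1 p2 c' in linarith)+
      moreover have "d p1 p2 \<le> 3" using d_le_diam[OF p1(1) p2(1)] D by simp
      ultimately show False using e s p1 p2 c' by linarith
    qed
    then show "\<exists>c\<in>N y. ecc c \<le> 2" using c by blast
  qed
next
  assume A: "\<forall>y. simplicial y \<longrightarrow> (\<exists>c\<in>N y. ecc c \<le> 2)"
  obtain x y where xy: "simplicial x" "simplicial y" "d x y = diam" using simplicial_diametral_pair by blast
  then obtain c where c: "c \<in> N x" "ecc c \<le> 2" using A by blast
  have V: "x \<in> V" "y \<in> V" using xy simplicial_V by auto
  then have "c \<in> V" using c N_subset by blast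
  have "d x c \<le> 1" using d_1[of x c] V c \<open>c \<in> V\<close> by simp
  moreover have "d c y \<le> 2" using d_le_ecc[OF V(2), of c] c by simp
  ultimately show "diam \<le> 3" using d_tri[of x c y] V \<open>c \<in> V\<close> xy by linarith
qed

text \<open>If \<open>z\<close> had smaller eccentricity, the whole graph would be
  \<open>N z\<close>, which is a clique. Hence for diameter at most 2 the answer can be read off the
  search from any simplicial vertex.\<close>

lemma ecc_simplicial_diam_le_2:
  assumes z: "simplicial z" and D: "diam \<le> 2"
  shows "ecc z = diam"
proof (rule ccontr)
  have zV: "z \<in> V" using z by (rule simplicial_V)
  assume "ecc z \<noteq> diam"
  then have lt: "ecc z < diam" using ecc_le_diam[OF zV] by simp
  then have "ecc z \<le> 1" using D by simp
  then have N: "v \<in> N z" if "v \<in> V" for v using d_1[OF zV that] d_le_ecc[OF that, of z] by simp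
  obtain x y where xy: "simplicial x" "simplicial y" "d x y = diam" using simplicial_diametral_pair by blast
  then have "x \<in> N z" "y \<in> N z" using N simplicial_V by auto
  have "diam \<noteq> 0" using lt by simp
  then have "x \<noteq> y" using xy by auto
  then have "E x y" using simplicial_adjacent[OF z] \<open>x \<in> N z\<close> \<open>y \<in> N z\<close> by blast
  then have "diam \<le> 1" using d_edge xy by metis
  then have "ecc z = 0" using lt by simp
  then have "x = z" "y = z" using d_le_ecc[of _ z] d_0[OF zV] xy simplicial_V by (metis le_zero_eq)+
  then show False using \<open>x \<noteq> y\<close> by simp
qed

end

subsection \<open>The sweep\<close>

locale sweep = chordal_dp +
  fixes z v :: 'a
  assumes zV: "z \<in> V" and vV: "v \<in> V"
begin

text \<open>If \<open>v\<close> is closer than 3 to \<open>z\<close>, then \<open>R\<close> is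
  \<open>{v}\<close> by reflexivity of \<open>reach\<close>, and \<open>C\<close> is empty because
  its vertices need a neighbour in \<open>R\<close> at distance 3 from \<open>z\<close>.\<close>

definition R :: "'a set" where
  "R = {u. reach {w \<in> V. 3 \<le> d z w} v u}"

definition C :: "'a set" where
  "C = {c \<in> V. d z c = 2 \<and> (\<exists>u\<in>R. E c u \<and> d z u = 3)}"

text \<open>Meaningful only for nonempty \<open>C\<close>; statements about levels are therefore
  made under \<open>3 \<le> d z v\<close> or \<open>C \<noteq> {}\<close>.\<close>

definition lev :: "'a \<Rightarrow> nat" where
  "lev u = Min ((\<lambda>c. d c u) ` C)"

definition near :: "'a \<Rightarrow> 'a set" where
  "near u = {c \<in> C. d c u = lev u}"

lemma C_V: "c \<in> C \<Longrightarrow> c \<in> V"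
  by (simp add: C_def)

lemma finite_C [simp]: "finite C"
  using finite_subset[OF _ fin, of C] C_V by blast

lemma R_layer: assumes "3 \<le> d z v" "u \<in> R" shows "u \<in> V" "3 \<le> d z u"
  using reach_in[of "{w \<in> V. 3 \<le> d z w}" v u] assms vV by (auto simp: R_def)

lemma R_trivial: "\<not> 3 \<le> d z v \<Longrightarrow> u \<in> R \<Longrightarrow> u = v"
  unfolding R_def reach_def by (auto elim: converse_rtranclpE)

lemma v_R: "v \<in> R"
  by (simp add: R_def)

lemma R_step: "u \<in> R \<Longrightarrow> E u w \<Longrightarrow> w \<in> V \<Longrightarrow> 3 \<le> d z u \<Longrightarrow> 3 \<le> d z w \<Longrightarrow> w \<in> R"
  unfolding R_def using reach_trans[of _ v u w] reach_edge[of u w "{w \<in> V. 3 \<le> d z w}"] EV[of u w] by simp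

lemma R_connected: "a \<in> R \<Longrightarrow> b \<in> R \<Longrightarrow> reach R a b"
  unfolding R_def using component_connected by blast

text \<open>\<open>R\<close> and the ball of radius 1 around \<open>z\<close> are connected, have no
  edge between them and both touch every vertex of \<open>C\<close>; so
  \<open>separated_clique\<close> applies.\<close>

lemma clique_C: "clique C"
proof -
  have "E a b" if ab: "a \<in> C" "b \<in> C" "a \<noteq> b" for a b
  proof -
    obtain k1 where k1: "k1 \<in> R" "E a k1" "d z k1 = 3" using ab by (auto simp: C_def)
    obtain k2 where k2: "k2 \<in> R" "E b k2" "d z k2 = 3" using ab by (auto simp: C_def)
    have v3: "3 \<le> d z v" using R_trivial k1 by (metis order_refl)
    have l: "a \<in> V" "b \<in> V" "d z a = 2" "d z b = 2" using ab by (auto simp: C_def)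
    define M where "M = {w \<in> V. d z w \<le> 1}"
    have "z \<noteq> a" "z \<noteq> b" using l by auto
    obtain m2 where m2: "E m2 a" "d z m2 + 1 = d z a" using d_prev[OF zV l(1) \<open>z \<noteq> a\<close>] by blast
    obtain m1 where m1: "E m1 b" "d z m1 + 1 = d z b" using d_prev[OF zV l(2) \<open>z \<noteq> b\<close>] by blast
    have mM: "m1 \<in> M" "m2 \<in> M" using m1 m2 l EV[OF m1(1)] EV[OF m2(1)] by (auto simp: M_def)
    then have "reach M z m1" "reach M z m2" unfolding M_def using ball_reach[OF zV] by auto
    then have mm: "reach M m1 m2" by (rule reach_via)
    show ?thesis
    proof (rule separated_clique[of a b R M k1 k2 m1 m2])
      show "\<not> E u m" if "u \<in> R" "m \<in> M" for u m
      proof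
        assume "E u m"
        then have "d z u \<le> d z m + 1" using d_step[OF sym zV] by blast
        then show False using R_layer[OF v3 that(1)] that(2) by (auto simp: M_def)
      qed
      show "R \<inter> M = {}" using R_layer[OF v3] by (force simp: M_def)
      show "a \<notin> R \<union> M" "b \<notin> R \<union> M" using l R_layer[OF v3, of a] R_layer[OF v3, of b] by (auto simp: M_def)
      show "E b m1" "E k2 b" using sym[OF m1(1)] sym[OF k2(2)] by blast+
    qed (use k1 k2 m1 m2 mM mm R_connected ab in auto)
  qed
  then show ?thesis unfolding clique_def using C_V by blast
qed

context
  assumes v3: "3 \<le> d z v"
begin

lemma R_V: "u \<in> R \<Longrightarrow> u \<in> V"
  using R_layer[OF v3] by blast

text \<open>Go back from \<open>w\<close> along a shortest path to \<open>u\<close>. The first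
  vertex outside \<open>R\<close> cannot be at distance 3 or more from \<open>z\<close>, or it would
  belong to the component; being adjacent to \<open>R\<close> it is at distance exactly 2 and lies
  in \<open>C\<close>.\<close>

lemma C_separates:
  assumes u: "u \<in> V" "u \<notin> R" and w: "w \<in> R"
  shows "\<exists>c\<in>C. d u c + d c w = d u w"
  using w
proof (induction "d u w" arbitrary: w)
  case 0
  then show ?case using d_0[of u w] u R_V by auto
next
  case (Suc n)
  have wV: "w \<in> V" using Suc.prems R_V by blast
  have "u \<noteq> w" using u Suc.prems by auto
  then obtain w' where w': "E w' w" "d u w' + 1 = d u w" using d_prev[OF u(1) wV] by blast
  have w'V: "w' \<in> V" using EV w' by blast
  show ?case
  proof (cases "w' \<in> R")
    case True
    then obtain c where c: "c \<in> C" "d u c + d c w' = d u w'" using Suc.hyps(1)[of w'] Suc.hyps(2) w' by auto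
    then have "d c w \<le> d c w' + 1" "d u w \<le> d u c + d c w"
      using d_step[OF w'(1)] d_tri[OF u(1) _ wV] C_V by blast+
    then have "d u c + d c w = d u w" using c w' by linarith
    then show ?thesis using c by blast
  next
    case False
    have "3 \<le> d z w" using R_layer[OF v3 Suc.prems] by blast
    moreover have "d z w \<le> d z w' + 1" using d_step[OF w'(1) zV] .
    moreover have "\<not> 3 \<le> d z w'" using R_step[OF Suc.prems sym[OF w'(1)] w'V] False \<open>3 \<le> d z w\<close> by blast
    ultimately have "w' \<in> C" using w'V Suc.prems w' by (auto simp: C_def)
    moreover have "d w' w = 1"
    proof -
      have "w' \<noteq> w" using w' by auto
      then show ?thesis using d_edge[OF w'(1)] d_0[OF w'V wV] by linarith
    qed
    ultimately show ?thesis using w' by (intro bexI[of _ w']) auto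
  qed
qed

lemma C_ne: "C \<noteq> {}"
proof -
  have "z \<notin> R" using R_layer[OF v3, of z] by auto
  then show ?thesis using C_separates[OF zV _ v_R] by blast
qed

lemma lev_le: "c \<in> C \<Longrightarrow> lev u \<le> d c u"
  by (simp add: lev_def)

lemma near_ne: "near u \<noteq> {}"
  using Min_in[of "(\<lambda>c. d c u) ` C"] C_ne unfolding near_def lev_def by fastforce

text \<open>\<open>C\<close> is a clique, so the distances from \<open>u\<close> to \<open>C\<close>
  take at most two consecutive values. All of them are determined by \<open>lev u\<close> and
  \<open>near u\<close>.\<close>

lemma d_C: assumes "u \<in> V" "c \<in> C" shows "d c u = (if c \<in> near u then lev u else lev u + 1)"
proof -
  obtain c' where c': "c' \<in> C" "d c' u = lev u" using near_ne[of u] by (auto simp: near_def)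
  have "d c u \<le> lev u + 1"
  proof (cases "c = c'")
    case False
    then have "d c c' \<le> 1" using clique_C c' assms d_edge by (auto simp: clique_def)
    then show ?thesis using d_tri[of c c' u] C_V c' assms by auto
  qed (use c' in simp)
  then show ?thesis using lev_le[OF assms(2), of u] assms(2) by (auto simp: near_def)
qed

text \<open>A shortest path between the sides meets \<open>C\<close> in one vertex \<open>c\<close>
  at least; unless \<open>c\<close> is nearest to both ends, one of the two parts is longer by
  1.\<close>

lemma cross:
  assumes u: "u \<in> V" "u \<notin> R" and w: "w \<in> R"
  shows "lev u + lev w + (if near u \<inter> near w = {} then 1 else 0) \<le> d u w"
proof -
  obtain c where c: "c \<in> C" "d u c + d c w = d u w" using C_separates assms by blast
  have "d u c = d c u" using d_sym u C_V c by blast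
  then show ?thesis using c d_C[OF u(1) c(1)] d_C[OF R_V[OF w] c(1)] by (auto split: if_splits)
qed

lemma cross':
  assumes "u \<in> V" "w \<in> V" "u \<in> R \<longleftrightarrow> w \<notin> R"
  shows "lev u + lev w + (if near u \<inter> near w = {} then 1 else 0) \<le> d u w"
proof (cases "w \<in> R")
  case True
  then show ?thesis using cross assms by blast
next
  case False
  then show ?thesis using cross[of w u] assms d_sym[of u w] by (auto simp: Int_commute add.commute)
qed

text \<open>Two incomparable sets \<open>near u\<close> and \<open>near u'\<close> on one side of the separator \<open>C\<close>, together
  with a vertex on the other side, yield an asteroidal triple.\<close>

lemma near_comparable:
  assumes V: "u \<in> V" "u' \<in> V" "t \<in> V" and side: "u \<in> R \<longleftrightarrow> t \<notin> R" "u' \<in> R \<longleftrightarrow> t \<notin> R"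
    and l: "2 \<le> lev u" "2 \<le> lev u'" "2 \<le> lev t"
  shows "near u \<subseteq> near u' \<or> near u' \<subseteq> near u"
proof (rule ccontr)
  assume "\<not> ?thesis"
  then obtain c1 c2 where c: "c1 \<in> near u" "c1 \<notin> near u'" "c2 \<in> near u'" "c2 \<notin> near u" by blast
  then have cC: "c1 \<in> C" "c2 \<in> C" by (auto simp: near_def)
  then have cV: "c1 \<in> V" "c2 \<in> V" using C_V by auto
  have cc: "E c1 c2" using clique_C cC c by (auto simp: clique_def)
  have s: "d a b = d b a" if "a \<in> V" "b \<in> V" for a b using d_sym that .
  have dd: "d c1 u = lev u" "d c2 u = lev u + 1" "d c2 u' = lev u'" "d c1 u' = lev u' + 1"
    using d_C V cC c by auto
  \<comment> \<open>The edge \<open>c1 c2\<close> of \<open>C\<close> continues a geodesic from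
    either side, so the inequality for chordal graphs applies to two vertices on the same side of
    \<open>C\<close>. All three pairwise distances are now at least 4.\<close>
  have uu: "lev u + lev u' \<le> d u u'"
    using alpha_metric[OF V(1,2) cc] dd s V cV by simp
  have ut: "lev u + lev t \<le> d u t" "lev u' + lev t \<le> d u' t"
    using cross'[OF V(1,3)] cross'[OF V(2,3)] side by auto
  \<comment> \<open>A vertex of level at least 2 has no vertex of \<open>C\<close> in its closed
    neighbourhood, so \<open>C\<close> can be used to switch between the paths of the
    triple.\<close>
  have hop: "reach (V - N w) a b" if "a \<in> C" "b \<in> C" "w \<in> V" "2 \<le> lev w" for a b w
  proof (cases "a = b")
    case False
    have "q \<in> V - N w" if "q \<in> C" for q
    proof -
      have "\<not> d w q \<le> 1" using lev_le[OF that, of w] \<open>2 \<le> lev w\<close> s[of w q] \<open>w \<in> V\<close> C_V[OF that] by simp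
      then show ?thesis using d_1[of w q] C_V[OF that] \<open>w \<in> V\<close> by blast
    qed
    moreover have "E a b" using clique_C that False by (auto simp: clique_def)
    ultimately show ?thesis using reach_edge that by blast
  qed simp
  obtain c3 where c3: "c3 \<in> near t" using near_ne by blast
  then have c3C: "c3 \<in> C" "d c3 t = lev t" by (auto simp: near_def)
  have r1: "reach (V - N t) u u'"
  proof -
    have "reach (V - N t) u c1" "reach (V - N t) u' c2"
      using reach_avoid[of u c1 t] reach_avoid[of u' c2 t] V cV dd ut lev_le[OF cC(1), of t] lev_le[OF cC(2), of t] l
        s[of u c1] s[of u' c2] s[of t c1] s[of t c2] by auto
    then show ?thesis using hop[OF cC V(3) l(3)] reach_sym reach_trans by meson
  qed
  have r2: "reach (V - N u') u t"
  proof -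
    have "reach (V - N u') u c1" "reach (V - N u') t c3"
      using reach_avoid[of u c1 u'] reach_avoid[of t c3 u'] V cV dd ut uu c3C C_V lev_le[OF c3C(1), of u'] l
        s[of u c1] s[of t c3] s[of u' c1] s[of u' c3] s[of t u'] by auto
    then show ?thesis using hop[OF cC(1) c3C(1) V(2) l(2)] reach_sym reach_trans by meson
  qed
  have r3: "reach (V - N u) u' t"
  proof -
    have "reach (V - N u) u' c2" "reach (V - N u) t c3"
      using reach_avoid[of u' c2 u] reach_avoid[of t c3 u] V cV dd ut uu c3C C_V lev_le[OF c3C(1), of u] l
        s[of u' c2] s[of t c3] s[of u c2] s[of u c3] s[of t u] s[of u u'] by auto
    then show ?thesis using hop[OF cC(2) c3C(1) V(1) l(1)] reach_sym reach_trans by meson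
  qed
  show False
    using no_far_asteroidal_triple[OF V _ _ _ r1 r2 r3] uu ut l by simp
qed

end

text \<open>Assume that all eccentricities in question are smaller than \<open>diam\<close>. Far
  triples and simpliciality of \<open>z\<close> pin down a diametral pair: \<open>x\<close> at
  distance 2 from \<open>z\<close>, \<open>y\<close> at distance \<open>diam - 1\<close> and on the
  side of \<open>v\<close>. The choice of \<open>xs\<close> then gives \<open>near xs\<close>
  contained in \<open>near x\<close> or in \<open>near y\<close>, whichever lies on the same side,
  and this contradicts the distances across \<open>C\<close>.\<close>

theorem sweep_finds_diam:
  assumes D: "5 \<le> diam" and z: "simplicial z" and s: "s \<in> V" "d s z = ecc s" and v: "d z v = ecc z"
    and xs: "xs \<in> V" "\<And>u. C \<noteq> {} \<Longrightarrow> u \<in> V \<Longrightarrow> lev u < lev xs \<or> lev u = lev xs \<and> card (near xs) \<le> card (near u)"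
  shows "diam = ecc z \<or> diam = ecc xs \<or> (\<exists>c\<in>C. diam = ecc c)"
proof (rule ccontr)
  assume contra: "\<not> ?thesis"
  have lt: "ecc z < diam" "ecc xs < diam" "\<And>c. c \<in> C \<Longrightarrow> ecc c < diam"
    using contra ecc_le_diam zV xs(1) C_V by (metis le_neq_implies_less)+
  have sy: "d a b = d b a" if "a \<in> V" "b \<in> V" for a b using d_sym that .
  \<comment> \<open>Otherwise \<open>x\<close>, \<open>y\<close>, \<open>z\<close> form a far
    asteroidal triple. As \<open>z\<close> is farthest from \<open>s\<close>, shortest paths from
    \<open>s\<close> to \<open>x\<close> and to \<open>y\<close> avoid \<open>N z\<close>; the other
    two connections avoid the third vertex because \<open>d x y\<close> is the diameter.\<close>
  have close: "d z x \<le> 2 \<or> d z y \<le> 2" if xy: "x \<in> V" "y \<in> V" "d x y = diam" for x y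
  proof (rule ccontr)
    assume "\<not> ?thesis"
    then have f: "3 \<le> d z x" "3 \<le> d z y" by auto
    have le: "d x z \<le> diam" "d y z \<le> diam" using d_le_diam xy zV by auto
    have sxy: "d x z = d z x" "d y z = d z y" "d y x = d x y" using sy xy zV by auto
    have "reach (V - N y) x z" using reach_avoid[of x z y] xy zV f le sxy by auto
    moreover have "reach (V - N x) y z" using reach_avoid[of y z x] xy zV f le sxy by auto
    moreover have "reach (V - N z) x y"
    proof -
      have "d s x \<le> d s z" "d s y \<le> d s z" using d_le_ecc xy s by auto
      then have "reach (V - N z) s x" "reach (V - N z) s y"
        using reach_avoid[of s x z] reach_avoid[of s y z] xy zV f s by auto
      then show ?thesis by (rule reach_via)
    qed
    ultimately show False using no_far_asteroidal_triple[of x y z] xy zV f sxy D by auto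
  qed
  obtain x y where xy: "simplicial x" "simplicial y" "d x y = diam" "d z x \<le> 2"
  proof -
    obtain x y where "simplicial x" "simplicial y" "d x y = diam" using simplicial_diametral_pair by blast
    moreover from this have "d y x = diam" using sy simplicial_V by metis
    ultimately show ?thesis using that close simplicial_V by metis
  qed
  have V: "x \<in> V" "y \<in> V" using xy simplicial_V by auto
  have zle: "d z u \<le> diam - 1" if "u \<in> V" for u using d_le_ecc[OF that, of z] lt(1) by simp
  have yx: "d y x = diam" using sy V xy by metis
  \<comment> \<open>If \<open>x\<close> were in \<open>N z\<close>, it would be equal or adjacent to
    the first vertex of a shortest path from \<open>z\<close> to \<open>y\<close>, and
    \<open>z\<close> would be as far from \<open>y\<close> as \<open>x\<close> is.\<close>
  have zx: "d z x = 2"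
  proof (rule ccontr)
    assume "d z x \<noteq> 2"
    then have "d z x \<le> 1" using xy by simp
    then have xN: "x \<in> N z" using d_1[OF zV V(1)] by blast
    have "z \<noteq> y" using yx xN zV \<open>d z x \<le> 1\<close> D by auto
    then obtain w where w: "E z w" "d y w + 1 = d y z"
      using d_prev[OF V(2) zV] sym by blast
    have "d y x \<le> d y w + 1"
    proof (cases "w = x")
      case False
      have "w \<in> N z" using w by (simp add: N_def)
      then have "E w x" using simplicial_adjacent[OF z] xN False by blast
      then show ?thesis using d_step V by blast
    qed simp
    then have "diam \<le> d y z" using yx w by simp
    then show False using zle[OF V(2)] sy[OF zV V(2)] D by simp
  qed
  \<comment> \<open>The first steps from \<open>z\<close> towards \<open>x\<close> and towards
    \<open>y\<close> lie in the clique \<open>N z\<close>, so \<open>d x y\<close> is at most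
    \<open>1 + 1 + (d z y - 1)\<close>.\<close>
  have zy: "d z y = diam - 1"
  proof (rule ccontr)
    assume "d z y \<noteq> diam - 1"
    then have zy: "d z y \<le> diam - 2" using zle[OF V(2)] by simp
    have "z \<noteq> y" using yx zx D by auto
    then obtain w where w: "E z w" "d y w + 1 = d y z"
      using d_prev[OF V(2) zV] sym by blast
    have "z \<noteq> x" using zx by auto
    then obtain w' where w': "E z w'" "d x w' + 1 = d x z"
      using d_prev[OF V(1) zV] sym by blast
    have wV: "w \<in> V" "w' \<in> V" using w w' EV2 by blast+
    have "d w w' \<le> 1"
    proof (cases "w = w'")
      case False
      have "w \<in> N z" "w' \<in> N z" using w w' by (auto simp: N_def)
      then show ?thesis using simplicial_adjacent[OF z] False d_edge by blast
    qed simp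
    moreover have "d y x \<le> d y w + d w x" "d w x \<le> d w w' + d w' x" "d w' x = d x w'" "d x z = d z x" "d y z = d z y"
      using d_tri[OF V(2) wV(1) V(1)] d_tri[OF wV V(1)] sy[OF wV(2) V(1)] sy[OF V(1) zV] sy[OF V(2) zV] by blast+
    ultimately show False using w w' zx zy yx D by linarith
  qed
  have vz: "d z v = diam - 1" using d_le_ecc[OF V(2), of z] zy v lt(1) by simp
  then have v3: "3 \<le> d z v" using D by simp
  \<comment> \<open>Both \<open>v\<close> and \<open>y\<close> are at distance
    \<open>diam - 1\<close> from \<open>z\<close>. At distance 3 or more from each other they would
    form a far triple with \<open>z\<close>; so at most one vertex lies between them, and it is too
    far from \<open>z\<close> to leave the component.\<close>
  have yR: "y \<in> R"
  proof -
    have vy: "d v y \<le> 2"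
    proof (rule ccontr)
      assume "\<not> d v y \<le> 2"
      then have f: "3 \<le> d v y" by simp
      have le: "d v y \<le> diam" using d_le_diam vV V by blast
      have e: "d v z = diam - 1" "d y z = diam - 1" "d y v = d v y" using vz zy sy vV V zV by auto
      have "reach (V - N y) v z" using reach_avoid[of v z y] vV V zV e f by auto
      moreover have "reach (V - N v) y z" using reach_avoid[of y z v] vV V zV e f by auto
      moreover have "reach (V - N z) v y" using reach_avoid[of v y z] vV V zV e vz zy le D by auto
      moreover have "3 \<le> d v z" "3 \<le> d y z" using e D by linarith+
      ultimately show False using no_far_asteroidal_triple[of v y z] vV V zV f by blast
    qed
    have y3: "3 \<le> d z y" using zy D by simp
    consider "v = y" | w where "E v w" "E w y" | "E v y"
    proof (cases "d v y \<le> 1")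
      case True
      then show ?thesis using d_1[OF vV V(2)] that by (auto simp: N_def)
    next
      case False
      then have "v \<noteq> y" by auto
      then obtain w where w: "E w y" "d v w + 1 = d v y" using d_prev[OF vV V(2)] by blast
      then have "d v w \<le> 1" "v \<noteq> w" using vy False by auto
      then show ?thesis using d_1[OF vV, of w] EV[OF w(1)] w that(2)[of w] by (auto simp: N_def)
    qed
    then show ?thesis
    proof cases
      case 1
      then show ?thesis using v_R by simp
    next
      case 2
      have "d z y \<le> d z w + 1" using d_step[OF 2(2) zV] .
      then have "3 \<le> d z w" using zy D by simp
      then show ?thesis using R_step[OF R_step[OF v_R 2(1) _ v3] 2(2) V(2) _ y3] EV[OF 2(2)] by blast
    next
      case 3
      then show ?thesis using R_step[OF v_R _ V(2) v3 y3] by blast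
    qed
  qed
  have xR: "x \<notin> R" using R_layer[OF v3, of x] zx by auto
  have xC: "x \<notin> C" using lt(3)[of x] d_le_ecc[OF V(2), of x] xy by fastforce
  have zR: "z \<notin> R" using R_layer[OF v3, of z] by auto
  note levC = lev_le[OF v3] and dC = d_C[OF v3] and cr = cross'[OF v3] and cmp = near_comparable[OF v3]
  have levR: "lev u + 2 = d z u" if uR: "u \<in> R" for u
  proof -
    obtain c where c: "c \<in> C" "d z c + d c u = d z u" using C_separates[OF v3 zV zR uR] by blast
    obtain c' where c': "c' \<in> C" "d c' u = lev u" using near_ne[OF v3, of u] by (auto simp: near_def)
    have "d z u \<le> d z c' + d c' u" using d_tri[OF zV C_V[OF c'(1)] R_V[OF v3 uR]] .
    moreover have "d z c = 2" "d z c' = 2" using c c' by (auto simp: C_def)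
    ultimately show ?thesis using c c' levC[OF c(1), of u] by linarith
  qed
  have levy: "lev y = diam - 3" using levR[OF yR] zy by simp
  \<comment> \<open>The upper bound that matches \<open>cross\<close>: for vertices on different
    sides of \<open>C\<close> the two together determine the distance.\<close>
  have far: "d a b \<le> lev a + lev b + (if near a \<inter> near b = {} then 1 else 0)" if "a \<in> V" "b \<in> V" for a b
  proof (cases "near a \<inter> near b = {}")
    case True
    obtain c c' where c: "c \<in> near a" "c' \<in> near b" using near_ne[OF v3] by blast
    then have cC: "c \<in> C" "c' \<in> C" "d c a = lev a" "d c' b = lev b" by (auto simp: near_def)
    have "d c b \<le> lev b + 1" using dC[OF that(2) cC(1)] by simp
    then show ?thesis using d_tri[of a c b] sy[of a c] C_V[OF cC(1)] that cC True by simp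
  next
    case False
    then obtain c where "c \<in> near a" "c \<in> near b" by blast
    then have cC: "c \<in> C" "d c a = lev a" "d c b = lev b" by (auto simp: near_def)
    then show ?thesis using d_tri[of a c b] sy[of a c] C_V[OF cC(1)] that False by simp
  qed
  \<comment> \<open>\<open>diam \<le> lev x + (diam - 3) + 1\<close>, and if
    \<open>lev x = 2\<close> the last summand is needed, so \<open>near x\<close> and
    \<open>near y\<close> are disjoint.\<close>
  have levx: "2 \<le> lev x" using far[OF V] levy xy D by (auto split: if_splits)
  have disj: "near x \<inter> near y = {}" if "lev x = 2" using far[OF V] levy xy D that by (auto split: if_splits)
  have mx: "lev u < lev xs \<or> lev u = lev xs \<and> card (near xs) \<le> card (near u)" if "u \<in> V" for u
    using xs(2)[OF C_ne[OF v3] that] .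
  have fnear: "finite (near u)" for u by (rule finite_subset[OF _ finite_C]) (auto simp: near_def)
  have xsfar: "d xs u < diam" if "u \<in> V" for u using d_le_ecc[OF that, of xs] lt(2) by simp
  show False
  proof (cases "xs \<in> R")
    case True
    \<comment> \<open>\<open>xs\<close> on the side of \<open>y\<close>: its level is at least that
      of \<open>y\<close> by choice, and at most \<open>diam - 3\<close> since \<open>z\<close> has
      smaller eccentricity than \<open>diam\<close>.\<close>
    have l: "lev xs = diam - 3" using levR[OF True] zle[OF xs(1)] mx[OF V(2)] levy by linarith
    have "lev xs + lev x + (if near xs \<inter> near x = {} then 1 else 0) < diam"
      using cr[OF xs(1) V(1)] xsfar[OF V(1)] True xR by simp
    then have e: "lev x = 2" "near xs \<inter> near x \<noteq> {}" using l levx D by (auto split: if_splits)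
    have "near xs \<subseteq> near y \<or> near y \<subseteq> near xs"
      by (rule cmp[OF xs(1) V(2,1)]) (use True yR xR l levy levx D in auto)
    moreover have "card (near xs) \<le> card (near y)" using mx[OF V(2)] l levy by simp
    ultimately have "near xs \<subseteq> near y" using card_seteq[OF fnear, of "near y" xs] by blast
    then show False using disj[OF e(1)] e(2) by blast
  next
    case False
    \<comment> \<open>\<open>xs\<close> on the side of \<open>x\<close>: from
      \<open>lev y = diam - 3\<close> the level of \<open>xs\<close> is at most 2. This forces all
      three levels to be 2, hence diameter 5.\<close>
    have "lev xs + lev y + (if near xs \<inter> near y = {} then 1 else 0) < diam"
      using cr[OF xs(1) V(2)] xsfar[OF V(2)] False yR by simp
    moreover have "lev x \<le> lev xs" "lev y \<le> lev xs" using mx V by fastforce+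
    ultimately have e: "lev xs = 2" "lev y = 2" "lev x = 2" "near xs \<inter> near y \<noteq> {}"
      using levy levx D by (auto split: if_splits)
    have "near xs \<subseteq> near x \<or> near x \<subseteq> near xs"
      by (rule cmp[OF xs(1) V(1,2)]) (use False yR xR e in auto)
    moreover have "card (near xs) \<le> card (near x)" using mx[OF V(1)] e by simp
    ultimately have "near xs \<subseteq> near x" using card_seteq[OF fnear, of "near x" xs] by blast
    then show False using disj[OF e(3)] e(4) by blast
  qed
qed

end

subsection \<open>From digraphs to relations\<close>

definition adj :: "'a pair_pre_digraph \<Rightarrow> 'a \<Rightarrow> 'a \<Rightarrow> bool" where
  "adj G u v \<longleftrightarrow> (u, v) \<in> parcs G"

lemma con_graph_adj:
  assumes G: "pair_graph G" and con: "Digraph_Component.connected (with_proj G)"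
  shows "con_graph (pverts G) (adj G)"
proof -
  interpret pair_graph G by (rule G)
  have sym: "(u, v) \<in> parcs G \<Longrightarrow> (v, u) \<in> parcs G" for u v
    using graph_symmetric by auto
  have irr: "(u, u) \<notin> parcs G" for u using pair_no_loops[of "(u, u)"] by auto
  have ends: "parcs (mk_symmetric (with_proj G)) = parcs G"
    unfolding mk_symmetric_def using sym by auto
  have verts: "pverts (mk_symmetric (with_proj G)) = pverts G" by (simp add: mk_symmetric_def)
  have "(adj G)\<^sup>*\<^sup>* x y" if "x \<in> pverts G" "y \<in> pverts G" for x y
  proof -
    have "(x, y) \<in> rtrancl_on (pverts G) (parcs G)"
      using con that unfolding Digraph_Component.connected_def strongly_connected_def reachable_def
      by (simp add: ends verts)
    then have "(x, y) \<in> (parcs G)\<^sup>*" by (rule rtrancl_on_rtranclI)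
    then show ?thesis
      by (simp add: adj_def[abs_def] rtranclp_rtrancl_eq)
  qed
  moreover have "pverts G \<noteq> {}"
    using con verts unfolding Digraph_Component.connected_def strongly_connected_def by simp
  ultimately show ?thesis
    by unfold_locales
      (use sym pair_finite_verts irr in \<open>auto simp: adj_def dest: in_arcsD1\<close>)
qed

lemma vwalk_arcs_subset: "set (vwalk_arcs p) \<subseteq> A \<longleftrightarrow> successively (\<lambda>x y. (x, y) \<in> A) p"
  by (induction p rule: vwalk_arcs.induct) auto

lemma fst_vwalk_arcs: "fst ` set (vwalk_arcs p) = set (butlast p)"
  by (induction p rule: vwalk_arcs.induct) auto

lemma pcas_vwalk_arcs: "p \<noteq> [] \<Longrightarrow> pcas (hd p) (vwalk_arcs p) (last p)"
  by (induction p rule: vwalk_arcs.induct) auto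

lemma pcas_append: "pcas u (p @ q) w \<longleftrightarrow> (\<exists>v. pcas u p v \<and> pcas v q w)"
  by (induction p arbitrary: u) auto

lemma pawalk_verts_vwalk_arcs:
  "p \<noteq> [] \<Longrightarrow> pcas (last p) es w \<Longrightarrow>
    tl (pawalk_verts u (vwalk_arcs p @ es)) = tl p @ tl (pawalk_verts (last p) es)"
proof (induction p arbitrary: u rule: vwalk_arcs.induct)
  case (3 x y xs)
  have "pawalk_verts y (vwalk_arcs (y # xs) @ es) = y # tl (pawalk_verts y (vwalk_arcs (y # xs) @ es))"
  proof (cases xs)
    case Nil
    then show ?thesis using 3(3) by (cases es) auto
  qed auto
  then show ?case using 3 by simp
next
  case (2 x)
  then show ?case by (cases es) auto
qed auto

text \<open>The two glued walks become the arc list \<open>c\<close> of a digraph cycle, and the set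
  \<open>H\<close> becomes an induced subdigraph \<open>K\<close>. Reachability off
  \<open>N x\<close> contradicts domination once it is turned into a path.\<close>

lemma chordal_dp_adj:
  assumes G: "pair_graph G" and con: "Digraph_Component.connected (with_proj G)"
    and ch: "chordal (with_proj G)" and dp: "dominating_pair_graph (with_proj G)"
  shows "chordal_dp (pverts G) (adj G)"
proof -
  interpret pair_graph G by (rule G)
  interpret A: con_graph "pverts G" "adj G" by (rule con_graph_adj[OF G con])
  show ?thesis
  proof unfold_locales
    fix p q
    assume p: "successively (adj G) p" "p \<noteq> []" and q: "successively (adj G) q" "q \<noteq> []"
      and pq: "hd q = last p" "last q = hd p"
      and dist: "distinct (butlast p @ butlast q)" and len: "4 \<le> length (butlast p @ butlast q)"
    define c where "c = vwalk_arcs p @ vwalk_arcs q"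
    have cG: "set c \<subseteq> parcs G"
      using p q vwalk_arcs_subset[of _ "parcs G"] by (auto simp: c_def adj_def[abs_def])
    have lc: "length c = length (butlast p @ butlast q)"
      by (simp add: c_def flip: vwalk_length_def)
    \<comment> \<open>Cycles of the digraph library are required to be distinct in the tails,
      whereas the hypothesis is on the initial parts. As the ends of \<open>p\<close> and
      \<open>q\<close> match up, both contain the same vertices.\<close>
    have "mset (tl p @ tl q) = mset (butlast p @ butlast q)"
    proof -
      have "add_mset (hd p) (mset (tl p)) = add_mset (last p) (mset (butlast p))"
        "add_mset (hd q) (mset (tl q)) = add_mset (last q) (mset (butlast q))"
        using p q by (metis append_butlast_last_id hd_Cons_tl mset.simps(2) mset_append union_commute
            add_mset_add_single mset_single_iff mset.simps(1))+
      then have "add_mset (hd p) (add_mset (hd q) (mset (tl p) + mset (tl q))) =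
          add_mset (last p) (add_mset (last q) (mset (butlast p) + mset (butlast q)))"
        by (metis union_mset_add_mset_left union_mset_add_mset_right)
      then show ?thesis using pq by (simp add: add_mset_commute)
    qed
    then have "distinct (tl p @ tl q)" using dist mset_eq_imp_distinct_iff by blast
    moreover have "tl (pawalk_verts (hd p) c) = tl p @ tl q"
      using pawalk_verts_vwalk_arcs[OF p(2), of "vwalk_arcs q" "hd p" "hd p"] pcas_vwalk_arcs[OF q(2)] pq
        pawalk_verts_vwalk_arcs[OF q(2), of "[]" "last q" "last p"] by (simp add: c_def)
    moreover have "pcas (hd p) c (hd p)"
      using pcas_vwalk_arcs[OF p(2)] pcas_vwalk_arcs[OF q(2)] pq unfolding c_def by (metis pcas_append)
    moreover have "c \<noteq> []" using lc len by auto
    moreover have "hd p \<in> pverts G"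
    proof -
      have "fst (hd c) = hd p"
        using \<open>pcas (hd p) c (hd p)\<close> \<open>c \<noteq> []\<close> by (cases c) auto
      then show ?thesis using cG \<open>c \<noteq> []\<close> arc_fst_in_verts by (metis hd_in_set subsetD)
    qed
    ultimately have "pre_digraph.cycle (with_proj G) c"
      unfolding cycle_def awalk_def using cG by auto
    then obtain u v where uv: "(u, v) \<in> parcs G" "u \<in> fst ` set c" "v \<in> fst ` set c"
      "(u, v) \<notin> set c" "(v, u) \<notin> set c"
      using ch lc len unfolding chordal_def
      by (fastforce simp: arc_to_ends_def image_iff)
    have "fst ` set c \<subseteq> set p \<union> set q"
      by (auto simp: c_def image_Un fst_vwalk_arcs dest: in_set_butlastD)
    then show "\<exists>u v. adj G u v \<and> u \<in> set p \<union> set q \<and> v \<in> set p \<union> set q \<and>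
        (u, v) \<notin> set (vwalk_arcs p) \<union> set (vwalk_arcs q) \<and>
        (v, u) \<notin> set (vwalk_arcs p) \<union> set (vwalk_arcs q)"
      using uv by (intro exI[of _ u] exI[of _ v]) (auto simp: c_def adj_def)
  next
    fix H
    assume H: "H \<subseteq> pverts G" "H \<noteq> {}" and conH: "\<And>x y. x \<in> H \<Longrightarrow> y \<in> H \<Longrightarrow> A.reach H x y"
    define K where "K = \<lparr> pverts = H, parcs = {(u, v) \<in> parcs G. u \<in> H \<and> v \<in> H} \<rparr>"
    have K: "pverts K = H" "parcs K = {(u, v) \<in> parcs G. u \<in> H \<and> v \<in> H}" by (auto simp: K_def)
    have "wf_digraph (with_proj K)" by unfold_locales (auto simp: K)
    then have ind: "induced_subgraph (with_proj K) (with_proj G)"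
      unfolding induced_subgraph_def subgraph_def compatible_def
      using H wf_digraph_axioms by (auto simp: K)
    have sK: "parcs (mk_symmetric (with_proj K)) = parcs K" "pverts (mk_symmetric (with_proj K)) = H"
      using A.sym by (auto simp: mk_symmetric_def K adj_def)
    have "Digraph_Component.connected (with_proj K)"
      unfolding Digraph_Component.connected_def
    proof (rule strongly_connectedI)
      show "verts (with_proj (mk_symmetric (with_proj K))) \<noteq> {}" using H sK by simp
      fix u v assume "u \<in> verts (with_proj (mk_symmetric (with_proj K)))" "v \<in> verts (with_proj (mk_symmetric (with_proj K)))"
      then have uH: "A.reach H u v" "u \<in> H" using conH sK by auto
      then have "(u, v) \<in> rtrancl_on H (parcs K)"
        unfolding A.reach_def
        by (induction rule: rtranclp_induct) (auto simp: K adj_def intro: rtrancl_on_into_rtrancl_on)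
      then show "u \<rightarrow>\<^sup>*\<^bsub>with_proj (mk_symmetric (with_proj K))\<^esub> v" by (simp add: reachable_def sK K(1))
    qed
    then obtain u v where uv: "dominating_pair (with_proj K) u v"
      using dp ind unfolding dominating_pair_graph_def by blast
    have "\<not> A.reach (H - A.N x) u v" if x: "x \<in> H" "u \<notin> A.N x" "v \<notin> A.N x" for x
    proof
      assume R: "A.reach (H - A.N x) u v"
      have "u \<in> H" using uv by (simp add: dominating_pair_def K)
      then obtain r where r: "r \<noteq> []" "set r \<subseteq> H - A.N x" "distinct r" "successively (adj G) r" "hd r = u" "last r = v"
        \<comment> \<open>Equality predicates for the two ends turn reachability into a path without
          repetitions.\<close>
        using A.minimal_list[of u "H - A.N x" "(=) u" "(=) v" v] R x by auto
      have "set (vwalk_arcs r) \<subseteq> parcs K"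
      proof -
        have "set (vwalk_arcs r) \<subseteq> set r \<times> set r" by (induction r rule: vwalk_arcs.induct) auto
        moreover have "set (vwalk_arcs r) \<subseteq> parcs G"
          using r(4) vwalk_arcs_subset[of r "parcs G"] by (simp add: adj_def[abs_def])
        ultimately show ?thesis using r(2) by (auto simp: K)
      qed
      then have "vpath r (with_proj K)" unfolding vpath_def vwalk_def using r by (auto simp: K)
      then have "set r \<inter> closed_nbhd (with_proj K) x \<noteq> {}"
        using uv x r unfolding dominating_pair_def by (auto simp: K)
      moreover have "closed_nbhd (with_proj K) x \<subseteq> A.N x"
        by (auto simp: closed_nbhd_def A.N_def adj_def K)
      ultimately show False using r(2) by blast
    qed
    then show "\<exists>u\<in>H. \<exists>v\<in>H. \<forall>x\<in>H. u \<notin> A.N x \<longrightarrow> v \<notin> A.N x \<longrightarrow> \<not> A.reach (H - A.N x) u v"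
      using uv unfolding dominating_pair_def by (auto simp: K)
  qed
qed

text \<open>Awalks of length \<open>n\<close> correspond to the \<open>n\<close>-th relational
  power, so with unit costs \<open>\<mu>\<close> is \<open>d\<close>; connectedness and finiteness
  make the suprema attained natural numbers.\<close>

lemma diameter_adj:
  assumes G: "pair_graph G" and con: "Digraph_Component.connected (with_proj G)"
  shows "diameter (with_proj G) = ereal (real (con_graph.diam (pverts G) (adj G)))"
proof -
  interpret pair_graph G by (rule G)
  interpret A: con_graph "pverts G" "adj G" by (rule con_graph_adj[OF G con])
  have walk: "(\<exists>p. awalk u p v \<and> length p = n) \<longleftrightarrow> (adj G ^^ n) u v" if "u \<in> pverts G" for u v n
    using that
  proof (induction n arbitrary: u)
    case 0
    then show ?case by (auto simp: awalk_def)
  next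
    case (Suc n)
    have "(\<exists>p. awalk u p v \<and> length p = Suc n) \<longleftrightarrow> (\<exists>w. adj G u w \<and> (\<exists>p. awalk w p v \<and> length p = n))"
    proof
      assume "\<exists>p. awalk u p v \<and> length p = Suc n"
      then obtain e p where "awalk u (e # p) v" "length p = n" by (metis length_Suc_conv)
      then have "e \<in> parcs G" "fst e = u" "awalk (snd e) p v" using arc_snd_in_verts by (auto simp: awalk_def)
      then show "\<exists>w. adj G u w \<and> (\<exists>p. awalk w p v \<and> length p = n)"
        using \<open>length p = n\<close> by (intro exI[of _ "snd e"]) (auto simp: adj_def)
    next
      assume "\<exists>w. adj G u w \<and> (\<exists>p. awalk w p v \<and> length p = n)"
      then obtain w p where "adj G u w" "awalk w p v" "length p = n" by blast
      then have "awalk u ((u, w) # p) v \<and> length ((u, w) # p) = Suc n"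
        using Suc.prems by (auto simp: awalk_def adj_def)
      then show "\<exists>p. awalk u p v \<and> length p = Suc n" by blast
    qed
    also have "\<dots> \<longleftrightarrow> (\<exists>w. adj G u w \<and> (adj G ^^ n) w v)" using Suc.IH A.EV2 by blast
    also have "\<dots> \<longleftrightarrow> (adj G ^^ Suc n) u v" using relpowp_Suc_I2 relpowp_Suc_E2 by metis
    finally show ?case .
  qed
  have mu: "\<mu> (\<lambda>_. 1) u v = ereal (real (A.d u v))" if uv: "u \<in> pverts G" "v \<in> pverts G" for u v
  proof -
    have cost: "awalk_cost (\<lambda>_. 1) p = real (length p)" for p :: "('a \<times> 'a) list"
      by (induction p) auto
    obtain p where p: "awalk u p v" "length p = A.d u v" using walk[OF uv(1)] A.d_walk[OF uv] by blast
    show ?thesis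
    proof (rule antisym)
      show "\<mu> (\<lambda>_. 1) u v \<le> ereal (real (A.d u v))"
        using min_cost_le_walk_cost[OF p(1), of "\<lambda>_. 1"] cost p(2) by simp
      show "ereal (real (A.d u v)) \<le> \<mu> (\<lambda>_. 1) u v"
        unfolding \<mu>_def
      proof (rule INF_greatest)
        fix p assume "p \<in> {p. awalk u p v}"
        then have "A.d u v \<le> length p" using walk[OF uv(1)] A.d_le by blast
        then show "ereal (real (A.d u v)) \<le> ereal (awalk_cost (\<lambda>_. 1) p)" by (simp add: cost)
      qed
    qed
  qed
  have "diameter (with_proj G) = (SUP u \<in> pverts G. SUP v \<in> pverts G. ereal (real (A.d u v)))"
    unfolding diameter_def by (auto intro!: SUP_cong simp: mu)
  also have "\<dots> = ereal (real A.diam)"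
  proof (rule antisym)
    show "(SUP u \<in> pverts G. SUP v \<in> pverts G. ereal (real (A.d u v))) \<le> ereal (real A.diam)"
      by (intro SUP_least) (simp add: A.d_le_diam)
    obtain u v where "u \<in> pverts G" "v \<in> pverts G" "A.d u v = A.diam"
      using A.diam_attained A.ecc_attained by metis
    then show "ereal (real A.diam) \<le> (SUP u \<in> pverts G. SUP v \<in> pverts G. ereal (real (A.d u v)))"
      by (metis SUP_upper SUP_upper2)
  qed
  finally show ?thesis .
qed

section \<open>A program logic for the machine\<close>

text \<open>
  The memory past the input is viewed as 16 interleaved unbounded arrays, all initially 0. Registers
  1, 2 and 3 hold the first free address, the number of vertices, and the total size of the closed
  neighbourhoods; they are never reassigned.
\<close>

definition arr_addr :: "nat \<Rightarrow> aexp \<Rightarrow> aexp" where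
  "arr_addr j e = Add (Reg 1) (Add (Mul (Lit 16) e) (Lit j))"

definition arr :: "nat \<Rightarrow> aexp \<Rightarrow> aexp" where
  "arr j e = Load (arr_addr j e)"

definition put :: "nat \<Rightarrow> aexp \<Rightarrow> aexp \<Rightarrow> com" where
  "put j e x = Store (arr_addr j e) x"

section \<open>Sizes of expressions and bounds on their evaluation cost\<close>

fun asz :: "aexp \<Rightarrow> nat" where
  "asz (Lit k) = 1"
| "asz (Reg r) = 1"
| "asz (Load a) = asz a + 1"
| "asz (Add a b) = asz a + asz b + 1"
| "asz (Sub a b) = asz a + asz b + 1"
| "asz (Mul a b) = asz a + asz b + 1"
| "asz (Div a b) = asz a + asz b + 1"

fun lits :: "aexp \<Rightarrow> bool" where
  "lits (Lit k) = (k \<le> 16)"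
| "lits (Reg r) = True"
| "lits (Load a) = lits a"
| "lits (Add a b) = (lits a \<and> lits b)"
| "lits (Sub a b) = (lits a \<and> lits b)"
| "lits (Mul a b) = (lits a \<and> lits b)"
| "lits (Div a b) = (lits a \<and> lits b)"

text \<open>Literals up to 16 admit the stride of the interleaved arrays. Together with the bound on
  the number of nodes this keeps every intermediate value, in particular every address, within a
  fixed power of the word bound.\<close>

definition small :: "aexp \<Rightarrow> bool" where
  "small e \<longleftrightarrow> asz e \<le> 80 \<and> lits e"

lemma binlen_mono: "a \<le> b \<Longrightarrow> binlen a \<le> binlen b"
  using floor_log_mono by (simp add: binlen_def mono_def)

lemma floor_log_le: "a < 2 ^ k \<Longrightarrow> 0 < k \<Longrightarrow> floor_log a < k"
proof (cases "a = 0")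
  case False
  assume "a < 2 ^ k" "0 < k"
  then have "(2::nat) ^ floor_log a < 2 ^ k" using floor_log_exp2_le[of a] False by linarith
  then show ?thesis by simp
qed simp

lemma binlen_power: "0 < k \<Longrightarrow> binlen (b ^ k) \<le> k * binlen b"
proof -
  assume k: "0 < k"
  have "b < 2 ^ binlen b" using floor_log_exp2_gt[of b] by (simp add: binlen_def)
  then have "b ^ k < (2 ^ binlen b) ^ k" using k by (simp add: power_strict_mono)
  then have "b ^ k < 2 ^ (k * binlen b)" by (simp add: power_mult[symmetric] mult.commute)
  moreover have "0 < k * binlen b" using k by (simp add: binlen_def)
  ultimately show ?thesis using floor_log_le[of "b ^ k" "k * binlen b"] by (simp add: binlen_def)
qed

lemma asz_pos: "0 < asz e"
  by (induction e) auto

text \<open>Products add exponents. For sums, \<open>x + y \<le> 2 * (x * y)\<close> for positive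
  \<open>x\<close> and \<open>y\<close>, and the factor 2 is paid for by the node of the sum
  itself.\<close>

lemma aval_le_power:
  assumes "lits e" "16 \<le> b" "\<And>r. fst s r \<le> b" "\<And>a. snd s a \<le> b"
  shows "aval e s \<le> b ^ asz e"
  using assms(1)
proof (induction e)
  case (Load e)
  have "snd s (aval e s) \<le> b ^ 1" using assms by simp
  also have "\<dots> \<le> b ^ (asz e + 1)" using assms(2) by (intro power_increasing) auto
  finally show ?case by simp
next
  case (Add e1 e2)
  have p: "1 \<le> b ^ asz e1" "1 \<le> b ^ asz e2" using assms(2) by auto
  have "x + y \<le> 2 * (x * y)" if "1 \<le> x" "1 \<le> y" for x y :: nat
    using that by (cases x; cases y) auto
  then have "b ^ asz e1 + b ^ asz e2 \<le> 2 * (b ^ asz e1 * b ^ asz e2)" using p by blast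
  also have "\<dots> \<le> b * (b ^ asz e1 * b ^ asz e2)" using assms(2) by (intro mult_le_mono1) simp
  finally show ?case using Add by (simp add: power_add algebra_simps)
next
  case (Sub e1 e2)
  then have "aval (Sub e1 e2) s \<le> b ^ asz e1" by simp
  also have "\<dots> \<le> b ^ asz (Sub e1 e2)" using assms(2) by (intro power_increasing) auto
  finally show ?case .
next
  case (Mul e1 e2)
  have "aval (Mul e1 e2) s \<le> b ^ asz e1 * b ^ asz e2" using Mul by (simp add: mult_le_mono)
  also have "\<dots> \<le> b ^ asz (Mul e1 e2)" using assms(2)
    by (simp add: power_add[symmetric] power_increasing)
  finally show ?case .
next
  case (Div e1 e2)
  then have "aval (Div e1 e2) s \<le> b ^ asz e1" using le_trans[OF div_le_dividend] by simp
  also have "\<dots> \<le> b ^ asz (Div e1 e2)" using assms(2) by (intro power_increasing) auto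
  finally show ?case .
qed (use assms in \<open>auto intro: le_trans\<close>)

lemma acost_le:
  assumes "lits e" "16 \<le> b" "\<And>r. fst s r \<le> b" "\<And>a. snd s a \<le> b" "asz e \<le> k"
  shows "acost e s \<le> asz e * (k * binlen b)"
  using assms(1,5)
proof (induction e)
  case (Lit x)
  then have "binlen x \<le> binlen b" using assms(2) by (intro binlen_mono) simp
  also have "\<dots> \<le> k * binlen b" using Lit by (cases k) auto
  finally show ?case by simp
next
  case (Reg r)
  then have "binlen (fst s r) \<le> binlen b" using assms(3) by (intro binlen_mono) simp
  also have "\<dots> \<le> k * binlen b" using Reg by (cases k) auto
  finally show ?case by simp
next
  case (Load e)
  have "binlen (aval (Load e) s) \<le> binlen b" using assms(4) by (intro binlen_mono) simp
  also have "\<dots> \<le> k * binlen b" using Load by (cases k) auto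
  finally show ?case using Load by (simp add: algebra_simps)
next
  case (Add e1 e2)
  have "binlen (aval (Add e1 e2) s) \<le> binlen (b ^ asz (Add e1 e2))"
    using aval_le_power[of "Add e1 e2"] Add.prems assms by (intro binlen_mono) blast
  also have "\<dots> \<le> k * binlen b" using binlen_power[OF asz_pos] Add.prems by (meson le_trans mult_le_mono1)
  finally show ?case using Add by (simp add: algebra_simps)
next
  case (Sub e1 e2)
  have "binlen (aval (Sub e1 e2) s) \<le> binlen (b ^ asz (Sub e1 e2))"
    using aval_le_power[of "Sub e1 e2"] Sub.prems assms by (intro binlen_mono) blast
  also have "\<dots> \<le> k * binlen b" using binlen_power[OF asz_pos] Sub.prems by (meson le_trans mult_le_mono1)
  finally show ?case using Sub by (simp add: algebra_simps)
next
  case (Mul e1 e2)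
  have "binlen (aval (Mul e1 e2) s) \<le> binlen (b ^ asz (Mul e1 e2))"
    using aval_le_power[of "Mul e1 e2"] Mul.prems assms by (intro binlen_mono) blast
  also have "\<dots> \<le> k * binlen b" using binlen_power[OF asz_pos] Mul.prems by (meson le_trans mult_le_mono1)
  finally show ?case using Mul by (simp add: algebra_simps)
next
  case (Div e1 e2)
  have "binlen (aval (Div e1 e2) s) \<le> binlen (b ^ asz (Div e1 e2))"
    using aval_le_power[of "Div e1 e2"] Div.prems assms by (intro binlen_mono) blast
  also have "\<dots> \<le> k * binlen b" using binlen_power[OF asz_pos] Div.prems by (meson le_trans mult_le_mono1)
  finally show ?case using Div by (simp add: algebra_simps)
qed

section \<open>Timed total correctness of commands\<close>

type_synonym regs = "nat \<Rightarrow> nat"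
type_synonym arrays = "nat \<Rightarrow> nat \<Rightarrow> nat"

locale ram =
  fixes F n M B :: nat and I :: "nat \<Rightarrow> nat"
  assumes F_le: "F \<le> B" and n_le: "n \<le> B" and M_le: "M \<le> B" and B_ge: "16 \<le> B" and I_le: "I a \<le> B"
begin

text \<open>Registers 1 to 3 and the memory below \<open>F\<close> show their constants whatever
  \<open>R\<close> and \<open>A\<close> are, so no invariant has to mention them.\<close>

definition st :: "regs \<Rightarrow> arrays \<Rightarrow> state" where
  "st R A = (R(1 := F, 2 := n, 3 := M), \<lambda>a. if a < F then I a else A ((a - F) mod 16) ((a - F) div 16))"

definition ok :: "regs \<Rightarrow> arrays \<Rightarrow> bool" where
  "ok R A \<longleftrightarrow> (\<forall>r. R r \<le> B) \<and> (\<forall>j i. A j i \<le> B)"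

text \<open>A small expression has at most 80 nodes, each of value at most \<open>B\<^sup>8\<^sup>0\<close>; a command evaluates at most two
  of them, hence the factor 2 * 80 * 80.\<close>

definition unit :: nat where
  "unit = 12800 * binlen B"

text \<open>A Hoare triple for total correctness with time counted in \<open>unit\<close>. The bound
  \<open>ok\<close> on all words is both assumed and guaranteed, so rules may use it without its
  appearing in invariants.\<close>

definition run :: "com \<Rightarrow> regs \<Rightarrow> arrays \<Rightarrow> nat \<Rightarrow> (regs \<Rightarrow> arrays \<Rightarrow> bool) \<Rightarrow> bool" where
  "run c R A T Q \<longleftrightarrow> (ok R A \<longrightarrow> (\<exists>t R' A'. exec c (st R A) t (st R' A') \<and> t \<le> T * unit \<and> ok R' A' \<and> Q R' A'))"

lemma fst_st [simp]:
  "fst (st R A) r = (if r = 1 then F else if r = 2 then n else if r = 3 then M else R r)"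
  by (simp add: st_def)

lemma aval_arr [simp]: "j < 16 \<Longrightarrow> aval (arr j e) (st R A) = A j (aval e (st R A))"
proof -
  assume "j < 16"
  moreover from this have "(16 * x + j) mod 16 = j" "(16 * x + j) div 16 = x" for x by simp_all
  ultimately show ?thesis by (simp add: arr_def arr_addr_def st_def)
qed

lemma aval_Load_input: "aval e (st R A) < F \<Longrightarrow> aval (Load e) (st R A) = I (aval e (st R A))"
  by (simp add: st_def)

lemma st_bounds: assumes "ok R A" shows "fst (st R A) r \<le> B" "snd (st R A) a \<le> B"
  using assms F_le n_le M_le I_le by (auto simp: ok_def st_def)

lemma unit_ge: "ok R A \<Longrightarrow> small e \<Longrightarrow> 2 * acost e (st R A) \<le> unit"
proof -
  assume *: "ok R A" "small e"
  then have "acost e (st R A) \<le> asz e * (80 * binlen B)"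
    using acost_le[of e B "st R A" 80] st_bounds[OF *(1)] B_ge by (auto simp: small_def)
  also have "\<dots> \<le> 80 * (80 * binlen B)" using * by (intro mult_le_mono1) (simp add: small_def)
  finally show ?thesis by (simp add: unit_def)
qed

lemma unit_pos: "1 \<le> unit"
  by (simp add: unit_def binlen_def)

lemma run_mono: "run c R A T Q \<Longrightarrow> T \<le> T' \<Longrightarrow> (\<And>R' A'. Q R' A' \<Longrightarrow> Q' R' A') \<Longrightarrow> run c R A T' Q'"
  unfolding run_def by (meson le_trans mult_le_mono1)

lemma run_ok: "(ok R A \<Longrightarrow> run c R A T Q) \<Longrightarrow> run c R A T Q"
  by (simp add: run_def)

lemma run_skip: "Q R A \<Longrightarrow> run Skip R A 1 Q"
  unfolding run_def using exec.Skip unit_pos by fastforce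

lemma run_assign:
  assumes "r \<noteq> 1" "r \<noteq> 2" "r \<noteq> 3" "small e" "ok R A \<Longrightarrow> aval e (st R A) \<le> B"
    and "Q (R(r := aval e (st R A))) A"
  shows "run (Assign r e) R A 1 Q"
  unfolding run_def
proof
  assume ok: "ok R A"
  have "st (R(r := aval e (st R A))) A = ((fst (st R A))(r := aval e (st R A)), snd (st R A))"
    using assms(1-3) by (auto simp: st_def fun_eq_iff)
  then have "exec (Assign r e) (st R A) (acost e (st R A)) (st (R(r := aval e (st R A))) A)"
    using exec.Assign[of r e "st R A"] by simp
  moreover have "acost e (st R A) \<le> 1 * unit" using unit_ge[OF ok assms(4)] by simp
  moreover have "ok (R(r := aval e (st R A))) A" using ok assms(5)[OF ok] by (simp add: ok_def)
  ultimately show "\<exists>t R' A'. exec (Assign r e) (st R A) t (st R' A') \<and> t \<le> 1 * unit \<and> ok R' A' \<and> Q R' A'"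
    using assms(6) by blast
qed

lemma run_put:
  assumes "j < 16" "small (arr_addr j e)" "small x" "ok R A \<Longrightarrow> aval x (st R A) \<le> B"
    and "Q R (A(j := (A j)(aval e (st R A) := aval x (st R A))))"
  shows "run (put j e x) R A 1 Q"
  unfolding run_def
proof
  assume ok: "ok R A"
  define i v where "i = aval e (st R A)" and "v = aval x (st R A)"
  have ad: "aval (arr_addr j e) (st R A) = F + (16 * i + j)" by (simp add: arr_addr_def i_def)
  have "st R (A(j := (A j)(i := v))) = (fst (st R A), (snd (st R A))(F + (16 * i + j) := v))"
  proof -
    have "(A(j := (A j)(i := v))) ((a - F) mod 16) ((a - F) div 16) =
        (if a = F + (16 * i + j) then v else A ((a - F) mod 16) ((a - F) div 16))" if "F \<le> a" for a
    proof -
      have "a = F + (16 * i + j) \<longleftrightarrow> (a - F) mod 16 = j \<and> (a - F) div 16 = i"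
        using that assms(1) by (auto simp: algebra_simps)
      then show ?thesis by auto
    qed
    then show ?thesis using assms(1) by (auto simp: st_def fun_eq_iff)
  qed
  then have "exec (put j e x) (st R A) (acost (arr_addr j e) (st R A) + acost x (st R A)) (st R (A(j := (A j)(i := v))))"
    using exec.Store[of "arr_addr j e" x "st R A"] by (simp add: put_def ad v_def)
  moreover have "acost (arr_addr j e) (st R A) + acost x (st R A) \<le> 1 * unit"
    using unit_ge[OF ok assms(2)] unit_ge[OF ok assms(3)] by simp
  moreover have "ok R (A(j := (A j)(i := v)))" using ok assms(4)[OF ok] by (simp add: ok_def v_def)
  ultimately show "\<exists>t R' A'. exec (put j e x) (st R A) t (st R' A') \<and> t \<le> 1 * unit \<and> ok R' A' \<and> Q R' A'"
    using assms(5) unfolding i_def v_def by blast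
qed

lemma run_seq:
  assumes "run c R A T1 (\<lambda>R' A'. run d R' A' T2 Q)"
  shows "run (Seq c d) R A (T1 + T2) Q"
  unfolding run_def
proof
  assume ok: "ok R A"
  obtain t R' A' where 1: "exec c (st R A) t (st R' A')" "t \<le> T1 * unit" "ok R' A'" "run d R' A' T2 Q"
    using assms ok unfolding run_def[of c] by blast
  then obtain t' R'' A'' where 2: "exec d (st R' A') t' (st R'' A'')" "t' \<le> T2 * unit" "ok R'' A''" "Q R'' A''"
    unfolding run_def by blast
  show "\<exists>t R' A'. exec (Seq c d) (st R A) t (st R' A') \<and> t \<le> (T1 + T2) * unit \<and> ok R' A' \<and> Q R' A'"
  proof (intro exI conjI)
    show "exec (Seq c d) (st R A) (t + t') (st R'' A'')" using exec.Seq[OF 1(1) 2(1)] .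
    show "t + t' \<le> (T1 + T2) * unit" using 1 2 by (simp add: algebra_simps)
  qed (use 2 in auto)
qed

lemma run_cond:
  assumes "small b" "aval b (st R A) \<noteq> 0 \<Longrightarrow> run c R A T Q" "aval b (st R A) = 0 \<Longrightarrow> run d R A T Q"
  shows "run (Cond b c d) R A (1 + T) Q"
  unfolding run_def
proof
  assume ok: "ok R A"
  have b: "acost b (st R A) \<le> unit" using unit_ge[OF ok assms(1)] by simp
  show "\<exists>t R' A'. exec (Cond b c d) (st R A) t (st R' A') \<and> t \<le> (1 + T) * unit \<and> ok R' A' \<and> Q R' A'"
  proof (cases "aval b (st R A) = 0")
    case True
    obtain t R' A' where 1: "exec d (st R A) t (st R' A')" "t \<le> T * unit" "ok R' A'" "Q R' A'"
      using assms(3)[OF True] ok unfolding run_def by blast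
    have "acost b (st R A) + t \<le> (1 + T) * unit" using 1 b by simp
    then show ?thesis using exec.CondF[OF True 1(1), of c] 1 by blast
  next
    case False
    obtain t R' A' where 1: "exec c (st R A) t (st R' A')" "t \<le> T * unit" "ok R' A'" "Q R' A'"
      using assms(2)[OF False] ok unfolding run_def by blast
    have "acost b (st R A) + t \<le> (1 + T) * unit" using 1 b by simp
    then show ?thesis using exec.CondT[OF False 1(1), of d] 1 by blast
  qed
qed

text \<open>The potential method: each round lowers \<open>pot\<close> by at least its own time
  \<open>t\<close> plus 1 for the test. This gives termination and the total time at once; the final
  test accounts for the extra 1.\<close>

lemma run_while:
  assumes b: "small b" and I0: "Inv R A"
    and exit: "\<And>R A. Inv R A \<Longrightarrow> ok R A \<Longrightarrow> aval b (st R A) = 0 \<Longrightarrow> Q R A"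
    and step: "\<And>R A. Inv R A \<Longrightarrow> aval b (st R A) \<noteq> 0 \<Longrightarrow>
      \<exists>t. t + 1 \<le> pot R A \<and> run c R A t (\<lambda>R' A'. Inv R' A' \<and> pot R' A' + t + 1 \<le> pot R A)"
  shows "run (While b c) R A (pot R A + 1) Q"
  using I0
proof (induction "pot R A" arbitrary: R A rule: less_induct)
  case less
  show ?case unfolding run_def
  proof
    assume ok: "ok R A"
    have bc: "acost b (st R A) \<le> unit" using unit_ge[OF ok b] by simp
    show "\<exists>t R' A'. exec (While b c) (st R A) t (st R' A') \<and> t \<le> (pot R A + 1) * unit \<and> ok R' A' \<and> Q R' A'"
    proof (cases "aval b (st R A) = 0")
      case True
      have "acost b (st R A) \<le> (pot R A + 1) * unit" using bc by simp
      then show ?thesis using exec.WhileF[OF True, of c] exit[OF less.prems ok True] ok by blast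
    next
      case False
      obtain t where "run c R A t (\<lambda>R' A'. Inv R' A' \<and> pot R' A' + t + 1 \<le> pot R A)"
        using step[OF less.prems False] by blast
      then obtain t1 R' A' where 1: "exec c (st R A) t1 (st R' A')" "t1 \<le> t * unit" "ok R' A'" "Inv R' A'"
        "pot R' A' + t + 1 \<le> pot R A"
        using ok unfolding run_def by blast
      have "run (While b c) R' A' (pot R' A' + 1) Q" using less.hyps[of R' A'] 1 by simp
      then obtain t2 R'' A'' where 2: "exec (While b c) (st R' A') t2 (st R'' A'')" "t2 \<le> (pot R' A' + 1) * unit"
        "ok R'' A''" "Q R'' A''"
        using 1(3) unfolding run_def by blast
      have "acost b (st R A) + t1 + t2 \<le> (1 + t + (pot R' A' + 1)) * unit"
        using bc 1(2) 2(2) by (simp add: algebra_simps)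
      also have "\<dots> \<le> (pot R A + 1) * unit" using 1(5) by (intro mult_le_mono1) simp
      finally show ?thesis using exec.WhileT[OF False 1(1) 2(1)] 2 by blast
    qed
  qed
qed

definition For :: "nat \<Rightarrow> aexp \<Rightarrow> aexp \<Rightarrow> com \<Rightarrow> com" where
  "For r lo hi c = Seq (Assign r lo) (While (Sub hi (Reg r)) (Seq c (Assign r (Add (Reg r) (Lit 1)))))"

text \<open>The guard evaluates \<open>hi\<close> afresh in each round, hence the hypothesis that
  \<open>J\<close> fixes its value. In the time bound each round pays 2 for test and increment, and
  2 more are for the initial assignment and the last test.\<close>

lemma run_for:
  assumes r: "r \<noteq> 1" "r \<noteq> 2" "r \<noteq> 3" and sm: "small lo" "small (Sub hi (Reg r))"
    and lo: "aval lo (st R A) = a" and ab: "a \<le> b" "b \<le> B"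
    and hi: "\<And>i R A. J i R A \<Longrightarrow> aval hi (st R A) = b"
    and init: "J a (R(r := a)) A"
    and step: "\<And>i R A. a \<le> i \<Longrightarrow> i < b \<Longrightarrow> R r = i \<Longrightarrow> J i R A \<Longrightarrow>
      run c R A (g i) (\<lambda>R' A'. R' r = i \<and> J (Suc i) (R'(r := Suc i)) A')"
    and exit: "\<And>R A. R r = b \<Longrightarrow> J b R A \<Longrightarrow> Q R A"
    and T: "(\<Sum>i=a..<b. g i + 2) + 2 \<le> T"
  shows "run (For r lo hi c) R A T Q"
proof -
  define Inv where "Inv R A \<longleftrightarrow> a \<le> R r \<and> R r \<le> b \<and> J (R r) R A" for R A
  define pot where "pot R A = (\<Sum>i=R r..<b. g i + 2)" for R :: regs and A :: arrays
  have sv: "aval (Sub hi (Reg r)) (st R A) = b - R r" if "Inv R A" for R A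
    using hi[of "R r" R A] that r by (simp add: Inv_def)
  have W: "run (While (Sub hi (Reg r)) (Seq c (Assign r (Add (Reg r) (Lit 1))))) (R(r := a)) A
      (pot (R(r := a)) A + 1) Q"
  proof (rule run_while[of _ Inv])
    show "small (Sub hi (Reg r))" by (rule sm)
    show "Inv (R(r := a)) A" using init ab by (simp add: Inv_def)
    show "Q R A" if "Inv R A" "aval (Sub hi (Reg r)) (st R A) = 0" for R A
    proof -
      have "b - R r = 0" using sv[OF that(1)] that(2) by metis
      then have "R r = b" "J (R r) R A" using that(1) by (auto simp: Inv_def)
      then show ?thesis using exit[of R A] by simp
    qed
    fix R A assume I: "Inv R A" and nz: "aval (Sub hi (Reg r)) (st R A) \<noteq> 0"
    define i where "i = R r"
    have "b - R r \<noteq> 0" using sv[OF I] nz by metis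
    then have i: "a \<le> i" "i < b" "J i R A" using I by (auto simp: Inv_def i_def)
    have "run (Seq c (Assign r (Add (Reg r) (Lit 1)))) R A (g i + 1)
        (\<lambda>R' A'. Inv R' A' \<and> pot R' A' + (g i + 1) + 1 \<le> pot R A)"
    proof (rule run_seq, rule run_mono[OF step[OF i(1,2) _ i(3)]])
      show "R r = i" by (simp add: i_def)
      fix R' A' assume *: "R' r = i \<and> J (Suc i) (R'(r := Suc i)) A'"
      have pe: "pot R A = pot (R'(r := Suc i)) A' + g i + 2"
        using i(2) by (simp add: pot_def i_def[symmetric] sum.atLeast_Suc_lessThan)
      show "run (Assign r (Add (Reg r) (Lit 1))) R' A' 1
          (\<lambda>R' A'. Inv R' A' \<and> pot R' A' + (g i + 1) + 1 \<le> pot R A)"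
        by (rule run_assign) (use r * i ab pe in \<open>auto simp: small_def Inv_def\<close>)
    qed simp
    moreover have "g i + 1 + 1 \<le> pot R A"
      using i(2) by (simp add: pot_def i_def[symmetric] sum.atLeast_Suc_lessThan)
    ultimately show "\<exists>t. t + 1 \<le> pot R A \<and> run (Seq c (Assign r (Add (Reg r) (Lit 1)))) R A t
        (\<lambda>R' A'. Inv R' A' \<and> pot R' A' + t + 1 \<le> pot R A)" by blast
  qed
  have "run (For r lo hi c) R A (1 + (pot (R(r := a)) A + 1)) Q"
    unfolding For_def
    by (rule run_seq, rule run_assign) (use r sm lo ab W in auto)
  then show ?thesis by (rule run_mono) (use T in \<open>auto simp: pot_def\<close>)
qed

subsection \<open>Weakest preconditions of loop-free code\<close>

lemma arr_addr_inject [simp]: "arr_addr j e = arr_addr j' e' \<longleftrightarrow> j = j' \<and> e = e'"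
  by (auto simp: arr_addr_def)

text \<open>Time is left to \<open>tm\<close> and syntactic admissibility to \<open>lf\<close>, so
  that correctness of loop-free code is plain simplification. The clause for \<open>Store\<close>
  recovers array and index from the address, uniquely by \<open>arr_addr_inject\<close>; loops have
  their own rules.\<close>

primrec wp :: "com \<Rightarrow> (regs \<Rightarrow> arrays \<Rightarrow> bool) \<Rightarrow> regs \<Rightarrow> arrays \<Rightarrow> bool" where
  "wp Skip Q R A = Q R A"
| "wp (Assign r e) Q R A = (aval e (st R A) \<le> B \<and> Q (R(r := aval e (st R A))) A)"
| "wp (Store a v) Q R A = (\<exists>j e. a = arr_addr j e \<and> aval v (st R A) \<le> B \<and>
    Q R (A(j := (A j)(aval e (st R A) := aval v (st R A)))))"
| "wp (Seq c d) Q R A = wp c (wp d Q) R A"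
| "wp (Cond b c d) Q R A = (if aval b (st R A) \<noteq> 0 then wp c Q R A else wp d Q R A)"
| "wp (While b c) Q R A = False"

primrec lf :: "com \<Rightarrow> bool" where
  "lf Skip = True"
| "lf (Assign r e) = (r \<noteq> 1 \<and> r \<noteq> 2 \<and> r \<noteq> 3 \<and> small e)"
| "lf (Store a v) = (\<exists>j e. a = arr_addr j e \<and> j < 16 \<and> small (arr_addr j e) \<and> small v)"
| "lf (Seq c d) = (lf c \<and> lf d)"
| "lf (Cond b c d) = (small b \<and> lf c \<and> lf d)"
| "lf (While b c) = False"

primrec tm :: "com \<Rightarrow> nat" where
  "tm Skip = 1"
| "tm (Assign r e) = 1"
| "tm (Store a v) = 1"
| "tm (Seq c d) = tm c + tm d"
| "tm (Cond b c d) = 1 + max (tm c) (tm d)"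
| "tm (While b c) = 1"

lemma wp_put [simp]: "wp (put j e v) Q R A =
    (aval v (st R A) \<le> B \<and> Q R (A(j := (A j)(aval e (st R A) := aval v (st R A)))))"
  by (auto simp: put_def)

lemma lf_put [simp]: "lf (put j e v) = (j < 16 \<and> small (arr_addr j e) \<and> small v)"
  by (auto simp: put_def)

lemma tm_put [simp]: "tm (put j e v) = 1"
  by (simp add: put_def)

lemma lf_Store: "lf (Store a v) \<Longrightarrow> \<exists>j e. Store a v = put j e v \<and> j < 16 \<and> small (arr_addr j e) \<and> small v"
  by (auto simp: put_def)

lemma run_wp_aux: "lf c \<Longrightarrow> (ok R A \<Longrightarrow> wp c Q R A) \<Longrightarrow> run c R A (tm c) Q"
proof (induction c arbitrary: Q R A)
  case Skip
  show ?case by (rule run_ok) (use Skip run_skip[of Q R A] in simp)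
next
  case (Assign r e)
  show ?case unfolding tm.simps by (rule run_ok, rule run_assign) (use Assign in \<open>auto simp del: fun_upd_apply\<close>)
next
  case (Store a v)
  then obtain j e where e: "Store a v = put j e v" "j < 16" "small (arr_addr j e)" "small v"
    using lf_Store by blast
  show ?case
  proof (rule run_ok)
    assume "ok R A"
    then have "wp (put j e v) Q R A" using Store.prems(2) e(1) by simp
    then show "run (Store a v) R A (tm (Store a v)) Q"
      unfolding e(1) tm_put by (intro run_put) (use e in auto)
  qed
next
  case (Seq c d)
  have "run c R A (tm c) (\<lambda>R' A'. wp d Q R' A')" using Seq.IH(1)[of R A "wp d Q"] Seq.prems by simp
  then have "run c R A (tm c) (\<lambda>R' A'. run d R' A' (tm d) Q)"
    by (rule run_mono) (use Seq.IH(2) Seq.prems in auto)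
  then show ?case using run_seq by simp
next
  case (Cond b c d)
  show ?case
  proof (rule run_ok)
    assume ok: "ok R A"
    have "run (Cond b c d) R A (1 + max (tm c) (tm d)) Q"
    proof (rule run_cond)
      show "small b" using Cond by simp
      show "run c R A (max (tm c) (tm d)) Q" if "aval b (st R A) \<noteq> 0"
        by (rule run_mono[OF Cond.IH(1)]) (use Cond.prems that ok in auto)
      show "run d R A (max (tm c) (tm d)) Q" if "aval b (st R A) = 0"
        by (rule run_mono[OF Cond.IH(2)]) (use Cond.prems that ok in auto)
    qed
    then show "run (Cond b c d) R A (tm (Cond b c d)) Q" by simp
  qed
qed auto

lemma run_wp: "lf c \<Longrightarrow> tm c \<le> T \<Longrightarrow> (ok R A \<Longrightarrow> wp c Q R A) \<Longrightarrow> run c R A T Q"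
  using run_mono[OF run_wp_aux] by blast

end

lemma small_simps [simp]:
  "asz (arr j e) = asz e + 7" "lits (arr j e) \<longleftrightarrow> j \<le> 16 \<and> lits e"
  "asz (arr_addr j e) = asz e + 6" "lits (arr_addr j e) \<longleftrightarrow> j \<le> 16 \<and> lits e"
  by (auto simp: arr_def arr_addr_def)

section \<open>Loops over the graph\<close>

text \<open>Lists, degrees and \<open>M\<close> refer to closed neighbourhoods, so \<open>q\<close>
  is the integer square root of the sum of closed degrees. The bound on \<open>B\<close> leaves room
  for counters up to small multiples of \<open>n\<close>; array indices may exceed
  \<open>B\<close>.\<close>

locale graph_ram = ram F n M B I + chordal_dp "{..<n}" E
  for F n M B :: nat and I :: "nat \<Rightarrow> nat" and E :: "nat \<Rightarrow> nat \<Rightarrow> bool" +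
  fixes L :: "nat \<Rightarrow> nat list" and q :: nat
  assumes L_distinct: "u < n \<Longrightarrow> distinct (L u)" and L_set: "u < n \<Longrightarrow> set (L u) = N u"
    and M_eq: "M = (\<Sum>u<n. card (N u))" and B_ge_M: "4 * M + 16 \<le> B"
    and q_le: "q * q \<le> M" and q_gt: "M < (q + 1) * (q + 1)"
begin

definition dg :: "nat \<Rightarrow> nat" where
  "dg u = card (N u)"

definition PT :: "nat \<Rightarrow> nat" where
  "PT u = (\<Sum>v<u. dg v)"

lemma length_L: "u < n \<Longrightarrow> length (L u) = dg u"
  using L_distinct L_set distinct_card[of "L u"] by (simp add: dg_def)

lemma PT_Suc [simp]: "PT (Suc u) = PT u + dg u"
  by (simp add: PT_def)

lemma PT_n: "PT n = M"
  by (simp add: PT_def M_eq dg_def)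

lemma PT_le: "u \<le> n \<Longrightarrow> PT u \<le> M"
  unfolding PT_n[symmetric] PT_def by (intro sum_mono2) auto

lemma N_less: "x < n \<Longrightarrow> y \<in> N x \<Longrightarrow> y < n"
  using N_subset[of x] by auto

lemma self_N [simp]: "x \<in> N x"
  by (simp add: N_def)

lemma dg_pos: "1 \<le> dg x"
proof -
  have "N x \<noteq> {}" using self_N[of x] by blast
  then have "0 < card (N x)" by (simp add: card_gt_0_iff)
  then show ?thesis by (simp add: dg_def Suc_le_eq)
qed

lemma sum_dg: "(\<Sum>u<n. dg u) = M"
  by (simp add: M_eq dg_def)

lemma n_le_M: "n \<le> M"
proof -
  have "(\<Sum>u<n. 1) \<le> (\<Sum>u<n. dg u)" by (intro sum_mono) (rule dg_pos)
  then show ?thesis using sum_dg by simp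
qed

lemma n_pos: "0 < n"
  using ne by auto

lemma q_pos: "1 \<le> q"
proof (rule ccontr)
  assume "\<not> 1 \<le> q"
  then have "q = 0" by simp
  then show False using q_gt n_le_M n_pos by simp
qed

lemma le_q: "k * k \<le> M \<Longrightarrow> k \<le> q"
proof (rule ccontr)
  assume "k * k \<le> M" "\<not> k \<le> q"
  then have "(q + 1) * (q + 1) \<le> k * k" by (intro mult_le_mono) auto
  then show False using \<open>k * k \<le> M\<close> q_gt by simp
qed

lemma M_le_qM: "M \<le> q * M"
  using q_pos by simp

lemma sum_N_dg_le: "x < n \<Longrightarrow> S \<subseteq> N x \<Longrightarrow> (\<Sum>y\<in>S. dg y) \<le> M"
  unfolding sum_dg[symmetric] using N_less by (intro sum_mono2) auto

text \<open>If \<open>k\<close> neighbours have degree at least \<open>dg x\<close>, then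
  \<open>k \<le> dg x\<close>, and their degrees sum to at least \<open>k * k\<close> and at most to
  \<open>M\<close>.\<close>

lemma card_heavier_le_q: "x < n \<Longrightarrow> card {y \<in> N x. dg x \<le> dg y} \<le> q"
proof (rule le_q)
  assume x: "x < n"
  define S where "S = {y \<in> N x. dg x \<le> dg y}"
  have "card S * card S \<le> card S * dg x"
    unfolding S_def dg_def by (intro mult_le_mono2 card_mono) auto
  also have "\<dots> = (\<Sum>y\<in>S. dg x)" by simp
  also have "\<dots> \<le> (\<Sum>y\<in>S. dg y)" by (intro sum_mono) (simp add: S_def)
  also have "\<dots> \<le> M" using sum_N_dg_le[OF x, of S] by (auto simp: S_def)
  finally show "card {y \<in> N x. dg x \<le> dg y} * card {y \<in> N x. dg x \<le> dg y} \<le> M" by (simp add: S_def)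
qed

lemma index_inject: "a < n \<Longrightarrow> b < n \<Longrightarrow> a' < n \<Longrightarrow> b' < n \<Longrightarrow> a * n + b = a' * n + b' \<longleftrightarrow> a = a' \<and> b = b'"
proof
  assume *: "a < n" "b < n" "a' < n" "b' < n" "a * n + b = a' * n + b'"
  have "(x * n + y) div n = x" "(x * n + y) mod n = y" if "y < n" for x y using that by simp_all
  then show "a = a' \<and> b = b'" using * by metis
qed auto

text \<open>Concatenated lists with row starts, and in addition a full adjacency matrix for
  constant-time adjacency tests. The matrix has \<open>n * n\<close> cells, but memory is initially
  0 and only its \<open>M\<close> ones are ever written, so no quadratic initialisation
  occurs.\<close>

definition garr :: "(nat \<Rightarrow> nat) \<Rightarrow> (nat \<Rightarrow> nat) \<Rightarrow> (nat \<Rightarrow> nat) \<Rightarrow> bool" where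
  "garr pt cl am \<longleftrightarrow> (\<forall>u\<le>n. pt u = PT u) \<and> (\<forall>u<n. \<forall>i<dg u. cl (PT u + i) = L u ! i) \<and>
     (\<forall>u<n. \<forall>v<n. am (u * n + v) = (if v \<in> N u then 1 else 0))"

abbreviation graph :: "arrays \<Rightarrow> bool" where
  "graph A \<equiv> garr (A 0) (A 1) (A 2)"

lemma garr_PT: "garr pt cl am \<Longrightarrow> u \<le> n \<Longrightarrow> pt u = PT u"
  by (simp add: garr_def)

lemma garr_adj: "garr pt cl am \<Longrightarrow> u < n \<Longrightarrow> v < n \<Longrightarrow> am (u * n + v) = (if v \<in> N u then 1 else 0)"
  by (simp add: garr_def)

definition dgE :: "nat \<Rightarrow> aexp" where
  "dgE r = Sub (arr 0 (Add (Reg r) (Lit 1))) (arr 0 (Reg r))"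

definition idx :: "nat \<Rightarrow> nat \<Rightarrow> aexp" where
  "idx a b = Add (Mul (Reg a) (Reg 2)) (Reg b)"

lemma aval_dgE: "graph A \<Longrightarrow> r \<notin> {1, 2, 3} \<Longrightarrow> R r < n \<Longrightarrow> aval (dgE r) (st R A) = dg (R r)"
  by (simp add: dgE_def garr_PT)

lemma aval_idx [simp]: "a \<notin> {1, 2, 3} \<Longrightarrow> b \<notin> {1, 2, 3} \<Longrightarrow> aval (idx a b) (st R A) = R a * n + R b"
  by (simp add: idx_def)

lemma small_E [simp]: "asz (dgE r) = 19" "lits (dgE r)" "asz (idx a b) = 5" "lits (idx a b)"
  by (simp_all add: dgE_def idx_def)

section \<open>Loops over vertices, neighbours and triangles\<close>

definition Verts :: "nat \<Rightarrow> com \<Rightarrow> com" where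
  "Verts r c = For r (Lit 0) (Reg 2) c"

lemma run_verts:
  assumes r: "r \<notin> {1, 2, 3}"
    and init: "J 0 R A" and Jr: "\<And>i R A x. J i R A \<Longrightarrow> J i (R(r := x)) A"
    and step: "\<And>i R A. i < n \<Longrightarrow> R r = i \<Longrightarrow> J i R A \<Longrightarrow> run c R A (g i) (\<lambda>R' A'. R' r = i \<and> J (Suc i) R' A')"
    and exit: "\<And>R A. J n R A \<Longrightarrow> Q R A"
    and T: "(\<Sum>i<n. g i + 2) + 2 \<le> T"
  shows "run (Verts r c) R A T Q"
  unfolding Verts_def
proof (rule run_for[where J = J and g = g and a = 0 and b = n])
  show "run c R A (g i) (\<lambda>R' A'. R' r = i \<and> J (Suc i) (R'(r := Suc i)) A')"
    if "0 \<le> i" "i < n" "R r = i" "J i R A" for i R A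
    by (rule run_mono[OF step]) (use that Jr in auto)
qed (use assms n_le in \<open>auto simp: small_def atLeast0LessThan\<close>)

definition Nbrs :: "nat \<Rightarrow> nat \<Rightarrow> nat \<Rightarrow> com \<Rightarrow> com" where
  "Nbrs k u w c = For k (arr 0 (Reg u)) (arr 0 (Add (Reg u) (Lit 1))) (Seq (Assign w (arr 1 (Reg k))) c)"

text \<open>The invariant is indexed by the set of neighbours already treated, not by a list
  position, so clients need not know the order of the list. Time may depend on the
  neighbour.\<close>

lemma run_nbrs:
  assumes regs: "k \<notin> {1, 2, 3}" "u \<notin> {1, 2, 3}" "w \<notin> {1, 2, 3}" "k \<noteq> w" "k \<noteq> u" and x: "x < n"
    and init: "J {} R A"
    and Jk: "\<And>S R A i. J S R A \<Longrightarrow> J S (R(k := i)) A" and Jw: "\<And>S R A i. J S R A \<Longrightarrow> J S (R(w := i)) A"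
    and Jx: "\<And>S R A. J S R A \<Longrightarrow> R u = x \<and> graph A"
    and step: "\<And>S y R A. J S R A \<Longrightarrow> y \<in> N x \<Longrightarrow> y < n \<Longrightarrow> S \<subseteq> N x \<Longrightarrow> y \<notin> S \<Longrightarrow> R w = y \<Longrightarrow>
      run c R A (g y) (\<lambda>R' A'. R' k = R k \<and> J (insert y S) R' A')"
    and exit: "\<And>R A. J (N x) R A \<Longrightarrow> Q R A"
    and T: "(\<Sum>y\<in>N x. g y + 3) + 2 \<le> T"
  shows "run (Nbrs k u w c) R A T Q"
proof -
  define s where "s i = set (take (i - PT x) (L x))" for i
  have Lx: "length (L x) = dg x" "distinct (L x)" "set (L x) = N x" using length_L L_distinct L_set x by auto
  have e: "N x = (\<lambda>i. L x ! (i - PT x)) ` {PT x..<PT (Suc x)}"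
  proof -
    have "N x = (\<lambda>i. L x ! i) ` {0..<dg x}" using Lx nth_image[of "dg x" "L x"] by simp
    also have "\<dots> = (\<lambda>i. L x ! (i - PT x)) ` ((+) (PT x) ` {0..<dg x})"
      by (simp only: image_image add_diff_cancel_left')
    finally show ?thesis by (simp add: add.commute)
  qed
  have inj: "inj_on (\<lambda>i. L x ! (i - PT x)) {PT x..<PT (Suc x)}"
    using Lx by (auto simp: inj_on_def nth_eq_iff_index_eq)
  have sumT: "(\<Sum>i=PT x..<PT (Suc x). g (L x ! (i - PT x)) + 1 + 2) = (\<Sum>y\<in>N x. g y + 3)"
    unfolding e sum.reindex[OF inj] comp_def by (intro sum.cong) auto
  show ?thesis unfolding Nbrs_def
  proof (rule run_for[where J = "\<lambda>i. J (s i)" and a = "PT x" and b = "PT (Suc x)" and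
        g = "\<lambda>i. g (L x ! (i - PT x)) + 1"])
    have r0: "R u = x" "graph A" using Jx[OF init] by auto
    show "aval (arr 0 (Reg u)) (st R A) = PT x" using regs r0 x by (simp add: garr_PT)
    show "PT x \<le> PT (Suc x)" by simp
    show "PT (Suc x) \<le> B" using PT_le[of "Suc x"] x M_le by simp
    show "aval (arr 0 (Add (Reg u) (Lit 1))) (st R A) = PT (Suc x)" if "J (s i) R A" for i R A
      using regs Jx[OF that] garr_PT[of "A 0" "A 1" "A 2" "Suc x"] x by simp
    show "J (s (PT x)) (R(k := PT x)) A" using init Jk by (simp add: s_def)
    show "Q R A" if "R k = PT (Suc x)" "J (s (PT (Suc x))) R A" for R A
      using exit that Lx by (simp add: s_def)
    fix i R A assume i: "PT x \<le> i" "i < PT (Suc x)" "R k = i" "J (s i) R A"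
    define y where "y = L x ! (i - PT x)"
    have lt: "i - PT x < dg x" using i by auto
    have yN: "y \<in> N x" using lt Lx nth_mem by (fastforce simp: y_def)
    have y: "y \<in> N x" "y < n" "y \<notin> s i" "s i \<subseteq> N x" "s (Suc i) = insert y (s i)"
    proof -
      show "y \<in> N x" "y < n" using yN N_less x by auto
      show "s i \<subseteq> N x" using Lx set_take_subset[of _ "L x"] by (auto simp: s_def)
      show "s (Suc i) = insert y (s i)" using lt Lx i by (simp add: s_def Suc_diff_le take_Suc_conv_app_nth y_def)
      have "distinct (take (Suc (i - PT x)) (L x))" using Lx by simp
      then show "y \<notin> s i" using lt Lx by (simp add: s_def take_Suc_conv_app_nth y_def)
    qed
    have g: "graph A" using Jx[OF i(4)] by simp
    have "A 1 (PT x + (i - PT x)) = y" using g x lt unfolding garr_def y_def by blast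
    then have cl: "A 1 i = y" using i by simp
    have c: "run c (R(w := y)) A (g y) (\<lambda>R' A'. R' k = i \<and> J (insert y (s i)) R' A')"
      using step[OF Jw[OF i(4), of y] y(1,2,4,3)] regs i(3) by simp
    have "run (Seq (Assign w (arr 1 (Reg k))) c) R A (1 + g y) (\<lambda>R' A'. R' k = i \<and> J (s (Suc i)) (R'(k := Suc i)) A')"
    proof (rule run_seq, rule run_assign)
      show "aval (arr 1 (Reg k)) (st R A) \<le> B" using regs i(3) cl y(2) n_le by simp
      have "run c (R(w := y)) A (g y) (\<lambda>R' A'. R' k = i \<and> J (s (Suc i)) (R'(k := Suc i)) A')"
        by (rule run_mono[OF c]) (use Jk y in auto)
      then show "run c (R(w := aval (arr 1 (Reg k)) (st R A))) A (g y)
          (\<lambda>R' A'. R' k = i \<and> J (s (Suc i)) (R'(k := Suc i)) A')"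
        using regs i(3) cl by simp
    qed (use regs in \<open>auto simp: small_def\<close>)
    then show "run (Seq (Assign w (arr 1 (Reg k))) c) R A (g (L x ! (i - PT x)) + 1)
        (\<lambda>R' A'. R' k = i \<and> J (s (Suc i)) (R'(k := Suc i)) A')"
      by (simp add: y_def add.commute)
  qed (use regs T sumT in \<open>auto simp: small_def\<close>)
qed

lemma run_nbrs_const:
  assumes regs: "k \<notin> {1, 2, 3}" "u \<notin> {1, 2, 3}" "w \<notin> {1, 2, 3}" "k \<noteq> w" "k \<noteq> u" and x: "x < n"
    and init: "J {} R A"
    and Jk: "\<And>S R A i. J S R A \<Longrightarrow> J S (R(k := i)) A" and Jw: "\<And>S R A i. J S R A \<Longrightarrow> J S (R(w := i)) A"
    and Jx: "\<And>S R A. J S R A \<Longrightarrow> R u = x \<and> graph A"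
    and step: "\<And>S y R A. J S R A \<Longrightarrow> y \<in> N x \<Longrightarrow> y < n \<Longrightarrow> S \<subseteq> N x \<Longrightarrow> y \<notin> S \<Longrightarrow> R w = y \<Longrightarrow>
      run c R A g (\<lambda>R' A'. R' k = R k \<and> J (insert y S) R' A')"
    and exit: "\<And>R A. J (N x) R A \<Longrightarrow> Q R A"
    and T: "dg x * (g + 3) + 2 \<le> T"
  shows "run (Nbrs k u w c) R A T Q"
proof (rule run_nbrs[where J = J and g = "\<lambda>_. g" and x = x])
  show "(\<Sum>y\<in>N x. g + 3) + 2 \<le> T" using T by (simp add: dg_def)
qed fact+

text \<open>Ordering the first two vertices by degree bounds the number of triples by \<open>M\<^sup>3\<^sup>/\<^sup>2\<close>.\<close>

definition Tri :: "com \<Rightarrow> com" where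
  "Tri c = Verts 5 (Nbrs 6 5 7 (Cond (Sub (Add (dgE 7) (Lit 1)) (dgE 5))
     (Nbrs 8 5 9 (Cond (arr 2 (idx 9 7)) c Skip)) Skip))"

text \<open>Neighbourhoods are closed, so degenerate triples with coinciding entries are included;
  pairs of equal degree occur in both orders.\<close>

definition TT :: "(nat \<times> nat \<times> nat) set" where
  "TT = {(a, b, w). a < n \<and> b \<in> N a \<and> dg a \<le> dg b \<and> w \<in> N a \<and> w \<in> N b}"

text \<open>Each \<open>a\<close> has at most \<open>q\<close> neighbours that are at least as
  heavy, and for each of them \<open>N a\<close> is scanned once. The sum over \<open>a\<close> is
  \<open>q * M\<close> up to constant factors.\<close>

lemma run_tri:
  assumes init: "J {} R A" and Jr: "\<And>S R A r i. r \<in> {5, 6, 7, 8, 9} \<Longrightarrow> J S R A \<Longrightarrow> J S (R(r := i)) A"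
    and Jg: "\<And>S R A. J S R A \<Longrightarrow> graph A"
    and step: "\<And>S a b w R A. J S R A \<Longrightarrow> (a, b, w) \<in> TT \<Longrightarrow> (a, b, w) \<notin> S \<Longrightarrow> S \<subseteq> TT \<Longrightarrow>
      R 5 = a \<Longrightarrow> R 7 = b \<Longrightarrow> R 9 = w \<Longrightarrow>
      run c R A g (\<lambda>R' A'. (\<forall>r\<in>{5, 6, 7, 8, 9}. R' r = R r) \<and> J (insert (a, b, w) S) R' A')"
    and exit: "\<And>R A. J TT R A \<Longrightarrow> Q R A"
    and g1: "1 \<le> g" and T: "(g + 20) * (q * M) \<le> T"
  shows "run (Tri c) R A T Q"
proof -
  \<comment> \<open>\<open>s1\<close>, \<open>s2\<close> and \<open>s3\<close> are the triples
    finished at the current point of the outer, middle and inner loop.\<close>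
  define s1 where "s1 i = {(a, b, w) \<in> TT. a < i}" for i
  define s2 where "s2 i X = s1 i \<union> {(a, b, w) \<in> TT. a = i \<and> b \<in> X}" for i X
  define s3 where "s3 i X y Z = s2 i X \<union> {(a, b, w) \<in> TT. a = i \<and> b = y \<and> w \<in> Z}" for i X y Z
  have sT: "s3 i X y Z \<subseteq> TT" for i X y Z by (auto simp: s3_def s2_def s1_def)
  define h where "h i y = (if dg i \<le> dg y then dg i * (g + 4) + 2 else 0) + 2" for i y
  have inner: "run (Nbrs 8 5 9 (Cond (arr 2 (idx 9 7)) c Skip)) R A (dg i * (g + 4) + 2)
      (\<lambda>R' A'. R' 6 = R 6 \<and> R' 5 = i \<and> J (s2 i (insert y X)) R' A')"
    if i: "i < n" "y \<in> N i" "y \<notin> X" "dg i \<le> dg y" and R: "R 5 = i" "R 7 = y" "J (s2 i X) R A" for i y X R A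
  proof -
    have yn: "y < n" using N_less i by blast
    show ?thesis
    proof (rule run_nbrs_const[where x = i and g = "g + 1" and
          J = "\<lambda>Z R' A'. R' 5 = i \<and> R' 7 = y \<and> R' 6 = R 6 \<and> J (s3 i X y Z) R' A'"])
      have "s3 i X y {} = s2 i X" by (auto simp: s3_def)
      then show "R 5 = i \<and> R 7 = y \<and> R 6 = R 6 \<and> J (s3 i X y {}) R A" using R by simp
      show "R' 6 = R 6 \<and> R' 5 = i \<and> J (s2 i (insert y X)) R' A'"
        if "R' 5 = i \<and> R' 7 = y \<and> R' 6 = R 6 \<and> J (s3 i X y (N i)) R' A'" for R' A'
      proof -
        have "s3 i X y (N i) = s2 i (insert y X)" unfolding s3_def s2_def by (auto simp: TT_def)
        then show ?thesis using that by simp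
      qed
      fix Z w R' A'
      assume J: "R' 5 = i \<and> R' 7 = y \<and> R' 6 = R 6 \<and> J (s3 i X y Z) R' A'"
        and w: "w \<in> N i" "w < n" "Z \<subseteq> N i" "w \<notin> Z" "R' 9 = w"
      have g: "graph A'" using J Jg by blast
      have v: "aval (arr 2 (idx 9 7)) (st R' A') = (if y \<in> N w then 1 else 0)"
        using g w yn J by (simp add: garr_adj)
      have "run (Cond (arr 2 (idx 9 7)) c Skip) R' A' (1 + g)
          (\<lambda>R'' A''. R'' 8 = R' 8 \<and> R'' 5 = i \<and> R'' 7 = y \<and> R'' 6 = R 6 \<and> J (s3 i X y (insert w Z)) R'' A'')"
      proof (rule run_cond)
        assume "aval (arr 2 (idx 9 7)) (st R' A') \<noteq> 0"
        then have "y \<in> N w" using v by (auto split: if_splits)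
        then have wy: "w \<in> N y" using N_sym by blast
        have t: "(i, y, w) \<in> TT" using i w wy by (simp add: TT_def)
        have nt: "(i, y, w) \<notin> s3 i X y Z" using i w by (auto simp: s3_def s2_def s1_def)
        have e: "insert (i, y, w) (s3 i X y Z) = s3 i X y (insert w Z)" using t by (auto simp: s3_def)
        have J': "J (s3 i X y Z) R' A'" "R' 5 = i" "R' 7 = y" "R' 9 = w" using J w by auto
        show "run c R' A' g (\<lambda>R'' A''. R'' 8 = R' 8 \<and> R'' 5 = i \<and> R'' 7 = y \<and> R'' 6 = R 6 \<and> J (s3 i X y (insert w Z)) R'' A'')"
          by (rule run_mono[OF step[OF J'(1) t nt sT J'(2-4)]]) (use J e in auto)
      next
        assume "aval (arr 2 (idx 9 7)) (st R' A') = 0"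
        then have "y \<notin> N w" using v by (auto split: if_splits)
        then have "w \<notin> N y" using N_sym by blast
        then have e: "s3 i X y (insert w Z) = s3 i X y Z" by (auto simp: s3_def TT_def)
        have "run Skip R' A' 1 (\<lambda>R'' A''. R'' 8 = R' 8 \<and> R'' 5 = i \<and> R'' 7 = y \<and> R'' 6 = R 6 \<and> J (s3 i X y (insert w Z)) R'' A'')"
          by (rule run_skip) (use J e in auto)
        then show "run Skip R' A' g (\<lambda>R'' A''. R'' 8 = R' 8 \<and> R'' 5 = i \<and> R'' 7 = y \<and> R'' 6 = R 6 \<and> J (s3 i X y (insert w Z)) R'' A'')"
          by (rule run_mono) (use g1 in auto)
      qed (simp add: small_def)
      then show "run (Cond (arr 2 (idx 9 7)) c Skip) R' A' (g + 1)
          (\<lambda>R'' A''. R'' 8 = R' 8 \<and> R'' 5 = i \<and> R'' 7 = y \<and> R'' 6 = R 6 \<and> J (s3 i X y (insert w Z)) R'' A'')"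
        by (simp add: add.commute)
    qed (use i Jr Jg in \<open>auto simp: algebra_simps\<close>)
  qed
  have outer: "run (Nbrs 6 5 7 (Cond (Sub (Add (dgE 7) (Lit 1)) (dgE 5))
      (Nbrs 8 5 9 (Cond (arr 2 (idx 9 7)) c Skip)) Skip)) R A ((\<Sum>y\<in>N i. h i y + 3) + 2)
      (\<lambda>R' A'. R' 5 = i \<and> J (s1 (Suc i)) R' A')"
    if i: "i < n" and R: "R 5 = i" "J (s1 i) R A" for i R A
  proof (rule run_nbrs[where x = i and g = "h i" and J = "\<lambda>X R' A'. R' 5 = i \<and> J (s2 i X) R' A'"])
    have "s2 i {} = s1 i" by (auto simp: s2_def)
    then show "R 5 = i \<and> J (s2 i {}) R A" using R by simp
    have "s2 i (N i) = s1 (Suc i)" by (auto simp: s2_def s1_def TT_def less_Suc_eq)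
    then show "R' 5 = i \<and> J (s1 (Suc i)) R' A'" if "R' 5 = i \<and> J (s2 i (N i)) R' A'" for R' A' using that by simp
    fix X y R' A'
    assume J: "R' 5 = i \<and> J (s2 i X) R' A'" and y: "y \<in> N i" "y < n" "X \<subseteq> N i" "y \<notin> X" "R' 7 = y"
    have g: "graph A'" using J Jg by blast
    have v: "aval (Sub (Add (dgE 7) (Lit 1)) (dgE 5)) (st R' A') = dg y + 1 - dg i"
      using aval_dgE[OF g, of 7 R'] aval_dgE[OF g, of 5 R'] J y i by simp
    have "run (Cond (Sub (Add (dgE 7) (Lit 1)) (dgE 5)) (Nbrs 8 5 9 (Cond (arr 2 (idx 9 7)) c Skip)) Skip) R' A'
        (1 + (h i y - 1)) (\<lambda>R'' A''. R'' 6 = R' 6 \<and> R'' 5 = i \<and> J (s2 i (insert y X)) R'' A'')"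
    proof (rule run_cond)
      assume "aval (Sub (Add (dgE 7) (Lit 1)) (dgE 5)) (st R' A') \<noteq> 0"
      then have le: "dg i \<le> dg y" using v by simp
      show "run (Nbrs 8 5 9 (Cond (arr 2 (idx 9 7)) c Skip)) R' A' (h i y - 1)
          (\<lambda>R'' A''. R'' 6 = R' 6 \<and> R'' 5 = i \<and> J (s2 i (insert y X)) R'' A'')"
        by (rule run_mono[OF inner[OF i y(1,4) le]]) (use J y le in \<open>auto simp: h_def\<close>)
    next
      assume "aval (Sub (Add (dgE 7) (Lit 1)) (dgE 5)) (st R' A') = 0"
      then have le: "\<not> dg i \<le> dg y" using v by simp
      then have "s2 i (insert y X) = s2 i X" by (auto simp: s2_def TT_def)
      then have "run Skip R' A' 1 (\<lambda>R'' A''. R'' 6 = R' 6 \<and> R'' 5 = i \<and> J (s2 i (insert y X)) R'' A'')"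
        using J by (intro run_skip) simp
      then show "run Skip R' A' (h i y - 1) (\<lambda>R'' A''. R'' 6 = R' 6 \<and> R'' 5 = i \<and> J (s2 i (insert y X)) R'' A'')"
        by (rule run_mono) (use le in \<open>auto simp: h_def\<close>)
    qed (simp add: small_def)
    then show "run (Cond (Sub (Add (dgE 7) (Lit 1)) (dgE 5)) (Nbrs 8 5 9 (Cond (arr 2 (idx 9 7)) c Skip)) Skip) R' A'
        (h i y) (\<lambda>R'' A''. R'' 6 = R' 6 \<and> R'' 5 = i \<and> J (s2 i (insert y X)) R'' A'')"
      by (rule run_mono) (auto simp: h_def)
  qed (use i Jr Jg in auto)
  have hs: "(\<Sum>y\<in>N i. h i y + 3) \<le> dg i * (q * (g + 4) + 7)" if "i < n" for i
  proof -
    define k where "k = card {y \<in> N i. dg i \<le> dg y}"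
    have "(\<Sum>y\<in>N i. if dg i \<le> dg y then dg i * (g + 4) + 2 else 0) = k * (dg i * (g + 4) + 2)"
      by (simp add: sum.If_cases Int_def k_def)
    then have e: "(\<Sum>y\<in>N i. h i y + 3) = k * (dg i * (g + 4)) + 2 * k + 5 * dg i"
      by (simp add: h_def sum.distrib dg_def algebra_simps)
    have "k * (dg i * (g + 4)) \<le> q * (dg i * (g + 4))"
      using card_heavier_le_q[OF that] unfolding k_def by (rule mult_le_mono1)
    moreover have "k \<le> dg i" unfolding dg_def[of i] k_def by (intro card_mono) auto
    moreover have "dg i * (q * (g + 4) + 7) = q * (dg i * (g + 4)) + 7 * dg i" by (simp add: algebra_simps)
    ultimately show ?thesis using e by linarith
  qed
  show ?thesis unfolding Tri_def
  proof (rule run_verts[where J = "\<lambda>i. J (s1 i)" and g = "\<lambda>i. (\<Sum>y\<in>N i. h i y + 3) + 2"])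
    have "s1 0 = {}" by (auto simp: s1_def)
    then show "J (s1 0) R A" using init by simp
    have "s1 n = TT" by (auto simp: s1_def TT_def)
    then show "\<And>R A. J (s1 n) R A \<Longrightarrow> Q R A" using exit by simp
    have "(\<Sum>i<n. (\<Sum>y\<in>N i. h i y + 3) + 2 + 2) \<le> (\<Sum>i<n. dg i * (q * (g + 4) + 7) + 4)"
      by (rule sum_mono) (use hs in fastforce)
    then have "(\<Sum>i<n. (\<Sum>y\<in>N i. h i y + 3) + 2 + 2) + 2 \<le> (\<Sum>i<n. dg i * (q * (g + 4) + 7) + 4) + 2"
      by simp
    also have "\<dots> = M * (q * (g + 4) + 7) + 4 * n + 2"
      by (simp add: sum.distrib sum_distrib_right[symmetric] sum_dg)
    also have "\<dots> \<le> (g + 4) * (q * M) + 13 * M"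
      using n_le_M n_pos by (simp add: algebra_simps)
    also have "\<dots> \<le> (g + 4) * (q * M) + 16 * (q * M)" using M_le_qM by linarith
    also have "\<dots> = (g + 20) * (q * M)" by (simp add: algebra_simps)
    finally show "(\<Sum>i<n. (\<Sum>y\<in>N i. h i y + 3) + 2 + 2) + 2 \<le> T" using T by simp
  qed (use outer Jr in auto)
qed

section \<open>Deciding whether the diameter is at most 2 or at most 3\<close>

text \<open>Array 3 receives the numbers of common neighbours of edges, array 4 the simplicial vertices, arrays
  5, 6 and 7 count the best pairs \<open>(a, b)\<close>, their ends, and the pairs with a given common neighbour, and array 8
  marks the vertices of eccentricity at most 2. Registers 16 and 17 tell whether the diameter exceeds 2 or 3.\<close>

definition cntS :: "nat \<Rightarrow> (nat \<Rightarrow> bool) \<Rightarrow> nat" where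
  "cntS i P = card {z. z < i \<and> z < n \<and> simplicial z \<and> P z}"

lemma cntS_Suc: "i < n \<Longrightarrow> cntS (Suc i) P = cntS i P + (if simplicial i \<and> P i then 1 else 0)"
proof -
  assume "i < n"
  then have "{z. z < Suc i \<and> z < n \<and> simplicial z \<and> P z} =
      (if simplicial i \<and> P i then insert i {z. z < i \<and> z < n \<and> simplicial z \<and> P z}
       else {z. z < i \<and> z < n \<and> simplicial z \<and> P z})"
    by (auto simp: less_Suc_eq)
  then show ?thesis by (auto simp: cntS_def)
qed

lemma cntS_0 [simp]: "cntS 0 P = 0"
  by (simp add: cntS_def)

lemma cntS_cong: "(\<And>z. z < i \<Longrightarrow> P z = P' z) \<Longrightarrow> cntS i P = cntS i P'"
  unfolding cntS_def by (rule arg_cong[of _ _ card]) auto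

lemma cntS_le: "cntS i P \<le> n"
  unfolding cntS_def using card_mono[of "{..<n}" "{z. z < i \<and> z < n \<and> simplicial z \<and> P z}"] by auto

lemma simplicial_less: "simplicial y \<Longrightarrow> y < n"
  using simplicial_V by auto

lemma simplicial_iff: "y < n \<Longrightarrow> simplicial y \<longleftrightarrow> (\<forall>a\<in>N y. \<forall>b\<in>N y. b \<in> N a)"
proof -
  assume y: "y < n"
  have "b \<in> N a \<longleftrightarrow> a = b \<or> E a b" for a b by (auto simp: N_def)
  then show ?thesis using y N_subset[of y] by (auto simp: simplicial_def clique_def)
qed

text \<open>The closed neighbourhood of each member contains \<open>Q\<close>, so the degrees of the
  members sum to at least \<open>card Q * card Q\<close>.\<close>

lemma clique_card_le: assumes "clique Q" shows "card Q * card Q \<le> M"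
proof -
  have Q: "Q \<subseteq> {..<n}" using assms by (simp add: clique_def)
  have "card Q \<le> dg a" if "a \<in> Q" for a
    unfolding dg_def using assms that by (intro card_mono finite_N) (auto simp: clique_def N_def)
  then have "(\<Sum>a\<in>Q. card Q) \<le> (\<Sum>a\<in>Q. dg a)" by (rule sum_mono)
  also have "\<dots> \<le> M" unfolding sum_dg[symmetric] using Q by (intro sum_mono2) auto
  finally show ?thesis by simp
qed

subsection \<open>Common neighbours\<close>

definition common_com :: com where
  "common_com = Tri (put 3 (idx 5 7) (Add (arr 3 (idx 5 7)) (Lit 1)))"

lemma run_common:
  assumes g: "graph A" and z: "\<And>x. A 3 x = 0"
    and Q: "\<And>R' f. (\<And>r. r \<notin> {5..14} \<Longrightarrow> R' r = R r) \<Longrightarrow>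
      (\<And>a b. a < n \<Longrightarrow> b \<in> N a \<Longrightarrow> dg a \<le> dg b \<Longrightarrow> f (a * n + b) = card (N a \<inter> N b)) \<Longrightarrow> Q R' (A(3 := f))"
    and T: "21 * (q * M) \<le> T"
  shows "run common_com R A T Q"
  unfolding common_com_def
proof (rule run_tri[where g = 1 and J = "\<lambda>S R' A'. (\<forall>r. r \<notin> {5..14} \<longrightarrow> R' r = R r) \<and>
    (\<exists>f. A' = A(3 := f) \<and> (\<forall>a<n. \<forall>b<n. f (a * n + b) = card {w. (a, b, w) \<in> S}))"])
  show "(\<forall>r. r \<notin> {5..14} \<longrightarrow> R r = R r) \<and>
    (\<exists>f. A = A(3 := f) \<and> (\<forall>a<n. \<forall>b<n. f (a * n + b) = card {w. (a, b, w) \<in> {}}))"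
    using z by (auto intro!: exI[of _ "A 3"])
  fix R' A'
  assume "(\<forall>r. r \<notin> {5..14} \<longrightarrow> R' r = R r) \<and>
    (\<exists>f. A' = A(3 := f) \<and> (\<forall>a<n. \<forall>b<n. f (a * n + b) = card {w. (a, b, w) \<in> TT}))"
  then obtain f where f: "\<And>r. r \<notin> {5..14} \<Longrightarrow> R' r = R r" "A' = A(3 := f)"
    "\<And>a b. a < n \<Longrightarrow> b < n \<Longrightarrow> f (a * n + b) = card {w. (a, b, w) \<in> TT}" by blast
  have "f (a * n + b) = card (N a \<inter> N b)" if "a < n" "b \<in> N a" "dg a \<le> dg b" for a b
  proof -
    have "{w. (a, b, w) \<in> TT} = N a \<inter> N b" using that by (auto simp: TT_def)
    then show ?thesis using f(3)[of a b] that N_less by simp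
  qed
  then show "Q R' A'" using Q[of R' f] f(1,2) by simp
next
  fix S a b w R' A'
  assume J: "(\<forall>r. r \<notin> {5..14} \<longrightarrow> R' r = R r) \<and>
    (\<exists>f. A' = A(3 := f) \<and> (\<forall>a<n. \<forall>b<n. f (a * n + b) = card {w. (a, b, w) \<in> S}))"
    and t: "(a, b, w) \<in> TT" "(a, b, w) \<notin> S" "S \<subseteq> TT" and R': "R' 5 = a" "R' 7 = b" "R' 9 = w"
  from J obtain f where f: "\<And>r. r \<notin> {5..14} \<Longrightarrow> R' r = R r" "A' = A(3 := f)"
    "\<And>a b. a < n \<Longrightarrow> b < n \<Longrightarrow> f (a * n + b) = card {w. (a, b, w) \<in> S}" by blast
  have ab: "a < n" "b < n" using t(1) N_less by (auto simp: TT_def)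
  have fin: "finite {w. (a', b', w) \<in> S}" for a' b'
    by (rule finite_subset[OF _ finite_N[of a']]) (use t(3) in \<open>auto simp: TT_def\<close>)
  have "{w. (a, b, w) \<in> S} \<subseteq> {..<n}" using t(3) N_less by (auto simp: TT_def)
  then have le: "card {w. (a, b, w) \<in> S} \<le> n" using card_mono[of "{..<n}"] by fastforce
  define f' where "f' = f(a * n + b := f (a * n + b) + 1)"
  have f': "f' (a' * n + b') = card {w'. (a', b', w') \<in> insert (a, b, w) S}" if "a' < n" "b' < n" for a' b'
  proof (cases "a' = a \<and> b' = b")
    case True
    then have "{w'. (a', b', w') \<in> insert (a, b, w) S} = insert w {w. (a, b, w) \<in> S}" by auto
    then show ?thesis using True fin[of a b] t(2) f(3)[OF ab] by (simp add: f'_def)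
  next
    case False
    then have "a' * n + b' \<noteq> a * n + b" using index_inject that ab by blast
    moreover have "{w'. (a', b', w') \<in> insert (a, b, w) S} = {w'. (a', b', w') \<in> S}" using False by auto
    ultimately show ?thesis using f(3)[OF that] by (simp add: f'_def)
  qed
  show "run (put 3 (idx 5 7) (Add (arr 3 (idx 5 7)) (Lit 1))) R' A' 1
    (\<lambda>R'' A''. (\<forall>r\<in>{5, 6, 7, 8, 9}. R'' r = R' r) \<and> (\<forall>r. r \<notin> {5..14} \<longrightarrow> R'' r = R r) \<and>
    (\<exists>f. A'' = A(3 := f) \<and> (\<forall>a'<n. \<forall>b'<n. f (a' * n + b') = card {w'. (a', b', w') \<in> insert (a, b, w) S})))"
  proof (rule run_put)
    show "aval (Add (arr 3 (idx 5 7)) (Lit 1)) (st R' A') \<le> B"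
      using R' f(2) f(3)[OF ab] le B_ge_M n_le_M by simp
    have "A'(3 := (A' 3)(aval (idx 5 7) (st R' A') := aval (Add (arr 3 (idx 5 7)) (Lit 1)) (st R' A'))) = A(3 := f')"
      using R' f(2) by (simp add: f'_def)
    then show "(\<forall>r\<in>{5, 6, 7, 8, 9}. R' r = R' r) \<and> (\<forall>r. r \<notin> {5..14} \<longrightarrow> R' r = R r) \<and>
      (\<exists>f. A'(3 := (A' 3)(aval (idx 5 7) (st R' A') := aval (Add (arr 3 (idx 5 7)) (Lit 1)) (st R' A'))) = A(3 := f) \<and>
        (\<forall>a'<n. \<forall>b'<n. f (a' * n + b') = card {w'. (a', b', w') \<in> insert (a, b, w) S}))"
      using f(1) f' by auto
  qed (auto simp: small_def)
qed (use g T in auto)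

subsection \<open>Best pairs of simplicial vertices\<close>

text \<open>Register 10 remains nonzero as long as \<open>N y\<close> looks like a clique; 11 holds
  the largest union so far, 12 and 13 its pair. Only pairs ordered by degree are evaluated, since
  only for these array 3 is filled; the union is symmetric, so nothing is lost.\<close>

definition pair_step :: com where
  "pair_step = Cond (arr 2 (idx 7 9))
     (Cond (Sub (Add (dgE 9) (Lit 1)) (dgE 7))
       (Seq (Assign 14 (Sub (Add (dgE 7) (dgE 9)) (arr 3 (idx 7 9))))
         (Cond (Sub (Reg 14) (Reg 11))
           (Seq (Assign 11 (Reg 14)) (Seq (Assign 12 (Reg 7)) (Assign 13 (Reg 9)))) Skip)) Skip)
     (Assign 10 (Lit 0))"

definition record_pair :: com where
  "record_pair = Cond (Reg 10)
     (Seq (put 4 (Reg 5) (Lit 1)) (Seq (Assign 15 (Add (Reg 15) (Lit 1)))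
       (Seq (put 5 (idx 12 13) (Add (arr 5 (idx 12 13)) (Lit 1)))
         (Seq (put 6 (Reg 12) (Add (arr 6 (Reg 12)) (Lit 1)))
           (Seq (put 6 (Reg 13) (Add (arr 6 (Reg 13)) (Lit 1)))
             (Cond (Sub (Reg 2) (Reg 11)) (Assign 16 (Lit 1)) Skip)))))) Skip"

text \<open>A vertex with \<open>dg y * dg y > M\<close> cannot be simplicial and is skipped. For
  the others the quadratic loop over \<open>N y\<close> costs at most \<open>q * dg y\<close>, which
  sums to \<open>q * M\<close>.\<close>

definition best_com :: com where
  "best_com = Verts 5 (Cond (Sub (Add (Reg 3) (Lit 1)) (Mul (dgE 5) (dgE 5)))
     (Seq (Seq (Assign 10 (Lit 1)) (Seq (Assign 11 (Lit 0)) (Seq (Assign 12 (Reg 5)) (Assign 13 (Reg 5)))))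
       (Seq (Nbrs 6 5 7 (Nbrs 8 5 9 pair_step)) record_pair)) Skip)"

definition pinv :: "nat \<Rightarrow> (nat \<times> nat) set \<Rightarrow> regs \<Rightarrow> bool" where
  "pinv y P R \<longleftrightarrow> (R 10 \<noteq> 0 \<longleftrightarrow> (\<forall>(a, b)\<in>P. b \<in> N a)) \<and> R 12 \<in> N y \<and> R 13 \<in> N y \<and> dg (R 12) \<le> dg (R 13) \<and>
     (R 11 = 0 \<or> R 11 = card (N (R 12) \<union> N (R 13))) \<and>
     (\<forall>(a, b)\<in>P. b \<in> N a \<longrightarrow> dg a \<le> dg b \<longrightarrow> card (N a \<union> N b) \<le> R 11)"

definition common :: "(nat \<Rightarrow> nat) \<Rightarrow> bool" where
  "common f \<longleftrightarrow> (\<forall>a<n. \<forall>b\<in>N a. dg a \<le> dg b \<longrightarrow> f (a * n + b) = card (N a \<inter> N b))"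

lemma card_N_Un_le: "a < n \<Longrightarrow> b < n \<Longrightarrow> card (N a \<union> N b) \<le> n"
  using card_mono[of "{..<n}" "N a \<union> N b"] N_subset[of a] N_subset[of b] by simp

lemma run_pair_step:
  assumes g: "graph A" and c: "common (A 3)" and ab: "a < n" "b < n" "a \<in> N y" "b \<in> N y"
    and R: "R 7 = a" "R 9 = b" and P: "pinv y P R"
  shows "run pair_step R A 7 (\<lambda>R' A'. A' = A \<and> (\<forall>r. r \<notin> {10..14} \<longrightarrow> R' r = R r) \<and> pinv y (insert (a, b) P) R')"
proof (rule run_wp)
  show "lf pair_step" by (simp add: pair_step_def small_def)
  show "tm pair_step \<le> 7" by (simp add: pair_step_def)
  have v1: "aval (arr 2 (idx 7 9)) (st R A) = (if b \<in> N a then 1 else 0)"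
    using g R ab by (simp add: garr_adj)
  have v2: "aval (dgE 7) (st R A) = dg a" "aval (dgE 9) (st R A) = dg b"
    using aval_dgE[OF g, of 7 R] aval_dgE[OF g, of 9 R] R ab by auto
  show "wp pair_step (\<lambda>R' A'. A' = A \<and> (\<forall>r. r \<notin> {10..14} \<longrightarrow> R' r = R r) \<and> pinv y (insert (a, b) P) R') R A"
  proof (cases "b \<in> N a")
    case False
    then show ?thesis using v1 P by (auto simp: pair_step_def pinv_def)
  next
    case True
    show ?thesis
    proof (cases "dg a \<le> dg b")
      case False
      then show ?thesis using v1 v2 P True by (auto simp: pair_step_def pinv_def)
    next
      case le: True
      have "A 3 (a * n + b) = card (N a \<inter> N b)" using c ab True le by (auto simp: common_def)
      then have v3: "dg a + dg b - A 3 (a * n + b) = card (N a \<union> N b)"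
        using card_Un_Int[of "N a" "N b"] by (simp add: dg_def)
      have "card (N a \<union> N b) \<le> B" using card_N_Un_le[OF ab(1,2)] n_le by simp
      then show ?thesis using v1 v2 v3 P True le R ab n_le
        by (auto simp: pair_step_def pinv_def)
    qed
  qed
qed

text \<open>\<open>pa\<close> and \<open>pb\<close> are ghost functions for the pairs chosen by the
  first \<open>i\<close> vertices; the memory only keeps how often each pair (\<open>f5\<close>) and
  each vertex as an end (\<open>f6\<close>) was chosen. \<open>s\<close> counts the simplicial
  vertices, \<open>t\<close> flags a ball of radius 2 that is not everything.\<close>

definition pairs :: "nat \<Rightarrow> (nat \<Rightarrow> nat) \<Rightarrow> (nat \<Rightarrow> nat) \<Rightarrow> (nat \<Rightarrow> nat) \<Rightarrow> (nat \<Rightarrow> nat) \<Rightarrow> (nat \<Rightarrow> nat) \<Rightarrow> nat \<Rightarrow> nat \<Rightarrow> bool" where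
  "pairs i pa pb f4 f5 f6 s t \<longleftrightarrow>
     (\<forall>y<n. f4 y \<noteq> 0 \<longleftrightarrow> y < i \<and> simplicial y) \<and>
     (\<forall>y<i. simplicial y \<longrightarrow> best_pair y (pa y, pb y) \<and> dg (pa y) \<le> dg (pb y)) \<and>
     (\<forall>p<n. \<forall>r<n. f5 (p * n + r) = cntS i (\<lambda>y. pa y = p \<and> pb y = r)) \<and>
     (\<forall>p<n. f6 p = cntS i (\<lambda>y. pa y = p) + cntS i (\<lambda>y. pb y = p)) \<and>
     s = cntS i (\<lambda>_. True) \<and>
     (t \<noteq> 0 \<longleftrightarrow> (\<exists>y<i. simplicial y \<and> card (N (pa y) \<union> N (pb y)) \<noteq> n))"

lemma pinv_best:
  assumes y: "y < n" and P: "pinv y (N y \<times> N y) R"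
  shows "R 10 \<noteq> 0 \<longleftrightarrow> simplicial y"
    and "simplicial y \<Longrightarrow> best_pair y (R 12, R 13) \<and> dg (R 12) \<le> dg (R 13) \<and> R 11 = card (N (R 12) \<union> N (R 13))"
proof -
  show s: "R 10 \<noteq> 0 \<longleftrightarrow> simplicial y" using P simplicial_iff[OF y] by (auto simp: pinv_def)
  assume si: "simplicial y"
  have le: "card (N a \<union> N b) \<le> R 11" if "a \<in> N y" "b \<in> N y" for a b
  proof (cases "dg a \<le> dg b")
    case True
    then show ?thesis using P si that simplicial_iff[OF y] by (auto simp: pinv_def)
  next
    case False
    then have "card (N b \<union> N a) \<le> R 11" using P si that simplicial_iff[OF y] by (auto simp: pinv_def)
    then show ?thesis by (simp add: Un_commute)
  qed
  \<comment> \<open>The initial value 0 of register 11 means that nothing has been recorded; the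
    pair \<open>(y, y)\<close> alone makes it positive.\<close>
  have "card (N y \<union> N y) \<le> R 11" by (rule le) auto
  then have "R 11 \<noteq> 0" using dg_pos[of y] by (simp add: dg_def)
  then have "R 11 = card (N (R 12) \<union> N (R 13))" using P by (auto simp: pinv_def)
  then show "best_pair y (R 12, R 13) \<and> dg (R 12) \<le> dg (R 13) \<and> R 11 = card (N (R 12) \<union> N (R 13))"
    using P le by (auto simp: best_pair_def pinv_def)
qed

lemma run_pair_loop:
  assumes g: "graph A" and c: "common (A 3)" and y: "y < n" "R 5 = y" and P: "pinv y {} R"
  shows "run (Nbrs 6 5 7 (Nbrs 8 5 9 pair_step)) R A (dg y * (dg y * 10 + 5) + 2)
     (\<lambda>R' A'. A' = A \<and> R' 5 = y \<and> (\<forall>r. r \<notin> {5..14} \<longrightarrow> R' r = R r) \<and> pinv y (N y \<times> N y) R')"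
proof (rule run_nbrs_const[where x = y and g = "dg y * 10 + 2" and
    J = "\<lambda>S R' A'. A' = A \<and> R' 5 = y \<and> (\<forall>r. r \<notin> {5..14} \<longrightarrow> R' r = R r) \<and> pinv y (S \<times> N y) R'"])
  fix S a R' A'
  assume J: "A' = A \<and> R' 5 = y \<and> (\<forall>r. r \<notin> {5..14} \<longrightarrow> R' r = R r) \<and> pinv y (S \<times> N y) R'"
    and a: "a \<in> N y" "a < n" "S \<subseteq> N y" "a \<notin> S" "R' 7 = a"
  show "run (Nbrs 8 5 9 pair_step) R' A' (dg y * 10 + 2) (\<lambda>R'' A''. R'' 6 = R' 6 \<and> A'' = A \<and> R'' 5 = y \<and>
      (\<forall>r. r \<notin> {5..14} \<longrightarrow> R'' r = R r) \<and> pinv y (insert a S \<times> N y) R'')"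
  proof (rule run_nbrs_const[where x = y and g = 7 and
      J = "\<lambda>Z R'' A''. A'' = A \<and> R'' 5 = y \<and> R'' 6 = R' 6 \<and> R'' 7 = a \<and> (\<forall>r. r \<notin> {5..14} \<longrightarrow> R'' r = R r) \<and>
        pinv y (S \<times> N y \<union> {a} \<times> Z) R''"])
    fix Z b R'' A''
    assume J2: "A'' = A \<and> R'' 5 = y \<and> R'' 6 = R' 6 \<and> R'' 7 = a \<and> (\<forall>r. r \<notin> {5..14} \<longrightarrow> R'' r = R r) \<and>
        pinv y (S \<times> N y \<union> {a} \<times> Z) R''"
      and b: "b \<in> N y" "b < n" "Z \<subseteq> N y" "b \<notin> Z" "R'' 9 = b"
    have e: "insert (a, b) (S \<times> N y \<union> {a} \<times> Z) = S \<times> N y \<union> {a} \<times> insert b Z" by auto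
    have "run pair_step R'' A 7 (\<lambda>R3 A3. A3 = A \<and> (\<forall>r. r \<notin> {10..14} \<longrightarrow> R3 r = R'' r) \<and>
        pinv y (S \<times> N y \<union> {a} \<times> insert b Z) R3)"
      using run_pair_step[OF g c a(2) b(2) a(1) b(1), of R'' "S \<times> N y \<union> {a} \<times> Z"] J2 b unfolding e by blast
    then show "run pair_step R'' A'' 7 (\<lambda>R3 A3. R3 8 = R'' 8 \<and> A3 = A \<and> R3 5 = y \<and> R3 6 = R' 6 \<and> R3 7 = a \<and>
        (\<forall>r. r \<notin> {5..14} \<longrightarrow> R3 r = R r) \<and> pinv y (S \<times> N y \<union> {a} \<times> insert b Z) R3)"
      using J2 by (auto elim!: run_mono)
  next
    show "R'' 6 = R' 6 \<and> A'' = A \<and> R'' 5 = y \<and> (\<forall>r. r \<notin> {5..14} \<longrightarrow> R'' r = R r) \<and> pinv y (insert a S \<times> N y) R''"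
      if "A'' = A \<and> R'' 5 = y \<and> R'' 6 = R' 6 \<and> R'' 7 = a \<and> (\<forall>r. r \<notin> {5..14} \<longrightarrow> R'' r = R r) \<and>
        pinv y (S \<times> N y \<union> {a} \<times> N y) R''" for R'' A''
    proof -
      have "S \<times> N y \<union> {a} \<times> N y = insert a S \<times> N y" by auto
      then show ?thesis using that by simp
    qed
  qed (use J a g y in \<open>auto simp: pinv_def\<close>)
qed (use P g y in \<open>auto simp: pinv_def algebra_simps\<close>)

lemma pairs_step:
  assumes P: "pairs y pa pb f4 f5 f6 s t" and y: "y < n" "simplicial y"
    and b: "best_pair y (p, r)" "dg p \<le> dg r"
  shows "pairs (Suc y) (pa(y := p)) (pb(y := r)) (f4(y := 1)) (f5(p * n + r := f5 (p * n + r) + 1))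
    ((f6(p := f6 p + 1))(r := (f6(p := f6 p + 1)) r + 1)) (s + 1)
    (if card (N p \<union> N r) \<noteq> n then 1 else t)"
proof -
  have pr: "p < n" "r < n" using b(1) N_less[OF y(1)] by (auto simp: best_pair_def)
  have c: "cntS (Suc y) (\<lambda>z. X ((pa(y := p)) z) ((pb(y := r)) z)) =
      cntS y (\<lambda>z. X (pa z) (pb z)) + (if X p r then 1 else 0)" for X
  proof -
    have "cntS y (\<lambda>z. X ((pa(y := p)) z) ((pb(y := r)) z)) = cntS y (\<lambda>z. X (pa z) (pb z))"
      by (rule cntS_cong) auto
    then show ?thesis using cntS_Suc[OF y(1)] y(2) by simp
  qed
  show ?thesis unfolding pairs_def
  proof (intro conjI)
    show "\<forall>z<n. (f4(y := 1)) z \<noteq> 0 \<longleftrightarrow> z < Suc y \<and> simplicial z"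
      using P y by (auto simp: pairs_def less_Suc_eq)
    show "\<forall>z<Suc y. simplicial z \<longrightarrow> best_pair z ((pa(y := p)) z, (pb(y := r)) z) \<and>
        dg ((pa(y := p)) z) \<le> dg ((pb(y := r)) z)"
      using P b by (auto simp: pairs_def less_Suc_eq)
    show "\<forall>p'<n. \<forall>r'<n. (f5(p * n + r := f5 (p * n + r) + 1)) (p' * n + r') =
        cntS (Suc y) (\<lambda>z. (pa(y := p)) z = p' \<and> (pb(y := r)) z = r')"
    proof (intro allI impI)
      fix p' r' assume "p' < n" "r' < n"
      then show "(f5(p * n + r := f5 (p * n + r) + 1)) (p' * n + r') =
        cntS (Suc y) (\<lambda>z. (pa(y := p)) z = p' \<and> (pb(y := r)) z = r')"
        using P c[of "\<lambda>u v. u = p' \<and> v = r'"] index_inject[OF \<open>p' < n\<close> \<open>r' < n\<close> pr] pr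
        by (auto simp: pairs_def)
    qed
    show "\<forall>p'<n. ((f6(p := f6 p + 1))(r := (f6(p := f6 p + 1)) r + 1)) p' =
        cntS (Suc y) (\<lambda>z. (pa(y := p)) z = p') + cntS (Suc y) (\<lambda>z. (pb(y := r)) z = p')"
    proof (intro allI impI)
      fix p' assume "p' < n"
      then show "((f6(p := f6 p + 1))(r := (f6(p := f6 p + 1)) r + 1)) p' =
        cntS (Suc y) (\<lambda>z. (pa(y := p)) z = p') + cntS (Suc y) (\<lambda>z. (pb(y := r)) z = p')"
        using P c[of "\<lambda>u v. u = p'"] c[of "\<lambda>u v. v = p'"] by (auto simp: pairs_def)
    qed
    show "s + 1 = cntS (Suc y) (\<lambda>_. True)" using P c[of "\<lambda>_ _. True"] by (simp add: pairs_def)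
    show "(if card (N p \<union> N r) \<noteq> n then 1 else t) \<noteq> 0 \<longleftrightarrow>
        (\<exists>z<Suc y. simplicial z \<and> card (N ((pa(y := p)) z) \<union> N ((pb(y := r)) z)) \<noteq> n)"
      using P y by (auto simp: pairs_def less_Suc_eq)
  qed
qed

lemma pairs_skip:
  assumes P: "pairs y pa pb f4 f5 f6 s t" and y: "y < n" "\<not> simplicial y"
  shows "pairs (Suc y) pa pb f4 f5 f6 s t"
proof -
  have "cntS (Suc y) X = cntS y X" for X using cntS_Suc[OF y(1)] y(2) by simp
  then show ?thesis using P y by (auto simp: pairs_def less_Suc_eq)
qed

lemma pairs_0: "(\<And>x. f4 x = 0) \<Longrightarrow> (\<And>x. f5 x = 0) \<Longrightarrow> (\<And>x. f6 x = 0) \<Longrightarrow> pairs 0 pa pb f4 f5 f6 0 0"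
  by (simp add: pairs_def)

lemma run_best:
  assumes g: "graph A" and c: "common (A 3)"
    and z: "\<And>j x. j \<in> {4, 5, 6} \<Longrightarrow> A j x = 0" "R 15 = 0" "R 16 = 0"
    and Q: "\<And>R' pa pb f4 f5 f6. (\<And>r. r \<notin> {5..16} \<Longrightarrow> R' r = R r) \<Longrightarrow>
      pairs n pa pb f4 f5 f6 (R' 15) (R' 16) \<Longrightarrow> Q R' (A(4 := f4, 5 := f5, 6 := f6))"
    and T: "60 * (q * M) \<le> T"
  shows "run best_com R A T Q"
  unfolding best_com_def
proof (rule run_verts[where g = "\<lambda>i. 10 * (q * dg i) + 5 * dg i + 20" and
    J = "\<lambda>i R' A'. (\<forall>r. r \<notin> {5..16} \<longrightarrow> R' r = R r) \<and>
      (\<exists>pa pb f4 f5 f6. A' = A(4 := f4, 5 := f5, 6 := f6) \<and> pairs i pa pb f4 f5 f6 (R' 15) (R' 16))"])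
  have "A = A(4 := A 4, 5 := A 5, 6 := A 6)" by simp
  then show "(\<forall>r. r \<notin> {5..16} \<longrightarrow> R r = R r) \<and>
      (\<exists>pa pb f4 f5 f6. A = A(4 := f4, 5 := f5, 6 := f6) \<and> pairs 0 pa pb f4 f5 f6 (R 15) (R 16))"
    using pairs_0[of "A 4" "A 5" "A 6"] z by fastforce
  have "(\<Sum>i<n. 10 * (q * dg i) + 5 * dg i + 20 + 2) = 10 * (q * M) + 5 * M + 22 * n"
    by (simp add: sum.distrib sum_distrib_left[symmetric] sum_dg)
  then show "(\<Sum>i<n. 10 * (q * dg i) + 5 * dg i + 20 + 2) + 2 \<le> T"
    using T M_le_qM n_le_M n_pos by linarith
next
  fix y R' A'
  assume y: "y < n" "R' 5 = y" and J: "(\<forall>r. r \<notin> {5..16} \<longrightarrow> R' r = R r) \<and>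
      (\<exists>pa pb f4 f5 f6. A' = A(4 := f4, 5 := f5, 6 := f6) \<and> pairs y pa pb f4 f5 f6 (R' 15) (R' 16))"
  then obtain pa pb f4 f5 f6 where A': "A' = A(4 := f4, 5 := f5, 6 := f6)"
    and P: "pairs y pa pb f4 f5 f6 (R' 15) (R' 16)" and fr: "\<And>r. r \<notin> {5..16} \<Longrightarrow> R' r = R r" by blast
  have g': "graph A'" "common (A' 3)" using g c A' by auto
  define Post where "Post R'' A'' \<longleftrightarrow> R'' 5 = y \<and> (\<forall>r. r \<notin> {5..16} \<longrightarrow> R'' r = R r) \<and>
      (\<exists>pa pb f4 f5 f6. A'' = A(4 := f4, 5 := f5, 6 := f6) \<and> pairs (Suc y) pa pb f4 f5 f6 (R'' 15) (R'' 16))" for R'' A''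
  let ?init = "Seq (Assign 10 (Lit 1)) (Seq (Assign 11 (Lit 0)) (Seq (Assign 12 (Reg 5)) (Assign 13 (Reg 5))))"
  have v: "aval (Sub (Add (Reg 3) (Lit 1)) (Mul (dgE 5) (dgE 5))) (st R' A') = M + 1 - dg y * dg y"
    using aval_dgE[OF g'(1), of 5 R'] y by simp
  have "run (Cond (Sub (Add (Reg 3) (Lit 1)) (Mul (dgE 5) (dgE 5)))
     (Seq ?init (Seq (Nbrs 6 5 7 (Nbrs 8 5 9 pair_step)) record_pair)) Skip) R' A' (1 + (10 * (q * dg y) + 5 * dg y + 19)) Post"
  proof (rule run_cond)
    assume "aval (Sub (Add (Reg 3) (Lit 1)) (Mul (dgE 5) (dgE 5))) (st R' A') \<noteq> 0"
    then have "dg y * dg y \<le> M" using v by simp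
    then have "dg y \<le> q" by (rule le_q)
    then have le: "dg y * dg y \<le> q * dg y" by (rule mult_le_mono1)
    define R1 where "R1 = R'(10 := 1, 11 := 0, 12 := y, 13 := y)"
    have rec: "run record_pair R2 A' 9 Post"
      if R2: "R2 5 = y" "\<forall>r. r \<notin> {5..14} \<longrightarrow> R2 r = R1 r" "pinv y (N y \<times> N y) R2" for R2
    proof (rule run_wp)
      show "lf record_pair" by (simp add: record_pair_def small_def)
      show "tm record_pair \<le> 9" by (simp add: record_pair_def)
      note pb1 = pinv_best(1)[OF y(1) R2(3)] and pb2 = pinv_best(2)[OF y(1) R2(3)]
      have r15: "R2 15 = R' 15" "R2 16 = R' 16" using R2(2) by (simp_all add: R1_def)
      have fr2: "R2 r = R r" if "r \<notin> {5..16}" for r using R2(2) fr that by (auto simp: R1_def)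
      have 12: "R2 12 < n" "R2 13 < n" using R2(3) N_less[OF y(1)] by (auto simp: pinv_def)
      show "wp record_pair Post R2 A'"
      proof (cases "simplicial y")
        case False
        have "Post R2 A'" unfolding Post_def using R2(1) fr2 r15 A' pairs_skip[OF P y(1) False] by metis
        then show ?thesis using pb1 False by (simp add: record_pair_def)
      next
        case True
        note st = pairs_step[OF P y(1) True, of "R2 12" "R2 13"]
        have b: "best_pair y (R2 12, R2 13)" "dg (R2 12) \<le> dg (R2 13)" "R2 11 = card (N (R2 12) \<union> N (R2 13))"
          using pb2[OF True] by auto
        have bound: "f5 (R2 12 * n + R2 13) \<le> n" "f6 (R2 12) \<le> 2 * n" "f6 (R2 13) \<le> 2 * n" "R' 15 \<le> n"
          using P 12 cntS_le add_le_mono[OF cntS_le cntS_le] by (auto simp: pairs_def mult_2)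
        have Bn: "2 * n + 2 \<le> B" using B_ge_M n_le_M by simp
        have le: "card (N (R2 12) \<union> N (R2 13)) \<le> n" using card_N_Un_le 12 by simp
        define f6' where "f6' = (f6(R2 12 := f6 (R2 12) + 1))(R2 13 := (f6(R2 12 := f6 (R2 12) + 1)) (R2 13) + 1)"
        have st': "pairs (Suc y) (pa(y := R2 12)) (pb(y := R2 13)) (f4(y := 1))
            (f5(R2 12 * n + R2 13 := f5 (R2 12 * n + R2 13) + 1)) f6' (R' 15 + 1)
            (if R2 11 \<noteq> n then 1 else R' 16)"
          using st[OF b(1,2)] b(3) unfolding f6'_def by simp
        have "Post (R2(15 := R' 15 + 1, 16 := (if R2 11 \<noteq> n then 1 else R' 16)))
            (A(4 := f4(y := 1), 5 := f5(R2 12 * n + R2 13 := f5 (R2 12 * n + R2 13) + 1), 6 := f6'))"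
          unfolding Post_def using st' R2(1) fr2 by fastforce
        moreover have "n - R2 11 \<noteq> 0 \<longleftrightarrow> R2 11 \<noteq> n" using le unfolding b(3)[symmetric] by linarith
        moreover have "R2(15 := R' 15 + 1, 16 := R' 16) = R2(15 := R' 15 + 1)" using r15 by (simp add: fun_eq_iff)
        moreover have "A'(4 := f4(y := 1), 5 := f5(R2 12 * n + R2 13 := f5 (R2 12 * n + R2 13) + 1), 6 := f6') =
            A(4 := f4(y := 1), 5 := f5(R2 12 * n + R2 13 := f5 (R2 12 * n + R2 13) + 1), 6 := f6')"
          by (simp add: A' fun_eq_iff)
        moreover have "A' 4 = f4" "A' 5 = f5" "A' 6 = f6" by (simp_all add: A')
        ultimately show ?thesis
          using pb1 True R2(1) r15 12 bound Bn B_ge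
          by (cases "R2 11 = n") (simp_all add: record_pair_def f6'_def del: fun_upd_apply, simp_all)
      qed
    qed
    have loop: "run (Nbrs 6 5 7 (Nbrs 8 5 9 pair_step)) R1 A' (dg y * (dg y * 10 + 5) + 2)
       (\<lambda>R2 A2. A2 = A' \<and> R2 5 = y \<and> (\<forall>r. r \<notin> {5..14} \<longrightarrow> R2 r = R1 r) \<and> pinv y (N y \<times> N y) R2)"
      by (rule run_pair_loop[OF g' y(1)]) (auto simp: R1_def y pinv_def)
    have "run (Seq ?init (Seq (Nbrs 6 5 7 (Nbrs 8 5 9 pair_step)) record_pair)) R' A'
        (4 + ((dg y * (dg y * 10 + 5) + 2) + 9)) Post"
    proof (rule run_seq, rule run_wp)
      show "wp ?init (\<lambda>R' A'. run (Seq (Nbrs 6 5 7 (Nbrs 8 5 9 pair_step)) record_pair) R' A'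
        ((dg y * (dg y * 10 + 5) + 2) + 9) Post) R' A'"
      proof -
        have "run (Seq (Nbrs 6 5 7 (Nbrs 8 5 9 pair_step)) record_pair) R1 A' ((dg y * (dg y * 10 + 5) + 2) + 9) Post"
          by (rule run_seq, rule run_mono[OF loop]) (use rec in auto)
        then show ?thesis using y n_le B_ge by (simp add: R1_def)
      qed
    qed (auto simp: small_def)
    then show "run (Seq ?init (Seq (Nbrs 6 5 7 (Nbrs 8 5 9 pair_step)) record_pair)) R' A' (10 * (q * dg y) + 5 * dg y + 19) Post"
    proof (rule run_mono)
      have "dg y * (dg y * 10 + 5) = 10 * (dg y * dg y) + 5 * dg y" by (simp add: algebra_simps)
      then show "4 + ((dg y * (dg y * 10 + 5) + 2) + 9) \<le> 10 * (q * dg y) + 5 * dg y + 19" using le by linarith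
    qed
  next
    assume "aval (Sub (Add (Reg 3) (Lit 1)) (Mul (dgE 5) (dgE 5))) (st R' A') = 0"
    then have "\<not> dg y * dg y \<le> M" using v by simp
    then have ns: "\<not> simplicial y" using clique_card_le[of "N y"] by (auto simp: simplicial_def dg_def)
    have "Post R' A'" unfolding Post_def
    proof (intro conjI allI impI exI)
      show "A' = A(4 := f4, 5 := f5, 6 := f6)" by (rule A')
      show "pairs (Suc y) pa pb f4 f5 f6 (R' 15) (R' 16)" by (rule pairs_skip[OF P y(1) ns])
    qed (use y(2) fr in auto)
    then have "run Skip R' A' 1 Post" by (rule run_skip[of Post])
    then show "run Skip R' A' (10 * (q * dg y) + 5 * dg y + 19) Post" by (rule run_mono) auto
  qed (simp add: small_def)
  then show "run (Cond (Sub (Add (Reg 3) (Lit 1)) (Mul (dgE 5) (dgE 5)))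
     (Seq ?init (Seq (Nbrs 6 5 7 (Nbrs 8 5 9 pair_step)) record_pair)) Skip) R' A' (10 * (q * dg y) + 5 * dg y + 20)
     (\<lambda>R'' A''. R'' 5 = y \<and> (\<forall>r. r \<notin> {5..16} \<longrightarrow> R'' r = R r) \<and>
      (\<exists>pa pb f4 f5 f6. A'' = A(4 := f4, 5 := f5, 6 := f6) \<and> pairs (Suc y) pa pb f4 f5 f6 (R'' 15) (R'' 16)))"
    by (rule run_mono) (auto simp: Post_def)
qed (use Q in auto)

subsection \<open>Vertices of eccentricity at most 2\<close>

text \<open>Both ends of a best pair lie in a clique and are ordered by degree, so every pair with a
  common neighbour \<open>w\<close> appears as a triple of \<open>TT\<close>. Adding the
  multiplicity of the pair to the counter of \<open>w\<close> handles all \<open>y\<close> with this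
  pair at once.\<close>

definition both_com :: com where
  "both_com = Tri (put 7 (Reg 9) (Add (arr 7 (Reg 9)) (arr 5 (idx 5 7))))"

lemma run_both:
  assumes g: "graph A" and z: "\<And>x. A 7 x = 0"
    and P: "pairs n pa pb (A 4) (A 5) (A 6) s t"
    and Q: "\<And>R' f. (\<And>r. r \<notin> {5..14} \<Longrightarrow> R' r = R r) \<Longrightarrow>
      (\<And>w. w < n \<Longrightarrow> f w = cntS n (\<lambda>y. w \<in> N (pa y) \<and> w \<in> N (pb y))) \<Longrightarrow> Q R' (A(7 := f))"
    and T: "21 * (q * M) \<le> T"
  shows "run both_com R A T Q"
  unfolding both_com_def
proof (rule run_tri[where g = 1 and J = "\<lambda>S R' A'. (\<forall>r. r \<notin> {5..14} \<longrightarrow> R' r = R r) \<and>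
    (\<exists>f. A' = A(7 := f) \<and> (\<forall>w. f w = cntS n (\<lambda>y. (pa y, pb y, w) \<in> S)))"])
  show "(\<forall>r. r \<notin> {5..14} \<longrightarrow> R r = R r) \<and> (\<exists>f. A = A(7 := f) \<and> (\<forall>w. f w = cntS n (\<lambda>y. (pa y, pb y, w) \<in> {})))"
    using z by (auto intro!: exI[of _ "A 7"] simp: cntS_def)
  fix R' A'
  assume "(\<forall>r. r \<notin> {5..14} \<longrightarrow> R' r = R r) \<and>
    (\<exists>f. A' = A(7 := f) \<and> (\<forall>w. f w = cntS n (\<lambda>y. (pa y, pb y, w) \<in> TT)))"
  then obtain f where f: "\<And>r. r \<notin> {5..14} \<Longrightarrow> R' r = R r" "A' = A(7 := f)"
    "\<And>w. f w = cntS n (\<lambda>y. (pa y, pb y, w) \<in> TT)" by blast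
  have "f w = cntS n (\<lambda>y. w \<in> N (pa y) \<and> w \<in> N (pb y))" if "w < n" for w
  proof -
    have "(pa y, pb y, w) \<in> TT \<longleftrightarrow> w \<in> N (pa y) \<and> w \<in> N (pb y)" if "simplicial y" for y
    proof -
      have b: "best_pair y (pa y, pb y)" "dg (pa y) \<le> dg (pb y)" "y < n"
        using P that simplicial_less by (auto simp: pairs_def)
      then have "pa y \<in> N y" "pb y \<in> N y" by (auto simp: best_pair_def)
      then show ?thesis using b N_less simplicial_iff[of y] that by (auto simp: TT_def)
    qed
    then show ?thesis unfolding f(3) cntS_def by (intro arg_cong[of _ _ card]) blast
  qed
  then show "Q R' A'" using Q[of R' f] f(1,2) by simp
next
  fix S a b w R' A'
  assume J: "(\<forall>r. r \<notin> {5..14} \<longrightarrow> R' r = R r) \<and>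
    (\<exists>f. A' = A(7 := f) \<and> (\<forall>w. f w = cntS n (\<lambda>y. (pa y, pb y, w) \<in> S)))"
    and t: "(a, b, w) \<in> TT" "(a, b, w) \<notin> S" "S \<subseteq> TT" and R': "R' 5 = a" "R' 7 = b" "R' 9 = w"
  from J obtain f where f: "\<And>r. r \<notin> {5..14} \<Longrightarrow> R' r = R r" "A' = A(7 := f)"
    "\<And>w. f w = cntS n (\<lambda>y. (pa y, pb y, w) \<in> S)" by blast
  have ab: "a < n" "b < n" using t(1) N_less by (auto simp: TT_def)
  have cnt: "A 5 (a * n + b) = cntS n (\<lambda>y. pa y = a \<and> pb y = b)" using P ab by (auto simp: pairs_def)
  define f' where "f' = f(w := f w + A 5 (a * n + b))"
  have f': "f' w' = cntS n (\<lambda>y. (pa y, pb y, w') \<in> insert (a, b, w) S)" for w'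
  proof (cases "w' = w")
    case True
    have "{z. z < n \<and> z < n \<and> simplicial z \<and> (pa z, pb z, w) \<in> insert (a, b, w) S} =
        {z. z < n \<and> z < n \<and> simplicial z \<and> (pa z, pb z, w) \<in> S} \<union>
        {z. z < n \<and> z < n \<and> simplicial z \<and> (pa z = a \<and> pb z = b)}" by auto
    moreover have "{z. z < n \<and> z < n \<and> simplicial z \<and> (pa z, pb z, w) \<in> S} \<inter>
        {z. z < n \<and> z < n \<and> simplicial z \<and> (pa z = a \<and> pb z = b)} = {}" using t(2) by auto
    ultimately show ?thesis using True f(3) cnt by (simp add: f'_def cntS_def card_Un_disjoint)
  next
    case False
    then show ?thesis using f(3) by (simp add: f'_def cntS_def)
  qed
  show "run (put 7 (Reg 9) (Add (arr 7 (Reg 9)) (arr 5 (idx 5 7)))) R' A' 1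
    (\<lambda>R'' A''. (\<forall>r\<in>{5, 6, 7, 8, 9}. R'' r = R' r) \<and> (\<forall>r. r \<notin> {5..14} \<longrightarrow> R'' r = R r) \<and>
    (\<exists>f. A'' = A(7 := f) \<and> (\<forall>w'. f w' = cntS n (\<lambda>y. (pa y, pb y, w') \<in> insert (a, b, w) S))))"
  proof (rule run_put)
    have "f' w \<le> n" using f'[of w] cntS_le by simp
    then show "aval (Add (arr 7 (Reg 9)) (arr 5 (idx 5 7))) (st R' A') \<le> B"
      using R' f(2) n_le by (simp add: f'_def)
    have "A'(7 := (A' 7)(aval (Reg 9) (st R' A') := aval (Add (arr 7 (Reg 9)) (arr 5 (idx 5 7))) (st R' A'))) = A(7 := f')"
      using R' f(2) by (simp add: f'_def)
    then show "(\<forall>r\<in>{5, 6, 7, 8, 9}. R' r = R' r) \<and> (\<forall>r. r \<notin> {5..14} \<longrightarrow> R' r = R r) \<and>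
      (\<exists>f. A'(7 := (A' 7)(aval (Reg 9) (st R' A') := aval (Add (arr 7 (Reg 9)) (arr 5 (idx 5 7))) (st R' A'))) = A(7 := f) \<and>
        (\<forall>w'. f w' = cntS n (\<lambda>y. (pa y, pb y, w') \<in> insert (a, b, w) S)))"
      using f(1) f' by blast
  qed (auto simp: small_def)
qed (use g T in auto)

text \<open>Register 10 sums, over \<open>N c\<close>, how often a vertex is an end of a best pair.
  The guard is the absolute difference of the two counts, written as two truncated
  subtractions.\<close>

definition central_com :: com where
  "central_com = Verts 5 (Seq (Assign 10 (Lit 0)) (Seq
     (Nbrs 6 5 7 (Assign 10 (Add (Reg 10) (arr 6 (Reg 7)))))
     (Cond (Add (Sub (Reg 10) (Add (Reg 15) (arr 7 (Reg 5)))) (Sub (Add (Reg 15) (arr 7 (Reg 5))) (Reg 10)))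
       Skip (put 8 (Reg 5) (Lit 1)))))"

lemma sum_cntS: assumes "finite S" shows "(\<Sum>a\<in>S. cntS i (\<lambda>y. h y = a)) = cntS i (\<lambda>y. h y \<in> S)"
  using assms
proof (induction S)
  case (insert a S)
  have "{z. z < i \<and> z < n \<and> simplicial z \<and> h z \<in> insert a S} =
      {z. z < i \<and> z < n \<and> simplicial z \<and> h z = a} \<union> {z. z < i \<and> z < n \<and> simplicial z \<and> h z \<in> S}" by auto
  moreover have "{z. z < i \<and> z < n \<and> simplicial z \<and> h z = a} \<inter> {z. z < i \<and> z < n \<and> simplicial z \<and> h z \<in> S} = {}"
    using insert by auto
  ultimately have "cntS i (\<lambda>y. h y \<in> insert a S) = cntS i (\<lambda>y. h y = a) + cntS i (\<lambda>y. h y \<in> S)"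
    by (simp add: cntS_def card_Un_disjoint)
  then show ?case using insert by simp
qed (simp add: cntS_def)

text \<open>By inclusion and exclusion, a vertex sees all pairs iff the two counts agree.\<close>

lemma cntS_all_iff:
  "cntS n X + cntS n Y = cntS n (\<lambda>_. True) + cntS n (\<lambda>y. X y \<and> Y y) \<longleftrightarrow> (\<forall>y. simplicial y \<longrightarrow> X y \<or> Y y)"
proof -
  define SX SY U where "SX = {z. z < n \<and> simplicial z \<and> X z}" and "SY = {z. z < n \<and> simplicial z \<and> Y z}"
    and "U = {z. z < n \<and> simplicial z}"
  have fin: "finite SX" "finite SY" "finite U" by (auto simp: SX_def SY_def U_def)
  have "{z. z < n \<and> simplicial z \<and> X z \<and> Y z} = SX \<inter> SY" by (auto simp: SX_def SY_def)
  then have c: "cntS n X = card SX" "cntS n Y = card SY" "cntS n (\<lambda>_. True) = card U" "cntS n (\<lambda>y. X y \<and> Y y) = card (SX \<inter> SY)"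
    by (simp_all add: cntS_def SX_def SY_def U_def)
  have "card SX + card SY = card (SX \<union> SY) + card (SX \<inter> SY)" using card_Un_Int fin by blast
  moreover have "card (SX \<union> SY) = card U \<longleftrightarrow> SX \<union> SY = U"
  proof -
    have "SX \<union> SY \<subseteq> U" unfolding SX_def SY_def U_def by blast
    then show ?thesis using card_subset_eq[OF fin(3)] by metis
  qed
  moreover have "SX \<union> SY = U \<longleftrightarrow> (\<forall>y. simplicial y \<longrightarrow> X y \<or> Y y)"
    unfolding SX_def SY_def U_def using simplicial_less by blast
  moreover have "x = u + i \<longleftrightarrow> v = u" if "x = v + i" for x u i v :: nat using that by simp
  ultimately show ?thesis unfolding c by metis
qed

lemma run_central:
  assumes g: "graph A" and z: "\<And>x. A 8 x = 0"
    and P: "pairs n pa pb (A 4) (A 5) (A 6) (R 15) (R 16)"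
    and s: "\<And>w. w < n \<Longrightarrow> A 7 w = cntS n (\<lambda>y. w \<in> N (pa y) \<and> w \<in> N (pb y))"
    and Q: "\<And>R' f. (\<And>r. r \<notin> {5..14} \<Longrightarrow> R' r = R r) \<Longrightarrow>
      (\<And>c. c < n \<Longrightarrow> f c \<noteq> 0 \<longleftrightarrow> ecc c \<le> 2) \<Longrightarrow> Q R' (A(8 := f))"
    and T: "20 * (q * M) \<le> T"
  shows "run central_com R A T Q"
  unfolding central_com_def
proof (rule run_verts[where g = "\<lambda>i. dg i * 4 + 5" and J = "\<lambda>i R' A'. (\<forall>r. r \<notin> {5..14} \<longrightarrow> R' r = R r) \<and>
      (\<exists>f. A' = A(8 := f) \<and> (\<forall>c. f c \<noteq> 0 \<longleftrightarrow> c < i \<and> ecc c \<le> 2))"])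
  show "(\<forall>r. r \<notin> {5..14} \<longrightarrow> R r = R r) \<and> (\<exists>f. A = A(8 := f) \<and> (\<forall>c. f c \<noteq> 0 \<longleftrightarrow> c < 0 \<and> ecc c \<le> 2))"
    using z by (auto intro!: exI[of _ "A 8"])
  have "(\<Sum>i<n. dg i * 4 + 5 + 2) = M * 4 + 7 * n"
    by (simp add: sum.distrib sum_distrib_right[symmetric] sum_dg)
  then show "(\<Sum>i<n. dg i * 4 + 5 + 2) + 2 \<le> T" using T M_le_qM n_le_M n_pos by linarith
next
  fix c R' A'
  assume c: "c < n" "R' 5 = c" and J: "(\<forall>r. r \<notin> {5..14} \<longrightarrow> R' r = R r) \<and>
      (\<exists>f. A' = A(8 := f) \<and> (\<forall>c'. f c' \<noteq> 0 \<longleftrightarrow> c' < c \<and> ecc c' \<le> 2))"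
  then obtain f where f: "A' = A(8 := f)" "\<And>c'. f c' \<noteq> 0 \<longleftrightarrow> c' < c \<and> ecc c' \<le> 2" by blast
  have fr: "R' r = R r" if "r \<notin> {5..14}" for r using J that by blast
  have W: "A 6 a = cntS n (\<lambda>y. pa y = a) + cntS n (\<lambda>y. pb y = a)" if "a < n" for a
    using P that by (auto simp: pairs_def)
  define H where "H S = cntS n (\<lambda>y. pa y \<in> S) + cntS n (\<lambda>y. pb y \<in> S)" for S
  have H: "H (insert a S) = H S + A 6 a" if "a \<notin> S" "finite S" "a < n" for a S
    using sum_cntS[of "insert a S" n pa] sum_cntS[of "insert a S" n pb] sum_cntS[of S n pa] sum_cntS[of S n pb] that W
    by (simp add: H_def)
  have HB: "H S \<le> B" for S
    using add_le_mono[OF cntS_le cntS_le, of n "\<lambda>y. pa y \<in> S" n "\<lambda>y. pb y \<in> S"] B_ge_M n_le_M by (simp add: H_def)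
  define Post where "Post R'' A'' \<longleftrightarrow> R'' 5 = c \<and> (\<forall>r. r \<notin> {5..14} \<longrightarrow> R'' r = R r) \<and>
      (\<exists>f. A'' = A(8 := f) \<and> (\<forall>c'. f c' \<noteq> 0 \<longleftrightarrow> c' < Suc c \<and> ecc c' \<le> 2))" for R'' A''
  let ?loop = "Nbrs 6 5 7 (Assign 10 (Add (Reg 10) (arr 6 (Reg 7))))"
  let ?fin = "Cond (Add (Sub (Reg 10) (Add (Reg 15) (arr 7 (Reg 5)))) (Sub (Add (Reg 15) (arr 7 (Reg 5))) (Reg 10)))
       Skip (put 8 (Reg 5) (Lit 1))"
  have "run (Seq (Assign 10 (Lit 0)) (Seq ?loop ?fin)) R' A' (1 + ((dg c * 4 + 2) + 2)) Post"
  proof (rule run_seq, rule run_assign)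
    show "run (Seq ?loop ?fin) (R'(10 := aval (Lit 0) (st R' A'))) A' ((dg c * 4 + 2) + 2) Post"
    proof (rule run_seq, rule run_nbrs_const[where x = c and g = 1 and J = "\<lambda>S R'' A''. A'' = A' \<and> R'' 5 = c \<and>
        (\<forall>r. r \<notin> {5..14} \<longrightarrow> R'' r = R r) \<and> R'' 10 = H S"])
      fix S a R'' A''
      assume J2: "A'' = A' \<and> R'' 5 = c \<and> (\<forall>r. r \<notin> {5..14} \<longrightarrow> R'' r = R r) \<and> R'' 10 = H S"
        and a: "a \<in> N c" "a < n" "S \<subseteq> N c" "a \<notin> S" "R'' 7 = a"
      have "H (insert a S) = H S + A 6 a" using H a finite_subset[OF a(3) finite_N] by blast
      then show "run (Assign 10 (Add (Reg 10) (arr 6 (Reg 7)))) R'' A'' 1 (\<lambda>R3 A3. R3 6 = R'' 6 \<and> A3 = A' \<and> R3 5 = c \<and>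
          (\<forall>r. r \<notin> {5..14} \<longrightarrow> R3 r = R r) \<and> R3 10 = H (insert a S))"
        using HB[of "insert a S"] J2 a(5) f(1) by (intro run_assign) (auto simp: small_def)
    next
      fix R'' A''
      assume J2: "A'' = A' \<and> R'' 5 = c \<and> (\<forall>r. r \<notin> {5..14} \<longrightarrow> R'' r = R r) \<and> R'' 10 = H (N c)"
      have bp: "best_pair y (pa y, pb y)" if "simplicial y" for y
        using P that simplicial_less by (auto simp: pairs_def)
      have "c \<in> N u \<longleftrightarrow> u \<in> N c" for u using N_sym by blast
      then have e7: "A 7 c = cntS n (\<lambda>y. pa y \<in> N c \<and> pb y \<in> N c)" using s[OF c(1)] by simp
      have s15: "R 15 = cntS n (\<lambda>_. True)" using P by (simp add: pairs_def)
      have "H (N c) = R 15 + A 7 c \<longleftrightarrow> (\<forall>y. simplicial y \<longrightarrow> pa y \<in> N c \<or> pb y \<in> N c)"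
        unfolding H_def s15 e7 by (rule cntS_all_iff)
      also have "\<dots> \<longleftrightarrow> (\<forall>y. simplicial y \<longrightarrow> c \<in> N (pa y) \<union> N (pb y))" using N_sym by blast
      also have "\<dots> \<longleftrightarrow> ecc c \<le> 2" using ecc_le_2_iff[of pa pb c] bp c(1) by simp
      finally have iff: "H (N c) = R 15 + A 7 c \<longleftrightarrow> ecc c \<le> 2" .
      show "run ?fin R'' A'' 2 Post"
      proof (rule run_wp)
        show "wp ?fin Post R'' A''"
        proof (cases "ecc c \<le> 2")
          case True
          have "Post R'' (A'(8 := (A' 8)(c := 1)))" unfolding Post_def using J2 f True
            by (auto intro!: exI[of _ "f(c := 1)"] simp: less_Suc_eq split: if_splits)
          then show ?thesis using True iff J2 f(1) B_ge by simp
        next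
          case False
          then have "Post R'' A''" unfolding Post_def using J2 f by (auto intro!: exI[of _ f] simp: less_Suc_eq)
          moreover have "H (N c) - (R 15 + A 7 c) + (R 15 + A 7 c - H (N c)) \<noteq> 0" using False iff by linarith
          ultimately show ?thesis using J2 f(1) by simp
        qed
      qed (auto simp: small_def)
    qed (use c g f(1) fr in \<open>auto simp: H_def cntS_def\<close>)
  qed (auto simp: small_def)
  then show "run (Seq (Assign 10 (Lit 0)) (Seq ?loop ?fin)) R' A' (dg c * 4 + 5)
     (\<lambda>R'' A''. R'' 5 = c \<and> (\<forall>r. r \<notin> {5..14} \<longrightarrow> R'' r = R r) \<and>
      (\<exists>f. A'' = A(8 := f) \<and> (\<forall>c'. f c' \<noteq> 0 \<longleftrightarrow> c' < Suc c \<and> ecc c' \<le> 2)))"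
    by (rule run_mono) (auto simp: Post_def)
qed (use Q in auto)

section \<open>The test for diameter at most 3\<close>

definition diam3_com :: com where
  "diam3_com = Verts 5 (Cond (arr 4 (Reg 5)) (Seq (Assign 10 (Lit 0))
     (Seq (Nbrs 6 5 7 (Cond (arr 8 (Reg 7)) (Assign 10 (Lit 1)) Skip)) (Cond (Reg 10) Skip (Assign 17 (Lit 1))))) Skip)"

lemma run_diam3:
  assumes g: "graph A" and z: "R 17 = 0"
    and s: "\<And>y. y < n \<Longrightarrow> A 4 y \<noteq> 0 \<longleftrightarrow> simplicial y" and c8: "\<And>c. c < n \<Longrightarrow> A 8 c \<noteq> 0 \<longleftrightarrow> ecc c \<le> 2"
    and Q: "\<And>R'. (\<And>r. r \<notin> {5..14} \<union> {17} \<Longrightarrow> R' r = R r) \<Longrightarrow> R' 17 \<noteq> 0 \<longleftrightarrow> \<not> diam \<le> 3 \<Longrightarrow> Q R' A"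
    and T: "20 * (q * M) \<le> T"
  shows "run diam3_com R A T Q"
  unfolding diam3_com_def
proof (rule run_verts[where g = "\<lambda>i. dg i * 5 + 6" and J = "\<lambda>i R' A'. A' = A \<and> (\<forall>r. r \<notin> {5..14} \<union> {17} \<longrightarrow> R' r = R r) \<and>
      (R' 17 \<noteq> 0 \<longleftrightarrow> (\<exists>y<i. simplicial y \<and> \<not> (\<exists>c\<in>N y. ecc c \<le> 2)))"])
  have "(\<Sum>i<n. dg i * 5 + 6 + 2) = M * 5 + 8 * n"
    by (simp add: sum.distrib sum_distrib_right[symmetric] sum_dg)
  then show "(\<Sum>i<n. dg i * 5 + 6 + 2) + 2 \<le> T" using T M_le_qM n_le_M n_pos by linarith
  show "Q R' A'" if "A' = A \<and> (\<forall>r. r \<notin> {5..14} \<union> {17} \<longrightarrow> R' r = R r) \<and>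
      (R' 17 \<noteq> 0 \<longleftrightarrow> (\<exists>y<n. simplicial y \<and> \<not> (\<exists>c\<in>N y. ecc c \<le> 2)))" for R' A'
  proof -
    have "R' 17 \<noteq> 0 \<longleftrightarrow> \<not> diam \<le> 3" using that diam_le_3_iff simplicial_less by blast
    then show ?thesis using Q[of R'] that by blast
  qed
  fix y R' A'
  assume y: "y < n" "R' 5 = y" and J: "A' = A \<and> (\<forall>r. r \<notin> {5..14} \<union> {17} \<longrightarrow> R' r = R r) \<and>
      (R' 17 \<noteq> 0 \<longleftrightarrow> (\<exists>y'<y. simplicial y' \<and> \<not> (\<exists>c\<in>N y'. ecc c \<le> 2)))"
  define Post where "Post R'' A'' \<longleftrightarrow> R'' 5 = y \<and> A'' = A \<and> (\<forall>r. r \<notin> {5..14} \<union> {17} \<longrightarrow> R'' r = R r) \<and>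
      (R'' 17 \<noteq> 0 \<longleftrightarrow> (\<exists>y'<Suc y. simplicial y' \<and> \<not> (\<exists>c\<in>N y'. ecc c \<le> 2)))" for R'' A''
  let ?loop = "Nbrs 6 5 7 (Cond (arr 8 (Reg 7)) (Assign 10 (Lit 1)) Skip)"
  let ?fin = "Cond (Reg 10) Skip (Assign 17 (Lit 1))"
  have "run (Cond (arr 4 (Reg 5)) (Seq (Assign 10 (Lit 0)) (Seq ?loop ?fin)) Skip) R' A' (1 + (1 + ((dg y * 5 + 2) + 2))) Post"
  proof (rule run_cond)
    assume "aval (arr 4 (Reg 5)) (st R' A') \<noteq> 0"
    then have sy: "simplicial y" using s y J by simp
    show "run (Seq (Assign 10 (Lit 0)) (Seq ?loop ?fin)) R' A' (1 + ((dg y * 5 + 2) + 2)) Post"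
    proof (rule run_seq, rule run_assign)
      show "run (Seq ?loop ?fin) (R'(10 := aval (Lit 0) (st R' A'))) A' ((dg y * 5 + 2) + 2) Post"
    proof (rule run_seq, rule run_nbrs_const[where x = y and g = 2 and
        J = "\<lambda>S R'' A''. A'' = A \<and> R'' 5 = y \<and> (\<forall>r. r \<notin> {5..14} \<longrightarrow> R'' r = R' r) \<and>
          (R'' 10 \<noteq> 0 \<longleftrightarrow> (\<exists>c\<in>S. ecc c \<le> 2))"])
      fix S a R'' A''
      assume J2: "A'' = A \<and> R'' 5 = y \<and> (\<forall>r. r \<notin> {5..14} \<longrightarrow> R'' r = R' r) \<and> (R'' 10 \<noteq> 0 \<longleftrightarrow> (\<exists>c\<in>S. ecc c \<le> 2))"
        and a: "a \<in> N y" "a < n" "S \<subseteq> N y" "a \<notin> S" "R'' 7 = a"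
      show "run (Cond (arr 8 (Reg 7)) (Assign 10 (Lit 1)) Skip) R'' A'' 2 (\<lambda>R3 A3. R3 6 = R'' 6 \<and> A3 = A \<and> R3 5 = y \<and>
          (\<forall>r. r \<notin> {5..14} \<longrightarrow> R3 r = R' r) \<and> (R3 10 \<noteq> 0 \<longleftrightarrow> (\<exists>c\<in>insert a S. ecc c \<le> 2)))"
        by (rule run_wp) (use J2 a c8[OF a(2)] B_ge in \<open>auto simp: small_def\<close>)
    next
      fix R'' A''
      assume J2: "A'' = A \<and> R'' 5 = y \<and> (\<forall>r. r \<notin> {5..14} \<longrightarrow> R'' r = R' r) \<and> (R'' 10 \<noteq> 0 \<longleftrightarrow> (\<exists>c\<in>N y. ecc c \<le> 2))"
      show "run ?fin R'' A'' 2 Post"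
        by (rule run_wp) (use J2 J sy B_ge in \<open>auto simp: small_def Post_def less_Suc_eq\<close>)
    qed (use y g J in auto)
    qed (auto simp: small_def)
  next
    assume "aval (arr 4 (Reg 5)) (st R' A') = 0"
    then have sy: "\<not> simplicial y" using s[of y] y J by simp
    have "Post R' A'" unfolding Post_def using J y sy by (auto simp: less_Suc_eq)
    then have "run Skip R' A' 1 Post" by (rule run_skip[of Post])
    then show "run Skip R' A' (1 + ((dg y * 5 + 2) + 2)) Post" by (rule run_mono) auto
  qed (simp add: small_def)
  then show "run (Cond (arr 4 (Reg 5)) (Seq (Assign 10 (Lit 0)) (Seq ?loop ?fin)) Skip) R' A' (dg y * 5 + 6)
     (\<lambda>R'' A''. R'' 5 = y \<and> A'' = A \<and> (\<forall>r. r \<notin> {5..14} \<union> {17} \<longrightarrow> R'' r = R r) \<and>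
      (R'' 17 \<noteq> 0 \<longleftrightarrow> (\<exists>y'<Suc y. simplicial y' \<and> \<not> (\<exists>c\<in>N y'. ecc c \<le> 2))))"
    by (rule run_mono) (auto simp: Post_def)
qed (use z in auto)

section \<open>Breadth-first search\<close>

text \<open>The search starts at register 20 and enters only vertices whose key (array 11) is at least
  the threshold in register 21. Array 9 receives the distances plus 1, with 0 for unreached vertices.\<close>

definition visit_com :: com where
  "visit_com = Cond (arr 9 (Reg 27)) Skip (Cond (Sub (Add (arr 11 (Reg 27)) (Lit 1)) (Reg 21))
     (Seq (put 9 (Reg 27) (Add (arr 9 (Reg 25)) (Lit 1)))
       (Seq (put 10 (Reg 24) (Reg 27)) (Assign 24 (Add (Reg 24) (Lit 1))))) Skip)"

definition bfs_com :: com where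
  "bfs_com = Seq (Verts 22 (put 9 (Reg 22) (Lit 0)))
     (Seq (Seq (put 9 (Reg 20) (Lit 1)) (Seq (put 10 (Lit 0) (Reg 20)) (Seq (Assign 23 (Lit 0)) (Assign 24 (Lit 1)))))
       (While (Sub (Reg 24) (Reg 23))
         (Seq (Seq (Assign 25 (arr 10 (Reg 23))) (Assign 23 (Add (Reg 23) (Lit 1)))) (Nbrs 26 25 27 visit_com))))"

text \<open>The outcome of the search without its queue: closure under edges bounds \<open>D\<close>
  from above, the existence of predecessors bounds it from below. The same description serves
  distances and components; the start need not be allowed by \<open>al\<close>.\<close>

definition bfs_tree :: "(nat \<Rightarrow> bool) \<Rightarrow> nat \<Rightarrow> (nat \<Rightarrow> nat) \<Rightarrow> bool" where
  "bfs_tree al src D \<longleftrightarrow> D src = 1 \<and>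
     (\<forall>w<n. D w \<noteq> 0 \<longrightarrow> (\<forall>x\<in>N w. al x \<longrightarrow> D x \<noteq> 0 \<and> D x \<le> D w + 1)) \<and>
     (\<forall>w<n. D w \<noteq> 0 \<longrightarrow> w = src \<or> (\<exists>u<n. D u \<noteq> 0 \<and> w \<in> N u \<and> al w \<and> D w = D u + 1))"

lemma bfs_tree_dist:
  assumes T: "bfs_tree al src D" and al: "\<And>w. w < n \<Longrightarrow> al w" and s: "src < n" and w: "w < n"
  shows "D w = d src w + 1"
proof (rule antisym)
  have up: "D w \<noteq> 0 \<and> D w \<le> d src w + 1" if "w < n" for w
    using that
  proof (induction "d src w" arbitrary: w)
    case 0
    then show ?case using d_0[of src w] s T by (simp add: bfs_tree_def)
  next
    case (Suc k)
    then have "src \<noteq> w" by auto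
    then obtain u where u: "E u w" "d src u + 1 = d src w" using d_prev[of src w] s Suc.prems by auto
    have "u < n" using EV[OF u(1)] by simp
    then have "D u \<noteq> 0 \<and> D u \<le> d src u + 1" using Suc.hyps(1)[of u] Suc.hyps(2) u(2) by simp
    moreover have "w \<in> N u" using u by (simp add: N_def)
    ultimately show ?case using T al[OF Suc.prems] u \<open>u < n\<close> unfolding bfs_tree_def by fastforce
  qed
  then show "D w \<le> d src w + 1" using w by blast
  have low: "d src w + 1 \<le> D w" if "w < n" "D w \<noteq> 0" for w
    using that
  proof (induction "D w" arbitrary: w rule: less_induct)
    case less
    from T less.prems consider "w = src" | u where "u < n" "D u \<noteq> 0" "w \<in> N u" "D w = D u + 1"
      unfolding bfs_tree_def by blast
    then show ?case
    proof cases
      case 1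
      then show ?thesis using T by (simp add: bfs_tree_def)
    next
      case 2
      have "d src u + 1 \<le> D u" using less.hyps[of u] 2 by simp
      moreover have "d src w \<le> d src u + 1"
        using 2(3) d_step[of u w src] s by (auto simp: N_def)
      ultimately show ?thesis using 2 by simp
    qed
  qed
  then show "d src w + 1 \<le> D w" using up[OF w] w by blast
qed

lemma bfs_tree_reach:
  assumes T: "bfs_tree al src D" and X: "X \<subseteq> {..<n}" "\<And>w. w < n \<Longrightarrow> al w \<longleftrightarrow> w \<in> X"
    and s: "src < n" "src \<in> X \<or> X = {}" and w: "w < n"
  shows "D w \<noteq> 0 \<longleftrightarrow> reach X src w"
proof
  show "reach X src w" if "D w \<noteq> 0"
    using w that
  proof (induction "D w" arbitrary: w rule: less_induct)
    case less
    from T less.prems consider "w = src" | u where "u < n" "D u \<noteq> 0" "w \<in> N u" "al w" "D w = D u + 1"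
      unfolding bfs_tree_def by blast
    then show ?case
    proof cases
      case 2
      have r: "reach X src u" using less.hyps[of u] 2 by simp
      have wX: "w \<in> X" using X(2)[OF less.prems(1)] 2(4) by blast
      then have "u \<in> X" using reach_in[OF r] s by blast
      then have "reach X u w" using reach_edge[of u w X] wX 2(3) by (auto simp: N_def)
      then show ?thesis using reach_trans[OF r] by blast
    qed simp
  qed
  assume "reach X src w"
  then have "w < n \<longrightarrow> D w \<noteq> 0" unfolding reach_def
  proof (induction rule: rtranclp_induct)
    case base
    then show ?case using T by (simp add: bfs_tree_def)
  next
    case (step y z)
    have "y < n" "al z" using step(2) X by auto
    moreover have "z \<in> N y" using step(2) by (simp add: N_def)
    ultimately show ?case using step T unfolding bfs_tree_def by blast
  qed
  then show "D w \<noteq> 0" using w by blast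
qed

text \<open>\<open>Qu\<close> lists the reached vertices without repetition and by nondecreasing
  distance. The bound \<open>Suc i\<close> on the entry at position \<open>i\<close> keeps distances
  within the word bound while the search is running.\<close>

definition bbase :: "(nat \<Rightarrow> bool) \<Rightarrow> nat \<Rightarrow> (nat \<Rightarrow> nat) \<Rightarrow> (nat \<Rightarrow> nat) \<Rightarrow> nat \<Rightarrow> bool" where
  "bbase al src D Qu t \<longleftrightarrow> 0 < t \<and> t \<le> n \<and> Qu 0 = src \<and> D src = 1 \<and> inj_on Qu {..<t} \<and>
     Qu ` {..<t} = {w. w < n \<and> D w \<noteq> 0} \<and>
     (\<forall>i<t. D (Qu i) \<le> Suc i) \<and> (\<forall>i j. i \<le> j \<longrightarrow> j < t \<longrightarrow> D (Qu i) \<le> D (Qu j)) \<and>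
     (\<forall>i<t. i \<noteq> 0 \<longrightarrow> (\<exists>j<t. Qu i \<in> N (Qu j) \<and> al (Qu i) \<and> D (Qu i) = D (Qu j) + 1))"

definition bclosed :: "(nat \<Rightarrow> bool) \<Rightarrow> (nat \<Rightarrow> nat) \<Rightarrow> nat \<Rightarrow> nat set \<Rightarrow> bool" where
  "bclosed al D u S \<longleftrightarrow> (\<forall>w\<in>S. al w \<longrightarrow> D w \<noteq> 0 \<and> D w \<le> D u + 1)"

text \<open>The state during the expansion of queue position \<open>p\<close>, with the neighbours
  in \<open>S\<close> inspected: the queue spans at most two consecutive layers.
  \<open>bouter\<close> describes the moments between expansions.\<close>

definition binv :: "(nat \<Rightarrow> bool) \<Rightarrow> nat \<Rightarrow> nat \<Rightarrow> nat set \<Rightarrow> (nat \<Rightarrow> nat) \<Rightarrow> (nat \<Rightarrow> nat) \<Rightarrow> nat \<Rightarrow> bool" where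
  "binv al src p S D Qu t \<longleftrightarrow> bbase al src D Qu t \<and> p < t \<and> (\<forall>i<t. D (Qu i) \<le> D (Qu p) + 1) \<and>
     (\<forall>j<p. bclosed al D (Qu j) (N (Qu j))) \<and> bclosed al D (Qu p) S"

lemma bbase_init: "src < n \<Longrightarrow> (\<And>w. w < n \<Longrightarrow> D w = (if w = src then 1 else 0)) \<Longrightarrow> Qu 0 = src \<Longrightarrow>
    binv al src 0 {} D Qu 1"
  by (auto simp: binv_def bbase_def bclosed_def lessThan_Suc split: if_splits)

lemma binv_skip:
  assumes b: "binv al src p S D Qu t" and w: "w < n" and s: "D w \<noteq> 0 \<or> \<not> al w"
  shows "binv al src p (insert w S) D Qu t"
proof -
  have "D w \<le> D (Qu p) + 1" if "D w \<noteq> 0"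
  proof -
    have "w \<in> Qu ` {..<t}" using b w that unfolding binv_def bbase_def by blast
    then show ?thesis using b unfolding binv_def by blast
  qed
  then have "bclosed al D (Qu p) (insert w S)" using b s unfolding binv_def bclosed_def by blast
  then show ?thesis using b unfolding binv_def by blast
qed

lemma binv_add:
  assumes b: "binv al src p S D Qu t" and w: "w < n" "w \<in> N (Qu p)" "D w = 0" "al w"
  shows "t < n" "D (Qu p) \<le> n" "binv al src p (insert w S) (D(w := D (Qu p) + 1)) (Qu(t := w)) (Suc t)"
proof -
  have bb: "0 < t" "t \<le> n" "Qu 0 = src" "D src = 1" "inj_on Qu {..<t}"
    "Qu ` {..<t} = {w. w < n \<and> D w \<noteq> 0}" "\<And>i. i < t \<Longrightarrow> D (Qu i) \<le> Suc i"
    "\<And>i j. i \<le> j \<Longrightarrow> j < t \<Longrightarrow> D (Qu i) \<le> D (Qu j)"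
    "\<And>i. i < t \<Longrightarrow> i \<noteq> 0 \<Longrightarrow> \<exists>j<t. Qu i \<in> N (Qu j) \<and> al (Qu i) \<and> D (Qu i) = D (Qu j) + 1"
    and p: "p < t" "\<And>i. i < t \<Longrightarrow> D (Qu i) \<le> D (Qu p) + 1"
    and cl: "\<And>j. j < p \<Longrightarrow> bclosed al D (Qu j) (N (Qu j))" "bclosed al D (Qu p) S"
    using b by (auto simp: binv_def bbase_def)
  have new: "Qu i \<noteq> w" if "i < t" for i using bb(6) w(3) that by blast
  have "card (insert w (Qu ` {..<t})) \<le> card {..<n}"
    using bb(6) w(1) by (intro card_mono) auto
  moreover have "card (insert w (Qu ` {..<t})) = Suc t" using new bb(5) by (subst card_insert_disjoint) (auto simp: card_image)
  ultimately show tn: "t < n" by simp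
  show "D (Qu p) \<le> n" using bb(7)[OF p(1)] p(1) tn by simp
  define D' Qu' where "D' = D(w := D (Qu p) + 1)" and "Qu' = Qu(t := w)"
  have Q: "Qu' i = (if i = t then w else Qu i)" for i by (simp add: Qu'_def)
  have DQ: "D' (Qu' i) = (if i = t then D (Qu p) + 1 else D (Qu i))" if "i < Suc t" for i
    using that new by (auto simp: D'_def Qu'_def)
  have "bbase al src D' Qu' (Suc t)"
    unfolding bbase_def
  proof (intro conjI)
    show "Suc t \<le> n" using tn by simp
    show "D' src = 1" using bb(4) w(3) by (auto simp: D'_def)
    show "Qu' 0 = src" using bb(1,3) by (simp add: Qu'_def)
    show "inj_on Qu' {..<Suc t}" 
    proof -
      have "w \<notin> Qu ` {..<t}" using new by auto
      then show ?thesis using inj_on_fun_updI[OF bb(5), of w t] by (auto simp: Qu'_def lessThan_Suc)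
    qed
    have "Qu' ` {..<Suc t} = insert w (Qu ` {..<t})" by (auto simp: Q lessThan_Suc)
    then show "Qu' ` {..<Suc t} = {w. w < n \<and> D' w \<noteq> 0}" using bb(6) w(1) by (auto simp: D'_def)
    show "\<forall>i<Suc t. D' (Qu' i) \<le> Suc i" 
    proof -
      have "D (Qu p) \<le> t" using bb(7)[OF p(1)] p(1) by linarith
      then show ?thesis using DQ bb(7) by (auto simp: less_Suc_eq)
    qed
    show "\<forall>i j. i \<le> j \<longrightarrow> j < Suc t \<longrightarrow> D' (Qu' i) \<le> D' (Qu' j)"
    proof (intro allI impI)
      fix i j assume ij: "i \<le> j" "j < Suc t"
      then show "D' (Qu' i) \<le> D' (Qu' j)"
        using DQ[of i] DQ[of j] bb(8)[of i j] p(2)[of i] by (cases "i = t"; cases "j = t") auto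
    qed
    show "\<forall>i<Suc t. i \<noteq> 0 \<longrightarrow> (\<exists>j<Suc t. Qu' i \<in> N (Qu' j) \<and> al (Qu' i) \<and> D' (Qu' i) = D' (Qu' j) + 1)"
    proof (intro allI impI)
      fix i assume i: "i < Suc t" "i \<noteq> 0"
      show "\<exists>j<Suc t. Qu' i \<in> N (Qu' j) \<and> al (Qu' i) \<and> D' (Qu' i) = D' (Qu' j) + 1"
      proof (cases "i = t")
        case True
        then show ?thesis using w p(1) DQ[of p] DQ[of t] by (intro exI[of _ p]) (auto simp: Q)
      next
        case False
        then obtain j where j: "j < t" "Qu i \<in> N (Qu j) \<and> al (Qu i) \<and> D (Qu i) = D (Qu j) + 1"
          using bb(9)[of i] i by auto
        then show ?thesis using False DQ[of i] DQ[of j] i by (intro exI[of _ j]) (auto simp: Q)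
      qed
    qed
  qed simp
  moreover have "\<forall>i<Suc t. D' (Qu' i) \<le> D' (Qu' p) + 1"
  proof (intro allI impI)
    fix i assume "i < Suc t"
    then show "D' (Qu' i) \<le> D' (Qu' p) + 1" using DQ[of i] DQ[of p] p(1) p(2)[of i] by (cases "i = t") auto
  qed
  moreover have keep: "bclosed al D' (Qu' j) X" if "bclosed al D (Qu j) X" "j < t" for j X
    using that DQ[of j] new[of j] w(3) by (auto simp: bclosed_def D'_def Q)
  have "\<forall>j<p. bclosed al D' (Qu' j) (N (Qu' j))"
    using keep cl(1) p(1) by (auto simp: Q)
  moreover have "bclosed al D' (Qu' p) (insert w S)"
    using keep[OF cl(2) p(1)] DQ[of p] p(1) by (auto simp: bclosed_def D'_def)
  ultimately show "binv al src p (insert w S) (D(w := D (Qu p) + 1)) (Qu(t := w)) (Suc t)"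
    using p(1) unfolding binv_def D'_def[symmetric] Qu'_def[symmetric] by auto
qed

definition bouter :: "(nat \<Rightarrow> bool) \<Rightarrow> nat \<Rightarrow> nat \<Rightarrow> (nat \<Rightarrow> nat) \<Rightarrow> (nat \<Rightarrow> nat) \<Rightarrow> nat \<Rightarrow> bool" where
  "bouter al src h D Qu t \<longleftrightarrow> bbase al src D Qu t \<and> h \<le> t \<and>
     (\<forall>j<h. bclosed al D (Qu j) (N (Qu j))) \<and> (h < t \<longrightarrow> (\<forall>i<t. D (Qu i) \<le> D (Qu h) + 1))"

lemma bouter_binv: "bouter al src h D Qu t \<Longrightarrow> h < t \<Longrightarrow> binv al src h {} D Qu t"
  by (auto simp: bouter_def binv_def bclosed_def)

lemma binv_bouter: "binv al src p (N (Qu p)) D Qu t \<Longrightarrow> bouter al src (Suc p) D Qu t"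
proof -
  assume b: "binv al src p (N (Qu p)) D Qu t"
  have "D (Qu i) \<le> D (Qu (Suc p)) + 1" if "Suc p < t" "i < t" for i
  proof -
    have "D (Qu p) \<le> D (Qu (Suc p))" using b that by (auto simp: binv_def bbase_def)
    moreover have "D (Qu i) \<le> D (Qu p) + 1" using b that by (auto simp: binv_def)
    ultimately show ?thesis by simp
  qed
  then show ?thesis using b by (auto simp: bouter_def binv_def less_Suc_eq)
qed

lemma bouter_tree: "bouter al src t D Qu t \<Longrightarrow> bfs_tree al src D"
proof -
  assume b: "bouter al src t D Qu t"
  then have bb: "bbase al src D Qu t" by (simp add: bouter_def)
  have e: "\<exists>i<t. Qu i = w" if "w < n" "D w \<noteq> 0" for w
  proof -
    have "w \<in> Qu ` {..<t}" using bb that by (simp add: bbase_def)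
    then show ?thesis by auto
  qed
  have Qn: "Qu i < n" "D (Qu i) \<noteq> 0" if "i < t" for i
  proof -
    have "Qu i \<in> Qu ` {..<t}" using that by auto
    then show "Qu i < n" "D (Qu i) \<noteq> 0" using bb by (auto simp: bbase_def)
  qed
  show ?thesis unfolding bfs_tree_def
  proof (intro conjI allI impI)
    show "D src = 1" using bb by (simp add: bbase_def)
    fix w assume w: "w < n" "D w \<noteq> 0"
    then obtain i where i: "i < t" "Qu i = w" using e by blast
    have "bclosed al D (Qu i) (N (Qu i))" using b i(1) unfolding bouter_def by blast
    then show "\<forall>x\<in>N w. al x \<longrightarrow> D x \<noteq> 0 \<and> D x \<le> D w + 1" using i(2) by (simp add: bclosed_def)
    show "w = src \<or> (\<exists>u<n. D u \<noteq> 0 \<and> w \<in> N u \<and> al w \<and> D w = D u + 1)"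
    proof (cases "i = 0")
      case True
      then show ?thesis using i bb by (simp add: bbase_def)
    next
      case False
      then obtain j where "j < t" "Qu i \<in> N (Qu j) \<and> al (Qu i) \<and> D (Qu i) = D (Qu j) + 1"
        using bb i unfolding bbase_def by blast
      then show ?thesis using Qn i(2) by blast
    qed
  qed
qed

lemma run_bfs:
  assumes g: "graph A" and s: "R 20 < n"
    and Q: "\<And>R' D Qu. (\<And>r. r \<notin> {22..27} \<Longrightarrow> R' r = R r) \<Longrightarrow>
      bfs_tree (\<lambda>w. R 21 \<le> A 11 w) (R 20) D \<Longrightarrow> Q R' (A(9 := D, 10 := Qu))"
    and T: "30 * M \<le> T"
  shows "run bfs_com R A T Q"
proof -
  define al src where "al = (\<lambda>w. R 21 \<le> A 11 w)" and "src = R 20"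
  define fr where "fr R' \<longleftrightarrow> (\<forall>r. r \<notin> {22..27} \<longrightarrow> R' r = R r)" for R' :: regs
  \<comment> \<open>The potential is spread over the vertices not yet taken from the queue; each is
    taken at most once and pays for the scan of its neighbours.\<close>
  define pot where "pot R' A' = (\<Sum>x\<in>{..<n} - A' 10 ` {..<R' 23}. dg x * 9 + 5)" for R' :: regs and A' :: arrays
  define Inv where "Inv R' A' \<longleftrightarrow> fr R' \<and> (\<exists>D Qu. A' = A(9 := D, 10 := Qu) \<and> bouter al src (R' 23) D Qu (R' 24))" for R' A'
  have visit: "run visit_com R1 A1 5 (\<lambda>R2 A2. R2 26 = R1 26 \<and> R2 23 = R1 23 \<and> R2 25 = R1 25 \<and> fr R2 \<and>
      (\<exists>D Qu. A2 = A(9 := D, 10 := Qu) \<and> Qu p = R1 25 \<and> (\<forall>i\<le>p. Qu i = Qu0 i) \<and> binv al src p (insert w S) D Qu (R2 24)))"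
    if J: "fr R1" "A1 = A(9 := D, 10 := Qu)" "Qu p = R1 25" "\<forall>i\<le>p. Qu i = Qu0 i" "binv al src p S D Qu (R1 24)"
      and w: "w \<in> N (R1 25)" "w < n" "R1 27 = w" for R1 A1 D Qu Qu0 p S w
  proof (rule run_wp)
    show "lf visit_com" "tm visit_com \<le> 5" by (simp_all add: visit_com_def small_def)
    have r21: "R1 21 = R 21" using J(1) by (simp add: fr_def)
    have A1: "A1 9 = D" "A1 10 = Qu" "A1 11 = A 11" using J(2) by simp_all
    have fr': "fr (R1(24 := x))" for x using J(1) by (simp add: fr_def)
    let ?P = "\<lambda>R2 A2. R2 26 = R1 26 \<and> R2 23 = R1 23 \<and> R2 25 = R1 25 \<and> fr R2 \<and>
      (\<exists>D Qu. A2 = A(9 := D, 10 := Qu) \<and> Qu p = R1 25 \<and> (\<forall>i\<le>p. Qu i = Qu0 i) \<and> binv al src p (insert w S) D Qu (R2 24))"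
    show "wp visit_com ?P R1 A1"
    proof (cases "D w \<noteq> 0 \<or> \<not> al w")
      case True
      have "?P R1 A1" using J binv_skip[OF J(5) w(2) True] by blast
      moreover have "D w = 0 \<Longrightarrow> A 11 w + 1 - R 21 = 0" using True by (auto simp: al_def)
      ultimately show ?thesis using A1 w(3) r21 by (auto simp: visit_com_def)
    next
      case False
      then have f: "D w = 0" "al w" by auto
      have wN: "w \<in> N (Qu p)" using w(1) J(3) by simp
      note add = binv_add[OF J(5) w(2) wN f]
      have pt: "p < R1 24" using J(5) by (simp add: binv_def)
      have "?P (R1(24 := Suc (R1 24))) (A1(9 := D(w := D (Qu p) + 1), 10 := Qu(R1 24 := w)))"
      proof -
        have "A1(9 := D(w := D (Qu p) + 1), 10 := Qu(R1 24 := w)) = A(9 := D(w := D (Qu p) + 1), 10 := Qu(R1 24 := w))"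
          by (simp add: J(2) fun_eq_iff)
        moreover have "binv al src p (insert w S) (D(w := D (Qu p) + 1)) (Qu(R1 24 := w)) ((R1(24 := Suc (R1 24))) 24)"
          using add(3) by simp
        moreover have "(Qu(R1 24 := w)) p = R1 25" "\<forall>i\<le>p. (Qu(R1 24 := w)) i = Qu0 i" using J pt by auto
        ultimately have "\<exists>D Qu'. A1(9 := D0, 10 := Qu(R1 24 := w)) = A(9 := D, 10 := Qu') \<and> Qu' p = R1 25 \<and>
            (\<forall>i\<le>p. Qu' i = Qu0 i) \<and> binv al src p (insert w S) D Qu' ((R1(24 := Suc (R1 24))) 24)"
          if "D0 = D(w := D (Qu p) + 1)" for D0 unfolding that by blast
        then show ?thesis using fr' by simp
      qed
      moreover have "A 11 w + 1 - R 21 \<noteq> 0" using f(2) by (auto simp: al_def)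
      moreover have "D (R1 25) + 1 \<le> B" "Suc (R1 24) \<le> B" "w \<le> B"
        using add(1,2) J(3) n_le_M B_ge_M w(2) by auto
      ultimately show ?thesis using A1 w(3) r21 f(1) J(3) by (simp add: visit_com_def)
    qed
  qed
  have loop: "run (While (Sub (Reg 24) (Reg 23)) (Seq (Seq (Assign 25 (arr 10 (Reg 23))) (Assign 23 (Add (Reg 23) (Lit 1))))
      (Nbrs 26 25 27 visit_com))) R1 A1 (pot R1 A1 + 1) Q" if "Inv R1 A1" for R1 A1
    using that
  proof (rule run_while[where Inv = Inv and pot = pot, rotated 1])
    fix R1 A1
    assume I: "Inv R1 A1" and z: "aval (Sub (Reg 24) (Reg 23)) (st R1 A1) = 0"
    then obtain D Qu where *: "A1 = A(9 := D, 10 := Qu)" "bouter al src (R1 23) D Qu (R1 24)" "fr R1" by (auto simp: Inv_def)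
    have "R1 23 = R1 24" using z *(2) by (simp add: bouter_def)
    then have "bfs_tree al src D" using bouter_tree *(2) by metis
    then show "Q R1 A1" using Q[of R1 D Qu] * by (simp add: fr_def al_def src_def)
  next
    fix R1 A1
    assume I: "Inv R1 A1" and nz: "aval (Sub (Reg 24) (Reg 23)) (st R1 A1) \<noteq> 0"
    then obtain D Qu where *: "A1 = A(9 := D, 10 := Qu)" "bouter al src (R1 23) D Qu (R1 24)" "fr R1" by (auto simp: Inv_def)
    define p u where "p = R1 23" and "u = Qu p"
    have pt: "p < R1 24" using nz by (simp add: p_def)
    have b0: "binv al src p {} D Qu (R1 24)" using bouter_binv[OF *(2)] pt by (simp add: p_def)
    then have bb: "bbase al src D Qu (R1 24)" by (simp add: binv_def)
    have un: "u < n"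
    proof -
      have "u \<in> Qu ` {..<R1 24}" using pt by (auto simp: u_def)
      then show ?thesis using bb by (auto simp: bbase_def)
    qed
    have tn: "R1 24 \<le> n" using bb by (simp add: bbase_def)
    have unew: "u \<notin> Qu ` {..<p}"
    proof
      assume "u \<in> Qu ` {..<p}"
      then obtain i where "i < p" "Qu i = Qu p" by (auto simp: u_def)
      moreover have "inj_on Qu {..<R1 24}" using bb by (simp add: bbase_def)
      ultimately show False using pt by (auto simp: inj_on_def)
    qed
    have potstep: "pot R2 A2 + (dg u * 9 + 5) = pot R1 A1" if "R2 23 = Suc p" "\<forall>i\<le>p. A2 10 i = Qu i" for R2 A2
    proof -
      define G where "G = {..<n} - insert u (Qu ` {..<p})"
      have "A2 10 ` {..<Suc p} = insert u (Qu ` {..<p})" using that(2) by (auto simp: u_def lessThan_Suc)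
      then have "pot R2 A2 = (\<Sum>x\<in>G. dg x * 9 + 5)" by (simp only: pot_def that(1) G_def)
      moreover have "pot R1 A1 = (\<Sum>x\<in>insert u G. dg x * 9 + 5)"
      proof -
        have "{..<n} - Qu ` {..<p} = insert u G" using un unew by (auto simp: G_def)
        moreover have "A1 10 = Qu" by (simp add: *(1))
        ultimately show ?thesis by (simp only: pot_def p_def[symmetric])
      qed
      moreover have "(\<Sum>x\<in>insert u G. dg x * 9 + 5) = (dg u * 9 + 5) + (\<Sum>x\<in>G. dg x * 9 + 5)"
        by (rule sum.insert) (simp_all add: G_def)
      ultimately show ?thesis by linarith
    qed
    define R2 where "R2 = R1(25 := u, 23 := Suc p)"
    have nb: "run (Nbrs 26 25 27 visit_com) R2 A1 (dg u * 8 + 2) (\<lambda>R3 A3. Inv R3 A3 \<and> pot R3 A3 + (dg u * 8 + 4) + 1 \<le> pot R1 A1)"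
    proof (rule run_nbrs_const[where x = u and g = 5 and J = "\<lambda>S R3 A3. R3 25 = u \<and> R3 23 = Suc p \<and> fr R3 \<and>
        (\<exists>D Qu'. A3 = A(9 := D, 10 := Qu') \<and> Qu' p = u \<and> (\<forall>i\<le>p. Qu' i = Qu i) \<and> binv al src p S D Qu' (R3 24))"])
      show "R2 25 = u \<and> R2 23 = Suc p \<and> fr R2 \<and>
        (\<exists>D Qu'. A1 = A(9 := D, 10 := Qu') \<and> Qu' p = u \<and> (\<forall>i\<le>p. Qu' i = Qu i) \<and> binv al src p {} D Qu' (R2 24))"
        using * b0 by (auto simp: R2_def u_def fr_def)
      fix R3 A3
      show "Inv R3 A3 \<and> pot R3 A3 + (dg u * 8 + 4) + 1 \<le> pot R1 A1"
        if J: "R3 25 = u \<and> R3 23 = Suc p \<and> fr R3 \<and>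
        (\<exists>D Qu'. A3 = A(9 := D, 10 := Qu') \<and> Qu' p = u \<and> (\<forall>i\<le>p. Qu' i = Qu i) \<and> binv al src p (N u) D Qu' (R3 24))"
      proof -
        from J obtain D' Qu' where J': "A3 = A(9 := D', 10 := Qu')" "Qu' p = u" "\<forall>i\<le>p. Qu' i = Qu i"
          "binv al src p (N u) D' Qu' (R3 24)" by blast
        have "bouter al src (Suc p) D' Qu' (R3 24)" using binv_bouter J'(2,4) by simp
        then have "Inv R3 A3" unfolding Inv_def using J J'(1) by auto
        moreover have "pot R3 A3 + (dg u * 9 + 5) = pot R1 A1" using potstep J J' by simp
        ultimately show ?thesis by simp
      qed
      show "R3 25 = u \<and> graph A3" if J: "R3 25 = u \<and> R3 23 = Suc p \<and> fr R3 \<and>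
        (\<exists>D Qu'. A3 = A(9 := D, 10 := Qu') \<and> Qu' p = u \<and> (\<forall>i\<le>p. Qu' i = Qu i) \<and> binv al src p S D Qu' (R3 24))" for S
        using J g by auto
      fix S w
      assume J: "R3 25 = u \<and> R3 23 = Suc p \<and> fr R3 \<and>
        (\<exists>D Qu'. A3 = A(9 := D, 10 := Qu') \<and> Qu' p = u \<and> (\<forall>i\<le>p. Qu' i = Qu i) \<and> binv al src p S D Qu' (R3 24))"
        and w: "w \<in> N u" "w < n" "S \<subseteq> N u" "w \<notin> S" "R3 27 = w"
      from J obtain D' Qu' where J': "A3 = A(9 := D', 10 := Qu')" "Qu' p = u" "\<forall>i\<le>p. Qu' i = Qu i"
          "binv al src p S D' Qu' (R3 24)" by blast
      have c: "R3 25 = u" "R3 23 = Suc p" "fr R3" using J by auto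
      show "run visit_com R3 A3 5 (\<lambda>R4 A4. R4 26 = R3 26 \<and> R4 25 = u \<and> R4 23 = Suc p \<and> fr R4 \<and>
        (\<exists>D Qu'. A4 = A(9 := D, 10 := Qu') \<and> Qu' p = u \<and> (\<forall>i\<le>p. Qu' i = Qu i) \<and> binv al src p (insert w S) D Qu' (R4 24)))"
        by (rule run_mono[OF visit[OF c(3) J'(1) _ J'(3,4) _ w(2,5)]]) (use c J' w in auto)
    qed (use un in \<open>auto simp: fr_def\<close>)
    have "run (Seq (Seq (Assign 25 (arr 10 (Reg 23))) (Assign 23 (Add (Reg 23) (Lit 1)))) (Nbrs 26 25 27 visit_com)) R1 A1
        (2 + (dg u * 8 + 2)) (\<lambda>R3 A3. Inv R3 A3 \<and> pot R3 A3 + (dg u * 8 + 4) + 1 \<le> pot R1 A1)"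
    proof (rule run_seq, rule run_wp)
      have "A1 10 p = u" by (simp add: *(1) u_def)
      moreover have "u \<le> B" "Suc p \<le> B" using un n_le tn pt by auto
      ultimately show "wp (Seq (Assign 25 (arr 10 (Reg 23))) (Assign 23 (Add (Reg 23) (Lit 1))))
          (\<lambda>R' A'. run (Nbrs 26 25 27 visit_com) R' A' (dg u * 8 + 2)
            (\<lambda>R3 A3. Inv R3 A3 \<and> pot R3 A3 + (dg u * 8 + 4) + 1 \<le> pot R1 A1)) R1 A1"
        using nb p_def by (simp add: R2_def)
    qed (auto simp: small_def)
    moreover have "2 + (dg u * 8 + 2) = dg u * 8 + 4" by simp
    moreover have "dg u * 8 + 4 + 1 \<le> pot R1 A1"
    proof -
      have "pot (R1(23 := Suc p)) A1 + (dg u * 9 + 5) = pot R1 A1" by (rule potstep) (simp_all add: *(1))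
      then show ?thesis by linarith
    qed
    ultimately show "\<exists>t. t + 1 \<le> pot R1 A1 \<and>
        run (Seq (Seq (Assign 25 (arr 10 (Reg 23))) (Assign 23 (Add (Reg 23) (Lit 1)))) (Nbrs 26 25 27 visit_com)) R1 A1 t
          (\<lambda>R' A'. Inv R' A' \<and> pot R' A' + t + 1 \<le> pot R1 A1)"
      by (intro exI[of _ "dg u * 8 + 4"]) (simp only: simp_thms)
  qed (simp add: small_def)
  have potle: "pot R1 A1 \<le> 9 * M + 5 * n" for R1 A1
  proof -
    have "pot R1 A1 \<le> (\<Sum>x<n. dg x * 9 + 5)" unfolding pot_def by (intro sum_mono2) auto
    also have "\<dots> = 9 * M + 5 * n" by (simp add: sum.distrib sum_distrib_right[symmetric] sum_dg)
    finally show ?thesis .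
  qed
  have rest: "run (Seq (Seq (put 9 (Reg 20) (Lit 1)) (Seq (put 10 (Lit 0) (Reg 20)) (Seq (Assign 23 (Lit 0)) (Assign 24 (Lit 1)))))
      (While (Sub (Reg 24) (Reg 23)) (Seq (Seq (Assign 25 (arr 10 (Reg 23))) (Assign 23 (Add (Reg 23) (Lit 1))))
        (Nbrs 26 25 27 visit_com)))) R1 A1 (4 + (9 * M + 5 * n + 1)) Q"
    if J: "fr R1" "A1 = A(9 := D)" "\<forall>w<n. D w = 0" for R1 A1 D
  proof (rule run_seq, rule run_wp)
    define R2 A2 where "R2 = R1(23 := 0, 24 := 1)" and "A2 = A1(9 := D(src := 1), 10 := (A 10)(0 := src))"
    have r20: "R1 20 = src" using J(1) by (simp add: fr_def src_def)
    have "binv al src 0 {} (D(src := 1)) ((A 10)(0 := src)) 1"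
      using s J(3) by (intro bbase_init) (auto simp: src_def)
    then have "bouter al src 0 (D(src := 1)) ((A 10)(0 := src)) 1" by (simp add: binv_def bouter_def)
    moreover have "A2 = A(9 := D(src := 1), 10 := (A 10)(0 := src))" by (simp add: A2_def J(2) fun_eq_iff)
    ultimately have "Inv R2 A2" unfolding Inv_def using J(1) by (auto simp: R2_def fr_def)
    from run_mono[OF loop[OF this]] potle
    have l: "run (While (Sub (Reg 24) (Reg 23)) (Seq (Seq (Assign 25 (arr 10 (Reg 23))) (Assign 23 (Add (Reg 23) (Lit 1))))
        (Nbrs 26 25 27 visit_com))) R2 A2 (9 * M + 5 * n + 1) Q" by simp
    have "src \<le> B" using s n_le by (simp add: src_def)
    then show "wp (Seq (put 9 (Reg 20) (Lit 1)) (Seq (put 10 (Lit 0) (Reg 20)) (Seq (Assign 23 (Lit 0)) (Assign 24 (Lit 1)))))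
       (\<lambda>R' A'. run (While (Sub (Reg 24) (Reg 23)) (Seq (Seq (Assign 25 (arr 10 (Reg 23))) (Assign 23 (Add (Reg 23) (Lit 1))))
        (Nbrs 26 25 27 visit_com))) R' A' (9 * M + 5 * n + 1) Q) R1 A1"
      using l r20 B_ge J(2) by (simp add: R2_def A2_def)
  qed (auto simp: small_def)
  have "run bfs_com R A ((3 * n + 2) + (4 + (9 * M + 5 * n + 1))) Q"
    unfolding bfs_com_def
  proof (rule run_seq, rule run_verts[where g = "\<lambda>_. 1" and
      J = "\<lambda>i R' A'. fr R' \<and> (\<exists>D. A' = A(9 := D) \<and> (\<forall>w<i. D w = 0))"])
    have "A = A(9 := A 9)" by simp
    then show "fr R \<and> (\<exists>D. A = A(9 := D) \<and> (\<forall>w<0. D w = 0))" unfolding fr_def by blast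
    fix i R' A'
    assume i: "i < n" "R' 22 = i" and J: "fr R' \<and> (\<exists>D. A' = A(9 := D) \<and> (\<forall>w<i. D w = 0))"
    then obtain D where D: "A' = A(9 := D)" "\<forall>w<i. D w = 0" by blast
    show "run (put 9 (Reg 22) (Lit 0)) R' A' 1 (\<lambda>R'' A''. R'' 22 = i \<and> fr R'' \<and> (\<exists>D. A'' = A(9 := D) \<and> (\<forall>w<Suc i. D w = 0)))"
    proof (rule run_put)
      have "A'(9 := (A' 9)(i := 0)) = A(9 := D(i := 0))" by (simp add: D(1))
      moreover have "\<forall>w<Suc i. (D(i := 0)) w = 0" using D(2) by (simp add: less_Suc_eq)
      ultimately have "\<exists>D. A'(9 := (A' 9)(i := 0)) = A(9 := D) \<and> (\<forall>w<Suc i. D w = 0)" by blast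
      then show "R' 22 = i \<and> fr R' \<and> (\<exists>D. A'(9 := (A' 9)(aval (Reg 22) (st R' A') := aval (Lit 0) (st R' A'))) = A(9 := D) \<and> (\<forall>w<Suc i. D w = 0))"
        using i J by simp
    qed (auto simp: small_def)
  qed (use rest in \<open>auto simp: fr_def\<close>)
  then show ?thesis by (rule run_mono) (use T n_le_M n_pos in auto)
qed

section \<open>The sweep as a program\<close>

lemma run_seqI: "run c R A T1 (\<lambda>R' A'. run c' R' A' T2 Q) \<Longrightarrow> T1 + T2 \<le> T \<Longrightarrow> run (Seq c c') R A T Q"
  using run_mono[OF run_seq[of c R A T1 c' T2 Q], of T Q] by blast

lemma run_scan:
  assumes r: "r \<notin> {1, 2, 3}" and c: "lf c" "tm c \<le> g"
    and init: "J 0 R A" and Jr: "\<And>i R A x. J i R A \<Longrightarrow> J i (R(r := x)) A"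
    and step: "\<And>i R A. i < n \<Longrightarrow> R r = i \<Longrightarrow> J i R A \<Longrightarrow> ok R A \<Longrightarrow> wp c (\<lambda>R' A'. R' r = i \<and> J (Suc i) R' A') R A"
    and exit: "\<And>R A. J n R A \<Longrightarrow> Q R A"
    and T: "n * (g + 2) + 2 \<le> T"
  shows "run (Verts r c) R A T Q"
proof (rule run_verts[where J = J and g = "\<lambda>_. g"])
  show "run c R A g (\<lambda>R' A'. R' r = i \<and> J (Suc i) R' A')" if "i < n" "R r = i" "J i R A" for i R A
    by (rule run_wp) (use c step that in auto)
qed (use assms in auto)

lemma run_dist:
  assumes g: "graph A" and s: "R 20 < n" "R 21 = 0"
    and Q: "\<And>R' D Qu. (\<And>r. r \<notin> {22..27} \<Longrightarrow> R' r = R r) \<Longrightarrow>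
      (\<And>w. w < n \<Longrightarrow> D w = d (R 20) w + 1) \<Longrightarrow> Q R' (A(9 := D, 10 := Qu))"
    and T: "30 * M \<le> T"
  shows "run bfs_com R A T Q"
proof (rule run_bfs)
  fix R' D Qu
  assume f: "\<And>r. r \<notin> {22..27} \<Longrightarrow> R' r = R r" and t: "bfs_tree (\<lambda>w. R 21 \<le> A 11 w) (R 20) D"
  have "D w = d (R 20) w + 1" if "w < n" for w using bfs_tree_dist[OF t _ s(1) that] s(2) by simp
  then show "Q R' (A(9 := D, 10 := Qu))" using Q f by blast
qed (use g s T in auto)

text \<open>Array 9 holds distances plus 1, so the initial maximum 0 in register 19 is beaten by the
  first admissible vertex and needs no special case.\<close>

definition pick_com :: "aexp \<Rightarrow> com" where
  "pick_com e = Seq (Seq (Assign 18 (Lit 0)) (Assign 19 (Lit 0)))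
     (Verts 28 (Cond e (Cond (Sub (arr 9 (Reg 28)) (Reg 19))
       (Seq (Assign 18 (Reg 28)) (Assign 19 (arr 9 (Reg 28)))) Skip) Skip))"

lemma run_pick:
  assumes e: "small e" "\<And>R' i. i < n \<Longrightarrow> R' 28 = i \<Longrightarrow> aval e (st R' A) \<noteq> 0 \<longleftrightarrow> P i"
    and P: "\<exists>i<n. P i" "\<And>i. i < n \<Longrightarrow> A 9 i \<noteq> 0"
    and Q: "\<And>R'. (\<And>r. r \<notin> {18, 19, 28} \<Longrightarrow> R' r = R r) \<Longrightarrow> R' 18 < n \<Longrightarrow> P (R' 18) \<Longrightarrow> R' 19 = A 9 (R' 18) \<Longrightarrow>
      (\<And>i. i < n \<Longrightarrow> P i \<Longrightarrow> A 9 i \<le> A 9 (R' 18)) \<Longrightarrow> Q R' A"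
    and T: "n * 7 + 4 \<le> T"
  shows "run (pick_com e) R A T Q"
  unfolding pick_com_def
proof (rule run_seqI[where ?T1.0 = 2 and ?T2.0 = "n * 7 + 2"], rule run_wp)
  define J where "J i R' A' \<longleftrightarrow> A' = A \<and> (\<forall>r. r \<notin> {18, 19, 28} \<longrightarrow> R' r = R r) \<and>
    (\<forall>k<i. P k \<longrightarrow> A 9 k \<le> R' 19) \<and> (R' 19 = 0 \<or> R' 18 < n \<and> P (R' 18) \<and> R' 19 = A 9 (R' 18))"
    for i :: nat and R' :: regs and A' :: arrays
  have "run (Verts 28 (Cond e (Cond (Sub (arr 9 (Reg 28)) (Reg 19))
       (Seq (Assign 18 (Reg 28)) (Assign 19 (arr 9 (Reg 28)))) Skip) Skip)) (R(18 := 0, 19 := 0)) A (n * 7 + 2) Q"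
  proof (rule run_scan[where g = 5 and J = J])
    show "lf (Cond e (Cond (Sub (arr 9 (Reg 28)) (Reg 19)) (Seq (Assign 18 (Reg 28)) (Assign 19 (arr 9 (Reg 28)))) Skip) Skip)"
      using e(1) by (simp add: small_def)
    show "J 0 (R(18 := 0, 19 := 0)) A" by (simp add: J_def)
    show "Q R' A'" if J: "J n R' A'" for R' A'
    proof -
      obtain k where k: "k < n" "P k" using P(1) by blast
      have "0 < A 9 k" using P(2) k by simp
      also have "A 9 k \<le> R' 19" using J k by (simp add: J_def)
      finally have "R' 18 < n \<and> P (R' 18) \<and> R' 19 = A 9 (R' 18)" using J by (simp add: J_def)
      then show ?thesis using J Q[of R'] by (simp add: J_def)
    qed
    fix i R' A'
    assume i: "i < n" "R' 28 = i" and J: "J i R' A'" and ok: "ok R' A'"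
    have A: "A' = A" using J by (simp add: J_def)
    have b: "aval e (st R' A') \<noteq> 0 \<longleftrightarrow> P i" using e(2)[of i R'] i A by blast
    have le: "i \<le> B" "A 9 i \<le> B" using i n_le ok A by (auto simp: ok_def)
    show "wp (Cond e (Cond (Sub (arr 9 (Reg 28)) (Reg 19)) (Seq (Assign 18 (Reg 28)) (Assign 19 (arr 9 (Reg 28)))) Skip) Skip)
      (\<lambda>R' A'. R' 28 = i \<and> J (Suc i) R' A') R' A'"
      using b J i le P(2)[OF i(1)] by (auto simp: J_def less_Suc_eq)
  qed (auto simp: J_def)
  then show "wp (Seq (Assign 18 (Lit 0)) (Assign 19 (Lit 0))) (\<lambda>R' A'. run (Verts 28 (Cond e (Cond (Sub (arr 9 (Reg 28)) (Reg 19))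
       (Seq (Assign 18 (Reg 28)) (Assign 19 (arr 9 (Reg 28)))) Skip) Skip)) R' A' (n * 7 + 2) Q) R A" by simp
qed (use T in \<open>auto simp: small_def\<close>)

section \<open>Choosing \<open>z\<close> and \<open>v\<close> and finding the separator\<close>

definition first_com :: com where
  "first_com = Seq (Seq (Assign 20 (Lit 0)) (Assign 21 (Lit 0))) (Seq bfs_com (pick_com (arr 4 (Reg 28))))"

lemma run_first:
  assumes g: "graph A" and s: "\<And>y. y < n \<Longrightarrow> A 4 y \<noteq> 0 \<longleftrightarrow> simplicial y"
    and Q: "\<And>R' A'. (\<And>r. r \<notin> {18..28} \<Longrightarrow> R' r = R r) \<Longrightarrow> (\<And>j. j \<notin> {9, 10} \<Longrightarrow> A' j = A j) \<Longrightarrow> R' 21 = 0 \<Longrightarrow>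
      R' 18 < n \<Longrightarrow> simplicial (R' 18) \<Longrightarrow> d 0 (R' 18) = ecc 0 \<Longrightarrow> Q R' A'"
    and T: "43 * M \<le> T"
  shows "run first_com R A T Q"
  unfolding first_com_def
proof (rule run_seqI[where ?T1.0 = 2 and ?T2.0 = "30 * M + (n * 7 + 4)"], rule run_wp)
  have "run (Seq bfs_com (pick_com (arr 4 (Reg 28)))) (R(20 := 0, 21 := 0)) A (30 * M + (n * 7 + 4)) Q"
  proof (rule run_seq, rule run_dist)
    fix R1 D Qu
    assume f: "\<And>r. r \<notin> {22..27} \<Longrightarrow> R1 r = (R(20 := 0, 21 := 0)) r"
      and D: "\<And>w. w < n \<Longrightarrow> D w = d ((R(20 := 0, 21 := 0)) 20) w + 1"
    have D0: "D w = d 0 w + 1" if "w < n" for w using D[OF that] by simp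
    show "run (pick_com (arr 4 (Reg 28))) R1 (A(9 := D, 10 := Qu)) (n * 7 + 4) Q"
    proof (rule run_pick[where P = simplicial])
      show "aval (arr 4 (Reg 28)) (st R' (A(9 := D, 10 := Qu))) \<noteq> 0 \<longleftrightarrow> simplicial i" if "i < n" "R' 28 = i" for R' i
        using s[of i] that by simp
      \<comment> \<open>Some farthest vertex from 0 is simplicial, so restricting the maximum to
        simplicial vertices does not lower it.\<close>
      obtain y where y: "simplicial y" "d 0 y = ecc 0" using simplicial_farthest[of 0] n_pos by auto
      have yn: "y < n" using y simplicial_less by blast
      show "\<exists>i<n. simplicial i" using y yn by blast
      fix R'
      assume a: "\<And>r. r \<notin> {18, 19, 28} \<Longrightarrow> R' r = R1 r" "R' 18 < n" "simplicial (R' 18)"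
        "\<And>i. i < n \<Longrightarrow> simplicial i \<Longrightarrow> (A(9 := D, 10 := Qu)) 9 i \<le> (A(9 := D, 10 := Qu)) 9 (R' 18)"
      have "ecc 0 \<le> d 0 (R' 18)" using a(4)[OF yn y(1)] y(2) D0[OF yn] D0[OF a(2)] by simp
      moreover have "d 0 (R' 18) \<le> ecc 0" using d_le_ecc a(2) by simp
      ultimately have "d 0 (R' 18) = ecc 0" by simp
      then show "Q R' (A(9 := D, 10 := Qu))" by (intro Q) (use f a in auto)
    qed (use D0 in \<open>auto simp: small_def arr_def arr_addr_def\<close>)
  qed (use g n_pos in auto)
  then show "wp (Seq (Assign 20 (Lit 0)) (Assign 21 (Lit 0)))
      (\<lambda>R' A'. run (Seq bfs_com (pick_com (arr 4 (Reg 28)))) R' A' (30 * M + (n * 7 + 4)) Q) R A" by simp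
  show "2 + (30 * M + (n * 7 + 4)) \<le> T" using T n_le_M n_pos by linarith
qed (auto simp: small_def)

text \<open>Register 29 becomes the running maximum of distances plus 1, register 30 keeps the value
  for \<open>z\<close> for the case of diameter at most 2. The distances are copied to array 11 as
  keys for the restricted search.\<close>

definition second_com :: com where
  "second_com = Seq (Assign 20 (Reg 18)) (Seq bfs_com (Seq (pick_com (Lit 1))
     (Seq (Seq (Assign 29 (Reg 19)) (Assign 30 (Reg 19))) (Verts 28 (put 11 (Reg 28) (arr 9 (Reg 28)))))))"

lemma run_second:
  assumes g: "graph A" and z: "R 18 < n" "R 21 = 0"
    and Q: "\<And>R' A'. (\<And>r. r \<notin> {18..30} \<Longrightarrow> R' r = R r) \<Longrightarrow> (\<And>j. j \<notin> {9, 10, 11} \<Longrightarrow> A' j = A j) \<Longrightarrow>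
      (\<And>w. w < n \<Longrightarrow> A' 11 w = d (R 18) w + 1) \<Longrightarrow> R' 18 < n \<Longrightarrow> d (R 18) (R' 18) = ecc (R 18) \<Longrightarrow>
      R' 29 = ecc (R 18) + 1 \<Longrightarrow> R' 30 = ecc (R 18) + 1 \<Longrightarrow> Q R' A'"
    and T: "50 * M \<le> T"
  shows "run second_com R A T Q"
  unfolding second_com_def
proof (rule run_seqI[where ?T1.0 = 1 and ?T2.0 = "30 * M + ((n * 7 + 4) + (2 + (n * 3 + 2)))"], rule run_wp)
  define z where "z = R 18"
  let ?c3 = "Seq (Seq (Assign 29 (Reg 19)) (Assign 30 (Reg 19))) (Verts 28 (put 11 (Reg 28) (arr 9 (Reg 28))))"
  have "run (Seq bfs_com (Seq (pick_com (Lit 1)) ?c3)) (R(20 := z)) A (30 * M + ((n * 7 + 4) + (2 + (n * 3 + 2)))) Q"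
  proof (rule run_seq, rule run_dist)
    fix R1 D Qu
    assume f1: "\<And>r. r \<notin> {22..27} \<Longrightarrow> R1 r = (R(20 := z)) r"
      and D: "\<And>w. w < n \<Longrightarrow> D w = d ((R(20 := z)) 20) w + 1"
    have D0: "D w = d z w + 1" if "w < n" for w using D[OF that] by simp
    show "run (Seq (pick_com (Lit 1)) ?c3) R1 (A(9 := D, 10 := Qu)) ((n * 7 + 4) + (2 + (n * 3 + 2))) Q"
    proof (rule run_seq, rule run_pick[where P = "\<lambda>_. True"])
      fix R2
      assume a: "\<And>r. r \<notin> {18, 19, 28} \<Longrightarrow> R2 r = R1 r" "R2 18 < n" "R2 19 = (A(9 := D, 10 := Qu)) 9 (R2 18)"
        "\<And>i. i < n \<Longrightarrow> True \<Longrightarrow> (A(9 := D, 10 := Qu)) 9 i \<le> (A(9 := D, 10 := Qu)) 9 (R2 18)"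
      obtain y where y: "y < n" "d z y = ecc z" using ecc_attained[of z] by auto
      have "ecc z \<le> d z (R2 18)" using a(4)[OF y(1)] y D0[OF y(1)] D0[OF a(2)] by simp
      moreover have "d z (R2 18) \<le> ecc z" using d_le_ecc a(2) by simp
      ultimately have e: "d z (R2 18) = ecc z" by simp
      have r19: "R2 19 = ecc z + 1" using a(3) D0[OF a(2)] e by simp
      define R3 where "R3 = R2(29 := ecc z + 1, 30 := ecc z + 1)"
      define J where "J i R' A' \<longleftrightarrow> (\<forall>r. r \<noteq> 28 \<longrightarrow> R' r = R3 r) \<and> (\<forall>j. j \<noteq> 11 \<longrightarrow> A' j = (A(9 := D, 10 := Qu)) j) \<and>
        (\<forall>w<i. A' 11 w = D w)" for i :: nat and R' :: regs and A' :: arrays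
      have copy: "run (Verts 28 (put 11 (Reg 28) (arr 9 (Reg 28)))) R3 (A(9 := D, 10 := Qu)) (n * 3 + 2) Q"
      proof (rule run_scan[where g = 1 and J = J])
        show "Q R' A'" if "J n R' A'" for R' A'
        proof (rule Q)
          show "A' 11 w = d (R 18) w + 1" if "w < n" for w using \<open>J n R' A'\<close> D0 that by (simp add: J_def z_def)
        qed (use that a f1 e in \<open>auto simp: J_def R3_def z_def\<close>)
        show "wp (put 11 (Reg 28) (arr 9 (Reg 28))) (\<lambda>R' A'. R' 28 = i \<and> J (Suc i) R' A') R' A'"
          if "i < n" "R' 28 = i" "J i R' A'" "ok R' A'" for i R' A'
        proof -
          have "A' 9 = D" using that by (simp add: J_def)
          moreover from this have "D i \<le> B" using that(4) unfolding ok_def by metis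
          ultimately show ?thesis using that(1-3) by (auto simp: J_def less_Suc_eq)
        qed
      qed (auto simp: J_def small_def)
      have "ok R2 (A(9 := D, 10 := Qu)) \<Longrightarrow> ecc z + 1 \<le> B" using r19 unfolding ok_def by metis
      then show "run ?c3 R2 (A(9 := D, 10 := Qu)) (2 + (n * 3 + 2)) Q"
        by (intro run_seq run_wp) (use r19 copy in \<open>auto simp: small_def R3_def\<close>)
    qed (use D0 n_pos in \<open>auto simp: small_def\<close>)
  qed (use g z in \<open>auto simp: z_def\<close>)
  then show "wp (Assign 20 (Reg 18)) (\<lambda>R' A'. run (Seq bfs_com (Seq (pick_com (Lit 1)) ?c3)) R' A'
      (30 * M + ((n * 7 + 4) + (2 + (n * 3 + 2)))) Q) R A" using z n_le by (simp add: z_def)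
  show "1 + (30 * M + ((n * 7 + 4) + (2 + (n * 3 + 2)))) \<le> T" using T n_le_M n_pos by linarith
qed (auto simp: small_def)

text \<open>The separator in the form tested by the program: an edge changes the distance to
  \<open>z\<close> by at most 1, so one end below 3 and the other at least 3 means exactly 2 and
  3.\<close>

definition CC :: "nat \<Rightarrow> nat \<Rightarrow> nat set" where
  "CC z v = {c. c < n \<and> d z c < 3 \<and> (\<exists>u\<in>N c. reach {w. w < n \<and> 3 \<le> d z w} v u \<and> 3 \<le> d z u)}"

lemma CC_eq: assumes "z < n" "v < n" shows "CC z v = sweep.C {..<n} E z v"
proof -
  interpret S: sweep "{..<n}" E z v by unfold_locales (use assms in auto)
  have e: "{w. w < n \<and> 3 \<le> d z w} = {w \<in> {..<n}. 3 \<le> d z w}" by auto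
  have "c \<in> CC z v" if "c \<in> S.C" for c using that unfolding CC_def S.C_def S.R_def e by (auto simp: N_def)
  moreover have "c \<in> S.C" if c: "c \<in> CC z v" for c
  proof -
    obtain u where u: "u \<in> N c" "reach {w \<in> {..<n}. 3 \<le> d z w} v u" "3 \<le> d z u" using c unfolding CC_def e by blast
    have cn: "c < n" "d z c < 3" using c by (auto simp: CC_def)
    then have "u \<noteq> c" using u by auto
    then have E: "E c u" using u by (auto simp: N_def)
    then have "d z u \<le> d z c + 1" using d_step assms by auto
    then have "d z c = 2" "d z u = 3" using cn u by auto
    then show ?thesis unfolding S.C_def S.R_def using E u cn by auto
  qed
  ultimately show ?thesis by blast
qed

lemma card_CC: assumes "z < n" "v < n" shows "card (CC z v) \<le> q"
proof -
  interpret S: sweep "{..<n}" E z v by unfold_locales (use assms in auto)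
  show ?thesis using le_q clique_card_le S.clique_C CC_eq[OF assms] by metis
qed

text \<open>Keys are distances plus 1. The threshold 4 thus confines the search to distance at least
  3 from \<open>z\<close>, and the differences with 4 and with 3 test for distance below 3 and at
  least 3.\<close>

definition third_com :: com where
  "third_com = Seq (Seq (Assign 20 (Reg 18)) (Assign 21 (Lit 4))) (Seq bfs_com (Verts 28 (Nbrs 31 28 32
     (Cond (Sub (Lit 4) (arr 11 (Reg 28))) (Cond (arr 9 (Reg 32)) (Cond (Sub (arr 11 (Reg 32)) (Lit 3))
       (put 14 (Reg 28) (Lit 1)) Skip) Skip) Skip))))"

lemma run_third:
  assumes g: "graph A" and z: "z < n" "R 18 < n" "d z (R 18) = ecc z" "\<And>w. w < n \<Longrightarrow> A 11 w = d z w + 1"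
    "\<And>w. A 14 w = 0"
    and Q: "\<And>R' A'. (\<And>r. r \<notin> {18..28} \<union> {31, 32} \<Longrightarrow> R' r = R r) \<Longrightarrow> (\<And>j. j \<notin> {9, 10, 14} \<Longrightarrow> A' j = A j) \<Longrightarrow>
      (\<And>c. c < n \<Longrightarrow> A' 14 c \<noteq> 0 \<longleftrightarrow> c \<in> CC z (R 18)) \<Longrightarrow> Q R' A'"
    and T: "50 * M \<le> T"
  shows "run third_com R A T Q"
  unfolding third_com_def
proof (rule run_seqI[where ?T1.0 = 2 and ?T2.0 = "30 * M + (7 * M + 4 * n + 2)"], rule run_wp)
  define v X where "v = R 18" and "X = {w. w < n \<and> 3 \<le> d z w}"
  define R0 where "R0 = R(20 := v, 21 := 4)"
  let ?t = "Cond (Sub (Lit 4) (arr 11 (Reg 28))) (Cond (arr 9 (Reg 32)) (Cond (Sub (arr 11 (Reg 32)) (Lit 3))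
       (put 14 (Reg 28) (Lit 1)) Skip) Skip) Skip"
  \<comment> \<open>\<open>v\<close> is farthest from \<open>z\<close>: if it is closer than 3, so
    is every vertex.\<close>
  have vX: "v \<in> X \<or> X = {}"
    using z(2,3) d_le_ecc[of _ z] by (force simp: X_def v_def)
  have "run (Seq bfs_com (Verts 28 (Nbrs 31 28 32 ?t))) R0 A (30 * M + (7 * M + 4 * n + 2)) Q"
  proof (rule run_seq, rule run_bfs)
    show "R0 20 < n" using z by (simp add: R0_def v_def)
    fix R1 D Qu
    assume f1: "\<And>r. r \<notin> {22..27} \<Longrightarrow> R1 r = R0 r" and t: "bfs_tree (\<lambda>w. R0 21 \<le> A 11 w) (R0 20) D"
    have D: "D w \<noteq> 0 \<longleftrightarrow> reach X v w" if "w < n" for w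
    proof (rule bfs_tree_reach[OF t[unfolded R0_def, simplified] _ _ _ _ that])
      show "4 \<le> A 11 w \<longleftrightarrow> w \<in> X" if "w < n" for w using z(4)[OF that] that by (auto simp: X_def)
    qed (use vX z in \<open>auto simp: X_def v_def\<close>)
    define fr where "fr R' A' \<longleftrightarrow> (\<forall>r. r \<notin> {18..28} \<union> {31, 32} \<longrightarrow> R' r = R r) \<and>
        (\<forall>j. j \<noteq> 14 \<longrightarrow> A' j = (A(9 := D, 10 := Qu)) j)" for R' :: regs and A' :: arrays
    define mk where "mk c u \<longleftrightarrow> d z c < 3 \<and> reach X v u \<and> 3 \<le> d z u" for c u
    have CC: "c \<in> CC z v \<longleftrightarrow> (\<exists>u\<in>N c. mk c u)" if "c < n" for c
      using that by (auto simp: CC_def mk_def X_def)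
    define J where "J i R' A' \<longleftrightarrow> fr R' A' \<and> (\<forall>c<n. A' 14 c \<noteq> 0 \<longleftrightarrow> c < i \<and> c \<in> CC z v)"
      for i :: nat and R' :: regs and A' :: arrays
    show "run (Verts 28 (Nbrs 31 28 32 ?t)) R1 (A(9 := D, 10 := Qu)) (7 * M + 4 * n + 2) Q"
    proof (rule run_verts[where g = "\<lambda>i. dg i * 7 + 2" and J = J])
      show "J 0 R1 (A(9 := D, 10 := Qu))" using f1 z(5) by (auto simp: J_def fr_def R0_def)
      show "J i (R'(28 := x)) A'" if "J i R' A'" for i R' A' x using that by (simp add: J_def fr_def)
      show "Q R' A'" if J: "J n R' A'" for R' A'
        using Q[of R' A'] J by (simp add: J_def fr_def v_def)
      have "(\<Sum>i<n. dg i * 7 + 2 + 2) = M * 7 + 4 * n"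
        by (simp add: sum.distrib sum_distrib_right[symmetric] sum_dg del: add_2_eq_Suc')
      then show "(\<Sum>i<n. dg i * 7 + 2 + 2) + 2 \<le> 7 * M + 4 * n + 2" by simp
      fix c R' A'
      assume c: "c < n" "R' 28 = c" and J: "J c R' A'"
      define H where "H S R'' A'' \<longleftrightarrow> R'' 28 = c \<and> fr R'' A'' \<and>
        (\<forall>x<n. A'' 14 x \<noteq> 0 \<longleftrightarrow> x < c \<and> x \<in> CC z v \<or> x = c \<and> (\<exists>u\<in>S. mk c u))"
        for S and R'' :: regs and A'' :: arrays
      show "run (Nbrs 31 28 32 ?t) R' A' (dg c * 7 + 2) (\<lambda>R' A'. R' 28 = c \<and> J (Suc c) R' A')"
      proof (rule run_nbrs_const[where x = c and g = 4 and J = H])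
        show "H {} R' A'" using J c by (auto simp: H_def J_def)
        show "R2 28 = c \<and> J (Suc c) R2 A2" if "H (N c) R2 A2" for R2 A2
          using that CC[OF c(1)] by (auto simp: H_def J_def less_Suc_eq)
        show "R2 28 = c \<and> graph A2" if "H S R2 A2" for S R2 A2 using that g by (simp add: H_def fr_def)
        fix S y R2 A2
        assume H: "H S R2 A2" and y: "y \<in> N c" "y < n" "R2 32 = y"
        have "A2 11 c = d z c + 1" "A2 11 y = d z y + 1" "A2 9 y = D y" using H z(4) c y by (auto simp: H_def fr_def)
        moreover have "R2 28 = c" using H by (simp add: H_def)
        moreover have "mk c y \<Longrightarrow> H (insert y S) R2 (A2(14 := (A2 14)(c := 1)))"
          using H by (auto simp: H_def fr_def)
        moreover have "\<not> mk c y \<Longrightarrow> H (insert y S) R2 A2" using H by (auto simp: H_def)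
        ultimately have "wp ?t (\<lambda>R3 A3. R3 31 = R2 31 \<and> H (insert y S) R3 A3) R2 A2"
          using D[OF y(2)] y(3) B_ge by (auto simp: mk_def)
        then show "run ?t R2 A2 4 (\<lambda>R3 A3. R3 31 = R2 31 \<and> H (insert y S) R3 A3)"
          by (intro run_wp) (auto simp: small_def)
      qed (use c in \<open>auto simp: H_def fr_def\<close>)
    qed auto
  qed (use g in auto)
  then show "wp (Seq (Assign 20 (Reg 18)) (Assign 21 (Lit 4))) (\<lambda>R' A'. run (Seq bfs_com (Verts 28 (Nbrs 31 28 32 ?t))) R' A'
      (30 * M + (7 * M + 4 * n + 2)) Q) R A" using z n_le B_ge by (simp add: R0_def v_def)
  show "2 + (30 * M + (7 * M + 4 * n + 2)) \<le> T" using T n_le_M n_pos by linarith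
qed (auto simp: small_def)

text \<open>For each vertex, array 12 holds its distance to the searched part of \<open>C\<close> plus 1, with 0 if no vertex of \<open>C\<close>
  has been searched yet, and array 13 the number of nearest vertices.\<close>

definition levels :: "nat set \<Rightarrow> nat \<Rightarrow> nat \<Rightarrow> nat \<Rightarrow> bool" where
  "levels S x l k \<longleftrightarrow> (if S = {} then l = 0 else
     l = Min ((\<lambda>c. d c x) ` S) + 1 \<and> k = card {c \<in> S. d c x = Min ((\<lambda>c. d c x) ` S)})"

lemma levels_insert:
  assumes S: "finite S" "c \<notin> S" and l: "levels S x l k"
  shows "l = 0 \<or> d c x + 1 < l \<Longrightarrow> levels (insert c S) x (d c x + 1) 1"
    "l \<noteq> 0 \<Longrightarrow> d c x + 1 = l \<Longrightarrow> levels (insert c S) x l (k + 1)"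
    "l \<noteq> 0 \<Longrightarrow> l < d c x + 1 \<Longrightarrow> levels (insert c S) x l k"
proof -
  define m where "m = Min ((\<lambda>c. d c x) ` S)"
  have M: "Min ((\<lambda>c. d c x) ` insert c S) = min (d c x) m" if "S \<noteq> {}" using S that by (simp add: m_def)
  have lo: "m \<le> d c' x" if "c' \<in> S" for c' using S that by (simp add: m_def)
  show "levels (insert c S) x (d c x + 1) 1" if "l = 0 \<or> d c x + 1 < l"
  proof (cases "S = {}")
    case True
    have "{c' \<in> {c}. d c' x = d c x} = {c}" by auto
    then show ?thesis using True by (simp add: levels_def)
  next
    case False
    then have "d c x < m" using that l by (auto simp: levels_def m_def)
    then have "{c' \<in> insert c S. d c' x = d c x} = {c}" using lo by fastforce
    moreover have "min (d c x) m = d c x" using \<open>d c x < m\<close> by simp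
    ultimately show ?thesis unfolding levels_def M[OF False] by simp
  qed
  show "levels (insert c S) x l (k + 1)" if "l \<noteq> 0" "d c x + 1 = l"
  proof -
    have ne: "S \<noteq> {}" using that(1) l by (auto simp: levels_def)
    then have e: "d c x = m" "l = m + 1" "k = card {c \<in> S. d c x = m}" using that l by (auto simp: levels_def m_def)
    have "{c' \<in> insert c S. d c' x = m} = insert c {c \<in> S. d c x = m}" using e by auto
    then have "card {c' \<in> insert c S. d c' x = m} = k + 1" using S e(3) by simp
    then show ?thesis unfolding levels_def M[OF ne] using e by simp
  qed
  show "levels (insert c S) x l k" if "l \<noteq> 0" "l < d c x + 1"
  proof -
    have ne: "S \<noteq> {}" using that(1) l by (auto simp: levels_def)
    then have e: "m < d c x" "l = m + 1" "k = card {c \<in> S. d c x = m}" using that l by (auto simp: levels_def m_def)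
    have "{c' \<in> insert c S. d c' x = m} = {c \<in> S. d c x = m}" using e by auto
    then show ?thesis unfolding levels_def M[OF ne] using e by simp
  qed
qed

text \<open>Whatever the running maximum in register 29 is, it comes from an actual distance and so
  never exceeds \<open>diam + 1\<close>; the sweep only has to supply the lower bound.\<close>

definition dist_val :: "nat \<Rightarrow> bool" where
  "dist_val m \<longleftrightarrow> (\<exists>a<n. \<exists>b<n. m = d a b + 1)"

definition upd_com :: com where
  "upd_com = Seq (Cond (Sub (arr 9 (Reg 28)) (Reg 29)) (Assign 29 (arr 9 (Reg 28))) Skip)
     (Cond (arr 12 (Reg 28)) (Cond (Sub (arr 12 (Reg 28)) (arr 9 (Reg 28)))
       (Seq (put 12 (Reg 28) (arr 9 (Reg 28))) (put 13 (Reg 28) (Lit 1)))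
       (Cond (Sub (arr 9 (Reg 28)) (arr 12 (Reg 28))) Skip (put 13 (Reg 28) (Add (arr 13 (Reg 28)) (Lit 1)))))
       (Seq (put 12 (Reg 28) (arr 9 (Reg 28))) (put 13 (Reg 28) (Lit 1))))"

lemma run_upd:
  assumes c: "c < n" "c \<notin> S" "S \<subseteq> {..<n}" and D: "\<And>x. x < n \<Longrightarrow> A 9 x = d c x + 1"
    and l: "\<And>x. x < n \<Longrightarrow> levels S x (A 12 x) (A 13 x)" and v: "dist_val (R 29)"
    and Q: "\<And>R' A'. (\<And>r. r \<notin> {28, 29} \<Longrightarrow> R' r = R r) \<Longrightarrow> (\<And>j. j \<notin> {12, 13} \<Longrightarrow> A' j = A j) \<Longrightarrow>
      (\<And>x. x < n \<Longrightarrow> levels (insert c S) x (A' 12 x) (A' 13 x)) \<Longrightarrow> dist_val (R' 29) \<Longrightarrow> R 29 \<le> R' 29 \<Longrightarrow>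
      (\<And>x. x < n \<Longrightarrow> d c x + 1 \<le> R' 29) \<Longrightarrow> Q R' A'"
    and T: "8 * n + 2 \<le> T"
  shows "run (Verts 28 upd_com) R A T Q"
proof -
  have fS: "finite S" using c(3) finite_subset by blast
  define J where "J i R' A' \<longleftrightarrow> (\<forall>r. r \<notin> {28, 29} \<longrightarrow> R' r = R r) \<and> (\<forall>j. j \<notin> {12, 13} \<longrightarrow> A' j = A j) \<and>
    (\<forall>x<n. levels (if x < i then insert c S else S) x (A' 12 x) (A' 13 x)) \<and>
    dist_val (R' 29) \<and> R 29 \<le> R' 29 \<and> (\<forall>x<i. d c x + 1 \<le> R' 29)"
    for i :: nat and R' :: regs and A' :: arrays
  show ?thesis
  proof (rule run_scan[where J = J and g = 6])
    show "J 0 R A" using l v by (simp add: J_def)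
    show "Q R' A'" if "J n R' A'" for R' A' using Q[of R' A'] that by (simp add: J_def)
    fix i R' A'
    assume i: "i < n" "R' 28 = i" and J: "J i R' A'" and ok: "ok R' A'"
    define l k where "l = A' 12 i" and "k = A' 13 i"
    have A9: "A' 9 i = d c i + 1" using J D i by (simp add: J_def)
    have lk: "levels S i l k" using J i unfolding J_def l_def k_def by fastforce
    have b: "d c i + 1 \<le> B" using ok A9 unfolding ok_def by metis
    have kB: "l \<noteq> 0 \<Longrightarrow> k + 1 \<le> B"
    proof -
      assume "l \<noteq> 0"
      then have "k = card {c \<in> S. d c i = Min ((\<lambda>c. d c i) ` S)}" using lk by (auto simp: levels_def split: if_splits)
      also have "\<dots> \<le> card {..<n}" using c(3) by (intro card_mono) auto
      finally show ?thesis using n_le_M B_ge_M by simp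
    qed
    have upd: "J (Suc i) (R'(29 := m)) A2"
      if m: "m = max (R' 29) (d c i + 1)" and A2: "\<And>j. j \<notin> {12, 13} \<Longrightarrow> A2 j = A' j"
        "\<And>j x. x \<noteq> i \<Longrightarrow> A2 j x = A' j x" "levels (insert c S) i (A2 12 i) (A2 13 i)" for m A2
    proof -
      have "dist_val m" using J i c(1) unfolding m dist_val_def max_def J_def by auto
      moreover have "levels (if x < Suc i then insert c S else S) x (A2 12 x) (A2 13 x)" if "x < n" for x
        using J that A2(2)[of x] A2(3) unfolding J_def by (cases "x = i") (auto simp: less_Suc_eq)
      ultimately show ?thesis using J A2(1) by (auto simp: J_def m less_Suc_eq)
    qed
    define m where "m = max (R' 29) (d c i + 1)"
    have cases: "J (Suc i) (R'(29 := m)) (A'(12 := (A' 12)(i := d c i + 1), 13 := (A' 13)(i := 1)))" if "l = 0 \<or> d c i + 1 < l"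
      using levels_insert(1)[OF fS c(2) lk that] by (intro upd) (auto simp: m_def)
    moreover have "J (Suc i) (R'(29 := m)) (A'(13 := (A' 13)(i := k + 1)))" if "l \<noteq> 0" "d c i + 1 = l"
      using levels_insert(2)[OF fS c(2) lk that] by (intro upd) (auto simp: m_def l_def)
    moreover have "J (Suc i) (R'(29 := m)) A'" if "l \<noteq> 0" "l < d c i + 1"
      using levels_insert(3)[OF fS c(2) lk that] by (intro upd) (auto simp: m_def l_def k_def)
    ultimately have W: "wp (Cond (arr 12 (Reg 28)) (Cond (Sub (arr 12 (Reg 28)) (arr 9 (Reg 28)))
       (Seq (put 12 (Reg 28) (arr 9 (Reg 28))) (put 13 (Reg 28) (Lit 1)))
       (Cond (Sub (arr 9 (Reg 28)) (arr 12 (Reg 28))) Skip (put 13 (Reg 28) (Add (arr 13 (Reg 28)) (Lit 1)))))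
       (Seq (put 12 (Reg 28) (arr 9 (Reg 28))) (put 13 (Reg 28) (Lit 1)))) (\<lambda>R'' A''. R'' 28 = i \<and> J (Suc i) R'' A'') (R'(29 := m)) A'"
      using i(2) A9 b kB B_ge by (cases "d c i + 1" l rule: linorder_cases)
        (simp_all add: l_def[symmetric] k_def[symmetric])
    have "R'(29 := m) = R'" if "R' 29 = m" using that by (simp add: fun_eq_iff)
    then show "wp upd_com (\<lambda>R'' A''. R'' 28 = i \<and> J (Suc i) R'' A'') R' A'"
      unfolding upd_com_def using W A9 i(2) b by (auto simp: m_def max_def simp del: fun_upd_apply split: if_splits)
  qed (use T in \<open>auto simp: upd_com_def small_def J_def\<close>)
qed

definition fourth_com :: com where
  "fourth_com = Seq (Assign 21 (Lit 0)) (Verts 37 (Cond (arr 14 (Reg 37))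
     (Seq (Assign 20 (Reg 37)) (Seq bfs_com (Verts 28 upd_com))) Skip))"

lemma run_fourth:
  assumes g: "graph A" and z: "z < n" "v < n" "\<And>c. c < n \<Longrightarrow> A 14 c \<noteq> 0 \<longleftrightarrow> c \<in> CC z v"
    "\<And>x. A 12 x = 0" "dist_val (R 29)"
    and Q: "\<And>R' A'. (\<And>r. r \<notin> {20..29} \<union> {37} \<Longrightarrow> R' r = R r) \<Longrightarrow> (\<And>j. j \<notin> {9, 10, 12, 13} \<Longrightarrow> A' j = A j) \<Longrightarrow>
      R' 21 = 0 \<Longrightarrow> (\<And>x. x < n \<Longrightarrow> levels (CC z v) x (A' 12 x) (A' 13 x)) \<Longrightarrow> dist_val (R' 29) \<Longrightarrow> R 29 \<le> R' 29 \<Longrightarrow>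
      (\<And>c x. c \<in> CC z v \<Longrightarrow> x < n \<Longrightarrow> d c x + 1 \<le> R' 29) \<Longrightarrow> Q R' A'"
    and T: "50 * (q * M) \<le> T"
  shows "run fourth_com R A T Q"
  unfolding fourth_com_def
proof (rule run_seqI[where ?T1.0 = 1 and ?T2.0 = "4 * n + q * (41 * M) + 2"], rule run_wp)
  define S where "S i = {c \<in> CC z v. c < i}" for i
  define J where "J i R' A' \<longleftrightarrow> (\<forall>r. r \<notin> {20..29} \<union> {37} \<longrightarrow> R' r = R r) \<and> (\<forall>j. j \<notin> {9, 10, 12, 13} \<longrightarrow> A' j = A j) \<and>
    R' 21 = 0 \<and> (\<forall>x<n. levels (S i) x (A' 12 x) (A' 13 x)) \<and> dist_val (R' 29) \<and> R 29 \<le> R' 29 \<and>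
    (\<forall>c\<in>S i. \<forall>x<n. d c x + 1 \<le> R' 29)"
    for i :: nat and R' :: regs and A' :: arrays
  let ?b = "Seq (Assign 20 (Reg 37)) (Seq bfs_com (Verts 28 upd_com))"
  have "run (Verts 37 (Cond (arr 14 (Reg 37)) ?b Skip)) (R(21 := 0)) A (4 * n + q * (41 * M) + 2) Q"
  proof (rule run_verts[where J = J and g = "\<lambda>c. 2 + (if c \<in> CC z v then 41 * M else 0)"])
    show "J 0 (R(21 := 0)) A" using z by (simp add: J_def S_def levels_def)
    show "Q R' A'" if "J n R' A'" for R' A'
    proof -
      have "S n = CC z v" by (auto simp: S_def CC_def)
      then show ?thesis using Q[of R' A'] that by (simp add: J_def)
    qed
    have "(\<Sum>c<n. if c \<in> CC z v then 41 * M else 0) = card (CC z v) * (41 * M)"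
    proof -
      have "{..<n} \<inter> {c. c \<in> CC z v} = CC z v" by (auto simp: CC_def)
      then show ?thesis by (simp add: sum.If_cases)
    qed
    also have "\<dots> \<le> q * (41 * M)" using card_CC z by (intro mult_le_mono1) blast
    finally have s: "(\<Sum>c<n. if c \<in> CC z v then 41 * M else 0) \<le> q * (41 * M)" .
    have "(\<Sum>c<n. 2 + (if c \<in> CC z v then 41 * M else 0) + 2) = (\<Sum>c<n. (if c \<in> CC z v then 41 * M else 0) + 4)"
      by (intro sum.cong) auto
    also have "\<dots> = (\<Sum>c<n. if c \<in> CC z v then 41 * M else 0) + 4 * n"
      by (simp add: sum.distrib)
    finally show "(\<Sum>c<n. 2 + (if c \<in> CC z v then 41 * M else 0) + 2) + 2 \<le> 4 * n + q * (41 * M) + 2"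
      using s by linarith
    fix c R' A'
    assume c: "c < n" "R' 37 = c" and J: "J c R' A'"
    have g': "graph A'" using g J by (simp add: J_def)
    have "run (Cond (arr 14 (Reg 37)) ?b Skip) R' A' (1 + (1 + (if c \<in> CC z v then 41 * M else 0)))
        (\<lambda>R' A'. R' 37 = c \<and> J (Suc c) R' A')"
    proof (rule run_cond)
      have A14: "aval (arr 14 (Reg 37)) (st R' A') = A 14 c" using J c by (simp add: J_def)
      show "run Skip R' A' (1 + (if c \<in> CC z v then 41 * M else 0)) (\<lambda>R' A'. R' 37 = c \<and> J (Suc c) R' A')"
        if a: "aval (arr 14 (Reg 37)) (st R' A') = 0"
      proof -
        have "c \<notin> CC z v" using z(3)[OF c(1)] a A14 by simp
        then have "S (Suc c) = S c" by (auto simp: S_def less_Suc_eq)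
        then have "run Skip R' A' 1 (\<lambda>R' A'. R' 37 = c \<and> J (Suc c) R' A')"
          by (intro run_skip) (use J c in \<open>simp add: J_def\<close>)
        then show ?thesis by (rule run_mono) auto
      qed
      assume "aval (arr 14 (Reg 37)) (st R' A') \<noteq> 0"
      then have cC: "c \<in> CC z v" using z(3)[OF c(1)] A14 by simp
      have S: "S (Suc c) = insert c (S c)" "c \<notin> S c" "S c \<subseteq> {..<n}" using cC by (auto simp: S_def less_Suc_eq CC_def)
      show "run ?b R' A' (1 + (if c \<in> CC z v then 41 * M else 0)) (\<lambda>R' A'. R' 37 = c \<and> J (Suc c) R' A')"
      proof (rule run_seqI[where ?T1.0 = 1 and ?T2.0 = "30 * M + (8 * n + 2)"], rule run_wp)
        have "run (Seq bfs_com (Verts 28 upd_com)) (R'(20 := c)) A' (30 * M + (8 * n + 2))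
            (\<lambda>R' A'. R' 37 = c \<and> J (Suc c) R' A')"
        proof (rule run_seq, rule run_dist)
          fix R1 D Qu
          assume f1: "\<And>r. r \<notin> {22..27} \<Longrightarrow> R1 r = (R'(20 := c)) r"
            and D: "\<And>w. w < n \<Longrightarrow> D w = d ((R'(20 := c)) 20) w + 1"
          show "run (Verts 28 upd_com) R1 (A'(9 := D, 10 := Qu)) (8 * n + 2) (\<lambda>R' A'. R' 37 = c \<and> J (Suc c) R' A')"
          proof (rule run_upd[where c = c and S = "S c"])
            have r29: "R1 29 = R' 29" using f1 by simp
            show "dist_val (R1 29)" using J r29 by (simp add: J_def)
            fix R2 A2
            assume a: "\<And>r. r \<notin> {28, 29} \<Longrightarrow> R2 r = R1 r" "\<And>j. j \<notin> {12, 13} \<Longrightarrow> A2 j = (A'(9 := D, 10 := Qu)) j"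
              "\<And>x. x < n \<Longrightarrow> levels (insert c (S c)) x (A2 12 x) (A2 13 x)" "dist_val (R2 29)" "R1 29 \<le> R2 29"
              "\<And>x. x < n \<Longrightarrow> d c x + 1 \<le> R2 29"
            show "R2 37 = c \<and> J (Suc c) R2 A2"
              unfolding J_def S(1)
            proof (intro conjI allI impI ballI)
              show "R2 37 = c" "R2 21 = 0" using a(1) f1 J c by (auto simp: J_def)
              show "R2 r = R r" if "r \<notin> {20..29} \<union> {37}" for r using that a(1)[of r] f1[of r] J by (auto simp: J_def)
              show "A2 j = A j" if "j \<notin> {9, 10, 12, 13}" for j using that a(2)[of j] J by (auto simp: J_def)
              show "levels (insert c (S c)) x (A2 12 x) (A2 13 x)" if "x < n" for x using a(3) that by blast
              show "dist_val (R2 29)" using a(4) .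
              show "R 29 \<le> R2 29" using a(5) r29 J by (simp add: J_def)
              show "d c' x + 1 \<le> R2 29" if c': "c' \<in> insert c (S c)" and x: "x < n" for c' x
              proof (cases "c' = c")
                case True
                then show ?thesis using a(6) x by simp
              next
                case False
                then have "d c' x + 1 \<le> R' 29" using J c' x by (simp add: J_def)
                then show ?thesis using a(5) r29 by simp
              qed
            qed
          qed (use c S J D in \<open>auto simp: J_def\<close>)
        qed (use c g' J in \<open>auto simp: J_def\<close>)
        then show "wp (Assign 20 (Reg 37)) (\<lambda>R' A'. run (Seq bfs_com (Verts 28 upd_com)) R' A' (30 * M + (8 * n + 2))
            (\<lambda>R' A'. R' 37 = c \<and> J (Suc c) R' A')) R' A'" using c n_le by simp
        show "1 + (30 * M + (8 * n + 2)) \<le> 1 + (if c \<in> CC z v then 41 * M else 0)" using cC n_le_M n_pos by simp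
      qed (auto simp: small_def)
    qed (auto simp: small_def)
    then show "run (Cond (arr 14 (Reg 37)) ?b Skip) R' A' (2 + (if c \<in> CC z v then 41 * M else 0))
        (\<lambda>R' A'. R' 37 = c \<and> J (Suc c) R' A')" by (rule run_mono) auto
  qed (auto simp: J_def)
  then show "wp (Assign 21 (Lit 0)) (\<lambda>R' A'. run (Verts 37 (Cond (arr 14 (Reg 37)) ?b Skip)) R' A'
      (4 * n + q * (41 * M) + 2) Q) R A" by simp
  have "q * (41 * M) = 41 * (q * M)" by simp
  then show "1 + (4 * n + q * (41 * M) + 2) \<le> T" using T n_le_M n_pos M_le_qM by linarith
qed (auto simp: small_def)

definition center_com :: com where
  "center_com = Seq (Seq (Assign 34 (Lit 0)) (Seq (Assign 35 (Lit 0)) (Assign 36 (Lit 0))))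
     (Verts 28 (Cond (Sub (arr 12 (Reg 28)) (Reg 35))
        (Seq (Assign 34 (Reg 28)) (Seq (Assign 35 (arr 12 (Reg 28))) (Assign 36 (arr 13 (Reg 28)))))
        (Cond (Sub (Reg 35) (arr 12 (Reg 28))) Skip (Cond (Sub (Reg 36) (arr 13 (Reg 28)))
          (Seq (Assign 34 (Reg 28)) (Seq (Assign 35 (arr 12 (Reg 28))) (Assign 36 (arr 13 (Reg 28))))) Skip))))"

definition beats :: "nat \<Rightarrow> nat \<Rightarrow> nat \<Rightarrow> nat \<Rightarrow> bool" where
  "beats l k l' k' \<longleftrightarrow> l' < l \<or> l' = l \<and> k \<le> k'"

text \<open>If \<open>C\<close> is empty, array 12 is 0 throughout and the choice is arbitrary;
  optimality is therefore promised only when all entries are nonzero.\<close>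

lemma run_center:
  assumes Q: "\<And>R'. (\<And>r. r \<notin> {28, 34, 35, 36} \<Longrightarrow> R' r = R r) \<Longrightarrow> R' 34 < n \<Longrightarrow>
      ((\<And>u. u < n \<Longrightarrow> A 12 u \<noteq> 0) \<Longrightarrow> (\<And>u. u < n \<Longrightarrow> beats (A 12 (R' 34)) (A 13 (R' 34)) (A 12 u) (A 13 u))) \<Longrightarrow> Q R' A"
    and T: "n * 8 + 5 \<le> T"
  shows "run center_com R A T Q"
  unfolding center_com_def
proof (rule run_seqI[where ?T1.0 = 3 and ?T2.0 = "n * 8 + 2"], rule run_wp)
  let ?s = "Seq (Assign 34 (Reg 28)) (Seq (Assign 35 (arr 12 (Reg 28))) (Assign 36 (arr 13 (Reg 28))))"
  let ?c = "Cond (Sub (arr 12 (Reg 28)) (Reg 35)) ?s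
     (Cond (Sub (Reg 35) (arr 12 (Reg 28))) Skip (Cond (Sub (Reg 36) (arr 13 (Reg 28))) ?s Skip))"
  define J where "J i R' A' \<longleftrightarrow> A' = A \<and> (\<forall>r. r \<notin> {28, 34, 35, 36} \<longrightarrow> R' r = R r) \<and> R' 34 < n \<and>
      (R' 35 = 0 \<and> R' 36 = 0 \<or> R' 35 = A 12 (R' 34) \<and> R' 36 = A 13 (R' 34)) \<and>
      (\<forall>u<i. beats (R' 35) (R' 36) (A 12 u) (A 13 u))" for i :: nat and R' :: regs and A' :: arrays
  have "run (Verts 28 ?c) (R(34 := 0, 35 := 0, 36 := 0)) A (n * 8 + 2) Q"
  proof (rule run_scan[where J = J and g = 6])
    show "J 0 (R(34 := 0, 35 := 0, 36 := 0)) A" using n_pos by (simp add: J_def)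
    show "Q R' A'" if J: "J n R' A'" for R' A'
    proof -
      have "beats (A 12 (R' 34)) (A 13 (R' 34)) (A 12 u) (A 13 u)"
        if nz: "\<And>u. u < n \<Longrightarrow> A 12 u \<noteq> 0" and u: "u < n" for u
      proof -
        have "beats (R' 35) (R' 36) (A 12 u) (A 13 u)" using J u by (simp add: J_def)
        moreover from this have "R' 35 \<noteq> 0" using nz[OF u] by (auto simp: beats_def)
        ultimately show ?thesis using J by (auto simp: J_def)
      qed
      then show ?thesis using Q[of R'] J by (simp add: J_def)
    qed
    fix i R' A'
    assume i: "i < n" "R' 28 = i" and J: "J i R' A'" and ok: "ok R' A'"
    have A: "A' = A" using J by (simp add: J_def)
    have b: "A 12 i \<le> B" "A 13 i \<le> B" "i \<le> B" using ok A i n_le by (auto simp: ok_def)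
    have set: "J (Suc i) (R'(34 := i, 35 := A 12 i, 36 := A 13 i)) A" if "beats (A 12 i) (A 13 i) (R' 35) (R' 36)"
      using J i that by (auto simp: J_def beats_def less_Suc_eq)
    have keep: "J (Suc i) R' A" if "beats (R' 35) (R' 36) (A 12 i) (A 13 i)"
      using J i that by (auto simp: J_def less_Suc_eq)
    show "wp ?c (\<lambda>R' A'. R' 28 = i \<and> J (Suc i) R' A') R' A'"
      using set keep b i A by (auto simp: beats_def simp del: fun_upd_apply) (simp_all add: beats_def)
  qed (auto simp: J_def small_def)
  then show "wp (Seq (Assign 34 (Lit 0)) (Seq (Assign 35 (Lit 0)) (Assign 36 (Lit 0))))
      (\<lambda>R' A'. run (Verts 28 ?c) R' A' (n * 8 + 2) Q) R A" by simp
qed (use T in \<open>auto simp: small_def\<close>)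

definition last_com :: com where
  "last_com = Seq (Assign 20 (Reg 34)) (Seq bfs_com (Seq (pick_com (Lit 1))
     (Cond (Sub (Reg 19) (Reg 29)) (Assign 29 (Reg 19)) Skip)))"

lemma run_last:
  assumes g: "graph A" and x: "R 34 < n" "R 21 = 0" "dist_val (R 29)"
    and Q: "\<And>R' A'. (\<And>r. r \<notin> {18..29} \<Longrightarrow> R' r = R r) \<Longrightarrow> dist_val (R' 29) \<Longrightarrow> R 29 \<le> R' 29 \<Longrightarrow>
      ecc (R 34) + 1 \<le> R' 29 \<Longrightarrow> Q R' A'"
    and T: "50 * M \<le> T"
  shows "run last_com R A T Q"
  unfolding last_com_def
proof (rule run_seqI[where ?T1.0 = 1 and ?T2.0 = "30 * M + ((n * 7 + 4) + 2)"], rule run_wp)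
  define x where "x = R 34"
  let ?c = "Cond (Sub (Reg 19) (Reg 29)) (Assign 29 (Reg 19)) Skip"
  have "run (Seq bfs_com (Seq (pick_com (Lit 1)) ?c)) (R(20 := x)) A (30 * M + ((n * 7 + 4) + 2)) Q"
  proof (rule run_seq, rule run_dist)
    fix R1 D Qu
    assume f1: "\<And>r. r \<notin> {22..27} \<Longrightarrow> R1 r = (R(20 := x)) r"
      and D: "\<And>w. w < n \<Longrightarrow> D w = d ((R(20 := x)) 20) w + 1"
    have D0: "D w = d x w + 1" if "w < n" for w using D[OF that] by simp
    show "run (Seq (pick_com (Lit 1)) ?c) R1 (A(9 := D, 10 := Qu)) ((n * 7 + 4) + 2) Q"
    proof (rule run_seq, rule run_pick[where P = "\<lambda>_. True"])
      fix R2
      assume a: "\<And>r. r \<notin> {18, 19, 28} \<Longrightarrow> R2 r = R1 r" "R2 18 < n" "R2 19 = (A(9 := D, 10 := Qu)) 9 (R2 18)"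
        "\<And>i. i < n \<Longrightarrow> True \<Longrightarrow> (A(9 := D, 10 := Qu)) 9 i \<le> (A(9 := D, 10 := Qu)) 9 (R2 18)"
      obtain y where y: "y < n" "d x y = ecc x" using ecc_attained[of x] by auto
      have r19: "R2 19 = d x (R2 18) + 1" using a(3) D0[OF a(2)] by simp
      have e: "ecc x \<le> d x (R2 18)" using a(4)[OF y(1)] y D0[OF y(1)] D0[OF a(2)] by simp
      have r29: "R2 29 = R 29" using a(1) f1 by simp
      have dv: "dist_val (R2 19)" unfolding dist_val_def r19 using a(2) x(1) x_def by blast
      have fr: "R2 r = R r" if "r \<notin> {18..29}" for r using a(1)[of r] f1[of r] that by auto
      show "run ?c R2 (A(9 := D, 10 := Qu)) 2 Q"
      proof (rule run_wp)
        assume ok: "ok R2 (A(9 := D, 10 := Qu))"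
        have "Q (R2(29 := R2 19)) (A(9 := D, 10 := Qu))" if "R2 29 < R2 19"
          by (rule Q) (use that dv r29 r19 e fr in \<open>auto simp: x_def\<close>)
        moreover have "Q R2 (A(9 := D, 10 := Qu))" if "\<not> R2 29 < R2 19"
          by (rule Q) (use that x(3) r29 r19 e fr in \<open>auto simp: x_def\<close>)
        ultimately show "wp ?c Q R2 (A(9 := D, 10 := Qu))" using ok by (simp add: ok_def)
      qed (auto simp: small_def)
    qed (use D0 n_pos in \<open>auto simp: small_def\<close>)
  qed (use g x in \<open>auto simp: x_def\<close>)
  then show "wp (Assign 20 (Reg 34)) (\<lambda>R' A'. run (Seq bfs_com (Seq (pick_com (Lit 1)) ?c)) R' A'
      (30 * M + ((n * 7 + 4) + 2)) Q) R A" using x n_le by (simp add: x_def)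
  show "1 + (30 * M + ((n * 7 + 4) + 2)) \<le> T" using T n_le_M n_pos by linarith
qed (auto simp: small_def)

section \<open>Assembling the program\<close>

definition flags_com :: com where
  "flags_com = Seq common_com (Seq best_com (Seq both_com (Seq central_com diam3_com)))"

lemma run_flags:
  assumes g: "graph A" and z: "\<And>j x. j \<in> {3..8} \<Longrightarrow> A j x = 0" "R 15 = 0" "R 16 = 0" "R 17 = 0"
    and Q: "\<And>R' A'. (\<And>r. r \<notin> {5..17} \<Longrightarrow> R' r = R r) \<Longrightarrow> (\<And>j. j \<notin> {3..8} \<Longrightarrow> A' j = A j) \<Longrightarrow>
      (\<And>y. y < n \<Longrightarrow> A' 4 y \<noteq> 0 \<longleftrightarrow> simplicial y) \<Longrightarrow> R' 16 \<noteq> 0 \<longleftrightarrow> \<not> diam \<le> 2 \<Longrightarrow> R' 17 \<noteq> 0 \<longleftrightarrow> \<not> diam \<le> 3 \<Longrightarrow> Q R' A'"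
    and T: "142 * (q * M) \<le> T"
  shows "run flags_com R A T Q"
proof -
  let ?t = "q * M"
  have "run flags_com R A (21 * ?t + (60 * ?t + (21 * ?t + (20 * ?t + 20 * ?t)))) Q"
    unfolding flags_com_def
  proof (rule run_seq, rule run_common)
    show "A 3 x = 0" for x using z(1) by simp
    fix R1 f3
    assume f1: "\<And>r. r \<notin> {5..14} \<Longrightarrow> R1 r = R r"
      and c: "\<And>a b. a < n \<Longrightarrow> b \<in> N a \<Longrightarrow> dg a \<le> dg b \<Longrightarrow> f3 (a * n + b) = card (N a \<inter> N b)"
    show "run (Seq best_com (Seq both_com (Seq central_com diam3_com))) R1 (A(3 := f3)) (60 * ?t + (21 * ?t + (20 * ?t + 20 * ?t))) Q"
    proof (rule run_seq, rule run_best)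
      show "common ((A(3 := f3)) 3)" using c by (simp add: common_def)
      show "(A(3 := f3)) j x = 0" if "j \<in> {4, 5, 6}" for j x using z(1)[of j x] that by auto
      fix R2 pa pb f4 f5 f6
      assume f2: "\<And>r. r \<notin> {5..16} \<Longrightarrow> R2 r = R1 r" and P: "pairs n pa pb f4 f5 f6 (R2 15) (R2 16)"
      define A2 where "A2 = A(3 := f3, 4 := f4, 5 := f5, 6 := f6)"
      have g2: "graph A2" using g by (simp add: A2_def)
      have z2: "A2 7 x = 0" "A2 8 x = 0" for x using z(1) by (auto simp: A2_def)
      have P2: "pairs n pa pb (A2 4) (A2 5) (A2 6) (R2 15) (R2 16)" using P by (simp add: A2_def)
      have "run (Seq both_com (Seq central_com diam3_com)) R2 A2 (21 * ?t + (20 * ?t + 20 * ?t)) Q"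
      proof (rule run_seq, rule run_both[OF g2 z2(1) P2])
        fix R3 f7
        assume f3: "\<And>r. r \<notin> {5..14} \<Longrightarrow> R3 r = R2 r"
          and w: "\<And>w. w < n \<Longrightarrow> f7 w = cntS n (\<lambda>y. w \<in> N (pa y) \<and> w \<in> N (pb y))"
        have r3: "R3 15 = R2 15" "R3 16 = R2 16" using f3 by simp_all
        show "run (Seq central_com diam3_com) R3 (A2(7 := f7)) (20 * ?t + 20 * ?t) Q"
        proof (rule run_seq, rule run_central)
          show "pairs n pa pb ((A2(7 := f7)) 4) ((A2(7 := f7)) 5) ((A2(7 := f7)) 6) (R3 15) (R3 16)"
            using P2 r3 by simp
          fix R4 and f8 :: "nat \<Rightarrow> nat"
          assume f4: "\<And>r. r \<notin> {5..14} \<Longrightarrow> R4 r = R3 r" and e: "\<And>c. c < n \<Longrightarrow> f8 c \<noteq> 0 \<longleftrightarrow> ecc c \<le> 2"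
          show "run diam3_com R4 (A2(7 := f7, 8 := f8)) (20 * ?t) Q"
          proof (rule run_diam3)
            show "R4 17 = 0" using f4 f3 f2 f1 z(4) by simp
            have s: "(A2(7 := f7, 8 := f8)) 4 y \<noteq> 0 \<longleftrightarrow> simplicial y" if "y < n" for y
              using P that by (simp add: pairs_def A2_def)
            then show "(A2(7 := f7, 8 := f8)) 4 y \<noteq> 0 \<longleftrightarrow> simplicial y" if "y < n" for y using that by blast
            fix R5
            assume f5: "\<And>r. r \<notin> {5..14} \<union> {17} \<Longrightarrow> R5 r = R4 r" and d3: "R5 17 \<noteq> 0 \<longleftrightarrow> \<not> diam \<le> 3"
            show "Q R5 (A2(7 := f7, 8 := f8))"
            proof (rule Q)
              show "R5 r = R r" if "r \<notin> {5..17}" for r using that f1[of r] f2[of r] f3[of r] f4[of r] f5[of r] by auto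
              show "(A2(7 := f7, 8 := f8)) j = A j" if "j \<notin> {3..8}" for j using that by (auto simp: A2_def)
              show "(A2(7 := f7, 8 := f8)) 4 y \<noteq> 0 \<longleftrightarrow> simplicial y" if "y < n" for y using s that by blast
              show "R5 17 \<noteq> 0 \<longleftrightarrow> \<not> diam \<le> 3" by (rule d3)
              have bp: "best_pair y (pa y, pb y)" if "simplicial y" for y
                using P that simplicial_less[OF that] by (simp add: pairs_def)
              have "R5 16 = R2 16" using f5 f4 f3 by simp
              then have "R5 16 \<noteq> 0 \<longleftrightarrow> (\<exists>y<n. simplicial y \<and> card (N (pa y) \<union> N (pb y)) \<noteq> n)"
                using P by (simp add: pairs_def)
              then show "R5 16 \<noteq> 0 \<longleftrightarrow> \<not> diam \<le> 2"
                using diam_le_2_iff[of pa pb, OF bp] simplicial_less by auto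
            qed
          qed (use g2 e in auto)
        qed (use g2 z2 w in auto)
      qed auto
      then show "run (Seq both_com (Seq central_com diam3_com)) R2 (A(3 := f3, 4 := f4, 5 := f5, 6 := f6)) (21 * ?t + (20 * ?t + 20 * ?t)) Q"
        by (simp add: A2_def)
    qed (use g f1 z in auto)
  qed (use g in auto)
  then show ?thesis by (rule run_mono) (use T in linarith)+
qed

text \<open>For empty \<open>CC z v\<close>, \<open>levels\<close> makes all \<open>l u\<close> zero
  and \<open>b\<close> says nothing about \<open>x\<close>; accordingly
  \<open>sweep_finds_diam\<close> requires optimality only for nonempty \<open>C\<close>.\<close>

lemma sweep_value:
  assumes D: "5 \<le> diam" and z: "simplicial z" "d 0 z = ecc 0" and v: "v < n" "d z v = ecc z" and x: "x < n"
    and l: "\<And>u. u < n \<Longrightarrow> levels (CC z v) u (l u) (k u)"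
    and b: "(\<And>u. u < n \<Longrightarrow> l u \<noteq> 0) \<Longrightarrow> (\<And>u. u < n \<Longrightarrow> beats (l x) (k x) (l u) (k u))"
  shows "diam = ecc z \<or> diam = ecc x \<or> (\<exists>c\<in>CC z v. diam = ecc c)"
proof -
  have zn: "z < n" using z simplicial_less by blast
  interpret S: sweep "{..<n}" E z v by unfold_locales (use zn v in auto)
  note C = CC_eq[OF zn v(1)]
  have "diam = ecc z \<or> diam = ecc x \<or> (\<exists>c\<in>S.C. diam = ecc c)"
  proof (rule S.sweep_finds_diam[OF D z(1) _ z(2) v(2)])
    fix u assume ne: "S.C \<noteq> {}" and "u \<in> {..<n}"
    then have u: "u < n" by simp
    have L: "l w = S.lev w + 1" "k w = card (S.near w)" if "w < n" for w
      using l[OF that] ne by (auto simp: levels_def C S.lev_def S.near_def)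
    then have "beats (l x) (k x) (l u) (k u)" using b u by simp
    then show "S.lev u < S.lev x \<or> S.lev u = S.lev x \<and> card (S.near x) \<le> card (S.near u)"
      using L[OF u] L[OF x] by (simp add: beats_def)
  qed (use n_pos x in auto)
  then show ?thesis unfolding C .
qed

definition sweep_com :: com where
  "sweep_com = Seq first_com (Seq second_com (Seq third_com (Seq fourth_com (Seq center_com last_com))))"

lemma run_sweep:
  assumes g: "graph A" and s: "\<And>y. y < n \<Longrightarrow> A 4 y \<noteq> 0 \<longleftrightarrow> simplicial y"
    and z: "\<And>x. A 12 x = 0" "\<And>x. A 14 x = 0"
    and Q: "\<And>R' A' z. (\<And>r. r \<notin> {18..37} \<Longrightarrow> R' r = R r) \<Longrightarrow> simplicial z \<Longrightarrow> R' 30 = ecc z + 1 \<Longrightarrow> dist_val (R' 29) \<Longrightarrow>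
      (5 \<le> diam \<Longrightarrow> diam + 1 \<le> R' 29) \<Longrightarrow> Q R' A'"
    and T: "256 * (q * M) \<le> T"
  shows "run sweep_com R A T Q"
proof -
  have "run sweep_com R A (43 * M + (50 * M + (50 * M + (50 * (q * M) + ((n * 8 + 5) + 50 * M))))) Q"
    unfolding sweep_com_def
  proof (rule run_seq, rule run_first)
    fix R1 A1
    assume f1: "\<And>r. r \<notin> {18..28} \<Longrightarrow> R1 r = R r" "\<And>j. j \<notin> {9, 10} \<Longrightarrow> A1 j = A j" "R1 21 = 0"
      and z1: "R1 18 < n" "simplicial (R1 18)" "d 0 (R1 18) = ecc 0"
    define z' where "z' = R1 18"
    show "run (Seq second_com (Seq third_com (Seq fourth_com (Seq center_com last_com)))) R1 A1
        (50 * M + (50 * M + (50 * (q * M) + ((n * 8 + 5) + 50 * M)))) Q"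
    proof (rule run_seq, rule run_second, unfold z'_def[symmetric])
      show "z' < n" "R1 21 = 0" "graph A1" using z1 f1 g by (simp_all add: z'_def)
      fix R2 A2
      assume f2: "\<And>r. r \<notin> {18..30} \<Longrightarrow> R2 r = R1 r" "\<And>j. j \<notin> {9, 10, 11} \<Longrightarrow> A2 j = A1 j"
        and z2: "\<And>w. w < n \<Longrightarrow> A2 11 w = d z' w + 1" "R2 18 < n" "d z' (R2 18) = ecc z'"
          "R2 29 = ecc z' + 1" "R2 30 = ecc z' + 1"
      define v where "v = R2 18"
      have g2: "graph A2" using f1 f2 g by simp
      have A2: "A2 12 x = 0" "A2 14 x = 0" for x using f1 f2 z by simp_all
      show "run (Seq third_com (Seq fourth_com (Seq center_com last_com))) R2 A2
        (50 * M + (50 * (q * M) + ((n * 8 + 5) + 50 * M))) Q"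
      proof (rule run_seq, rule run_third[where z = z'], unfold v_def[symmetric])
        show "z' < n" using z1 by (simp add: z'_def)
        fix R3 A3
        assume f3: "\<And>r. r \<notin> {18..28} \<union> {31, 32} \<Longrightarrow> R3 r = R2 r" "\<And>j. j \<notin> {9, 10, 14} \<Longrightarrow> A3 j = A2 j"
          and C: "\<And>c. c < n \<Longrightarrow> A3 14 c \<noteq> 0 \<longleftrightarrow> c \<in> CC z' v"
        have g3: "graph A3" using g2 f3 by simp
        have r3: "R3 29 = ecc z' + 1" "R3 30 = ecc z' + 1" using f3 z2 by simp_all
        have dv: "dist_val (R3 29)" unfolding dist_val_def r3 using z2(2,3) z1(1) z'_def by metis
        show "run (Seq fourth_com (Seq center_com last_com)) R3 A3 (50 * (q * M) + ((n * 8 + 5) + 50 * M)) Q"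
        proof (rule run_seq, rule run_fourth[where z = z' and v = v])
          show "A3 12 x = 0" for x using A2 f3 by simp
          fix R4 A4
          assume f4: "\<And>r. r \<notin> {20..29} \<union> {37} \<Longrightarrow> R4 r = R3 r" "\<And>j. j \<notin> {9, 10, 12, 13} \<Longrightarrow> A4 j = A3 j" "R4 21 = 0"
            and l: "\<And>x. x < n \<Longrightarrow> levels (CC z' v) x (A4 12 x) (A4 13 x)"
            and v4: "dist_val (R4 29)" "R3 29 \<le> R4 29" "\<And>c x. c \<in> CC z' v \<Longrightarrow> x < n \<Longrightarrow> d c x + 1 \<le> R4 29"
          have g4: "graph A4" using g3 f4 by simp
          show "run (Seq center_com last_com) R4 A4 ((n * 8 + 5) + 50 * M) Q"
          proof (rule run_seq, rule run_center)
            fix R5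
            assume f5: "\<And>r. r \<notin> {28, 34, 35, 36} \<Longrightarrow> R5 r = R4 r" "R5 34 < n"
              and b: "(\<And>u. u < n \<Longrightarrow> A4 12 u \<noteq> 0) \<Longrightarrow> (\<And>u. u < n \<Longrightarrow> beats (A4 12 (R5 34)) (A4 13 (R5 34)) (A4 12 u) (A4 13 u))"
            have r5: "R5 29 = R4 29" "R5 21 = 0" using f5 f4 by simp_all
            show "run last_com R5 A4 (50 * M) Q"
            proof (rule run_last)
              fix R6 A6
              assume f6: "\<And>r. r \<notin> {18..29} \<Longrightarrow> R6 r = R5 r" and v6: "dist_val (R6 29)" "R5 29 \<le> R6 29" "ecc (R5 34) + 1 \<le> R6 29"
              have fr: "R6 r = R r" if "r \<notin> {18..37}" for r
                using that f1(1)[of r] f2(1)[of r] f3(1)[of r] f4(1)[of r] f5(1)[of r] f6(1)[of r] by auto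
              have r30: "R6 30 = ecc z' + 1" using f6 f5 f4 r3 by simp
              have le: "R4 29 \<le> R6 29" using v6 r5 by simp
              have "diam + 1 \<le> R6 29" if D: "5 \<le> diam"
              proof -
                have "diam = ecc z' \<or> diam = ecc (R5 34) \<or> (\<exists>c\<in>CC z' v. diam = ecc c)"
                  using sweep_value[OF D _ _ _ _ f5(2) l b] z1 z2 unfolding z'_def[symmetric] v_def[symmetric] by blast
                moreover have "ecc c + 1 \<le> R6 29" if "c \<in> CC z' v" for c
                proof -
                  obtain y where "y < n" "d c y = ecc c" using ecc_attained[of c] by auto
                  then show ?thesis using v4(3)[OF that, of y] le by simp
                qed
                moreover have "ecc z' + 1 \<le> R6 29" using r3 v4(2) le by simp
                ultimately show ?thesis using v6(3) by auto
              qed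
              then show "Q R6 A6" using Q[OF fr _ r30 v6(1)] z1(2) by (simp add: z'_def)
            qed (use g4 f5 r5 v4 in auto)
          qed auto
        qed (use g3 dv C z1 z2 in \<open>auto simp: z'_def v_def\<close>)
      qed (use g2 z2 A2 in \<open>auto simp: v_def\<close>)
    qed auto
  qed (use g s in auto)
  then show ?thesis by (rule run_mono) (use T M_le_qM n_le_M n_pos in linarith)+
qed

text \<open>The sweep is run in any case, but its value is used only beyond diameter 3. A maximal
  distance above 4 is then the diameter; otherwise the diameter is below 5 and hence 4.\<close>

definition answer_com :: com where
  "answer_com = Cond (Reg 16) (Cond (Reg 17) (Cond (Sub (Reg 29) (Lit 5)) (Assign 0 (Sub (Reg 29) (Lit 1))) (Assign 0 (Lit 4)))
     (Assign 0 (Lit 3))) (Assign 0 (Sub (Reg 30) (Lit 1)))"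

definition diam_com :: com where
  "diam_com = Seq flags_com (Seq sweep_com answer_com)"

lemma run_diam:
  assumes g: "graph A" and z: "\<And>j x. j \<in> {3..15} \<Longrightarrow> A j x = 0" "R 15 = 0" "R 16 = 0" "R 17 = 0"
  shows "run diam_com R A (402 * (q * M)) (\<lambda>R' A'. R' 0 = diam)"
proof -
  have "run diam_com R A (142 * (q * M) + (256 * (q * M) + 4)) (\<lambda>R' A'. R' 0 = diam)"
    unfolding diam_com_def
  proof (rule run_seq, rule run_flags)
    fix R1 A1
    assume f1: "\<And>r. r \<notin> {5..17} \<Longrightarrow> R1 r = R r" "\<And>j. j \<notin> {3..8} \<Longrightarrow> A1 j = A j"
      and s: "\<And>y. y < n \<Longrightarrow> A1 4 y \<noteq> 0 \<longleftrightarrow> simplicial y"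
      and fl: "R1 16 \<noteq> 0 \<longleftrightarrow> \<not> diam \<le> 2" "R1 17 \<noteq> 0 \<longleftrightarrow> \<not> diam \<le> 3"
    show "run (Seq sweep_com answer_com) R1 A1 (256 * (q * M) + 4) (\<lambda>R' A'. R' 0 = diam)"
    proof (rule run_seq, rule run_sweep)
      fix R2 A2 z
      assume f2: "\<And>r. r \<notin> {18..37} \<Longrightarrow> R2 r = R1 r" and v: "simplicial z" "R2 30 = ecc z + 1" "dist_val (R2 29)"
        "5 \<le> diam \<Longrightarrow> diam + 1 \<le> R2 29"
      have fl2: "R2 16 \<noteq> 0 \<longleftrightarrow> \<not> diam \<le> 2" "R2 17 \<noteq> 0 \<longleftrightarrow> \<not> diam \<le> 3" using fl f2 by simp_all
      have up: "R2 29 \<le> diam + 1" using v(3) d_le_diam by (auto simp: dist_val_def)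
      show "run answer_com R2 A2 4 (\<lambda>R' A'. R' 0 = diam)"
      proof (rule run_wp)
        assume ok: "ok R2 A2"
        have b: "R2 29 \<le> B" "R2 30 \<le> B" using ok by (auto simp: ok_def)
        show "wp answer_com (\<lambda>R' A'. R' 0 = diam) R2 A2"
        proof (cases "diam \<le> 3")
          case False
          then have "R2 29 \<le> 5 \<Longrightarrow> diam = 4" "5 < R2 29 \<Longrightarrow> R2 29 = diam + 1" using v(4) up by (cases "5 \<le> diam"; simp)+
          then show ?thesis using fl2 b B_ge False by (auto simp: answer_com_def)
        next
          case True
          show ?thesis
          proof (cases "diam \<le> 2")
            case True
            then have "ecc z = diam" using ecc_simplicial_diam_le_2 v(1) by blast
            then show ?thesis using True fl2 v(2) b by (auto simp: answer_com_def)
          next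
            case False
            then show ?thesis using True fl2 B_ge by (auto simp: answer_com_def)
          qed
        qed
      qed (auto simp: answer_com_def small_def)
    qed (use f1 s g z in auto)
  qed (use g z in auto)
  then show ?thesis by (rule run_mono) (use M_le_qM n_le_M n_pos in linarith)+
qed

end

section \<open>Reading the input\<close>

text \<open>The input stores open neighbourhoods, \<open>L\<close> closed ones with the vertex
  itself in front. Row starts therefore differ by one per preceding vertex, and the input of length
  \<open>n + 2\<close> plus the number of arcs ends at \<open>M + 2\<close>.\<close>

locale input_ram = graph_ram +
  assumes ptr: "u \<le> n \<Longrightarrow> I (u + 1) + u = n + 2 + PT u"
    and lists: "u < n \<Longrightarrow> Suc i < dg u \<Longrightarrow> I (I (u + 1) + i) = L u ! Suc i"
    and hd_L: "u < n \<Longrightarrow> L u ! 0 = u" and F_eq: "F = M + 2"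
begin

lemma PT_mono: "x < u \<Longrightarrow> PT x + dg x \<le> PT u"
  unfolding PT_Suc[symmetric] unfolding PT_def by (intro sum_mono2) auto

definition built :: "nat \<Rightarrow> nat \<Rightarrow> arrays \<Rightarrow> bool" where
  "built u m A \<longleftrightarrow> (\<forall>x<u. \<forall>i<dg x. A 1 (PT x + i) = L x ! i) \<and> (\<forall>i<m. A 1 (PT u + i) = L u ! i) \<and>
     (\<forall>x<n. \<forall>y<n. A 2 (x * n + y) = (if x < u \<and> y \<in> N x \<or> x = u \<and> y \<in> set (take m (L u)) then 1 else 0))"

lemma built_step:
  assumes b: "built u m A" and u: "u < n" and m: "m < dg u"
  shows "L u ! m < n" "built u (Suc m) (A(1 := (A 1)(PT u + m := L u ! m), 2 := (A 2)(u * n + L u ! m := 1)))"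
proof -
  define w where "w = L u ! m"
  have lm: "m < length (L u)" using length_L u m by simp
  then have "w \<in> N u" using L_set[OF u] nth_mem[OF lm] by (simp add: w_def)
  then have w: "w < n" using N_less u by blast
  then show "L u ! m < n" by (simp add: w_def)
  have t: "set (take (Suc m) (L u)) = insert w (set (take m (L u)))"
    using lm by (simp add: take_Suc_conv_app_nth w_def)
  have pt: "PT x + i \<noteq> PT u + m" if "x < u" "i < dg x" for x i using PT_mono[OF that(1)] that(2) by simp
  show "built u (Suc m) (A(1 := (A 1)(PT u + m := L u ! m), 2 := (A 2)(u * n + L u ! m := 1)))"
    unfolding built_def w_def[symmetric] t
    using b u w pt by (auto simp: built_def w_def[symmetric] less_Suc_eq index_inject)
qed

lemma built_next: "built u (dg u) A \<Longrightarrow> u < n \<Longrightarrow> built (Suc u) 0 A"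
  using length_L[of u] L_set[of u] by (auto simp: built_def less_Suc_eq)

definition entry_com :: "nat \<Rightarrow> com" where
  "entry_com r = Seq (put 1 (Reg 10) (Reg r)) (Seq (put 2 (idx 5 r) (Lit 1)) (Assign 10 (Add (Reg 10) (Lit 1))))"

text \<open>Each row starts with the vertex itself, followed by its input list. The end of the list
  of \<open>u\<close> is the start recorded for \<open>u + 1\<close>, which exists also for the last
  vertex.\<close>

definition build_com :: com where
  "build_com = Seq (Assign 10 (Lit 0)) (Seq (Verts 5 (Seq (Seq (put 0 (Reg 5) (Reg 10)) (entry_com 5))
     (For 6 (Load (Add (Reg 5) (Lit 1))) (Load (Add (Reg 5) (Lit 2))) (Seq (Assign 7 (Load (Reg 6))) (entry_com 7)))))
     (put 0 (Reg 2) (Reg 10)))"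

lemma wp_entry:
  assumes b: "built u m A" "u < n" "m < dg u" and R: "R 5 = u" "R 10 = PT u + m" "R r = L u ! m" and r: "r \<notin> {1, 2, 3}"
    and Q: "\<And>A'. built u (Suc m) A' \<Longrightarrow> (\<And>j. j \<notin> {1, 2} \<Longrightarrow> A' j = A j) \<Longrightarrow> Q (R(10 := PT u + Suc m)) A'"
  shows "wp (entry_com r) Q R A"
proof -
  have l: "L u ! m < n" using built_step(1)[OF b] .
  have "PT u + Suc m \<le> B" using PT_le[of "Suc u"] b(2,3) M_le by simp
  moreover have "Q (R(10 := PT u + Suc m)) (A(1 := (A 1)(PT u + m := L u ! m), 2 := (A 2)(u * n + L u ! m := 1)))"
    by (rule Q) (use built_step(2)[OF b] in auto)
  ultimately show ?thesis using R r l n_le B_ge by (simp add: entry_com_def)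
qed

lemma lf_entry [simp]: "lf (entry_com r)" "tm (entry_com r) = 3"
  by (simp_all add: entry_com_def small_def)

lemma run_build:
  "run build_com (\<lambda>_. 0) (\<lambda>_ _. 0) (14 * M) (\<lambda>R A. graph A \<and> (\<forall>j x. j \<in> {3..15} \<longrightarrow> A j x = 0) \<and> (\<forall>r>10. R r = 0))"
proof -
  let ?Q = "\<lambda>R A. graph A \<and> (\<forall>j x. j \<in> {3..15} \<longrightarrow> A j x = 0) \<and> (\<forall>r>10. R r = 0)"
  let ?for = "For 6 (Load (Add (Reg 5) (Lit 1))) (Load (Add (Reg 5) (Lit 2))) (Seq (Assign 7 (Load (Reg 6))) (entry_com 7))"
  let ?body = "Seq (Seq (put 0 (Reg 5) (Reg 10)) (entry_com 5)) ?for"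
  define J where "J u m k R A \<longleftrightarrow> R 10 = PT u + m \<and> built u m A \<and> (\<forall>x<k. A 0 x = PT x) \<and>
    (\<forall>j x. j \<in> {3..15} \<longrightarrow> A j x = 0) \<and> (\<forall>r>10. R r = 0)" for u m k :: nat and R :: regs and A :: arrays
  have inner: "run ?for R A ((dg u - 1) * 6 + 2) (\<lambda>R' A'. R' 5 = u \<and> J (Suc u) 0 (Suc u) R' A')"
    if u: "u < n" and R: "R 5 = u" "J u 1 (Suc u) R A" for u R A
  proof -
    define a where "a = I (u + 1)"
    have uF: "u + 1 < F" "u + 2 < F" using F_eq n_le_M u by linarith+
    have pa: "a + u = n + 2 + PT u" using ptr[of u] u by (simp add: a_def)
    have pb: "I (u + 2) = a + (dg u - 1)"
      using ptr[of "Suc u"] u pa dg_pos[of u] by (simp add: numeral_2_eq_2)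
    have PM: "PT u + dg u \<le> M" using PT_le[of "Suc u"] u by simp
    have uPT: "u \<le> PT u"
    proof -
      have "(\<Sum>x<u. 1) \<le> PT u" unfolding PT_def by (intro sum_mono) (rule dg_pos)
      then show ?thesis by simp
    qed
    \<comment> \<open>Later vertices contribute at least 1 each to \<open>M\<close>. This keeps the
      reading position below \<open>F\<close>, so that the loop reads input and not the
      arrays.\<close>
    have nM: "n - u + PT u + (dg u - 1) \<le> M"
    proof -
      have "(\<Sum>x\<in>{Suc u..<n}. 1) \<le> (\<Sum>x\<in>{Suc u..<n}. dg x)" by (intro sum_mono) (rule dg_pos)
      moreover have "PT u + dg u + (\<Sum>x\<in>{Suc u..<n}. dg x) = M"
        using sum.atLeastLessThan_concat[of 0 "Suc u" n dg] u
        by (simp add: atLeast0LessThan PT_def sum_dg)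
      ultimately show ?thesis using u dg_pos[of u] by simp
    qed
    show ?thesis
    proof (rule run_for[where a = a and b = "a + (dg u - 1)" and g = "\<lambda>_. 4" and
          J = "\<lambda>k R' A'. R' 5 = u \<and> J u (Suc (k - a)) (Suc u) R' A'"])
      show "aval (Load (Add (Reg 5) (Lit 1))) (st R A) = a"
        using aval_Load_input[of "Add (Reg 5) (Lit 1)" R A] R(1) uF by (simp add: a_def)
      show "a + (dg u - 1) \<le> B" unfolding pb[symmetric] by (rule I_le)
      show "aval (Load (Add (Reg 5) (Lit 2))) (st R' A') = a + (dg u - 1)"
        if "R' 5 = u \<and> J u (Suc (i - a)) (Suc u) R' A'" for i R' A'
        using aval_Load_input[of "Add (Reg 5) (Lit 2)" R' A'] that uF pb by simp
      show "(R(6 := a)) 5 = u \<and> J u (Suc (a - a)) (Suc u) (R(6 := a)) A" using R by (simp add: J_def)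
      show "R' 5 = u \<and> J (Suc u) 0 (Suc u) R' A'"
        if "R' 5 = u \<and> J u (Suc (a + (dg u - 1) - a)) (Suc u) R' A'" for R' A'
      proof -
        have "Suc (a + (dg u - 1) - a) = dg u" using dg_pos[of u] by simp
        then show ?thesis using that built_next[OF _ u] by (auto simp: J_def)
      qed
      fix k R' A'
      assume k: "a \<le> k" "k < a + (dg u - 1)" "R' 6 = k" and J: "R' 5 = u \<and> J u (Suc (k - a)) (Suc u) R' A'"
      define m where "m = Suc (k - a)"
      have m: "m < dg u" using k by (simp add: m_def)
      have kF: "k < F" using k pa nM u F_eq by linarith
      have "I (a + (k - a)) = L u ! Suc (k - a)" using lists[OF u, of "k - a"] m by (simp add: a_def m_def)
      then have Ik: "aval (Load (Reg 6)) (st R' A') = L u ! m"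
        using aval_Load_input[of "Reg 6" R' A'] k kF by (simp add: m_def)
      have b: "built u m A'" using J by (simp add: J_def m_def)
      show "run (Seq (Assign 7 (Load (Reg 6))) (entry_com 7)) R' A' 4
          (\<lambda>R' A'. R' 6 = k \<and> (R'(6 := Suc k)) 5 = u \<and> J u (Suc (Suc k - a)) (Suc u) (R'(6 := Suc k)) A')"
      proof (rule run_wp)
        have "wp (entry_com 7) (\<lambda>R' A'. R' 6 = k \<and> (R'(6 := Suc k)) 5 = u \<and> J u (Suc (Suc k - a)) (Suc u) (R'(6 := Suc k)) A')
            (R'(7 := L u ! m)) A'"
        proof (rule wp_entry[OF b u m])
          fix A'' assume A'': "built u (Suc m) A''" "\<And>j. j \<notin> {1, 2} \<Longrightarrow> A'' j = A' j"
          have "Suc k - a = m" using k by (simp add: m_def)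
          then show "(R'(7 := L u ! m, 10 := PT u + Suc m)) 6 = k \<and> (R'(7 := L u ! m, 10 := PT u + Suc m, 6 := Suc k)) 5 = u \<and>
              J u (Suc (Suc k - a)) (Suc u) (R'(7 := L u ! m, 10 := PT u + Suc m, 6 := Suc k)) A''"
            using J A'' k by (auto simp: J_def)
        qed (use J in \<open>auto simp: J_def m_def\<close>)
        then show "wp (Seq (Assign 7 (Load (Reg 6))) (entry_com 7)) (\<lambda>R' A'. R' 6 = k \<and> (R'(6 := Suc k)) 5 = u \<and>
            J u (Suc (Suc k - a)) (Suc u) (R'(6 := Suc k)) A') R' A'"
          using Ik built_step(1)[OF b u m] n_le by (simp del: aval.simps)
      qed (auto simp: small_def)
    qed (auto simp: small_def)
  qed
  have outer: "run ?body R A (4 + ((dg u - 1) * 6 + 2)) (\<lambda>R' A'. R' 5 = u \<and> J (Suc u) 0 (Suc u) R' A')"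
    if u: "u < n" and R: "R 5 = u" "J u 0 u R A" for u R A
  proof (rule run_seq, rule run_wp)
    define A1 where "A1 = A(0 := (A 0)(u := PT u))"
    have b: "built u 0 A1" using R by (simp add: J_def built_def A1_def)
    have "wp (entry_com 5) (\<lambda>R' A'. run ?for R' A' ((dg u - 1) * 6 + 2) (\<lambda>R' A'. R' 5 = u \<and> J (Suc u) 0 (Suc u) R' A')) R A1"
    proof (rule wp_entry[OF b u])
      fix A2 assume A2: "built u (Suc 0) A2" "\<And>j. j \<notin> {1, 2} \<Longrightarrow> A2 j = A1 j"
      show "run ?for (R(10 := PT u + Suc 0)) A2 ((dg u - 1) * 6 + 2) (\<lambda>R' A'. R' 5 = u \<and> J (Suc u) 0 (Suc u) R' A')"
        by (rule inner[OF u]) (use R A2 in \<open>auto simp: J_def A1_def less_Suc_eq\<close>)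
    qed (use R u hd_L dg_pos[of u] in \<open>auto simp: J_def\<close>)
    moreover have "PT u \<le> B" using PT_le[of u] u M_le by simp
    ultimately show "wp (Seq (put 0 (Reg 5) (Reg 10)) (entry_com 5))
        (\<lambda>R' A'. run ?for R' A' ((dg u - 1) * 6 + 2) (\<lambda>R' A'. R' 5 = u \<and> J (Suc u) 0 (Suc u) R' A')) R A"
      using R by (simp add: J_def A1_def)
  qed (auto simp: small_def)
  have final: "run (put 0 (Reg 2) (Reg 10)) R A 1 ?Q" if J: "J n 0 n R A" for R A
  proof (rule run_wp)
    have gr: "garr ((A 0)(n := M)) (A 1) (A 2)"
      using J PT_n by (auto simp: J_def built_def garr_def le_eq_less_or_eq)
    then show "wp (put 0 (Reg 2) (Reg 10)) ?Q R A"
      using J PT_n M_le by (simp add: J_def)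
  qed (auto simp: small_def)
  have all: "run (Seq (Verts 5 ?body) (put 0 (Reg 2) (Reg 10))) ((\<lambda>_. 0)(10 := 0)) (\<lambda>_ _. 0) (6 * M + 2 * n + 2 + 1) ?Q"
  proof (rule run_seq, rule run_verts[where g = "\<lambda>u. 4 + ((dg u - 1) * 6 + 2)" and J = "\<lambda>u. J u 0 u"])
    show "J 0 0 0 ((\<lambda>_. 0)(10 := 0)) (\<lambda>_ _. 0)" by (simp add: J_def built_def PT_def)
    have "(\<Sum>u<n. 4 + ((dg u - 1) * 6 + 2) + 2) = (\<Sum>u<n. dg u * 6 + 2)"
    proof (rule sum.cong)
      show "4 + ((dg u - 1) * 6 + 2) + 2 = dg u * 6 + 2" for u using dg_pos[of u] by (cases "dg u") auto
    qed simp
    also have "\<dots> = 6 * M + 2 * n" by (simp add: sum.distrib sum_distrib_right[symmetric] sum_dg del: add_2_eq_Suc')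
    finally show "(\<Sum>u<n. 4 + ((dg u - 1) * 6 + 2) + 2) + 2 \<le> 6 * M + 2 * n + 2" by simp
    show "J i 0 i (R(5 := x)) A" if "J i 0 i R A" for i R A x using that by (simp add: J_def)
  qed (use outer final in auto)
  have "run build_com (\<lambda>_. 0) (\<lambda>_ _. 0) (1 + (6 * M + 2 * n + 2 + 1)) ?Q"
    unfolding build_com_def by (rule run_seq, rule run_assign) (use all in \<open>simp_all add: small_def\<close>)
  then show ?thesis by (rule run_mono) (use n_le_M n_pos in auto)
qed

definition main_com :: com where
  "main_com = Seq build_com diam_com"

lemma run_main: "run main_com (\<lambda>_. 0) (\<lambda>_ _. 0) (416 * (q * M)) (\<lambda>R A. R 0 = diam)"
  unfolding main_com_def
proof (rule run_seqI[where ?T1.0 = "14 * M" and ?T2.0 = "402 * (q * M)"])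
  show "run build_com (\<lambda>_. 0) (\<lambda>_ _. 0) (14 * M) (\<lambda>R A. run diam_com R A (402 * (q * M)) (\<lambda>R A. R 0 = diam))"
    by (rule run_mono[OF run_build]) (use run_diam in auto)
qed (use M_le_qM in linarith)

end

section \<open>The layout of the input\<close>

lemma nth_concat_take:
  "u < length xs \<Longrightarrow> i < length (xs ! u) \<Longrightarrow> concat xs ! (length (concat (take u xs)) + i) = xs ! u ! i"
proof -
  assume u: "u < length xs" and i: "i < length (xs ! u)"
  have "concat xs = concat (take u xs) @ xs ! u @ concat (drop (Suc u) xs)"
    by (subst id_take_nth_drop[OF u]) simp
  then show ?thesis using i by (simp add: nth_append)
qed

lemma length_concat_take: "u \<le> length xs \<Longrightarrow> length (concat (take u xs)) \<le> length (concat xs)"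
proof -
  have "concat xs = concat (take u xs) @ concat (drop u xs)" by (metis append_take_drop_id concat_append)
  then show ?thesis by simp
qed

lemma input_words_nth:
  "input_words xs ! 0 = length xs"
  "u \<le> length xs \<Longrightarrow> input_words xs ! Suc u = length xs + 2 + length (concat (take u xs))"
  "i < length (concat xs) \<Longrightarrow> input_words xs ! (length xs + 2 + i) = concat xs ! i"
  "length (input_words xs) = length xs + 2 + length (concat xs)"
  by (auto simp: input_words_def Let_def nth_append less_Suc_eq simp del: upt_Suc)

definition input_mem :: "nat list list \<Rightarrow> nat \<Rightarrow> nat" where
  "input_mem xs a = (if a < length (input_words xs) then input_words xs ! a else 0)"

definition size_of :: "nat list list \<Rightarrow> nat" where
  "size_of xs = length xs + length (concat xs)"

lemma input_ram_graph:
  assumes G: "pair_graph G" "Digraph_Component.connected (with_proj G)" "chordal (with_proj G)"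
      "dominating_pair_graph (with_proj G)"
    and xs: "adjacency_lists xs G"
  shows "input_ram (size_of xs + 2) (length xs) (size_of xs) (4 * size_of xs + 16) (input_mem xs) (adj G)
    (\<lambda>u. u # xs ! u) (floor_sqrt (size_of xs))"
proof -
  define n M where "n = length xs" and "M = size_of xs"
  have V: "pverts G = {..<n}" and l: "\<And>u. u < n \<Longrightarrow> distinct (xs ! u)" "\<And>u. u < n \<Longrightarrow> set (xs ! u) = {v. adj G u v}"
    using xs by (auto simp: adjacency_lists_def n_def adj_def)
  interpret chordal_dp "{..<n}" "adj G" using chordal_dp_adj[OF G] V by simp
  have Nu: "set (u # xs ! u) = N u" "distinct (u # xs ! u)" if "u < n" for u
    using l[OF that] irr by (auto simp: N_def)
  have cN: "card (N u) = Suc (length (xs ! u))" if "u < n" for u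
    using distinct_card[OF Nu(2)[OF that]] Nu(1)[OF that] by simp
  \<comment> \<open>Closed degrees exceed the lengths of the input lists by 1 each, which adds
    \<open>u\<close> over the first \<open>u\<close> vertices.\<close>
  have pt: "(\<Sum>v<u. card (N v)) = u + length (concat (take u xs))" if "u \<le> n" for u
    using that by (induction u) (auto simp: cN n_def take_Suc_conv_app_nth)
  have M: "M = (\<Sum>u<n. card (N u))" using pt[of n] by (simp add: M_def size_of_def n_def)
  have elt: "x \<le> M + 2" if "x \<in> set (concat xs)" for x
  proof -
    obtain ys where ys: "ys \<in> set xs" "x \<in> set ys" using \<open>x \<in> set (concat xs)\<close> by auto
    then obtain u where u: "u < n" "xs ! u = ys" by (auto simp: n_def in_set_conv_nth)
    then have "adj G u x" using l(2) ys(2) by auto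
    then have "x < n" using EV2 by auto
    then show ?thesis by (simp add: M_def size_of_def n_def)
  qed
  have mem: "input_mem xs a \<le> 4 * M + 16" for a
  proof -
    have "x \<le> M + 2" if "x \<in> set (input_words xs)" for x
      using that elt length_concat_take[of _ xs] by (auto simp: input_words_def Let_def M_def size_of_def)
    moreover have "input_words xs ! a \<in> set (input_words xs)" if "a < length (input_words xs)" using that by simp
    ultimately show ?thesis by (fastforce simp: input_mem_def)
  qed
  have nM: "n \<le> M" by (simp add: M_def size_of_def n_def)
  interpret graph_ram "M + 2" n M "4 * M + 16" "input_mem xs" "adj G" "\<lambda>u. u # xs ! u" "floor_sqrt M"
  proof unfold_locales
    show "input_mem xs a \<le> 4 * M + 16" for a by (rule mem)
    show "floor_sqrt M * floor_sqrt M \<le> M" using floor_sqrt_power2_le[of M] by (simp add: power2_eq_square)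
    show "M < (floor_sqrt M + 1) * (floor_sqrt M + 1)" using Suc_floor_sqrt_power2_gt[of M] by (simp add: power2_eq_square)
  qed (use Nu M nM in auto)
  have PT: "PT u = u + length (concat (take u xs))" if "u \<le> n" for u
    using pt[OF that] by (simp add: PT_def dg_def)
  have F: "length (input_words xs) = M + 2" using input_words_nth(4)[of xs] by (simp add: M_def size_of_def)
  have ptr: "input_mem xs (u + 1) = n + 2 + length (concat (take u xs))" if "u \<le> n" for u
    using input_words_nth(2)[of u xs] that nM F by (simp add: input_mem_def n_def)
  show ?thesis unfolding M_def[symmetric] n_def[symmetric]
  proof unfold_locales
    show "input_mem xs (u + 1) + u = n + 2 + PT u" if "u \<le> n" for u using ptr[OF that] PT[OF that] by simp
    fix u i assume u: "u < n" and i: "Suc i < dg u"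
    define j where "j = length (concat (take u xs)) + i"
    have il: "i < length (xs ! u)" using i cN[OF u] by (simp add: dg_def)
    have "length (concat (take (Suc u) xs)) \<le> length (concat xs)" using length_concat_take[of "Suc u" xs] u by (simp add: n_def)
    then have j: "j < length (concat xs)" using il u by (simp add: j_def n_def take_Suc_conv_app_nth)
    have "input_mem xs (n + 2 + j) = xs ! u ! i"
      using input_words_nth(3)[OF j] input_words_nth(4)[of xs] j nth_concat_take[of u xs i] u il
      by (simp add: input_mem_def n_def j_def)
    then show "input_mem xs (input_mem xs (u + 1) + i) = (u # xs ! u) ! Suc i"
      using ptr[of u] u by (simp add: j_def add.assoc)
  qed auto
qed

text \<open>Cell \<open>n + 1\<close> holds the first address past the input, which is
  \<open>M + 2\<close>. These assignments set the registers that \<open>st\<close> treats as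
  constants, so they are executed outside the program logic.\<close>

definition setup_com :: com where
  "setup_com = Seq (Assign 2 (Load (Lit 0))) (Seq (Assign 1 (Load (Add (Reg 2) (Lit 1)))) (Assign 3 (Sub (Reg 1) (Lit 2))))"

text \<open>\<open>main_com\<close> mentions no parameter of the locale in which it is defined, so
  this is one fixed program for all inputs.\<close>

definition program :: com where
  "program = Seq setup_com input_ram.main_com"

context input_ram begin

lemma exec_setup:
  assumes s: "I 0 = n" "\<And>a. F \<le> a \<Longrightarrow> I a = 0"
  shows "\<exists>t. exec setup_com (\<lambda>_. 0, I) t (st (\<lambda>_. 0) (\<lambda>_ _. 0)) \<and> t \<le> 3 * unit"
proof -
  have F: "I (n + 1) = F" using ptr[of n] PT_n F_eq by simp
  have c: "acost e (R, I) \<le> unit" if "small e" "\<And>r. R r \<le> B" for e R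
  proof -
    have "acost e (R, I) \<le> asz e * (80 * binlen B)"
      using acost_le[of e B "(R, I)" 80] that B_ge I_le by (simp add: small_def)
    also have "\<dots> \<le> 80 * (80 * binlen B)" using that by (intro mult_le_mono1) (simp add: small_def)
    finally show ?thesis by (simp add: unit_def)
  qed
  let ?r = "\<lambda>_::nat. 0::nat"
  have e: "exec (Assign 2 (Load (Lit 0))) (?r, I) (acost (Load (Lit 0)) (?r, I)) (?r(2 := n), I)"
    "exec (Assign 1 (Load (Add (Reg 2) (Lit 1)))) (?r(2 := n), I) (acost (Load (Add (Reg 2) (Lit 1))) (?r(2 := n), I))
      (?r(2 := n, 1 := F), I)"
    "exec (Assign 3 (Sub (Reg 1) (Lit 2))) (?r(2 := n, 1 := F), I) (acost (Sub (Reg 1) (Lit 2)) (?r(2 := n, 1 := F), I))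
      (?r(2 := n, 1 := F, 3 := M), I)"
    using exec.Assign[of 2 "Load (Lit 0)" "(?r, I)"] exec.Assign[of 1 "Load (Add (Reg 2) (Lit 1))" "(?r(2 := n), I)"]
      exec.Assign[of 3 "Sub (Reg 1) (Lit 2)" "(?r(2 := n, 1 := F), I)"] s F F_eq by simp_all
  have "st ?r (\<lambda>_ _. 0) = (?r(2 := n, 1 := F, 3 := M), I)"
    using s(2) by (auto simp: st_def fun_eq_iff)
  then have "exec setup_com (?r, I) (acost (Load (Lit 0)) (?r, I) + (acost (Load (Add (Reg 2) (Lit 1))) (?r(2 := n), I) +
      acost (Sub (Reg 1) (Lit 2)) (?r(2 := n, 1 := F), I))) (st ?r (\<lambda>_ _. 0))"
    unfolding setup_com_def using exec.Seq[OF e(1) exec.Seq[OF e(2,3)]] by simp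
  moreover have "acost (Load (Lit 0)) (?r, I) \<le> unit" by (rule c) (auto simp: small_def)
  moreover have "acost (Load (Add (Reg 2) (Lit 1))) (?r(2 := n), I) \<le> unit" by (rule c) (auto simp: small_def n_le)
  moreover have "acost (Sub (Reg 1) (Lit 2)) (?r(2 := n, 1 := F), I) \<le> unit" by (rule c) (auto simp: small_def n_le F_le)
  ultimately show ?thesis by (intro exI conjI) auto
qed

lemma exec_program:
  assumes "I 0 = n" "\<And>a. F \<le> a \<Longrightarrow> I a = 0"
  shows "\<exists>t s. exec program (\<lambda>_. 0, I) t s \<and> result s = diam \<and> t \<le> (3 + 416 * (q * M)) * unit"
proof -
  obtain t where t: "exec setup_com (\<lambda>_. 0, I) t (st (\<lambda>_. 0) (\<lambda>_ _. 0))" "t \<le> 3 * unit"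
    using exec_setup assms by blast
  have "ok (\<lambda>_. 0) (\<lambda>_ _. 0)" by (simp add: ok_def)
  then obtain t' R A where m: "exec main_com (st (\<lambda>_. 0) (\<lambda>_ _. 0)) t' (st R A)" "t' \<le> 416 * (q * M) * unit" "R 0 = diam"
    using run_main unfolding run_def by blast
  have "exec program (\<lambda>_. 0, I) (t + t') (st R A)" unfolding program_def by (rule exec.Seq[OF t(1) m(1)])
  moreover have "result (st R A) = diam" using m(3) by (simp add: result_def)
  moreover have "t + t' \<le> (3 + 416 * (q * M)) * unit" using t(2) m(2) by (simp add: algebra_simps)
  ultimately show ?thesis by blast
qed

end

section \<open>Running time in terms of the number of edges\<close>

lemma card_parcs_le: assumes "finite (parcs G)" shows "card (parcs G) \<le> 2 * num_edges G"
proof -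
  let ?f = "\<lambda>(u, v). {u, v}"
  have "card (parcs G) \<le> (\<Sum>e\<in>?f ` parcs G. 2)"
  proof -
    have "parcs G = (\<Union>e\<in>?f ` parcs G. {a \<in> parcs G. ?f a = e})" by auto
    then have "card (parcs G) \<le> (\<Sum>e\<in>?f ` parcs G. card {a \<in> parcs G. ?f a = e})"
      using card_UN_le[of "?f ` parcs G" "\<lambda>e. {a \<in> parcs G. ?f a = e}"] assms by simp
    also have "\<dots> \<le> (\<Sum>e\<in>?f ` parcs G. 2)"
    proof (rule sum_mono)
      fix e assume "e \<in> ?f ` parcs G"
      then obtain u v where e: "e = {u, v}" by auto
      have "{a \<in> parcs G. ?f a = e} \<subseteq> {(u, v), (v, u)}"
      proof
        fix a assume "a \<in> {a \<in> parcs G. ?f a = e}"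
        then have "{fst a, snd a} = {u, v}" by (simp add: e case_prod_beta)
        then have "fst a = u \<and> snd a = v \<or> fst a = v \<and> snd a = u" unfolding doubleton_eq_iff .
        then show "a \<in> {(u, v), (v, u)}" by (cases a) simp
      qed
      then have "card {a \<in> parcs G. ?f a = e} \<le> card {(u, v), (v, u)}" by (intro card_mono) auto
      also have "\<dots> \<le> 2" by (cases "u = v") simp_all
      finally show "card {a \<in> parcs G. ?f a = e} \<le> 2" .
    qed
    finally show ?thesis .
  qed
  then show ?thesis by (simp add: num_edges_def)
qed

text \<open>By connectedness every vertex has an outgoing arc unless it is the only one, so there
  are at most \<open>2 * num_edges G + 1\<close> vertices, besides the at most
  \<open>2 * num_edges G\<close> arcs.\<close>

lemma size_of_le:
  assumes G: "pair_graph G" "Digraph_Component.connected (with_proj G)" and xs: "adjacency_lists xs G"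
  shows "size_of xs \<le> 4 * num_edges G + 1"
proof -
  interpret pair_graph G by (rule G)
  define n where "n = length xs"
  have V: "pverts G = {..<n}" and l: "\<And>u. u < n \<Longrightarrow> distinct (xs ! u)" "\<And>u. u < n \<Longrightarrow> set (xs ! u) = {v. (u, v) \<in> parcs G}"
    using xs by (auto simp: adjacency_lists_def n_def)
  interpret C: con_graph "{..<n}" "adj G" using con_graph_adj[OF G] V by simp
  have fin: "finite (parcs G)" by simp
  have arcs: "parcs G = Sigma {..<n} (\<lambda>u. set (xs ! u))"
  proof -
    have "(u, v) \<in> parcs G \<longleftrightarrow> u < n \<and> v \<in> set (xs ! u)" for u v
      using l(2)[of u] C.EV[of u v] unfolding adj_def by blast
    then show ?thesis by auto
  qed
  have "card (parcs G) = (\<Sum>u<n. length (xs ! u))"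
    unfolding arcs using l(1) by (simp add: distinct_card)
  also have "\<dots> = length (concat xs)"
    by (simp add: length_concat sum_list_sum_nth n_def atLeast0LessThan)
  finally have c: "length (concat xs) = card (parcs G)" by simp
  have "n \<le> card (parcs G) + 1"
  proof (cases "n \<le> 1")
    case False
    have "{..<n} \<subseteq> fst ` parcs G"
    proof
      fix u assume u: "u \<in> {..<n}"
      define v where "v = (if u = 0 then 1 else 0 :: nat)"
      have "v \<in> {..<n}" "v \<noteq> u" using False by (auto simp: v_def)
      then have "(adj G)\<^sup>*\<^sup>* u v" using C.conn u by blast
      then obtain w where "adj G u w" using \<open>v \<noteq> u\<close> by (metis converse_rtranclpE)
      then show "u \<in> fst ` parcs G" by (force simp: adj_def)
    qed
    then have "n \<le> card (fst ` parcs G)" using card_mono[of "fst ` parcs G" "{..<n}"] fin by simp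
    also have "\<dots> \<le> card (parcs G)" using fin by (rule card_image_le)
    finally show ?thesis by simp
  qed simp
  then show ?thesis using c card_parcs_le[OF fin] by (simp add: size_of_def n_def)
qed

definition time_bound :: "nat \<Rightarrow> nat" where
  "time_bound m = (3 + 416 * (floor_sqrt (4 * m + 1) * (4 * m + 1))) * (12800 * binlen (4 * (4 * m + 1) + 16))"

text \<open>The bound is of order \<open>m^(3/2) * log m\<close>. The exponent 7/4 leaves a factor
  \<open>m^(1/4)\<close> to absorb the logarithm.\<close>

lemma time_bound_bigo: "(\<lambda>m. real (time_bound m)) \<in> O(\<lambda>m. real m powr (2 - 1 / 4))"
proof -
  define f where "f m = (3 + 416 * (sqrt (4 * real m + 1) * (4 * real m + 1))) * (12800 * (log 2 (16 * real m + 20) + 1))" for m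
  have "real (time_bound m) \<le> f m" for m
  proof -
    have "real (floor_sqrt (4 * m + 1)) \<le> sqrt (4 * real m + 1)"
    proof (rule real_le_rsqrt)
      have "real ((floor_sqrt (4 * m + 1))\<^sup>2) \<le> real (4 * m + 1)" using floor_sqrt_power2_le of_nat_le_iff by blast
      then show "(real (floor_sqrt (4 * m + 1)))\<^sup>2 \<le> 4 * real m + 1" by simp
    qed
    moreover have "real (binlen (4 * (4 * m + 1) + 16)) \<le> log 2 (16 * real m + 20) + 1"
      using le_log2_of_power[OF floor_log_exp2_le[of "4 * (4 * m + 1) + 16"]] by (simp add: binlen_def algebra_simps)
    ultimately show ?thesis unfolding f_def time_bound_def of_nat_mult of_nat_add
      by (intro mult_mono add_mono) auto
  qed
  then have "(\<lambda>m. real (time_bound m)) \<in> O(f)"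
    by (intro landau_o.big_mono always_eventually) (auto intro: order_trans[OF _ abs_ge_self])
  also have "f \<in> O(\<lambda>m. real m powr (2 - 1 / 4))" unfolding f_def by real_asymp
  finally show ?thesis .
qed

lemma floor_sqrt_mono': "a \<le> b \<Longrightarrow> floor_sqrt a \<le> floor_sqrt b"
  using mono_floor_sqrt by (simp add: mono_def)

theorem theorem6:
  shows "\<exists>\<epsilon>::real. \<epsilon> > 0 \<and>
    (\<exists>P T. T \<in> O(\<lambda>m. real m powr (2 - \<epsilon>)) \<and>
       computes_diameter_within P
         (\<lambda>G. pair_graph G \<and> Digraph_Component.connected (with_proj G) \<and>
              chordal (with_proj G) \<and> dominating_pair_graph (with_proj G)) T)"
proof (intro exI conjI)
  \<comment> \<open>Any positive value below 1/2 would serve, since only a logarithm has to be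
    absorbed.\<close>
  show "(0::real) < 1 / 4" by simp
  show "(\<lambda>m. real (time_bound m)) \<in> O(\<lambda>m. real m powr (2 - 1 / 4))" by (rule time_bound_bigo)
  show "computes_diameter_within program (\<lambda>G. pair_graph G \<and> Digraph_Component.connected (with_proj G) \<and>
      chordal (with_proj G) \<and> dominating_pair_graph (with_proj G)) (\<lambda>m. real (time_bound m))"
    unfolding computes_diameter_within_def
  proof (intro allI impI, elim conjE)
    fix G xs
    assume G: "pair_graph G" "Digraph_Component.connected (with_proj G)" "chordal (with_proj G)"
      "dominating_pair_graph (with_proj G)" and xs: "adjacency_lists xs G"
    interpret input_ram "size_of xs + 2" "length xs" "size_of xs" "4 * size_of xs + 16" "input_mem xs" "adj G"
      "\<lambda>u. u # xs ! u" "floor_sqrt (size_of xs)" by (rule input_ram_graph[OF G xs])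
    have init: "initial_state xs = (\<lambda>_. 0, input_mem xs)"
      by (auto simp: initial_state_def Let_def input_mem_def fun_eq_iff)
    have V: "pverts G = {..<length xs}" using xs by (simp add: adjacency_lists_def)
    have "input_mem xs 0 = length xs" "\<And>a. size_of xs + 2 \<le> a \<Longrightarrow> input_mem xs a = 0"
      using input_words_nth(1,4)[of xs] by (auto simp: input_mem_def size_of_def)
    then obtain t s where t: "exec program (\<lambda>_. 0, input_mem xs) t s" "result s = diam"
        "t \<le> (3 + 416 * (floor_sqrt (size_of xs) * size_of xs)) * unit"
      using exec_program by blast
    have le: "size_of xs \<le> 4 * num_edges G + 1" using size_of_le[OF G(1,2) xs] .
    have "(3 + 416 * (floor_sqrt (size_of xs) * size_of xs)) * unit \<le> time_bound (num_edges G)"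
      unfolding time_bound_def unit_def using le
      by (intro mult_mono add_mono binlen_mono floor_sqrt_mono') auto
    then have "real t \<le> real (time_bound (num_edges G))" using t(3) by simp
    moreover have "ereal (real (result s)) = diameter (with_proj G)"
      using diameter_adj[OF G(1,2)] t(2) V by simp
    ultimately show "\<exists>t s. exec program (initial_state xs) t s \<and> ereal (real (result s)) = diameter (with_proj G) \<and>
        real t \<le> real (time_bound (num_edges G))"
      using t(1) unfolding init by blast
  qed
qed

end
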